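(* Let $(A,L)$ be a Courant pair with $\dim H^2_{CP}(A,L)<\infty$, let $C_1=\mathbb{K}\oplus H^2_{CP}(A,L)'$, and let $\eta_1$ be the infinitesimal deformation of $(A,L)$ with base $C_1$ described in the context. For any infinitesimal deformation $\lambda$ of $(A,L)$ with a finite dimensional base $(R,\mathcal{M})$ there exists a unique homomorphism $\phi:C_1\to R$ (a unital $\mathbb{K}$-algebra homomorphism compatible with the augmentations) such that $\lambda$ is equivalent to the push-out $\phi_*\eta_1$.
   Context: $\mathbb{K}$ is a field of characteristic $0$; all maps are $\mathbb{K}$-linear unless stated otherwise; $V'$ denotes the dual of a vector space $V$. A (left) Leibniz algebra is a vector space $L$ with a bilinear bracket satisfying $[x,[y,z]]=[[x,y],z]+[y,[x,z]]$. A Courant pair $(A,L)$ consists of an associative algebra $A$, a Leibniz algebra $L$ and a Leibniz algebra homomorphism $\mu:L\to \mathrm{Der}_{\mathbb K}(A)$ (derivations with commutator bracket). The same notion is used over a commutative unital $\mathbb{K}$-algebra $R$, with all structure maps $R$-(bi)linear. A homomorphism of Courant pairs $(A,L)\to(A_1,L_1)$ is a pair $(f,g)$, with $f:A\to A_1$ an algebra homomorphism and $g:L\to L_1$ a Leibniz homomorphism, such that $f(\mu(x)(a))=\mu_1(g(x))(f(a))$. Cohomology of $(A,L)$. Put $C^{0,q}=\mathrm{Hom}(L^{\otimes q},L)$ and, for $p>0$, $C^{p,q}=\mathrm{Hom}(L^{\otimes q},\mathrm{Hom}(A^{\otimes p},A))\cong \mathrm{Hom}(L^{\otimes q}\otimes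 A^{\otimes p},A)$, $q\ge 0$. Vertical maps $C^{p,q}\to C^{p+1,q}$, all denoted $\delta_H$: for $p>0$, apply to the values in $\mathrm{Hom}(A^{\otimes p},A)$ the Hochschild coboundary $\delta_Hf(a_1,\dots,a_{p+1})=a_1f(a_2,\dots,a_{p+1})+\sum_{i=1}^{p}(-1)^if(a_1,\dots,a_ia_{i+1},\dots,a_{p+1})+(-1)^{p+1}f(a_1,\dots,a_p)a_{p+1}$; for $p=0$, $(\delta_H f)(x_1,\dots,x_q)(a)=\mu(f(x_1,\dots,x_q))(a)$. Horizontal maps $\delta_L:C^{p,q}\to C^{p,q+1}$: the Leibniz coboundary $$(\delta_L\psi)(x_1,\dots,x_{q+1})=(-1)^{q+1}\Big(\sum_{i=1}^{q}(-1)^{i-1}[x_i,\psi(x_1,\dots,\hat{x_i},\dots,x_{q+1})]+(-1)^{q+1}[\psi(x_1,\dots,x_q),x_{q+1}]+\sum_{1\le i<j\le q+1}(-1)^i\psi(x_1,\dots,\hat{x_i},\dots,x_{j-1},[x_i,x_j],x_{j+1},\dots,x_{q+1})\Big),$$ where for $p=0$ the brackets with values are those of $L$, and for $p>0$, $[x,f](a_1,\dots,a_p)=\mu(x)(f(a_1,\dots,a_p))-\sum_i f(a_1,\dots,\mu(x)(a_i),\dots,a_p)$ and $[f,x]=-[x,f]$. Put $C^n_{tot}(A,L)=\bigoplus_{p+q=n}C^{p,q}$, with $\delta_{tot}$ equal to $\delta_H+(-1)^p\delta_L$ on $C^{p,q}$; its cohomology is $H^*_{CP}(A,L)$. In particular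 $C^2_{tot}=\mathrm{Hom}(A^{\otimes 2},A)\oplus\mathrm{Hom}(L\otimes A,A)\oplus\mathrm{Hom}(L^{\otimes 2},L)$. Deformations. Let $R$ be a commutative unital $\mathbb{K}$-algebra with an augmentation $\epsilon:R\to\mathbb{K}$ (an algebra homomorphism, $\epsilon(1)=1$), $\mathcal{M}=\ker\epsilon$, and $\dim(\mathcal{M}^k/\mathcal{M}^{k+1})<\infty$ for all $k$. A deformation $\lambda$ of $(A,L)$ with base $(R,\mathcal{M})$ is a Courant pair structure over $R$ on $(R\otimes A,R\otimes L)$, given by a triplet $(\cdot_\lambda,\mu_\lambda,[-,-]_\lambda)$ of an $R$-bilinear associative product, an $R$-Leibniz homomorphism $\mu_\lambda:R\otimes L\to\mathrm{Der}_R(R\otimes A)$, and an $R$-bilinear Leibniz bracket, such that $(\epsilon\otimes\mathrm{id}_A,\epsilon\otimes\mathrm{id}_L):(R\otimes A,R\otimes L)\to(A,L)$ is a homomorphism of Courant pairs. It is infinitesimal if $R$ is local (with maximal ideal $\mathcal{M}$) and $\mathcal{M}^2=0$. Two deformations $\lambda_1,\lambda_2$ with the same base are equivalent if there is an $R$-linear isomorphism of Courant pairs $(\varphi_A,\varphi_L):(R\otimes A,R\otimes L)_{\lambda_1}\to(R\otimes A,R\otimes L)_{\lambda_2}$ with $(\epsilon\otimes\mathrm{id}_A)\circ\varphi_A=\epsilon\otimes\mathrm{id}_A$ and $(\epsilon\otimes\mathrm{id}_L)\circ\varphi_L=\epsilon\otimes\mathrm{id}_L$. Push-out. If $\lambda$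 is a deformation with base $(R,\mathcal{M})$, $(R_1,\mathcal{M}_1)$ is another augmented commutative unital algebra with augmentation $\epsilon_1$, and $\phi:R\to R_1$ is an algebra homomorphism with $\phi(1)=1$ and $\epsilon_1\circ\phi=\epsilon$, then $\phi_*\lambda$ is the deformation with base $(R_1,\mathcal{M}_1)$ obtained by extension of scalars along $\phi$, using $R_1\otimes A=R_1\otimes_R(R\otimes A)$, $R_1\otimes L=R_1\otimes_R(R\otimes L)$: e.g. $(r\otimes_R u)\cdot_{\phi_*\lambda}(s\otimes_R v)=rs\otimes_R(u\cdot_\lambda v)$, and similarly for the action and the bracket. The deformation $\eta_1$. Let $\mathcal{H}_{CP}=H^2_{CP}(A,L)$ be finite dimensional. $C_1=\mathbb{K}\oplus\mathcal{H}_{CP}'$ has multiplication $(k_1,h_1)(k_2,h_2)=(k_1k_2,k_1h_2+k_2h_1)$ and augmentation the projection to $\mathbb{K}$. Fix a linear map $\nu=(\nu^1,\nu^2,\nu^3):\mathcal{H}_{CP}\to C^2_{tot}(A,L)$ sending each class to a cocycle representing it, a basis $\{h_i\}$ of $\mathcal{H}_{CP}$ and its dual basis $\{g_i\}$. Then $\eta_1$ is the deformation with base $(C_1,\mathcal{H}_{CP}')$ given by $(1\otimes a)\cdot_{\eta_1}(1\otimes b)=1\otimes ab+\sum_i g_i\otimes\nu^1(h_i)(a,b)$, $\ \mu_{\eta_1}(1\otimes x)(1\otimes a)=1\otimes\mu(x)(a)+\sum_i g_i\otimes\nu^2(h_i)(x,a)$, $\ [1\otimes x,1\otimes y]_{\eta_1}=1\otimes[x,y]+\sum_i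 g_i\otimes\nu^3(h_i)(x,y)$, extended $C_1$-bilinearly. (Up to equivalence it does not depend on $\nu$.) *)

theory Defs
  imports "HOL-Algebra.Algebra"
begin

text \<open>
  Modules are records of the HOL-Algebra type \<open>('k, 'v) module\<close>. For a plain module the fields
  \<open>mult\<close> and \<open>one\<close> carry no information; for the (not necessarily unital) associative algebra of a
  Courant pair \<open>mult\<close> is the product, for its Leibniz algebra \<open>mult\<close> is the bracket, and in both
  cases \<open>one\<close> is ignored.
\<close>

section \<open>Linear algebra over a commutative ring\<close>

definition lin_maps ::
  "('k, 'm) ring_scheme \<Rightarrow> ('k, 'v) module \<Rightarrow> ('k, 'w) module \<Rightarrow> ('v \<Rightarrow> 'w) set" where
  "lin_maps K V W = {f \<in> carrier V \<rightarrow> carrier W.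
     (\<forall>x\<in>carrier V. \<forall>y\<in>carrier V. f (x \<oplus>\<^bsub>V\<^esub> y) = f x \<oplus>\<^bsub>W\<^esub> f y) \<and>
     (\<forall>k\<in>carrier K. \<forall>x\<in>carrier V. f (k \<odot>\<^bsub>V\<^esub> x) = k \<odot>\<^bsub>W\<^esub> f x)}"

definition bilin_maps ::
  "('k, 'm) ring_scheme \<Rightarrow> ('k, 'u) module \<Rightarrow> ('k, 'v) module \<Rightarrow> ('k, 'w) module
    \<Rightarrow> ('u \<Rightarrow> 'v \<Rightarrow> 'w) set" where
  "bilin_maps K U V W = {\<beta>.
     (\<forall>u\<in>carrier U. (\<lambda>v. \<beta> u v) \<in> lin_maps K V W) \<and>
     (\<forall>v\<in>carrier V. (\<lambda>u. \<beta> u v) \<in> lin_maps K U W)}"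

definition fin_dim :: "('k, 'm) ring_scheme \<Rightarrow> ('k, 'v) module \<Rightarrow> bool" where
  "fin_dim K V \<longleftrightarrow> (\<exists>S. finite S \<and> S \<subseteq> carrier V \<and>
     (\<forall>v\<in>carrier V. \<exists>c\<in>S \<rightarrow> carrier K. v = (\<Oplus>\<^bsub>V\<^esub>s\<in>S. c s \<odot>\<^bsub>V\<^esub> s)))"

definition is_basis ::
  "('k, 'm) ring_scheme \<Rightarrow> ('k, 'v) module \<Rightarrow> nat \<Rightarrow> (nat \<Rightarrow> 'v) \<Rightarrow> bool" where
  "is_basis K V n h \<longleftrightarrow> h \<in> {..<n} \<rightarrow> carrier V \<and>
     (\<forall>v\<in>carrier V. \<exists>!c. c \<in> {..<n} \<rightarrow>\<^sub>E carrier K \<and> v = (\<Oplus>\<^bsub>V\<^esub>i\<in>{..<n}. c i \<odot>\<^bsub>V\<^esub> h i))"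

definition dual_space :: "('k, 'm) ring_scheme \<Rightarrow> ('k, 'v) module \<Rightarrow> ('k, 'v \<Rightarrow> 'k) module" where
  "dual_space K V = \<lparr>
     carrier = {f \<in> carrier V \<rightarrow> carrier K.
       (\<forall>x\<in>carrier V. \<forall>y\<in>carrier V. f (x \<oplus>\<^bsub>V\<^esub> y) = f x \<oplus>\<^bsub>K\<^esub> f y) \<and>
       (\<forall>k\<in>carrier K. \<forall>x\<in>carrier V. f (k \<odot>\<^bsub>V\<^esub> x) = k \<otimes>\<^bsub>K\<^esub> f x) \<and>
       (\<forall>x. x \<notin> carrier V \<longrightarrow> f x = \<zero>\<^bsub>K\<^esub>)},
     monoid.mult = undefined, one = undefined,
     ring.zero = (\<lambda>_. \<zero>\<^bsub>K\<^esub>), add = (\<lambda>f g x. f x \<oplus>\<^bsub>K\<^esub> g x), module.smult = (\<lambda>k f x. k \<otimes>\<^bsub>K\<^esub> f x)\<rparr>"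

definition is_dual_basis ::
  "('k, 'm) ring_scheme \<Rightarrow> ('k, 'v) module \<Rightarrow> nat \<Rightarrow> (nat \<Rightarrow> 'v) \<Rightarrow> (nat \<Rightarrow> 'v \<Rightarrow> 'k) \<Rightarrow> bool" where
  "is_dual_basis K V n h g \<longleftrightarrow> g \<in> {..<n} \<rightarrow> carrier (dual_space K V) \<and>
     (\<forall>i<n. \<forall>j<n. g i (h j) = (if i = j then \<one>\<^bsub>K\<^esub> else \<zero>\<^bsub>K\<^esub>))"

definition quot_module :: "('k, 'v) module \<Rightarrow> 'v set \<Rightarrow> ('k, 'v set) module" where
  "quot_module V N = \<lparr>carrier = a_rcosets\<^bsub>V\<^esub> N, monoid.mult = undefined, one = undefined,
     ring.zero = N, add = set_add V,
     module.smult = (\<lambda>k Z. \<Union>x\<in>Z. N +>\<^bsub>V\<^esub> (k \<odot>\<^bsub>V\<^esub> x))\<rparr>"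

definition tuples :: "('k, 'v) module \<Rightarrow> nat \<Rightarrow> 'v list set" where
  "tuples V n = {vs. length vs = n \<and> set vs \<subseteq> carrier V}"

text \<open>
  \<open>multilin K V W n\<close> is the space of linear maps from the \<open>n\<close>-fold tensor power of \<open>V\<close> to \<open>W\<close>,
  realised as \<open>n\<close>-linear maps on lists of length \<open>n\<close>. The value outside of its domain is \<open>0\<close>.
\<close>

definition multilin ::
  "('k, 'm) ring_scheme \<Rightarrow> ('k, 'v) module \<Rightarrow> ('k, 'w) module \<Rightarrow> nat \<Rightarrow> ('k, 'v list \<Rightarrow> 'w) module" where
  "multilin K V W n = \<lparr>
     carrier = {f \<in> tuples V n \<rightarrow> carrier W.
       (\<forall>vs\<in>tuples V n. \<forall>i<n. (\<lambda>v. f (vs[i := v])) \<in> lin_maps K V W) \<and>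
       (\<forall>vs. vs \<notin> tuples V n \<longrightarrow> f vs = \<zero>\<^bsub>W\<^esub>)},
     monoid.mult = undefined, one = undefined,
     ring.zero = (\<lambda>_. \<zero>\<^bsub>W\<^esub>), add = (\<lambda>f g vs. f vs \<oplus>\<^bsub>W\<^esub> g vs), module.smult = (\<lambda>k f vs. k \<odot>\<^bsub>W\<^esub> f vs)\<rparr>"

section \<open>Tensor products\<close>

text \<open>
  The tensor product of \<open>K\<close>-modules is the free Abelian group on the pairs, modulo the usual
  relators.
\<close>

abbreviation tensor_free :: "('k, 'u) module \<Rightarrow> ('k, 'v) module \<Rightarrow> ('u \<times> 'v \<Rightarrow>\<^sub>0 int) monoid" where
  "tensor_free U V \<equiv> free_Abelian_group (carrier U \<times> carrier V)"

definition tensor_relators ::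
  "('k, 'm) ring_scheme \<Rightarrow> ('k, 'u) module \<Rightarrow> ('k, 'v) module \<Rightarrow> ('u \<times> 'v \<Rightarrow>\<^sub>0 int) set" where
  "tensor_relators K U V =
     {frag_of (u \<oplus>\<^bsub>U\<^esub> u', v) - frag_of (u, v) - frag_of (u', v) | u u' v.
        u \<in> carrier U \<and> u' \<in> carrier U \<and> v \<in> carrier V} \<union>
     {frag_of (u, v \<oplus>\<^bsub>V\<^esub> v') - frag_of (u, v) - frag_of (u, v') | u v v'.
        u \<in> carrier U \<and> v \<in> carrier V \<and> v' \<in> carrier V} \<union>
     {frag_of (k \<odot>\<^bsub>U\<^esub> u, v) - frag_of (u, k \<odot>\<^bsub>V\<^esub> v) | k u v.
        k \<in> carrier K \<and> u \<in> carrier U \<and> v \<in> carrier V}"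

definition tensor_null ::
  "('k, 'm) ring_scheme \<Rightarrow> ('k, 'u) module \<Rightarrow> ('k, 'v) module \<Rightarrow> ('u \<times> 'v \<Rightarrow>\<^sub>0 int) set" where
  "tensor_null K U V = generate (tensor_free U V) (tensor_relators K U V)"

definition pure_tensor ::
  "('k, 'm) ring_scheme \<Rightarrow> ('k, 'u) module \<Rightarrow> ('k, 'v) module \<Rightarrow> 'u \<Rightarrow> 'v
    \<Rightarrow> ('u \<times> 'v \<Rightarrow>\<^sub>0 int) set" where
  "pure_tensor K U V u v = tensor_null K U V #>\<^bsub>tensor_free U V\<^esub> frag_of (u, v)"

text \<open>
  The additive map out of a tensor product that sends \<open>u \<otimes> v\<close> to \<open>\<beta> u v\<close>, computed on an arbitrary
  representative; it is meaningful for maps \<open>\<beta>\<close> that respect the relators.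
\<close>

definition tensor_lift ::
  "('w, 'n) ring_scheme \<Rightarrow> ('u \<Rightarrow> 'v \<Rightarrow> 'w) \<Rightarrow> ('u \<times> 'v \<Rightarrow>\<^sub>0 int) set \<Rightarrow> 'w" where
  "tensor_lift W \<beta> Z = (let c = (SOME c. c \<in> Z) in
     \<Oplus>\<^bsub>W\<^esub>p\<in>Poly_Mapping.keys c. add_pow W (Poly_Mapping.lookup c p) (\<beta> (fst p) (snd p)))"

definition tensor_add_group ::
  "('k, 'm) ring_scheme \<Rightarrow> ('k, 'u) module \<Rightarrow> ('k, 'v) module \<Rightarrow> ('u \<times> 'v \<Rightarrow>\<^sub>0 int) set ring" where
  "tensor_add_group K U V = \<lparr>
     carrier = carrier (tensor_free U V Mod tensor_null K U V),
     monoid.mult = undefined, one = undefined,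
     ring.zero = \<one>\<^bsub>tensor_free U V Mod tensor_null K U V\<^esub>,
     add = monoid.mult (tensor_free U V Mod tensor_null K U V)\<rparr>"

definition tensor_prod ::
  "('k, 'm) ring_scheme \<Rightarrow> ('k, 'u) module \<Rightarrow> ('k, 'v) module
    \<Rightarrow> ('k, ('u \<times> 'v \<Rightarrow>\<^sub>0 int) set) module" where
  "tensor_prod K U V = ring.extend (tensor_add_group K U V)
     (module.fields (\<lambda>k. tensor_lift (tensor_add_group K U V)
        (\<lambda>u v. pure_tensor K U V (k \<odot>\<^bsub>U\<^esub> u) v)))"

text \<open>For a \<open>K\<close>-algebra \<open>R\<close>, the \<open>R\<close>-module with the same underlying group, with scalar
  multiplication \<open>s (r \<otimes> v) = sr \<otimes> v\<close>.\<close>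

definition ext_scal ::
  "('k, 'm) ring_scheme \<Rightarrow> ('k, 'r) module \<Rightarrow> ('k, 'v) module
    \<Rightarrow> ('r, ('r \<times> 'v \<Rightarrow>\<^sub>0 int) set) module" where
  "ext_scal K R V = ring.extend (tensor_add_group K R V)
     (module.fields (\<lambda>s. tensor_lift (tensor_add_group K R V)
        (\<lambda>r v. pure_tensor K R V (s \<otimes>\<^bsub>R\<^esub> r) v)))"

text \<open>The \<open>R\<close>-bilinear extension of a \<open>K\<close>-bilinear map \<open>\<beta>\<close> from \<open>U \<times> V\<close> to an \<open>R\<close>-module \<open>W\<close> to
  a map on \<open>(R \<otimes> U) \<times> (R \<otimes> V)\<close>.\<close>

definition bilin_ext ::
  "('k, 'r) module \<Rightarrow> ('r, 'w) module \<Rightarrow> ('u \<Rightarrow> 'v \<Rightarrow> 'w)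
    \<Rightarrow> ('r \<times> 'u \<Rightarrow>\<^sub>0 int) set \<Rightarrow> ('r \<times> 'v \<Rightarrow>\<^sub>0 int) set \<Rightarrow> 'w" where
  "bilin_ext R W \<beta> Z Y =
     tensor_lift W (\<lambda>r u. tensor_lift W (\<lambda>s v. (r \<otimes>\<^bsub>R\<^esub> s) \<odot>\<^bsub>W\<^esub> \<beta> u v) Y) Z"

section \<open>Courant pairs\<close>

record ('k, 'a, 'l) courant_data =
  alg :: "('k, 'a) module"
  lei :: "('k, 'l) module"
  act :: "'l \<Rightarrow> 'a \<Rightarrow> 'a"

definition assoc_algebra :: "('k, 'm) ring_scheme \<Rightarrow> ('k, 'a) module \<Rightarrow> bool" where
  "assoc_algebra S A \<longleftrightarrow> module S A \<and> monoid.mult A \<in> bilin_maps S A A A \<and>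
     (\<forall>a\<in>carrier A. \<forall>b\<in>carrier A. \<forall>c\<in>carrier A.
        (a \<otimes>\<^bsub>A\<^esub> b) \<otimes>\<^bsub>A\<^esub> c = a \<otimes>\<^bsub>A\<^esub> (b \<otimes>\<^bsub>A\<^esub> c))"

definition leibniz_algebra :: "('k, 'm) ring_scheme \<Rightarrow> ('k, 'l) module \<Rightarrow> bool" where
  "leibniz_algebra S L \<longleftrightarrow> module S L \<and> monoid.mult L \<in> bilin_maps S L L L \<and>
     (\<forall>x\<in>carrier L. \<forall>y\<in>carrier L. \<forall>z\<in>carrier L.
        x \<otimes>\<^bsub>L\<^esub> (y \<otimes>\<^bsub>L\<^esub> z) = ((x \<otimes>\<^bsub>L\<^esub> y) \<otimes>\<^bsub>L\<^esub> z) \<oplus>\<^bsub>L\<^esub> (y \<otimes>\<^bsub>L\<^esub> (x \<otimes>\<^bsub>L\<^esub> z)))"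

definition derivations :: "('k, 'm) ring_scheme \<Rightarrow> ('k, 'a) module \<Rightarrow> ('a \<Rightarrow> 'a) set" where
  "derivations S A = {D \<in> lin_maps S A A. \<forall>a\<in>carrier A. \<forall>b\<in>carrier A.
     D (a \<otimes>\<^bsub>A\<^esub> b) = (D a \<otimes>\<^bsub>A\<^esub> b) \<oplus>\<^bsub>A\<^esub> (a \<otimes>\<^bsub>A\<^esub> D b)}"

definition courant_pair :: "('k, 'm) ring_scheme \<Rightarrow> ('k, 'a, 'l) courant_data \<Rightarrow> bool" where
  "courant_pair S P \<longleftrightarrow> assoc_algebra S (alg P) \<and> leibniz_algebra S (lei P) \<and>
     (\<forall>x\<in>carrier (lei P). act P x \<in> derivations S (alg P)) \<and>
     act P \<in> bilin_maps S (lei P) (alg P) (alg P) \<and>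
     (\<forall>x\<in>carrier (lei P). \<forall>y\<in>carrier (lei P). \<forall>a\<in>carrier (alg P).
        act P (x \<otimes>\<^bsub>lei P\<^esub> y) a = act P x (act P y a) \<ominus>\<^bsub>alg P\<^esub> act P y (act P x a))"

definition courant_hom ::
  "('k, 'm) ring_scheme \<Rightarrow> ('k, 'a, 'l) courant_data \<Rightarrow> ('k, 'b, 'n) courant_data
    \<Rightarrow> ('a \<Rightarrow> 'b) \<Rightarrow> ('l \<Rightarrow> 'n) \<Rightarrow> bool" where
  "courant_hom S P Q f g \<longleftrightarrow>
     f \<in> lin_maps S (alg P) (alg Q) \<and> g \<in> lin_maps S (lei P) (lei Q) \<and>
     (\<forall>a\<in>carrier (alg P). \<forall>b\<in>carrier (alg P). f (a \<otimes>\<^bsub>alg P\<^esub> b) = f a \<otimes>\<^bsub>alg Q\<^esub> f b) \<and>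
     (\<forall>x\<in>carrier (lei P). \<forall>y\<in>carrier (lei P). g (x \<otimes>\<^bsub>lei P\<^esub> y) = g x \<otimes>\<^bsub>lei Q\<^esub> g y) \<and>
     (\<forall>x\<in>carrier (lei P). \<forall>a\<in>carrier (alg P). f (act P x a) = act Q (g x) (f a))"

section \<open>Cohomology of a Courant pair\<close>

text \<open>\<open>(-1)\<^sup>i v\<close> in a \<open>K\<close>-module \<open>V\<close>.\<close>

definition signed :: "('k, 'm) ring_scheme \<Rightarrow> ('k, 'v) module \<Rightarrow> nat \<Rightarrow> 'v \<Rightarrow> 'v" where
  "signed K V i v = ((\<ominus>\<^bsub>K\<^esub> \<one>\<^bsub>K\<^esub>) [^]\<^bsub>K\<^esub> i) \<odot>\<^bsub>V\<^esub> v"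

definition omit_nth :: "nat \<Rightarrow> 'v list \<Rightarrow> 'v list" where
  "omit_nth i xs = take i xs @ drop (Suc i) xs"

text \<open>List positions start at \<open>0\<close>, so the signs attached to an index \<open>i\<close> of a list are those of the
  usual formulas with \<open>i + 1\<close> in place of \<open>i\<close>.\<close>

definition hochschild ::
  "('k, 'm) ring_scheme \<Rightarrow> ('k, 'a) module \<Rightarrow> nat \<Rightarrow> ('a list \<Rightarrow> 'a) \<Rightarrow> 'a list \<Rightarrow> 'a" where
  "hochschild K A p f as = (if as \<in> tuples A (p + 1) then
       (as ! 0 \<otimes>\<^bsub>A\<^esub> f (drop 1 as))
       \<oplus>\<^bsub>A\<^esub> (\<Oplus>\<^bsub>A\<^esub>i\<in>{..<p}. signed K A (i + 1)
              (f (take i as @ [as ! i \<otimes>\<^bsub>A\<^esub> as ! (i + 1)] @ drop (i + 2) as)))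
       \<oplus>\<^bsub>A\<^esub> signed K A (p + 1) (f (take p as) \<otimes>\<^bsub>A\<^esub> as ! p)
     else \<zero>\<^bsub>A\<^esub>)"

text \<open>The Leibniz coboundary with values in \<open>M\<close>, for the left action \<open>la x m = [x, m]\<close> and the right
  action \<open>ra m x = [m, x]\<close>.\<close>

definition leibniz_cobdry ::
  "('k, 'm) ring_scheme \<Rightarrow> ('k, 'l) module \<Rightarrow> ('k, 'v) module \<Rightarrow> ('l \<Rightarrow> 'v \<Rightarrow> 'v) \<Rightarrow> ('v \<Rightarrow> 'l \<Rightarrow> 'v)
    \<Rightarrow> nat \<Rightarrow> ('l list \<Rightarrow> 'v) \<Rightarrow> 'l list \<Rightarrow> 'v" where
  "leibniz_cobdry K L M la ra q \<psi> xs = (if xs \<in> tuples L (q + 1) then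
       signed K M (q + 1)
        ((\<Oplus>\<^bsub>M\<^esub>i\<in>{..<q}. signed K M i (la (xs ! i) (\<psi> (omit_nth i xs))))
         \<oplus>\<^bsub>M\<^esub> signed K M (q + 1) (ra (\<psi> (take q xs)) (xs ! q))
         \<oplus>\<^bsub>M\<^esub> (\<Oplus>\<^bsub>M\<^esub>j\<in>{..q}. \<Oplus>\<^bsub>M\<^esub>i\<in>{..<j}.
                signed K M (i + 1) (\<psi> (omit_nth i (xs[j := xs ! i \<otimes>\<^bsub>L\<^esub> xs ! j])))))
     else \<zero>\<^bsub>M\<^esub>)"

definition hom_left_act ::
  "('k, 'a, 'l) courant_data \<Rightarrow> nat \<Rightarrow> 'l \<Rightarrow> ('a list \<Rightarrow> 'a) \<Rightarrow> 'a list \<Rightarrow> 'a" where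
  "hom_left_act P p x f as = (if as \<in> tuples (alg P) p then
       act P x (f as) \<ominus>\<^bsub>alg P\<^esub> (\<Oplus>\<^bsub>alg P\<^esub>i\<in>{..<p}. f (as[i := act P x (as ! i)]))
     else \<zero>\<^bsub>alg P\<^esub>)"

definition hom_right_act ::
  "('k, 'a, 'l) courant_data \<Rightarrow> nat \<Rightarrow> ('a list \<Rightarrow> 'a) \<Rightarrow> 'l \<Rightarrow> 'a list \<Rightarrow> 'a" where
  "hom_right_act P p f x as = \<ominus>\<^bsub>alg P\<^esub> hom_left_act P p x f as"

text \<open>The bigraded pieces: \<open>cochains0 K P q\<close> is bidegree \<open>(0, q)\<close>, and \<open>cochains K P p q\<close> is bidegree
  \<open>(p, q)\<close> for \<open>p > 0\<close>.\<close>

definition cochains0 ::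
  "('k, 'm) ring_scheme \<Rightarrow> ('k, 'a, 'l) courant_data \<Rightarrow> nat \<Rightarrow> ('k, 'l list \<Rightarrow> 'l) module" where
  "cochains0 K P q = multilin K (lei P) (lei P) q"

definition cochains ::
  "('k, 'm) ring_scheme \<Rightarrow> ('k, 'a, 'l) courant_data \<Rightarrow> nat \<Rightarrow> nat
    \<Rightarrow> ('k, 'l list \<Rightarrow> 'a list \<Rightarrow> 'a) module" where
  "cochains K P p q = multilin K (lei P) (multilin K (alg P) (alg P) p) q"

definition dH0 ::
  "('k, 'a, 'l) courant_data \<Rightarrow> ('l list \<Rightarrow> 'l) \<Rightarrow> 'l list \<Rightarrow> 'a list \<Rightarrow> 'a" where
  "dH0 P \<psi> xs as = (if as \<in> tuples (alg P) 1 then act P (\<psi> xs) (as ! 0) else \<zero>\<^bsub>alg P\<^esub>)"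

definition dH ::
  "('k, 'm) ring_scheme \<Rightarrow> ('k, 'a, 'l) courant_data \<Rightarrow> nat
    \<Rightarrow> ('l list \<Rightarrow> 'a list \<Rightarrow> 'a) \<Rightarrow> 'l list \<Rightarrow> 'a list \<Rightarrow> 'a" where
  "dH K P p F xs = hochschild K (alg P) p (F xs)"

definition dL0 ::
  "('k, 'm) ring_scheme \<Rightarrow> ('k, 'a, 'l) courant_data \<Rightarrow> nat
    \<Rightarrow> ('l list \<Rightarrow> 'l) \<Rightarrow> 'l list \<Rightarrow> 'l" where
  "dL0 K P q = leibniz_cobdry K (lei P) (lei P) (monoid.mult (lei P)) (monoid.mult (lei P)) q"

definition dL ::
  "('k, 'm) ring_scheme \<Rightarrow> ('k, 'a, 'l) courant_data \<Rightarrow> nat \<Rightarrow> nat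
    \<Rightarrow> ('l list \<Rightarrow> 'a list \<Rightarrow> 'a) \<Rightarrow> 'l list \<Rightarrow> 'a list \<Rightarrow> 'a" where
  "dL K P p q = leibniz_cobdry K (lei P) (multilin K (alg P) (alg P) p)
     (hom_left_act P p) (hom_right_act P p) q"

text \<open>A total cochain of degree \<open>n\<close> is a pair \<open>(\<psi>, F)\<close>: \<open>\<psi>\<close> is its component of bidegree \<open>(0, n)\<close>
  and \<open>F p\<close> its component of bidegree \<open>(p, n - p)\<close>, for \<open>1 \<le> p \<le> n\<close>.\<close>

type_synonym ('a, 'l) tot_cochain =
  "('l list \<Rightarrow> 'l) \<times> (nat \<Rightarrow> 'l list \<Rightarrow> 'a list \<Rightarrow> 'a)"

definition tot_cochains ::
  "('k, 'm) ring_scheme \<Rightarrow> ('k, 'a, 'l) courant_data \<Rightarrow> nat \<Rightarrow> ('k, ('a, 'l) tot_cochain) module" where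
  "tot_cochains K P n = \<lparr>
     carrier = {(\<psi>, F). \<psi> \<in> carrier (cochains0 K P n) \<and>
       (\<forall>p\<in>{1..n}. F p \<in> carrier (cochains K P p (n - p))) \<and>
       (\<forall>p. p \<notin> {1..n} \<longrightarrow> F p = (\<lambda>_ _. \<zero>\<^bsub>alg P\<^esub>))},
     monoid.mult = undefined, one = undefined,
     ring.zero = (\<lambda>_. \<zero>\<^bsub>lei P\<^esub>, \<lambda>_ _ _. \<zero>\<^bsub>alg P\<^esub>),
     add = (\<lambda>(\<psi>, F) (\<psi>', F'). (\<lambda>xs. \<psi> xs \<oplus>\<^bsub>lei P\<^esub> \<psi>' xs, \<lambda>p xs as. F p xs as \<oplus>\<^bsub>alg P\<^esub> F' p xs as)),
     module.smult = (\<lambda>k (\<psi>, F). (\<lambda>xs. k \<odot>\<^bsub>lei P\<^esub> \<psi> xs, \<lambda>p xs as. k \<odot>\<^bsub>alg P\<^esub> F p xs as))\<rparr>"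

text \<open>The component of bidegree \<open>(p, n + 1 - p)\<close> of the coboundary collects the vertical map from
  \<open>(p - 1, n + 1 - p)\<close> and the signed horizontal map from \<open>(p, n - p)\<close>; the latter is absent for
  \<open>p = n + 1\<close>.\<close>

definition d_tot ::
  "('k, 'm) ring_scheme \<Rightarrow> ('k, 'a, 'l) courant_data \<Rightarrow> nat
    \<Rightarrow> ('a, 'l) tot_cochain \<Rightarrow> ('a, 'l) tot_cochain" where
  "d_tot K P n c = (case c of (\<psi>, F) \<Rightarrow>
     (dL0 K P n \<psi>,
      \<lambda>p xs as. if p \<in> {1..n + 1} then
          (if p = 1 then dH0 P \<psi> xs as else dH K P (p - 1) (F (p - 1)) xs as)
          \<oplus>\<^bsub>alg P\<^esub> (if p \<le> n then signed K (alg P) p (dL K P p (n - p) (F p) xs as) else \<zero>\<^bsub>alg P\<^esub>)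
        else \<zero>\<^bsub>alg P\<^esub>))"

definition cocycles ::
  "('k, 'm) ring_scheme \<Rightarrow> ('k, 'a, 'l) courant_data \<Rightarrow> nat \<Rightarrow> ('a, 'l) tot_cochain set" where
  "cocycles K P n = {c \<in> carrier (tot_cochains K P n). d_tot K P n c = \<zero>\<^bsub>tot_cochains K P (n + 1)\<^esub>}"

definition coboundaries ::
  "('k, 'm) ring_scheme \<Rightarrow> ('k, 'a, 'l) courant_data \<Rightarrow> nat \<Rightarrow> ('a, 'l) tot_cochain set" where
  "coboundaries K P n = (case n of
     0 \<Rightarrow> {\<zero>\<^bsub>tot_cochains K P 0\<^esub>}
   | Suc m \<Rightarrow> d_tot K P m ` carrier (tot_cochains K P m))"

definition H_CP ::
  "('k, 'm) ring_scheme \<Rightarrow> ('k, 'a, 'l) courant_data \<Rightarrow> nat \<Rightarrow> ('k, ('a, 'l) tot_cochain set) module" where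
  "H_CP K P n = quot_module ((tot_cochains K P n)\<lparr>carrier := cocycles K P n\<rparr>) (coboundaries K P n)"

section \<open>Bases of deformations\<close>

definition aug_ideal :: "('k, 'm) ring_scheme \<Rightarrow> ('k, 'r) module \<Rightarrow> ('r \<Rightarrow> 'k) \<Rightarrow> 'r set" where
  "aug_ideal K R \<epsilon> = a_kernel R K \<epsilon>"

primrec ideal_power :: "('r, 'm) ring_scheme \<Rightarrow> 'r set \<Rightarrow> nat \<Rightarrow> 'r set" where
  "ideal_power R I 0 = carrier R"
| "ideal_power R I (Suc n) = ideal_prod R (ideal_power R I n) I"

definition augmented_algebra ::
  "('k, 'm) ring_scheme \<Rightarrow> ('k, 'r) module \<Rightarrow> ('r \<Rightarrow> 'k) \<Rightarrow> bool" where
  "augmented_algebra K R \<epsilon> \<longleftrightarrow> algebra K R \<and> \<epsilon> \<in> ring_hom R K \<and>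
     (\<forall>k\<in>carrier K. \<forall>r\<in>carrier R. \<epsilon> (k \<odot>\<^bsub>R\<^esub> r) = k \<otimes>\<^bsub>K\<^esub> \<epsilon> r)"

definition deformation_base ::
  "('k, 'm) ring_scheme \<Rightarrow> ('k, 'r) module \<Rightarrow> ('r \<Rightarrow> 'k) \<Rightarrow> bool" where
  "deformation_base K R \<epsilon> \<longleftrightarrow> augmented_algebra K R \<epsilon> \<and>
     (\<forall>k. fin_dim K (quot_module (R\<lparr>carrier := ideal_power R (aug_ideal K R \<epsilon>) k\<rparr>)
        (ideal_power R (aug_ideal K R \<epsilon>) (k + 1))))"

definition augmented_hom ::
  "('k, 'm) ring_scheme \<Rightarrow> ('k, 'r) module \<Rightarrow> ('r \<Rightarrow> 'k) \<Rightarrow> ('k, 's) module \<Rightarrow> ('s \<Rightarrow> 'k)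
    \<Rightarrow> ('r \<Rightarrow> 's) \<Rightarrow> bool" where
  "augmented_hom K R \<epsilon> R1 \<epsilon>1 \<phi> \<longleftrightarrow> \<phi> \<in> ring_hom R R1 \<and> \<phi> \<in> lin_maps K R R1 \<and>
     (\<forall>r\<in>carrier R. \<epsilon>1 (\<phi> r) = \<epsilon> r)"

definition trivial_ext :: "('k, 'm) ring_scheme \<Rightarrow> ('k, 'v) module \<Rightarrow> ('k, 'k \<times> 'v) module" where
  "trivial_ext K V = \<lparr>
     carrier = carrier K \<times> carrier V,
     monoid.mult = (\<lambda>(k1, v1) (k2, v2). (k1 \<otimes>\<^bsub>K\<^esub> k2, (k1 \<odot>\<^bsub>V\<^esub> v2) \<oplus>\<^bsub>V\<^esub> (k2 \<odot>\<^bsub>V\<^esub> v1))),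
     one = (\<one>\<^bsub>K\<^esub>, \<zero>\<^bsub>V\<^esub>),
     ring.zero = (\<zero>\<^bsub>K\<^esub>, \<zero>\<^bsub>V\<^esub>),
     add = (\<lambda>(k1, v1) (k2, v2). (k1 \<oplus>\<^bsub>K\<^esub> k2, v1 \<oplus>\<^bsub>V\<^esub> v2)),
     module.smult = (\<lambda>k (k1, v1). (k \<otimes>\<^bsub>K\<^esub> k1, k \<odot>\<^bsub>V\<^esub> v1))\<rparr>"

section \<open>Deformations\<close>

text \<open>The triplet of product, action and bracket.\<close>

type_synonym ('x, 'y) triplet = "('x \<Rightarrow> 'x \<Rightarrow> 'x) \<times> ('y \<Rightarrow> 'x \<Rightarrow> 'x) \<times> ('y \<Rightarrow> 'y \<Rightarrow> 'y)"

type_synonym ('r, 'a, 'l) deform =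
  "(('r \<times> 'a \<Rightarrow>\<^sub>0 int) set, ('r \<times> 'l \<Rightarrow>\<^sub>0 int) set) triplet"

definition with_triplet ::
  "('k, 'x) module \<Rightarrow> ('k, 'y) module \<Rightarrow> ('x, 'y) triplet \<Rightarrow> ('k, 'x, 'y) courant_data" where
  "with_triplet Z Y t = (case t of (m, \<mu>, b) \<Rightarrow>
     \<lparr>alg = Z\<lparr>monoid.mult := m\<rparr>, lei = Y\<lparr>monoid.mult := b\<rparr>, act = \<mu>\<rparr>)"

text \<open>The pair \<open>(R \<otimes> A, R \<otimes> L)\<close> with a given triplet, over \<open>R\<close> and over \<open>K\<close> respectively.\<close>

definition deformed ::
  "('k, 'm) ring_scheme \<Rightarrow> ('k, 'a, 'l) courant_data \<Rightarrow> ('k, 'r) module \<Rightarrow> ('r, 'a, 'l) deform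
    \<Rightarrow> ('r, ('r \<times> 'a \<Rightarrow>\<^sub>0 int) set, ('r \<times> 'l \<Rightarrow>\<^sub>0 int) set) courant_data" where
  "deformed K P R t = with_triplet (ext_scal K R (alg P)) (ext_scal K R (lei P)) t"

definition deformed_restr ::
  "('k, 'm) ring_scheme \<Rightarrow> ('k, 'a, 'l) courant_data \<Rightarrow> ('k, 'r) module \<Rightarrow> ('r, 'a, 'l) deform
    \<Rightarrow> ('k, ('r \<times> 'a \<Rightarrow>\<^sub>0 int) set, ('r \<times> 'l \<Rightarrow>\<^sub>0 int) set) courant_data" where
  "deformed_restr K P R t = with_triplet (tensor_prod K R (alg P)) (tensor_prod K R (lei P)) t"

text \<open>\<open>\<epsilon> \<otimes> id\<close>, with values in \<open>K \<otimes> V = V\<close>.\<close>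

definition aug_tensor ::
  "('k, 'v) module \<Rightarrow> ('r \<Rightarrow> 'k) \<Rightarrow> ('r \<times> 'v \<Rightarrow>\<^sub>0 int) set \<Rightarrow> 'v" where
  "aug_tensor V \<epsilon> = tensor_lift V (\<lambda>r v. \<epsilon> r \<odot>\<^bsub>V\<^esub> v)"

definition deformation ::
  "('k, 'm) ring_scheme \<Rightarrow> ('k, 'a, 'l) courant_data \<Rightarrow> ('k, 'r) module \<Rightarrow> ('r \<Rightarrow> 'k)
    \<Rightarrow> ('r, 'a, 'l) deform \<Rightarrow> bool" where
  "deformation K P R \<epsilon> t \<longleftrightarrow> deformation_base K R \<epsilon> \<and> courant_pair R (deformed K P R t) \<and>
     courant_hom K (deformed_restr K P R t) P (aug_tensor (alg P) \<epsilon>) (aug_tensor (lei P) \<epsilon>)"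

definition infinitesimal_deformation ::
  "('k, 'm) ring_scheme \<Rightarrow> ('k, 'a, 'l) courant_data \<Rightarrow> ('k, 'r) module \<Rightarrow> ('r \<Rightarrow> 'k)
    \<Rightarrow> ('r, 'a, 'l) deform \<Rightarrow> bool" where
  "infinitesimal_deformation K P R \<epsilon> t \<longleftrightarrow> deformation K P R \<epsilon> t \<and>
     {I. maximalideal I R} = {aug_ideal K R \<epsilon>} \<and> ideal_power R (aug_ideal K R \<epsilon>) 2 = {\<zero>\<^bsub>R\<^esub>}"

definition equivalent_deformations ::
  "('k, 'm) ring_scheme \<Rightarrow> ('k, 'a, 'l) courant_data \<Rightarrow> ('k, 'r) module \<Rightarrow> ('r \<Rightarrow> 'k)
    \<Rightarrow> ('r, 'a, 'l) deform \<Rightarrow> ('r, 'a, 'l) deform \<Rightarrow> bool" where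
  "equivalent_deformations K P R \<epsilon> t1 t2 \<longleftrightarrow>
     deformation K P R \<epsilon> t1 \<and> deformation K P R \<epsilon> t2 \<and>
     (\<exists>f g. courant_hom R (deformed K P R t1) (deformed K P R t2) f g \<and>
        bij_betw f (carrier (ext_scal K R (alg P))) (carrier (ext_scal K R (alg P))) \<and>
        bij_betw g (carrier (ext_scal K R (lei P))) (carrier (ext_scal K R (lei P))) \<and>
        (\<forall>u\<in>carrier (ext_scal K R (alg P)). aug_tensor (alg P) \<epsilon> (f u) = aug_tensor (alg P) \<epsilon> u) \<and>
        (\<forall>w\<in>carrier (ext_scal K R (lei P)). aug_tensor (lei P) \<epsilon> (g w) = aug_tensor (lei P) \<epsilon> w))"

text \<open>
  Push-out along \<open>\<phi> : R \<rightarrow> R1\<close>. The identification of \<open>R1 \<otimes>\<^sub>R (R \<otimes> V)\<close> with \<open>R1 \<otimes> V\<close> sends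
  \<open>r \<otimes>\<^sub>R u\<close> to \<open>r (\<phi> \<otimes> id) u\<close>; the elements \<open>r \<otimes> v = r \<otimes>\<^sub>R (1 \<otimes> v)\<close> generate additively, so the
  structure maps are the \<open>R1\<close>-bilinear extensions of
  \<open>(1 \<otimes>\<^sub>R (1 \<otimes> a), 1 \<otimes>\<^sub>R (1 \<otimes> b)) \<mapsto> 1 \<otimes>\<^sub>R ((1 \<otimes> a) \<cdot> (1 \<otimes> b))\<close> and its analogues.
\<close>

definition base_change ::
  "('k, 'm) ring_scheme \<Rightarrow> ('k, 's) module \<Rightarrow> ('k, 'v) module \<Rightarrow> ('r \<Rightarrow> 's)
    \<Rightarrow> ('r \<times> 'v \<Rightarrow>\<^sub>0 int) set \<Rightarrow> ('s \<times> 'v \<Rightarrow>\<^sub>0 int) set" where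
  "base_change K R1 V \<phi> = tensor_lift (tensor_prod K R1 V) (\<lambda>r v. pure_tensor K R1 V (\<phi> r) v)"

definition push_out ::
  "('k, 'm) ring_scheme \<Rightarrow> ('k, 'a, 'l) courant_data \<Rightarrow> ('k, 'r) module \<Rightarrow> ('k, 's) module
    \<Rightarrow> ('r \<Rightarrow> 's) \<Rightarrow> ('r, 'a, 'l) deform \<Rightarrow> ('s, 'a, 'l) deform" where
  "push_out K P R R1 \<phi> t = (case t of (m, \<mu>, b) \<Rightarrow>
     (let A = alg P; L = lei P;
          iA = pure_tensor K R A \<one>\<^bsub>R\<^esub>; iL = pure_tensor K R L \<one>\<^bsub>R\<^esub> in
      (bilin_ext R1 (ext_scal K R1 A) (\<lambda>a a'. base_change K R1 A \<phi> (m (iA a) (iA a'))),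
       bilin_ext R1 (ext_scal K R1 A) (\<lambda>x a. base_change K R1 A \<phi> (\<mu> (iL x) (iA a))),
       bilin_ext R1 (ext_scal K R1 L) (\<lambda>x y. base_change K R1 L \<phi> (b (iL x) (iL y))))))"

section \<open>The deformation \<open>\<eta>\<^sub>1\<close>\<close>

definition C1 ::
  "('k, 'm) ring_scheme \<Rightarrow> ('k, 'a, 'l) courant_data
    \<Rightarrow> ('k, 'k \<times> (('a, 'l) tot_cochain set \<Rightarrow> 'k)) module" where
  "C1 K P = trivial_ext K (dual_space K (H_CP K P 2))"

text \<open>Linear choices of representing cocycles. The elements of \<open>H_CP K P 2\<close> are cosets of cocycles,
  so \<open>c\<close> represents the class \<open>Z\<close> iff \<open>c \<in> Z\<close>.\<close>

definition cocycle_choice ::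
  "('k, 'm) ring_scheme \<Rightarrow> ('k, 'a, 'l) courant_data
    \<Rightarrow> (('a, 'l) tot_cochain set \<Rightarrow> ('a, 'l) tot_cochain) \<Rightarrow> bool" where
  "cocycle_choice K P \<nu> \<longleftrightarrow> \<nu> \<in> lin_maps K (H_CP K P 2) (tot_cochains K P 2) \<and>
     (\<forall>Z\<in>carrier (H_CP K P 2). \<nu> Z \<in> Z)"

definition eta1 ::
  "('k, 'm) ring_scheme \<Rightarrow> ('k, 'a, 'l) courant_data
    \<Rightarrow> (('a, 'l) tot_cochain set \<Rightarrow> ('a, 'l) tot_cochain)
    \<Rightarrow> nat \<Rightarrow> (nat \<Rightarrow> ('a, 'l) tot_cochain set) \<Rightarrow> (nat \<Rightarrow> ('a, 'l) tot_cochain set \<Rightarrow> 'k)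
    \<Rightarrow> ('k \<times> (('a, 'l) tot_cochain set \<Rightarrow> 'k), 'a, 'l) deform" where
  "eta1 K P \<nu> n h g =
     (let A = alg P; L = lei P; R = C1 K P;
          TA = ext_scal K R A; TL = ext_scal K R L;
          tA = pure_tensor K R A; tL = pure_tensor K R L;
          \<nu>1 = (\<lambda>Z a b. snd (\<nu> Z) 2 [] [a, b]);
          \<nu>2 = (\<lambda>Z x a. snd (\<nu> Z) 1 [x] [a]);
          \<nu>3 = (\<lambda>Z x y. fst (\<nu> Z) [x, y]) in
      (bilin_ext R TA (\<lambda>a b. tA \<one>\<^bsub>R\<^esub> (a \<otimes>\<^bsub>A\<^esub> b)
         \<oplus>\<^bsub>TA\<^esub> (\<Oplus>\<^bsub>TA\<^esub>i\<in>{..<n}. tA (\<zero>\<^bsub>K\<^esub>, g i) (\<nu>1 (h i) a b))),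
       bilin_ext R TA (\<lambda>x a. tA \<one>\<^bsub>R\<^esub> (act P x a)
         \<oplus>\<^bsub>TA\<^esub> (\<Oplus>\<^bsub>TA\<^esub>i\<in>{..<n}. tA (\<zero>\<^bsub>K\<^esub>, g i) (\<nu>2 (h i) x a))),
       bilin_ext R TL (\<lambda>x y. tL \<one>\<^bsub>R\<^esub> (x \<otimes>\<^bsub>L\<^esub> y)
         \<oplus>\<^bsub>TL\<^esub> (\<Oplus>\<^bsub>TL\<^esub>i\<in>{..<n}. tL (\<zero>\<^bsub>K\<^esub>, g i) (\<nu>3 (h i) x y)))))"

end

theory Submission imports Defs begin

text \<open>The proof is linear algebra in coordinates. Let \<open>\<M>\<close> be the maximal ideal of \<open>R\<close>, let
  \<open>r\<^sub>i\<close> be a basis of \<open>\<M>\<close>, and let \<open>\<theta>\<^sub>i\<close> be the functionals on \<open>R = K \<oplus> \<M>\<close> that vanish on \<open>1\<close> and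
  are dual to the \<open>r\<^sub>i\<close>. Because \<open>\<M>\<^sup>2 = 0\<close>, every \<open>\<theta>\<^sub>i\<close> is a derivation along the augmentation:
  \<open>\<theta>\<^sub>i(xy) = \<epsilon>(x) \<theta>\<^sub>i(y) + \<theta>\<^sub>i(x) \<epsilon>(y)\<close>. An element \<open>u\<close> of \<open>R \<otimes> V\<close> is determined by \<open>u\<^sub>0 = (\<epsilon> \<otimes> id) u\<close>
  and its coordinates \<open>u\<^sub>i = (\<theta>\<^sub>i \<otimes> id) u\<close> (\<open>coord_eqI\<close>), and an \<open>R\<close>-bilinear operation \<open>m\<close> that lifts
  an operation \<open>m\<^sub>0\<close> has the coordinates
  \<open>m(u,v)\<^sub>i = m\<^sub>0(u\<^sub>0,v\<^sub>i) + m\<^sub>0(u\<^sub>i,v\<^sub>0) + c\<^sub>i(u\<^sub>0,v\<^sub>0)\<close>, where the component \<open>c\<^sub>i\<close> is \<open>K\<close>-bilinear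
  (\<open>product_rule\<close>).

  In the laws of a Courant pair over \<open>R\<close> the terms that contain some \<open>u\<^sub>i\<close> cancel, since the
  undeformed operations obey the same laws. What remains of the law for the operations in the
  \<open>i\<close>-th coordinate is a component of the 2-cocycle equation for the triplet of components. So
  a deformation is a family of 2-cocycles indexed by \<open>i\<close> (\<open>deformation_iff\<close> and \<open>cocycle_iff\<close>).
  An \<open>R\<close>-linear automorphism of \<open>R \<otimes> V\<close> over the identity of \<open>V\<close> has the form
  \<open>u\<^sub>i \<mapsto> u\<^sub>i + F\<^sub>i(u\<^sub>0)\<close>, and such maps for \<open>A\<close> and \<open>L\<close> intertwine two deformations exactly if for
  every \<open>i\<close> the coboundary of the 1-cochain \<open>(F\<^sub>i, \<psi>\<^sub>i)\<close> is the difference of their \<open>i\<close>-th cocycles.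
  So two deformations are equivalent iff they have the same cohomology classes
  (\<open>equivalent_iff\<close> and \<open>coset_iff_cohomologous\<close>).

  The \<open>i\<close>-th cocycle of \<open>\<phi>\<^sub>*\<eta>\<^sub>1\<close> is \<open>\<Sum>\<^sub>j \<theta>\<^sub>i(\<phi>(g\<^sub>j)) \<nu>(h\<^sub>j)\<close> (\<open>push_out_eta1\<close>). If \<open>z\<^sub>i\<close> is the \<open>i\<close>-th class of
  \<open>\<lambda>\<close>, it follows that \<open>\<lambda>\<close> is equivalent to \<open>\<phi>\<^sub>*\<eta>\<^sub>1\<close> iff \<open>\<theta>\<^sub>i(\<phi>(g\<^sub>j)) = g\<^sub>j(z\<^sub>i)\<close> for all \<open>i\<close> and \<open>j\<close>
  (\<open>equivalent_push_out_iff\<close>). A homomorphism that respects the augmentations is determined by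
  the numbers on the left, and every choice of them occurs because both ideals have square zero.
  The unique solution is the map \<open>(k, \<xi>) \<mapsto> k \<cdot> 1 + \<Sum>\<^sub>i \<xi>(z\<^sub>i) r\<^sub>i\<close> (\<open>classifying\<close>).\<close>

section \<open>Additive maps and the universal property of the tensor product\<close>

definition additive_map :: "('v, 'm) ring_scheme \<Rightarrow> ('w, 'n) ring_scheme \<Rightarrow> ('v \<Rightarrow> 'w) \<Rightarrow> bool" where
  "additive_map V W f \<longleftrightarrow> f \<in> carrier V \<rightarrow> carrier W \<and>
     (\<forall>x\<in>carrier V. \<forall>y\<in>carrier V. f (x \<oplus>\<^bsub>V\<^esub> y) = f x \<oplus>\<^bsub>W\<^esub> f y)"

lemma additiveI:
  assumes "\<And>x. x \<in> carrier V \<Longrightarrow> f x \<in> carrier W"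
    and "\<And>x y. x \<in> carrier V \<Longrightarrow> y \<in> carrier V \<Longrightarrow> f (x \<oplus>\<^bsub>V\<^esub> y) = f x \<oplus>\<^bsub>W\<^esub> f y"
  shows "additive_map V W f"
  using assms by (simp add: additive_map_def)

lemma additive_closed: "additive_map V W f \<Longrightarrow> x \<in> carrier V \<Longrightarrow> f x \<in> carrier W"
  by (auto simp: additive_map_def)

lemma additive_add:
  "additive_map V W f \<Longrightarrow> x \<in> carrier V \<Longrightarrow> y \<in> carrier V \<Longrightarrow> f (x \<oplus>\<^bsub>V\<^esub> y) = f x \<oplus>\<^bsub>W\<^esub> f y"
  by (auto simp: additive_map_def)

lemma additive_zero:
  assumes "abelian_group V" "abelian_group W" "additive_map V W f"
  shows "f \<zero>\<^bsub>V\<^esub> = \<zero>\<^bsub>W\<^esub>"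
proof -
  interpret V: abelian_group V by fact
  interpret W: abelian_group W by fact
  have "f \<zero>\<^bsub>V\<^esub> \<oplus>\<^bsub>W\<^esub> f \<zero>\<^bsub>V\<^esub> = f \<zero>\<^bsub>V\<^esub>"
    using additive_add[OF assms(3), of "\<zero>\<^bsub>V\<^esub>" "\<zero>\<^bsub>V\<^esub>"] by simp
  then show ?thesis
    using additive_closed[OF assms(3), of "\<zero>\<^bsub>V\<^esub>"] by simp
qed

lemma additive_finsum:
  assumes "abelian_group V" "abelian_group W" "additive_map V W f" "\<And>i. i \<in> I \<Longrightarrow> x i \<in> carrier V"
  shows "f (\<Oplus>\<^bsub>V\<^esub>i\<in>I. x i) = (\<Oplus>\<^bsub>W\<^esub>i\<in>I. f (x i))"
proof -
  interpret V: abelian_group V by fact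
  interpret W: abelian_group W by fact
  note cl = additive_closed[OF assms(3)]
  show ?thesis
    using assms(4)
  proof (induction I rule: infinite_finite_induct)
    case (infinite A)
    then show ?case by (simp add: additive_zero[OF assms(1-3)])
  next
    case empty
    then show ?case by (simp add: additive_zero[OF assms(1-3)])
  next
    case (insert i I)
    then have "x \<in> I \<rightarrow> carrier V" "(\<lambda>i. f (x i)) \<in> I \<rightarrow> carrier W" "x i \<in> carrier V"
      by (auto intro: cl)
    with insert show ?case by (simp add: additive_add[OF assms(3)] cl)
  qed
qed

lemma additive_minus:
  assumes "abelian_group V" "abelian_group W" "additive_map V W f" "x \<in> carrier V"
  shows "f (\<ominus>\<^bsub>V\<^esub> x) = \<ominus>\<^bsub>W\<^esub> f x"
proof -
  interpret V: abelian_group V by fact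
  interpret W: abelian_group W by fact
  have "f (\<ominus>\<^bsub>V\<^esub> x) \<oplus>\<^bsub>W\<^esub> f x = \<zero>\<^bsub>W\<^esub>"
    using additive_add[OF assms(3), of "\<ominus>\<^bsub>V\<^esub> x" x] assms(4) additive_zero[OF assms(1-3)]
    by (simp add: V.l_neg)
  then show ?thesis
    using additive_closed[OF assms(3)] assms(4) by (metis V.a_inv_closed W.minus_equality)
qed

text \<open>The extension of \<open>f\<close> to formal integer combinations of generators. It is shaped like the sum
  that evaluates a balanced map on a representative of a tensor.\<close>

definition free_lift :: "('w, 'n) ring_scheme \<Rightarrow> ('p \<Rightarrow> 'w) \<Rightarrow> ('p \<Rightarrow>\<^sub>0 int) \<Rightarrow> 'w" where
  "free_lift W f c = (\<Oplus>\<^bsub>W\<^esub>p\<in>Poly_Mapping.keys c. add_pow W (Poly_Mapping.lookup c p) (f p))"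

context abelian_group
begin

lemma free_lift_superset:
  assumes f: "f \<in> S \<rightarrow> carrier G" and T: "finite T" "Poly_Mapping.keys c \<subseteq> T" "T \<subseteq> S"
  shows "free_lift G f c = (\<Oplus>p\<in>T. add_pow G (Poly_Mapping.lookup c p) (f p))"
  unfolding free_lift_def
proof (rule add.finprod_mono_neutral_cong)
  have cl: "f p \<in> carrier G" if "p \<in> T" for p using that f T by auto
  show "(\<lambda>p. [Poly_Mapping.lookup c p] \<cdot> f p) \<in> Poly_Mapping.keys c \<rightarrow> carrier G"
    using cl T by auto
  show "(\<lambda>p. [Poly_Mapping.lookup c p] \<cdot> f p) \<in> T \<rightarrow> carrier G"
    using cl by auto
qed (use T in \<open>auto simp: in_keys_iff add_pow_def\<close>)

lemma free_lift_closed: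
  assumes "f \<in> S \<rightarrow> carrier G" "Poly_Mapping.keys c \<subseteq> S"
  shows "free_lift G f c \<in> carrier G"
  unfolding free_lift_def by (rule finsum_closed) (use assms in auto)

lemma free_lift_add:
  assumes f: "f \<in> S \<rightarrow> carrier G" and c: "Poly_Mapping.keys c \<subseteq> S" and d: "Poly_Mapping.keys d \<subseteq> S"
  shows "free_lift G f (c + d) = free_lift G f c \<oplus> free_lift G f d"
proof -
  let ?T = "Poly_Mapping.keys c \<union> Poly_Mapping.keys d"
  have cl: "f p \<in> carrier G" if "p \<in> ?T" for p using that f c d by auto
  have T: "finite ?T" "?T \<subseteq> S" "Poly_Mapping.keys (c + d) \<subseteq> ?T"
    using c d Poly_Mapping.keys_add[of c d] by auto
  have "free_lift G f (c + d) = (\<Oplus>p\<in>?T. add_pow G (Poly_Mapping.lookup (c + d) p) (f p))"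
    by (rule free_lift_superset[OF f T(1,3,2)])
  also have "\<dots> = (\<Oplus>p\<in>?T. add_pow G (Poly_Mapping.lookup c p) (f p)
                          \<oplus> add_pow G (Poly_Mapping.lookup d p) (f p))"
    by (rule finsum_cong') (use cl in \<open>auto simp: lookup_add add.int_pow_mult\<close>)
  also have "\<dots> = (\<Oplus>p\<in>?T. add_pow G (Poly_Mapping.lookup c p) (f p))
                \<oplus> (\<Oplus>p\<in>?T. add_pow G (Poly_Mapping.lookup d p) (f p))"
    by (rule finsum_addf) (use cl in auto)
  also have "\<dots> = free_lift G f c \<oplus> free_lift G f d"
    using free_lift_superset[OF f T(1) _ T(2), of c] free_lift_superset[OF f T(1) _ T(2), of d] by simp
  finally show ?thesis .
qed

lemma free_lift_of: "f p \<in> carrier G \<Longrightarrow> free_lift G f (frag_of p) = f p"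
  by (simp add: free_lift_def keys_frag_of add.int_pow_1)

lemma free_lift_zero: "free_lift G f 0 = \<zero>"
  by (simp add: free_lift_def)

lemma free_lift_minus:
  assumes f: "f \<in> S \<rightarrow> carrier G" and c: "Poly_Mapping.keys c \<subseteq> S"
  shows "free_lift G f (- c) = \<ominus> free_lift G f c"
proof -
  have "free_lift G f (- c) \<oplus> free_lift G f c = \<zero>"
    using free_lift_add[OF f, of "- c" c] c by (simp add: free_lift_zero)
  then show ?thesis
    using free_lift_closed[OF f] c by (metis keys_minus minus_equality)
qed

lemma free_lift_diff:
  assumes f: "f \<in> S \<rightarrow> carrier G" and c: "Poly_Mapping.keys c \<subseteq> S" and d: "Poly_Mapping.keys d \<subseteq> S"
  shows "free_lift G f (c - d) = free_lift G f c \<ominus> free_lift G f d"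
  using free_lift_add[OF f, of c "- d"] free_lift_minus[OF f d] c d by (simp add: minus_eq)

end

definition balanced ::
  "('k, 'm) ring_scheme \<Rightarrow> ('k, 'u) module \<Rightarrow> ('k, 'v) module \<Rightarrow> ('w, 'n) ring_scheme
    \<Rightarrow> ('u \<Rightarrow> 'v \<Rightarrow> 'w) \<Rightarrow> bool" where
  "balanced K U V W \<beta> \<longleftrightarrow>
     (\<forall>u\<in>carrier U. additive_map V W (\<beta> u)) \<and> (\<forall>v\<in>carrier V. additive_map U W (\<lambda>u. \<beta> u v)) \<and>
     (\<forall>k\<in>carrier K. \<forall>u\<in>carrier U. \<forall>v\<in>carrier V. \<beta> (k \<odot>\<^bsub>U\<^esub> u) v = \<beta> u (k \<odot>\<^bsub>V\<^esub> v))"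

lemma balancedI:
  assumes "\<And>u v. u \<in> carrier U \<Longrightarrow> v \<in> carrier V \<Longrightarrow> \<beta> u v \<in> carrier W"
    and "\<And>u v v'. u \<in> carrier U \<Longrightarrow> v \<in> carrier V \<Longrightarrow> v' \<in> carrier V
            \<Longrightarrow> \<beta> u (v \<oplus>\<^bsub>V\<^esub> v') = \<beta> u v \<oplus>\<^bsub>W\<^esub> \<beta> u v'"
    and "\<And>u u' v. u \<in> carrier U \<Longrightarrow> u' \<in> carrier U \<Longrightarrow> v \<in> carrier V
            \<Longrightarrow> \<beta> (u \<oplus>\<^bsub>U\<^esub> u') v = \<beta> u v \<oplus>\<^bsub>W\<^esub> \<beta> u' v"
    and "\<And>k u v. k \<in> carrier K \<Longrightarrow> u \<in> carrier U \<Longrightarrow> v \<in> carrier V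
            \<Longrightarrow> \<beta> (k \<odot>\<^bsub>U\<^esub> u) v = \<beta> u (k \<odot>\<^bsub>V\<^esub> v)"
  shows "balanced K U V W \<beta>"
  using assms by (simp add: balanced_def additive_map_def)

lemma balanced_closed:
  "balanced K U V W \<beta> \<Longrightarrow> u \<in> carrier U \<Longrightarrow> v \<in> carrier V \<Longrightarrow> \<beta> u v \<in> carrier W"
  by (auto simp: balanced_def additive_map_def)

locale tensor = U: module K U + V: module K V
  for K :: "('k, 'm) ring_scheme" and U :: "('k, 'u) module" and V :: "('k, 'v) module"
begin

abbreviation "G \<equiv> tensor_add_group K U V"
abbreviation "F \<equiv> tensor_free U V"
abbreviation "S \<equiv> carrier U \<times> carrier V"
abbreviation "N \<equiv> tensor_null K U V"
abbreviation tens (infixl \<open>\<otimes>t\<close> 75) where "u \<otimes>t v \<equiv> pure_tensor K U V u v"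

lemma comm_F: "comm_group F" by (rule abelian_free_Abelian_group)

sublocale F: comm_group F by (rule comm_F)

lemma relators_carrier: "tensor_relators K U V \<subseteq> carrier F"
proof -
  have *: "frag_of (u, v) \<in> carrier F" if "u \<in> carrier U" "v \<in> carrier V" for u v
    using that by simp
  have minus: "x - y \<in> carrier F" if "x \<in> carrier F" "y \<in> carrier F" for x y
    using that keys_diff[of x y] by auto
  show ?thesis
    unfolding tensor_relators_def by (auto simp del: carrier_free_Abelian_group_iff intro!: minus *)
qed

lemma null_normal: "N \<lhd> F"
  unfolding tensor_null_def
  by (intro F.normal_iff_subgroup[THEN iffD2] F.generate_is_subgroup relators_carrier)

lemma null_subgroup: "subgroup N F"
  using null_normal by (simp add: normal_imp_subgroup)

sublocale N: normal N F by (rule null_normal)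

lemma group_carrier: "Z \<in> carrier G \<longleftrightarrow> (\<exists>c\<in>carrier F. Z = N #>\<^bsub>F\<^esub> c)"
  by (auto simp: tensor_add_group_def FactGroup_def RCOSETS_def)

lemma class_closed: "c \<in> carrier F \<Longrightarrow> N #>\<^bsub>F\<^esub> c \<in> carrier G"
  unfolding group_carrier by blast

lemma class_add:
  "c \<in> carrier F \<Longrightarrow> d \<in> carrier F \<Longrightarrow> (N #>\<^bsub>F\<^esub> c) \<oplus>\<^bsub>G\<^esub> (N #>\<^bsub>F\<^esub> d) = N #>\<^bsub>F\<^esub> (c + d)"
  using N.rcos_sum[of c d] by (simp add: tensor_add_group_def FactGroup_def)

lemma class_zero: "\<zero>\<^bsub>G\<^esub> = N #>\<^bsub>F\<^esub> 0"
  using F.coset_mult_one[of N] null_subgroup subgroup.subset[OF null_subgroup]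
  by (simp add: tensor_add_group_def FactGroup_def)

lemma abelian_G: "abelian_group G"
proof -
  have grp: "group (F Mod N)" by (rule N.factorgroup_is_group)
  have "comm_group (add_monoid G)"
  proof (rule group.group_comm_groupI)
    show "group (add_monoid G)"
      using grp unfolding group_def monoid_def group_axioms_def Units_def
      by (simp add: tensor_add_group_def)
    fix x y assume "x \<in> carrier (add_monoid G)" "y \<in> carrier (add_monoid G)"
    then obtain c d where "c \<in> carrier F" "d \<in> carrier F" "x = N #>\<^bsub>F\<^esub> c" "y = N #>\<^bsub>F\<^esub> d"
      using group_carrier by auto
    then show "x \<otimes>\<^bsub>add_monoid G\<^esub> y = y \<otimes>\<^bsub>add_monoid G\<^esub> x"
      using class_add[of c d] class_add[of d c] by (simp add: add.commute)
  qed
  then show ?thesis by (rule comm_group_abelian_groupI)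
qed

sublocale G: abelian_group G by (rule abelian_G)

lemma class_eqI:
  assumes "c \<in> carrier F" "d \<in> carrier F" "c - d \<in> N"
  shows "N #>\<^bsub>F\<^esub> c = N #>\<^bsub>F\<^esub> d"
proof -
  have "c \<in> N #>\<^bsub>F\<^esub> d"
    unfolding r_coset_def using assms(3) by (intro UN_I[of "c - d"]) auto
  then show ?thesis
    using F.repr_independence[OF _ assms(2) null_subgroup, of c] by simp
qed

lemma relator_null: "x \<in> tensor_relators K U V \<Longrightarrow> x \<in> N"
  unfolding tensor_null_def by (rule generate.incl)

lemma frag_in_F: "u \<in> carrier U \<Longrightarrow> v \<in> carrier V \<Longrightarrow> frag_of (u, v) \<in> carrier F"
  by simp

lemma pure_closed [simp, intro]: "u \<in> carrier U \<Longrightarrow> v \<in> carrier V \<Longrightarrow> u \<otimes>t v \<in> carrier G"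
  unfolding group_carrier pure_tensor_def using frag_in_F by blast

lemma F_add: "c \<in> carrier F \<Longrightarrow> d \<in> carrier F \<Longrightarrow> c + d \<in> carrier F"
  using F.m_closed[of c d] by simp

lemma pure_add_left:
  assumes "u \<in> carrier U" "u' \<in> carrier U" "v \<in> carrier V"
  shows "(u \<oplus>\<^bsub>U\<^esub> u') \<otimes>t v = u \<otimes>t v \<oplus>\<^bsub>G\<^esub> u' \<otimes>t v"
  unfolding pure_tensor_def class_add[OF frag_in_F[OF assms(1,3)] frag_in_F[OF assms(2,3)]]
proof (rule class_eqI)
  show "frag_of (u \<oplus>\<^bsub>U\<^esub> u', v) - (frag_of (u, v) + frag_of (u', v)) \<in> N"
    unfolding diff_diff_eq[symmetric]
    by (rule relator_null) (use assms in \<open>unfold tensor_relators_def, blast\<close>)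
qed (use assms in \<open>auto simp del: carrier_free_Abelian_group_iff intro!: F_add frag_in_F\<close>)

lemma pure_add_right:
  assumes "u \<in> carrier U" "v \<in> carrier V" "v' \<in> carrier V"
  shows "u \<otimes>t (v \<oplus>\<^bsub>V\<^esub> v') = u \<otimes>t v \<oplus>\<^bsub>G\<^esub> u \<otimes>t v'"
  unfolding pure_tensor_def class_add[OF frag_in_F[OF assms(1,2)] frag_in_F[OF assms(1,3)]]
proof (rule class_eqI)
  show "frag_of (u, v \<oplus>\<^bsub>V\<^esub> v') - (frag_of (u, v) + frag_of (u, v')) \<in> N"
    unfolding diff_diff_eq[symmetric]
    by (rule relator_null) (use assms in \<open>unfold tensor_relators_def, blast\<close>)
qed (use assms in \<open>auto simp del: carrier_free_Abelian_group_iff intro!: F_add frag_in_F\<close>)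

lemma pure_smult:
  assumes "k \<in> carrier K" "u \<in> carrier U" "v \<in> carrier V"
  shows "(k \<odot>\<^bsub>U\<^esub> u) \<otimes>t v = u \<otimes>t (k \<odot>\<^bsub>V\<^esub> v)"
  unfolding pure_tensor_def
proof (rule class_eqI)
  show "frag_of (k \<odot>\<^bsub>U\<^esub> u, v) - frag_of (u, k \<odot>\<^bsub>V\<^esub> v) \<in> N"
    by (rule relator_null) (use assms in \<open>unfold tensor_relators_def, blast\<close>)
qed (use assms in \<open>auto simp del: carrier_free_Abelian_group_iff intro!: frag_in_F\<close>)

text \<open>The relators that are divided out express exactly that \<open>\<beta>\<close> is balanced, so the extension of
  \<open>\<beta>\<close> kills each of them and hence the subgroup which they generate.\<close>

lemma free_lift_null:
  assumes W: "abelian_group W" and \<beta>: "balanced K U V W \<beta>" and c: "c \<in> N"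
  shows "free_lift W (\<lambda>p. \<beta> (fst p) (snd p)) c = \<zero>\<^bsub>W\<^esub>"
proof -
  interpret W: abelian_group W by fact
  let ?f = "\<lambda>p. \<beta> (fst p) (snd p)"
  have f: "?f \<in> S \<rightarrow> carrier W" by (auto intro: balanced_closed[OF \<beta>])
  have keys: "Poly_Mapping.keys x \<subseteq> S" if "x \<in> tensor_relators K U V" for x
    using subsetD[OF relators_carrier that] by simp
  have rel: "free_lift W ?f x = \<zero>\<^bsub>W\<^esub>" if "x \<in> tensor_relators K U V" for x
  proof -
    have two: "free_lift W ?f (frag_of p - frag_of q - frag_of r) = ?f p \<ominus>\<^bsub>W\<^esub> ?f q \<ominus>\<^bsub>W\<^esub> ?f r"
      "free_lift W ?f (frag_of p - frag_of q) = ?f p \<ominus>\<^bsub>W\<^esub> ?f q"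
      if "p \<in> S" "q \<in> S" "r \<in> S" for p q r
    proof -
      have k: "Poly_Mapping.keys (frag_of p - frag_of q) \<subseteq> S"
        using keys_diff[of "frag_of p" "frag_of q"] that by (auto simp: keys_frag_of)
      have "?f p \<in> carrier W" "?f q \<in> carrier W" "?f r \<in> carrier W"
        using that f by (auto intro: balanced_closed[OF \<beta>])
      then show "free_lift W ?f (frag_of p - frag_of q) = ?f p \<ominus>\<^bsub>W\<^esub> ?f q"
        "free_lift W ?f (frag_of p - frag_of q - frag_of r) = ?f p \<ominus>\<^bsub>W\<^esub> ?f q \<ominus>\<^bsub>W\<^esub> ?f r"
        using that k W.free_lift_diff[OF f, of "frag_of p" "frag_of q"]
          W.free_lift_diff[OF f k, of "frag_of r"]
        by (auto simp: keys_frag_of W.free_lift_of)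
    qed
    have two': "free_lift W ?f (frag_of p - frag_of q) = ?f p \<ominus>\<^bsub>W\<^esub> ?f q" if "p \<in> S" "q \<in> S" for p q
      using two(2)[OF that that(1)] .
    have cancel: "x \<oplus>\<^bsub>W\<^esub> y \<ominus>\<^bsub>W\<^esub> x \<ominus>\<^bsub>W\<^esub> y = \<zero>\<^bsub>W\<^esub>" if "x \<in> carrier W" "y \<in> carrier W" for x y
      using that by (simp add: W.minus_eq W.a_assoc W.a_lcomm[of y] W.r_neg)
    from that show ?thesis
      unfolding tensor_relators_def
      by (elim UnE CollectE exE conjE)
        (use \<beta> in \<open>simp_all add: two(1) two' cancel balanced_def additive_map_def Pi_iff W.r_neg W.minus_eq[of x x for x]\<close>)
  qed
  from c show ?thesis unfolding tensor_null_def
  proof (induction rule: generate.induct)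
    case one
    then show ?case by (simp add: W.free_lift_zero)
  next
    case (incl x)
    then show ?case by (rule rel)
  next
    case (inv x)
    then show ?case using keys[of x] rel[of x] W.free_lift_minus[OF f, of x] by simp
  next
    case (eng x y)
    then have "x \<in> carrier F" "y \<in> carrier F"
      using F.generate_incl[OF relators_carrier] by blast+
    then show ?case using eng W.free_lift_add[OF f, of x y] by simp
  qed
qed

text \<open>The lift picks an arbitrary representative of a class. Two representatives differ by an element
  of \<open>N\<close>, on which the extension of \<open>\<beta>\<close> vanishes, so any representative may be used.\<close>

lemma tensor_lift_class:
  assumes W: "abelian_group W" and \<beta>: "balanced K U V W \<beta>" and c: "c \<in> carrier F"
  shows "tensor_lift W \<beta> (N #>\<^bsub>F\<^esub> c) = free_lift W (\<lambda>p. \<beta> (fst p) (snd p)) c"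
proof -
  interpret W: abelian_group W by fact
  let ?f = "\<lambda>p. \<beta> (fst p) (snd p)"
  have f: "?f \<in> S \<rightarrow> carrier W" by (auto intro: balanced_closed[OF \<beta>])
  let ?e = "SOME e. e \<in> N #>\<^bsub>F\<^esub> c"
  have "c \<in> N #>\<^bsub>F\<^esub> c" by (rule F.rcos_self[OF c null_subgroup])
  then have "?e \<in> N #>\<^bsub>F\<^esub> c" by (metis someI)
  then obtain x where x: "x \<in> N" "?e = x + c" by (auto simp: r_coset_def)
  have "x \<in> carrier F" using subsetD[OF subgroup.subset[OF null_subgroup] x(1)] .
  then have "free_lift W ?f (x + c) = free_lift W ?f c"
    using W.free_lift_add[OF f, of x c] free_lift_null[OF W \<beta> x(1)] W.free_lift_closed[OF f, of c] c
    by simp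
  then show ?thesis
    by (simp only: tensor_lift_def Let_def x(2) free_lift_def)
qed

text \<open>The universal property of the tensor product consists of this lemma, the next one, and the
  induction over pure tensors below, which gives uniqueness.\<close>

lemma tensor_lift_additive:
  assumes W: "abelian_group W" and \<beta>: "balanced K U V W \<beta>"
  shows "additive_map G W (tensor_lift W \<beta>)"
proof -
  interpret W: abelian_group W by fact
  let ?f = "\<lambda>p. \<beta> (fst p) (snd p)"
  have f: "?f \<in> S \<rightarrow> carrier W" by (auto intro: balanced_closed[OF \<beta>])
  show ?thesis
  proof (rule additiveI)
    fix x assume "x \<in> carrier G"
    then show "tensor_lift W \<beta> x \<in> carrier W"
      using tensor_lift_class[OF W \<beta>] W.free_lift_closed[OF f] unfolding group_carrier by auto
  next
    fix x y assume "x \<in> carrier G" "y \<in> carrier G"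
    then obtain c d where "c \<in> carrier F" "d \<in> carrier F" "x = N #>\<^bsub>F\<^esub> c" "y = N #>\<^bsub>F\<^esub> d"
      unfolding group_carrier by auto
    then show "tensor_lift W \<beta> (x \<oplus>\<^bsub>G\<^esub> y) = tensor_lift W \<beta> x \<oplus>\<^bsub>W\<^esub> tensor_lift W \<beta> y"
      using tensor_lift_class[OF W \<beta>] W.free_lift_add[OF f, of c d] F_add[of c d]
      by (simp add: class_add del: carrier_free_Abelian_group_iff) simp
  qed
qed

lemma tensor_lift_pure:
  assumes W: "abelian_group W" and \<beta>: "balanced K U V W \<beta>" and "u \<in> carrier U" "v \<in> carrier V"
  shows "tensor_lift W \<beta> (u \<otimes>t v) = \<beta> u v"
proof -
  interpret W: abelian_group W by fact
  show ?thesis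
    unfolding pure_tensor_def tensor_lift_class[OF W \<beta> frag_in_F[OF assms(3,4)]]
    by (subst W.free_lift_of) (simp_all add: balanced_closed[OF \<beta> assms(3,4)])
qed

lemma pure_minus:
  assumes "u \<in> carrier U" "v \<in> carrier V"
  shows "(\<ominus>\<^bsub>U\<^esub> u) \<otimes>t v = \<ominus>\<^bsub>G\<^esub> (u \<otimes>t v)"
  by (rule additive_minus[OF U.M.abelian_group_axioms abelian_G _ assms(1)])
    (use assms in \<open>auto intro!: additiveI simp: pure_add_left\<close>)

text \<open>Sums of pure tensors suffice, without negatives: \<open>- (u \<otimes> v) = (- u) \<otimes> v\<close> is pure.\<close>

lemma tensor_induct [consumes 1, case_names zero pure add]:
  assumes Z: "Z \<in> carrier G" and zero: "Q \<zero>\<^bsub>G\<^esub>"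
    and pure: "\<And>u v. u \<in> carrier U \<Longrightarrow> v \<in> carrier V \<Longrightarrow> Q (u \<otimes>t v)"
    and add: "\<And>x y. x \<in> carrier G \<Longrightarrow> y \<in> carrier G \<Longrightarrow> Q x \<Longrightarrow> Q y \<Longrightarrow> Q (x \<oplus>\<^bsub>G\<^esub> y)"
  shows "Q Z"
proof -
  have one: "Q (N #>\<^bsub>F\<^esub> frag_of p)" if "p \<in> S" for p
    using that pure[of "fst p" "snd p"] by (auto simp: pure_tensor_def)
  \<comment> \<open>Induction over formal combinations builds differences, so the property is carried along for both signs.\<close>
  have neg: "c \<in> carrier F \<and> Q (N #>\<^bsub>F\<^esub> (- c)) \<and> Q (N #>\<^bsub>F\<^esub> c)" if "Poly_Mapping.keys c \<subseteq> S" for c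
    using that
  proof (induction c rule: frag_induction)
    case zero
    then show ?case using assms(2) by (simp add: class_zero)
  next
    case (one p)
    then obtain u v where p: "p = (u, v)" "u \<in> carrier U" "v \<in> carrier V" by auto
    have "(N #>\<^bsub>F\<^esub> (- frag_of p)) \<oplus>\<^bsub>G\<^esub> (u \<otimes>t v) = \<zero>\<^bsub>G\<^esub>"
      using p class_add[of "- frag_of p" "frag_of p"] by (simp add: class_zero pure_tensor_def)
    moreover have "N #>\<^bsub>F\<^esub> (- frag_of p) \<in> carrier G"
      by (rule class_closed) (use p in simp)
    ultimately have "N #>\<^bsub>F\<^esub> (- frag_of p) = (\<ominus>\<^bsub>U\<^esub> u) \<otimes>t v"
      using p by (metis G.minus_equality pure_closed pure_minus)
    then show ?case using p pure[of "\<ominus>\<^bsub>U\<^esub> u" v] pure[of u v] by (simp add: pure_tensor_def)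
  next
    case (diff a b)
    have step: "Q (N #>\<^bsub>F\<^esub> (x + y))"
      if "x \<in> carrier F" "y \<in> carrier F" "Q (N #>\<^bsub>F\<^esub> x)" "Q (N #>\<^bsub>F\<^esub> y)" for x y
      using add[of "N #>\<^bsub>F\<^esub> x" "N #>\<^bsub>F\<^esub> y"] that class_closed class_add by metis
    have "- a \<in> carrier F" "- b \<in> carrier F" using diff by simp_all
    then show ?case
      using step[of a "- b"] step[of "- a" b] diff F_add[of a "- b"]
      by (simp add: add.commute del: carrier_free_Abelian_group_iff)
  qed
  show ?thesis using Z neg unfolding group_carrier by auto
qed

end

section \<open>Extension of scalars\<close>

lemma abelian_group_transfer:
  assumes "abelian_group V" and "carrier W = carrier V" "\<zero>\<^bsub>W\<^esub> = \<zero>\<^bsub>V\<^esub>"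
    and "\<And>x y. x \<oplus>\<^bsub>W\<^esub> y = x \<oplus>\<^bsub>V\<^esub> y"
  shows "abelian_group W"
proof -
  interpret V: abelian_group V by fact
  show ?thesis
    by (rule abelian_groupI)
      (use assms(2-4) in \<open>auto simp: V.a_ac intro!: bexI[of _ "\<ominus>\<^bsub>V\<^esub> _"] V.l_neg\<close>)
qed

lemma additive_comp:
  "additive_map U V f \<Longrightarrow> additive_map V W g \<Longrightarrow> additive_map U W (\<lambda>x. g (f x))"
  by (rule additiveI) (auto simp: additive_closed additive_add)

lemma (in module) additive_smult:
  assumes "additive_map V M f" "r \<in> carrier R"
  shows "additive_map V M (\<lambda>x. r \<odot>\<^bsub>M\<^esub> f x)"
  by (rule additiveI) (use assms in \<open>auto simp: additive_closed additive_add smult_r_distr\<close>)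

locale scalar_ext = R: algebra K R + V: module K V
  for K :: "('k, 'm) ring_scheme" and R :: "('k, 'r) module" and V :: "('k, 'v) module"
begin

sublocale T: tensor K R V
  by (intro tensor.intro R.module_axioms V.module_axioms)

abbreviation "E \<equiv> ext_scal K R V"
abbreviation "E0 \<equiv> tensor_prod K R V"
abbreviation "tens \<equiv> pure_tensor K R V"

lemma ext_scal_sel:
  "carrier E = carrier T.G" "\<zero>\<^bsub>E\<^esub> = \<zero>\<^bsub>T.G\<^esub>" "(\<oplus>\<^bsub>E\<^esub>) = (\<oplus>\<^bsub>T.G\<^esub>)"
  "s \<odot>\<^bsub>E\<^esub> Z = tensor_lift T.G (\<lambda>r v. tens (s \<otimes>\<^bsub>R\<^esub> r) v) Z"
  by (simp_all add: ext_scal_def ring.defs module.defs)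

lemma tensor_prod_sel:
  "carrier E0 = carrier T.G" "\<zero>\<^bsub>E0\<^esub> = \<zero>\<^bsub>T.G\<^esub>" "(\<oplus>\<^bsub>E0\<^esub>) = (\<oplus>\<^bsub>T.G\<^esub>)"
  "k \<odot>\<^bsub>E0\<^esub> Z = tensor_lift T.G (\<lambda>r v. tens (k \<odot>\<^bsub>R\<^esub> r) v) Z"
  by (simp_all add: tensor_prod_def ring.defs module.defs)

lemma abelian_E: "abelian_group E"
  by (rule abelian_group_transfer[OF T.abelian_G]) (simp_all add: ext_scal_sel)

lemma abelian_E0: "abelian_group E0"
  by (rule abelian_group_transfer[OF T.abelian_G]) (simp_all add: tensor_prod_sel)

sublocale E: abelian_group E by (rule abelian_E)

lemma pure_closed [simp, intro]: "r \<in> carrier R \<Longrightarrow> v \<in> carrier V \<Longrightarrow> tens r v \<in> carrier E"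
  by (simp add: ext_scal_sel T.pure_closed)

lemma pure_add_left:
  "r \<in> carrier R \<Longrightarrow> s \<in> carrier R \<Longrightarrow> v \<in> carrier V \<Longrightarrow> tens (r \<oplus>\<^bsub>R\<^esub> s) v = tens r v \<oplus>\<^bsub>E\<^esub> tens s v"
  by (simp add: ext_scal_sel T.pure_add_left)

lemma pure_add_right:
  "r \<in> carrier R \<Longrightarrow> v \<in> carrier V \<Longrightarrow> w \<in> carrier V \<Longrightarrow> tens r (v \<oplus>\<^bsub>V\<^esub> w) = tens r v \<oplus>\<^bsub>E\<^esub> tens r w"
  by (simp add: ext_scal_sel T.pure_add_right)

lemmas pure_smult = T.pure_smult

lemma tensor_lift_additive:
  assumes "abelian_group W" "balanced K R V W \<beta>"
  shows "additive_map E W (tensor_lift W \<beta>)"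
  using T.tensor_lift_additive[OF assms] by (simp add: additive_map_def ext_scal_sel)

lemmas tensor_lift_pure = T.tensor_lift_pure

lemma tensor_induct [consumes 1, case_names zero pure add]:
  assumes "Z \<in> carrier E" "Q \<zero>\<^bsub>E\<^esub>"
    and "\<And>r v. r \<in> carrier R \<Longrightarrow> v \<in> carrier V \<Longrightarrow> Q (tens r v)"
    and "\<And>x y. x \<in> carrier E \<Longrightarrow> y \<in> carrier E \<Longrightarrow> Q x \<Longrightarrow> Q y \<Longrightarrow> Q (x \<oplus>\<^bsub>E\<^esub> y)"
  shows "Q Z"
  using T.tensor_induct[of Z Q] assms by (simp add: ext_scal_sel)

text \<open>Pure tensors generate. This is the way in which all identities on \<open>R \<otimes> V\<close> are checked below.\<close>

lemma additive_eqI: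
  assumes "abelian_group W" "additive_map E W f" "additive_map E W g" "Z \<in> carrier E"
    and "\<And>r v. r \<in> carrier R \<Longrightarrow> v \<in> carrier V \<Longrightarrow> f (tens r v) = g (tens r v)"
  shows "f Z = g Z"
  using assms(4)
proof (induction rule: tensor_induct)
  case zero
  show ?case
    using additive_zero[OF abelian_E assms(1,2)] additive_zero[OF abelian_E assms(1,3)] by simp
qed (simp_all add: assms(5) additive_add[OF assms(2)] additive_add[OF assms(3)])

lemma balanced_smult: "s \<in> carrier R \<Longrightarrow> balanced K R V T.G (\<lambda>r v. tens (s \<otimes>\<^bsub>R\<^esub> r) v)"
  by (rule balancedI)
    (auto simp: R.r_distr T.pure_add_left T.pure_add_right pure_smult[symmetric]
      R.smult_assoc2 R.m_comm[of s] )

lemma balanced_smult0: "k \<in> carrier K \<Longrightarrow> balanced K R V T.G (\<lambda>r v. tens (k \<odot>\<^bsub>R\<^esub> r) v)"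
  by (rule balancedI)
    (auto simp: R.smult_r_distr T.pure_add_left T.pure_add_right pure_smult[symmetric]
      R.smult_assoc1[symmetric] R.R.m_comm)

lemma smult_pure [simp]:
  "s \<in> carrier R \<Longrightarrow> r \<in> carrier R \<Longrightarrow> v \<in> carrier V \<Longrightarrow> s \<odot>\<^bsub>E\<^esub> (tens r v) = tens (s \<otimes>\<^bsub>R\<^esub> r) v"
  unfolding ext_scal_sel by (subst tensor_lift_pure[OF T.abelian_G balanced_smult]) auto

lemma smult0_pure:
  "k \<in> carrier K \<Longrightarrow> r \<in> carrier R \<Longrightarrow> v \<in> carrier V \<Longrightarrow> k \<odot>\<^bsub>E0\<^esub> (tens r v) = tens (k \<odot>\<^bsub>R\<^esub> r) v"
  unfolding tensor_prod_sel by (subst tensor_lift_pure[OF T.abelian_G balanced_smult0]) auto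

lemma smult_additive: "s \<in> carrier R \<Longrightarrow> additive_map E E (\<lambda>Z. s \<odot>\<^bsub>E\<^esub> Z)"
  using T.tensor_lift_additive[OF T.abelian_G balanced_smult] by (simp add: additive_map_def ext_scal_sel)

lemma smult0_additive: "k \<in> carrier K \<Longrightarrow> additive_map E E (\<lambda>Z. k \<odot>\<^bsub>E0\<^esub> Z)"
  using T.tensor_lift_additive[OF T.abelian_G balanced_smult0]
  by (simp add: additive_map_def ext_scal_sel tensor_prod_sel)

lemma module_E: "module R E"
proof (rule moduleI)
  show "cring R" by (rule R.M_cring)
  show "abelian_group E" by (rule abelian_E)
  fix a b x y assume a: "a \<in> carrier R" and b: "b \<in> carrier R" and x: "x \<in> carrier E" and y: "y \<in> carrier E"
  note cl = additive_closed[OF smult_additive] note ad = additive_add[OF smult_additive]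
  show "a \<odot>\<^bsub>E\<^esub> x \<in> carrier E" using a x by (rule cl)
  show "a \<odot>\<^bsub>E\<^esub> (x \<oplus>\<^bsub>E\<^esub> y) = a \<odot>\<^bsub>E\<^esub> x \<oplus>\<^bsub>E\<^esub> a \<odot>\<^bsub>E\<^esub> y" using a x y by (rule ad)
  show "(a \<oplus>\<^bsub>R\<^esub> b) \<odot>\<^bsub>E\<^esub> x = a \<odot>\<^bsub>E\<^esub> x \<oplus>\<^bsub>E\<^esub> b \<odot>\<^bsub>E\<^esub> x"
    by (rule additive_eqI[OF abelian_E _ _ x])
      (use a b in \<open>simp_all add: additive_map_def cl ad E.a_ac R.l_distr pure_add_left\<close>)
  show "(a \<otimes>\<^bsub>R\<^esub> b) \<odot>\<^bsub>E\<^esub> x = a \<odot>\<^bsub>E\<^esub> (b \<odot>\<^bsub>E\<^esub> x)"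
    by (rule additive_eqI[OF abelian_E _ _ x])
      (use a b in \<open>simp_all add: additive_map_def cl ad R.m_assoc\<close>)
next
  fix x assume x: "x \<in> carrier E"
  show "\<one>\<^bsub>R\<^esub> \<odot>\<^bsub>E\<^esub> x = x"
    by (rule additive_eqI[OF abelian_E smult_additive _ x]) (simp_all add: additive_map_def)
qed

sublocale E: module R E by (rule module_E)

text \<open>The action of \<open>K\<close> on \<open>R \<otimes> V\<close> comes from the action of \<open>R\<close> by restriction along \<open>k \<mapsto> k \<cdot> 1\<close>.
  In the laws for a deformation both actions occur: the reduction modulo the maximal ideal is
  only \<open>K\<close>-linear.\<close>

lemma smult0_eq: "k \<in> carrier K \<Longrightarrow> x \<in> carrier E \<Longrightarrow> k \<odot>\<^bsub>E0\<^esub> x = (k \<odot>\<^bsub>R\<^esub> \<one>\<^bsub>R\<^esub>) \<odot>\<^bsub>E\<^esub> x"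
  by (rule additive_eqI[OF abelian_E smult0_additive smult_additive])
    (auto simp: smult0_pure R.smult_assoc2)

end

text \<open>An \<open>R\<close>-bilinear extension exists as soon as \<open>\<beta>\<close> is \<open>K\<close>-bilinear, where \<open>K\<close> acts on the
  \<open>R\<close>-module \<open>W\<close> through \<open>k \<mapsto> k \<cdot> 1\<close>.\<close>

definition scalar_bilinear ::
  "('k, 'm) ring_scheme \<Rightarrow> ('k, 'r) module \<Rightarrow> ('k, 'u) module \<Rightarrow> ('k, 'v) module \<Rightarrow> ('r, 'w) module
    \<Rightarrow> ('u \<Rightarrow> 'v \<Rightarrow> 'w) \<Rightarrow> bool" where
  "scalar_bilinear K R U V W \<beta> \<longleftrightarrow>
     (\<forall>u\<in>carrier U. additive_map V W (\<beta> u)) \<and> (\<forall>v\<in>carrier V. additive_map U W (\<lambda>u. \<beta> u v)) \<and>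
     (\<forall>k\<in>carrier K. \<forall>u\<in>carrier U. \<forall>v\<in>carrier V.
        \<beta> (k \<odot>\<^bsub>U\<^esub> u) v = (k \<odot>\<^bsub>R\<^esub> \<one>\<^bsub>R\<^esub>) \<odot>\<^bsub>W\<^esub> \<beta> u v \<and> \<beta> u (k \<odot>\<^bsub>V\<^esub> v) = (k \<odot>\<^bsub>R\<^esub> \<one>\<^bsub>R\<^esub>) \<odot>\<^bsub>W\<^esub> \<beta> u v)"

locale bilinear_ext = U: scalar_ext K R U + V: scalar_ext K R V + W: module R W
  for K :: "('k, 'm) ring_scheme" and R :: "('k, 'r) module" and U :: "('k, 'u) module"
    and V :: "('k, 'v) module" and W :: "('r, 'w) module" +
  fixes \<beta> :: "'u \<Rightarrow> 'v \<Rightarrow> 'w"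
  assumes bilinear: "scalar_bilinear K R U V W \<beta>"
begin

lemma \<beta>_closed: "u \<in> carrier U \<Longrightarrow> v \<in> carrier V \<Longrightarrow> \<beta> u v \<in> carrier W"
  using bilinear by (auto simp: scalar_bilinear_def additive_map_def)

lemma \<beta>_add:
  "u \<in> carrier U \<Longrightarrow> v \<in> carrier V \<Longrightarrow> v' \<in> carrier V \<Longrightarrow> \<beta> u (v \<oplus>\<^bsub>V\<^esub> v') = \<beta> u v \<oplus>\<^bsub>W\<^esub> \<beta> u v'"
  "u \<in> carrier U \<Longrightarrow> u' \<in> carrier U \<Longrightarrow> v \<in> carrier V \<Longrightarrow> \<beta> (u \<oplus>\<^bsub>U\<^esub> u') v = \<beta> u v \<oplus>\<^bsub>W\<^esub> \<beta> u' v"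
  using bilinear by (auto simp: scalar_bilinear_def additive_map_def)

lemma \<beta>_smult:
  assumes "k \<in> carrier K" "u \<in> carrier U" "v \<in> carrier V"
  shows "\<beta> (k \<odot>\<^bsub>U\<^esub> u) v = (k \<odot>\<^bsub>R\<^esub> \<one>\<^bsub>R\<^esub>) \<odot>\<^bsub>W\<^esub> \<beta> u v"
    "\<beta> u (k \<odot>\<^bsub>V\<^esub> v) = (k \<odot>\<^bsub>R\<^esub> \<one>\<^bsub>R\<^esub>) \<odot>\<^bsub>W\<^esub> \<beta> u v"
  using bilinear assms by (auto simp: scalar_bilinear_def)

abbreviation "inner r u \<equiv> tensor_lift W (\<lambda>s v. (r \<otimes>\<^bsub>R\<^esub> s) \<odot>\<^bsub>W\<^esub> \<beta> u v)"

lemma abelian_W: "abelian_group W" by (rule W.M.abelian_group_axioms)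

lemma balanced_inner:
  assumes "r \<in> carrier R" "u \<in> carrier U"
  shows "balanced K R V W (\<lambda>s v. (r \<otimes>\<^bsub>R\<^esub> s) \<odot>\<^bsub>W\<^esub> \<beta> u v)"
proof (rule balancedI)
  fix k s v assume *: "k \<in> carrier K" "s \<in> carrier R" "v \<in> carrier V"
  have "r \<otimes>\<^bsub>R\<^esub> (k \<odot>\<^bsub>R\<^esub> s) = (r \<otimes>\<^bsub>R\<^esub> s) \<otimes>\<^bsub>R\<^esub> (k \<odot>\<^bsub>R\<^esub> \<one>\<^bsub>R\<^esub>)"
    using assms * by (simp add: U.R.smult_assoc2 U.R.m_comm[of _ "k \<odot>\<^bsub>R\<^esub> _"] U.R.m_comm[of r s])
  then show "(r \<otimes>\<^bsub>R\<^esub> (k \<odot>\<^bsub>R\<^esub> s)) \<odot>\<^bsub>W\<^esub> \<beta> u v = (r \<otimes>\<^bsub>R\<^esub> s) \<odot>\<^bsub>W\<^esub> \<beta> u (k \<odot>\<^bsub>V\<^esub> v)"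
    using assms * by (simp add: \<beta>_smult \<beta>_closed W.smult_assoc1)
qed (use assms in \<open>auto simp: \<beta>_closed \<beta>_add W.smult_r_distr W.smult_l_distr U.R.r_distr\<close>)

lemma inner_additive: "r \<in> carrier R \<Longrightarrow> u \<in> carrier U \<Longrightarrow> additive_map V.E W (inner r u)"
  by (rule V.tensor_lift_additive[OF abelian_W balanced_inner])

lemma inner_pure:
  "r \<in> carrier R \<Longrightarrow> u \<in> carrier U \<Longrightarrow> s \<in> carrier R \<Longrightarrow> v \<in> carrier V
    \<Longrightarrow> inner r u (V.tens s v) = (r \<otimes>\<^bsub>R\<^esub> s) \<odot>\<^bsub>W\<^esub> \<beta> u v"
  by (rule V.tensor_lift_pure[OF abelian_W balanced_inner])

lemma sum_additive:
  assumes "additive_map V.E W f" "additive_map V.E W g"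
  shows "additive_map V.E W (\<lambda>x. f x \<oplus>\<^bsub>W\<^esub> g x)"
  by (rule additiveI)
    (auto simp: additive_closed[OF assms(1)] additive_closed[OF assms(2)] additive_add[OF assms(1)]
      additive_add[OF assms(2)] W.M.a_ac)

text \<open>The extension of \<open>\<beta>\<close> is an iterated lift, first in the second argument and then in the first.
  The outer lift needs balancedness of the inner one, which is checked on pure tensors.\<close>

lemma balanced_outer:
  assumes Y: "Y \<in> carrier V.E"
  shows "balanced K R U W (\<lambda>r u. inner r u Y)"
proof (rule balancedI)
  fix k r u assume *: "k \<in> carrier K" "r \<in> carrier R" "u \<in> carrier U"
  show "inner (k \<odot>\<^bsub>R\<^esub> r) u Y = inner r (k \<odot>\<^bsub>U\<^esub> u) Y"
  proof (rule V.additive_eqI[OF abelian_W inner_additive inner_additive Y])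
    fix s v assume s: "s \<in> carrier R" "v \<in> carrier V"
    have "(k \<odot>\<^bsub>R\<^esub> r) \<otimes>\<^bsub>R\<^esub> s = (r \<otimes>\<^bsub>R\<^esub> s) \<otimes>\<^bsub>R\<^esub> (k \<odot>\<^bsub>R\<^esub> \<one>\<^bsub>R\<^esub>)"
      using * s by (simp add: U.R.smult_assoc2 U.R.m_comm[of _ "k \<odot>\<^bsub>R\<^esub> _"])
    then show "inner (k \<odot>\<^bsub>R\<^esub> r) u (V.tens s v) = inner r (k \<odot>\<^bsub>U\<^esub> u) (V.tens s v)"
      using * s by (simp add: inner_pure \<beta>_smult \<beta>_closed W.smult_assoc1)
  qed (use * in auto)
next
  fix r s u assume *: "r \<in> carrier R" "s \<in> carrier R" "u \<in> carrier U"
  show "inner (r \<oplus>\<^bsub>R\<^esub> s) u Y = inner r u Y \<oplus>\<^bsub>W\<^esub> inner s u Y"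
    by (rule V.additive_eqI[OF abelian_W inner_additive sum_additive Y])
      (use * in \<open>auto simp: inner_additive inner_pure \<beta>_closed W.smult_l_distr U.R.l_distr\<close>)
next
  fix r u u' assume *: "r \<in> carrier R" "u \<in> carrier U" "u' \<in> carrier U"
  show "inner r (u \<oplus>\<^bsub>U\<^esub> u') Y = inner r u Y \<oplus>\<^bsub>W\<^esub> inner r u' Y"
    by (rule V.additive_eqI[OF abelian_W inner_additive sum_additive Y])
      (use * in \<open>auto simp: inner_additive inner_pure \<beta>_closed \<beta>_add W.smult_r_distr\<close>)
next
  fix r u assume "r \<in> carrier R" "u \<in> carrier U"
  then show "inner r u Y \<in> carrier W" using additive_closed[OF inner_additive Y] by simp
qed

text \<open>Together with bilinearity, this value on pure tensors determines the extension.\<close>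

lemma bilin_ext_pure:
  assumes "r \<in> carrier R" "u \<in> carrier U" "s \<in> carrier R" "v \<in> carrier V"
  shows "bilin_ext R W \<beta> (U.tens r u) (V.tens s v) = (r \<otimes>\<^bsub>R\<^esub> s) \<odot>\<^bsub>W\<^esub> \<beta> u v"
  unfolding bilin_ext_def
  using U.tensor_lift_pure[OF abelian_W balanced_outer, of "V.tens s v" r u] assms
  by (simp add: inner_pure)

lemma bilin_ext_additive_left:
  "Y \<in> carrier V.E \<Longrightarrow> additive_map U.E W (\<lambda>Z. bilin_ext R W \<beta> Z Y)"
  unfolding bilin_ext_def by (rule U.tensor_lift_additive[OF abelian_W balanced_outer])

lemma bilin_ext_additive_right:
  assumes Z: "Z \<in> carrier U.E"
  shows "additive_map V.E W (bilin_ext R W \<beta> Z)"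
proof (rule additiveI)
  fix x y assume *: "x \<in> carrier V.E" "y \<in> carrier V.E"
  show "bilin_ext R W \<beta> Z x \<in> carrier W"
    by (rule additive_closed[OF bilin_ext_additive_left Z]) fact
  have sum: "additive_map U.E W (\<lambda>Z. bilin_ext R W \<beta> Z x \<oplus>\<^bsub>W\<^esub> bilin_ext R W \<beta> Z y)"
    using * by (intro additiveI)
      (auto simp: additive_closed[OF bilin_ext_additive_left] additive_add[OF bilin_ext_additive_left] W.M.a_ac)
  show "bilin_ext R W \<beta> Z (x \<oplus>\<^bsub>V.E\<^esub> y) = bilin_ext R W \<beta> Z x \<oplus>\<^bsub>W\<^esub> bilin_ext R W \<beta> Z y"
  proof (rule U.additive_eqI[OF abelian_W bilin_ext_additive_left sum Z])
    fix r u assume r: "r \<in> carrier R" "u \<in> carrier U"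
    have "bilin_ext R W \<beta> (U.tens r u) Y = inner r u Y" if "Y \<in> carrier V.E" for Y
      unfolding bilin_ext_def
      using U.tensor_lift_pure[OF abelian_W balanced_outer[OF that] r] .
    then show "bilin_ext R W \<beta> (U.tens r u) (x \<oplus>\<^bsub>V.E\<^esub> y)
        = bilin_ext R W \<beta> (U.tens r u) x \<oplus>\<^bsub>W\<^esub> bilin_ext R W \<beta> (U.tens r u) y"
      using * additive_add[OF inner_additive[OF r]] by simp
  qed (use * in auto)
qed

lemma bilin_ext_smult:
  assumes "r \<in> carrier R" "Z \<in> carrier U.E" "Y \<in> carrier V.E"
  shows "bilin_ext R W \<beta> (r \<odot>\<^bsub>U.E\<^esub> Z) Y = r \<odot>\<^bsub>W\<^esub> bilin_ext R W \<beta> Z Y"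
    "bilin_ext R W \<beta> Z (r \<odot>\<^bsub>V.E\<^esub> Y) = r \<odot>\<^bsub>W\<^esub> bilin_ext R W \<beta> Z Y"
proof -
  note L = bilin_ext_additive_left note Ri = bilin_ext_additive_right
  have rs: "(r \<otimes>\<^bsub>R\<^esub> s) \<otimes>\<^bsub>R\<^esub> t = r \<otimes>\<^bsub>R\<^esub> (s \<otimes>\<^bsub>R\<^esub> t)" "s \<otimes>\<^bsub>R\<^esub> (r \<otimes>\<^bsub>R\<^esub> t) = r \<otimes>\<^bsub>R\<^esub> (s \<otimes>\<^bsub>R\<^esub> t)"
    if "s \<in> carrier R" "t \<in> carrier R" for s t
    using assms(1) that by (simp_all add: U.R.m_ac)
  show "bilin_ext R W \<beta> (r \<odot>\<^bsub>U.E\<^esub> Z) Y = r \<odot>\<^bsub>W\<^esub> bilin_ext R W \<beta> Z Y"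
  proof (rule U.additive_eqI[OF abelian_W additive_comp[OF U.smult_additive L] W.additive_smult[OF L] assms(2)])
    fix s u assume s: "s \<in> carrier R" "u \<in> carrier U"
    show "bilin_ext R W \<beta> (r \<odot>\<^bsub>U.E\<^esub> U.tens s u) Y = r \<odot>\<^bsub>W\<^esub> bilin_ext R W \<beta> (U.tens s u) Y"
      by (rule V.additive_eqI[OF abelian_W Ri W.additive_smult[OF Ri] assms(3)])
        (use assms s in \<open>auto simp: bilin_ext_pure rs W.smult_assoc1 \<beta>_closed\<close>)
  qed (use assms in auto)
  show "bilin_ext R W \<beta> Z (r \<odot>\<^bsub>V.E\<^esub> Y) = r \<odot>\<^bsub>W\<^esub> bilin_ext R W \<beta> Z Y"
  proof (rule U.additive_eqI[OF abelian_W L W.additive_smult[OF L] assms(2)])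
    fix s u assume s: "s \<in> carrier R" "u \<in> carrier U"
    show "bilin_ext R W \<beta> (U.tens s u) (r \<odot>\<^bsub>V.E\<^esub> Y) = r \<odot>\<^bsub>W\<^esub> bilin_ext R W \<beta> (U.tens s u) Y"
      by (rule V.additive_eqI[OF abelian_W additive_comp[OF V.smult_additive Ri] W.additive_smult[OF Ri] assms(3)])
        (use assms s in \<open>auto simp: bilin_ext_pure rs W.smult_assoc1 \<beta>_closed\<close>)
  qed (use assms in auto)
qed

lemma bilin_ext_bilin: "bilin_ext R W \<beta> \<in> bilin_maps R U.E V.E W"
  unfolding bilin_maps_def lin_maps_def
  by (auto simp: additive_closed[OF bilin_ext_additive_left] bilin_ext_smult
      additive_add[OF bilin_ext_additive_left] additive_add[OF bilin_ext_additive_right])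

end

section \<open>Coordinates on an infinitesimal base\<close>

text \<open>Linearity as additivity plus homogeneity. Additivity alone is what the lemmas on sums and on
  tensors ask for.\<close>

definition functional :: "('k, 'm) ring_scheme \<Rightarrow> ('k, 'v, 'z) module_scheme \<Rightarrow> ('v \<Rightarrow> 'k) \<Rightarrow> bool" where
  "functional K V \<theta> \<longleftrightarrow> additive_map V K \<theta> \<and>
     (\<forall>k\<in>carrier K. \<forall>x\<in>carrier V. \<theta> (k \<odot>\<^bsub>V\<^esub> x) = k \<otimes>\<^bsub>K\<^esub> \<theta> x)"

lemma functionalD:
  assumes "functional K V \<theta>"
  shows "additive_map V K \<theta>"
    and "x \<in> carrier V \<Longrightarrow> \<theta> x \<in> carrier K"
    and "x \<in> carrier V \<Longrightarrow> y \<in> carrier V \<Longrightarrow> \<theta> (x \<oplus>\<^bsub>V\<^esub> y) = \<theta> x \<oplus>\<^bsub>K\<^esub> \<theta> y"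
    and "k \<in> carrier K \<Longrightarrow> x \<in> carrier V \<Longrightarrow> \<theta> (k \<odot>\<^bsub>V\<^esub> x) = k \<otimes>\<^bsub>K\<^esub> \<theta> x"
  using assms by (auto simp: functional_def additive_map_def)

context module
begin

definition spans :: "'c set \<Rightarrow> bool" where
  "spans S \<longleftrightarrow> finite S \<and> S \<subseteq> carrier M \<and>
     (\<forall>v\<in>carrier M. \<exists>c\<in>S \<rightarrow> carrier R. v = (\<Oplus>\<^bsub>M\<^esub>s\<in>S. c s \<odot>\<^bsub>M\<^esub> s))"

lemma comb_closed: "S \<subseteq> carrier M \<Longrightarrow> c \<in> S \<rightarrow> carrier R \<Longrightarrow> (\<Oplus>\<^bsub>M\<^esub>s\<in>S. c s \<odot>\<^bsub>M\<^esub> s) \<in> carrier M"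
  by (rule finsum_closed) auto

text \<open>The shape \<open>c + k e\<close> covers sums, scalar multiples and differences of combinations at once.\<close>

lemma comb_add:
  assumes "S \<subseteq> carrier M" "c \<in> S \<rightarrow> carrier R" "e \<in> S \<rightarrow> carrier R" "k \<in> carrier R"
  shows "(\<Oplus>\<^bsub>M\<^esub>s\<in>S. c s \<odot>\<^bsub>M\<^esub> s) \<oplus>\<^bsub>M\<^esub> k \<odot>\<^bsub>M\<^esub> (\<Oplus>\<^bsub>M\<^esub>s\<in>S. e s \<odot>\<^bsub>M\<^esub> s)
    = (\<Oplus>\<^bsub>M\<^esub>s\<in>S. (c s \<oplus> k \<otimes> e s) \<odot>\<^bsub>M\<^esub> s)"
proof -
  have smult: "additive_map M M (\<lambda>x. k \<odot>\<^bsub>M\<^esub> x)"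
    using assms(4) by (intro additiveI) (auto simp: smult_r_distr)
  have cl: "(\<lambda>s. c s \<odot>\<^bsub>M\<^esub> s) \<in> S \<rightarrow> carrier M" "(\<lambda>s. k \<odot>\<^bsub>M\<^esub> (e s \<odot>\<^bsub>M\<^esub> s)) \<in> S \<rightarrow> carrier M"
    using assms by (auto intro!: smult_closed)
  have "(\<Oplus>\<^bsub>M\<^esub>s\<in>S. c s \<odot>\<^bsub>M\<^esub> s) \<oplus>\<^bsub>M\<^esub> k \<odot>\<^bsub>M\<^esub> (\<Oplus>\<^bsub>M\<^esub>s\<in>S. e s \<odot>\<^bsub>M\<^esub> s)
      = (\<Oplus>\<^bsub>M\<^esub>s\<in>S. c s \<odot>\<^bsub>M\<^esub> s) \<oplus>\<^bsub>M\<^esub> (\<Oplus>\<^bsub>M\<^esub>s\<in>S. k \<odot>\<^bsub>M\<^esub> (e s \<odot>\<^bsub>M\<^esub> s))"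
    by (subst additive_finsum[OF M.abelian_group_axioms M.abelian_group_axioms smult, of S "\<lambda>s. e s \<odot>\<^bsub>M\<^esub> s"])
      (use assms in \<open>auto intro!: smult_closed\<close>)
  also have "\<dots> = (\<Oplus>\<^bsub>M\<^esub>s\<in>S. c s \<odot>\<^bsub>M\<^esub> s \<oplus>\<^bsub>M\<^esub> k \<odot>\<^bsub>M\<^esub> (e s \<odot>\<^bsub>M\<^esub> s))"
    by (rule M.finsum_addf[OF cl, symmetric])
  also have "\<dots> = (\<Oplus>\<^bsub>M\<^esub>s\<in>S. (c s \<oplus> k \<otimes> e s) \<odot>\<^bsub>M\<^esub> s)"
  proof (rule M.finsum_cong')
    fix s assume "s \<in> S"
    with assms have "c s \<in> carrier R" "e s \<in> carrier R" "s \<in> carrier M" by auto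
    then show "c s \<odot>\<^bsub>M\<^esub> s \<oplus>\<^bsub>M\<^esub> k \<odot>\<^bsub>M\<^esub> (e s \<odot>\<^bsub>M\<^esub> s) = (c s \<oplus> k \<otimes> e s) \<odot>\<^bsub>M\<^esub> s"
      using assms(4) by (simp add: smult_l_distr smult_assoc1)
  qed (use assms in \<open>auto intro!: smult_closed R.add.m_closed\<close>)
  finally show ?thesis .
qed

lemma sum_delta_smult:
  assumes S: "finite S" "S \<subseteq> carrier M" and "s \<in> S"
  shows "(\<Oplus>\<^bsub>M\<^esub>t\<in>S. (if s = t then \<one> else \<zero>) \<odot>\<^bsub>M\<^esub> t) = s"
proof -
  have "(\<Oplus>\<^bsub>M\<^esub>t\<in>S. (if s = t then \<one> else \<zero>) \<odot>\<^bsub>M\<^esub> t) = (\<Oplus>\<^bsub>M\<^esub>t\<in>S. if s = t then t else \<zero>\<^bsub>M\<^esub>)"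
    by (rule M.finsum_cong') (use S in auto)
  also have "\<dots> = s" by (rule M.finsum_singleton) (use assms in auto)
  finally show ?thesis .
qed

lemma comb_image:
  assumes T: "finite T" "T \<subseteq> carrier M" and S: "finite S" and "g \<in> S \<rightarrow> T" "c \<in> S \<rightarrow> carrier R"
  shows "\<exists>e\<in>T \<rightarrow> carrier R. (\<Oplus>\<^bsub>M\<^esub>s\<in>S. c s \<odot>\<^bsub>M\<^esub> g s) = (\<Oplus>\<^bsub>M\<^esub>t\<in>T. e t \<odot>\<^bsub>M\<^esub> t)"
  using S assms(4,5)
proof (induction S rule: finite_induct)
  case empty
  have "(\<Oplus>\<^bsub>M\<^esub>t\<in>T. \<zero> \<odot>\<^bsub>M\<^esub> t) = (\<Oplus>\<^bsub>M\<^esub>t\<in>T. \<zero>\<^bsub>M\<^esub>)" by (rule M.finsum_cong') (use T in auto)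
  then show ?case by (intro bexI[of _ "\<lambda>_. \<zero>"]) auto
next
  case (insert s S)
  then obtain e where e: "e \<in> T \<rightarrow> carrier R" "(\<Oplus>\<^bsub>M\<^esub>s\<in>S. c s \<odot>\<^bsub>M\<^esub> g s) = (\<Oplus>\<^bsub>M\<^esub>t\<in>T. e t \<odot>\<^bsub>M\<^esub> t)" by auto
  have gs: "g s \<in> T" "c s \<in> carrier R" "g s \<in> carrier M" using insert.prems T by auto
  have "(\<lambda>s. c s \<odot>\<^bsub>M\<^esub> g s) \<in> S \<rightarrow> carrier M" using insert.prems T by (auto intro!: smult_closed)
  then have "(\<Oplus>\<^bsub>M\<^esub>s\<in>insert s S. c s \<odot>\<^bsub>M\<^esub> g s) = c s \<odot>\<^bsub>M\<^esub> g s \<oplus>\<^bsub>M\<^esub> (\<Oplus>\<^bsub>M\<^esub>s\<in>S. c s \<odot>\<^bsub>M\<^esub> g s)"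
    using insert.hyps gs by simp
  also have "\<dots> = (\<Oplus>\<^bsub>M\<^esub>t\<in>T. e t \<odot>\<^bsub>M\<^esub> t) \<oplus>\<^bsub>M\<^esub> c s \<odot>\<^bsub>M\<^esub> (\<Oplus>\<^bsub>M\<^esub>t\<in>T. (if g s = t then \<one> else \<zero>) \<odot>\<^bsub>M\<^esub> t)"
    using gs comb_closed[OF T(2) e(1)] by (simp add: e(2) sum_delta_smult[OF T gs(1)] M.a_comm)
  also have "\<dots> = (\<Oplus>\<^bsub>M\<^esub>t\<in>T. (e t \<oplus> c s \<otimes> (if g s = t then \<one> else \<zero>)) \<odot>\<^bsub>M\<^esub> t)"
    by (rule comb_add[OF T(2) e(1) _ gs(2)]) auto
  finally show ?case using e(1) gs by (intro bexI[of _ "\<lambda>t. e t \<oplus> c s \<otimes> (if g s = t then \<one> else \<zero>)"]) auto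
qed

end

text \<open>A spanning set of minimal cardinality is independent: a nontrivial relation would allow to drop
  one of its elements.\<close>

lemma (in module) minimal_spanning_independent:
  assumes fld: "field R" and S: "spans S" and min: "\<And>T. spans T \<Longrightarrow> card S \<le> card T"
    and c: "c \<in> S \<rightarrow> carrier R" and zero: "(\<Oplus>\<^bsub>M\<^esub>s\<in>S. c s \<odot>\<^bsub>M\<^esub> s) = \<zero>\<^bsub>M\<^esub>" and t: "t \<in> S"
  shows "c t = \<zero>"
proof (rule ccontr)
  assume nz: "c t \<noteq> \<zero>"
  interpret F: field R by fact
  have Sf: "finite S" "S \<subseteq> carrier M" using S by (auto simp: spans_def)
  have "c t \<in> carrier R" using c t by auto
  with nz have "c t \<in> Units R" by (simp add: F.field_Units)
  then have ct: "c t \<in> carrier R" "inv (c t) \<in> carrier R" "inv (c t) \<otimes> c t = \<one>"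
    using R.Units_l_inv[of "c t"] by auto
  have "spans (S - {t})"
    unfolding spans_def
  proof (intro conjI ballI)
    fix v assume "v \<in> carrier M"
    then obtain a where a: "a \<in> S \<rightarrow> carrier R" "v = (\<Oplus>\<^bsub>M\<^esub>s\<in>S. a s \<odot>\<^bsub>M\<^esub> s)"
      using S by (auto simp: spans_def)
    define k where "k = \<ominus> (a t \<otimes> inv (c t))"
    have at: "a t \<in> carrier R" and k: "k \<in> carrier R" using a t ct by (auto simp: k_def)
    define b where "b = (\<lambda>s. a s \<oplus> k \<otimes> c s)"
    have b: "b \<in> S \<rightarrow> carrier R" using a(1) c k by (auto simp: b_def)
    have bt: "b t = \<zero>" using at ct by (simp add: b_def k_def R.l_minus R.m_assoc R.r_neg)
    have "v = v \<oplus>\<^bsub>M\<^esub> k \<odot>\<^bsub>M\<^esub> (\<Oplus>\<^bsub>M\<^esub>s\<in>S. c s \<odot>\<^bsub>M\<^esub> s)"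
      using \<open>v \<in> carrier M\<close> k zero by simp
    also have "\<dots> = (\<Oplus>\<^bsub>M\<^esub>s\<in>S. b s \<odot>\<^bsub>M\<^esub> s)"
      unfolding a(2) b_def by (rule comb_add[OF Sf(2) a(1) c k])
    also have "\<dots> = (\<Oplus>\<^bsub>M\<^esub>s\<in>insert t (S - {t}). b s \<odot>\<^bsub>M\<^esub> s)" using t by (simp add: insert_absorb)
    also have "\<dots> = b t \<odot>\<^bsub>M\<^esub> t \<oplus>\<^bsub>M\<^esub> (\<Oplus>\<^bsub>M\<^esub>s\<in>S - {t}. b s \<odot>\<^bsub>M\<^esub> s)"
      by (rule M.finsum_insert) (use Sf b t in auto)
    also have "\<dots> = (\<Oplus>\<^bsub>M\<^esub>s\<in>S - {t}. b s \<odot>\<^bsub>M\<^esub> s)"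
    proof -
      have "S - {t} \<subseteq> carrier M" "b \<in> S - {t} \<rightarrow> carrier R" "t \<in> carrier M" using Sf b t by auto
      from comb_closed[OF this(1,2)] this(3) show ?thesis by (simp add: bt)
    qed
    finally show "\<exists>c\<in>S - {t} \<rightarrow> carrier R. v = (\<Oplus>\<^bsub>M\<^esub>s\<in>S - {t}. c s \<odot>\<^bsub>M\<^esub> s)"
      using b by (intro bexI[of _ b]) auto
  qed (use Sf in auto)
  from min[OF this] card_Diff1_less[OF Sf(1) t] show False by simp
qed

text \<open>By independence, the coefficients of an element with respect to a minimal spanning set are
  unique, and therefore linear in the element: they are the dual basis.\<close>

lemma (in module) dual_bases_exist:
  assumes fld: "field R" and fin: "\<exists>S. spans S"
  obtains n :: nat and r \<theta> where "\<And>i. i < n \<Longrightarrow> r i \<in> carrier M" "\<And>i. i < n \<Longrightarrow> functional R M (\<theta> i)"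
    "\<And>i j. i < n \<Longrightarrow> j < n \<Longrightarrow> \<theta> i (r j) = (if i = j then \<one> else \<zero>)"
    "\<And>v. v \<in> carrier M \<Longrightarrow> v = (\<Oplus>\<^bsub>M\<^esub>i\<in>{..<n}. \<theta> i v \<odot>\<^bsub>M\<^esub> r i)"
proof -
  interpret F: field R by fact
  define S where "S = arg_min card spans"
  obtain S0 where S0: "spans S0" using fin by blast
  have S: "spans S" unfolding S_def by (rule arg_min_natI) (rule S0)
  have min: "card S \<le> card T" if "spans T" for T unfolding S_def by (rule arg_min_nat_le) (rule that)
  have Sf: "finite S" "S \<subseteq> carrier M" using S by (auto simp: spans_def)
  define C where "C v = (SOME c. c \<in> S \<rightarrow> carrier R \<and> v = (\<Oplus>\<^bsub>M\<^esub>s\<in>S. c s \<odot>\<^bsub>M\<^esub> s))" for v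
  have C: "C v \<in> S \<rightarrow> carrier R" "v = (\<Oplus>\<^bsub>M\<^esub>s\<in>S. C v s \<odot>\<^bsub>M\<^esub> s)" if "v \<in> carrier M" for v
  proof -
    have "\<exists>c. c \<in> S \<rightarrow> carrier R \<and> v = (\<Oplus>\<^bsub>M\<^esub>s\<in>S. c s \<odot>\<^bsub>M\<^esub> s)"
      using S that unfolding spans_def by blast
    note * = someI_ex[OF this, folded C_def]
    show "C v \<in> S \<rightarrow> carrier R" by (rule conjunct1[OF *])
    show "v = (\<Oplus>\<^bsub>M\<^esub>s\<in>S. C v s \<odot>\<^bsub>M\<^esub> s)" by (rule conjunct2[OF *])
  qed
  have uniq: "a t = b t" if a: "a \<in> S \<rightarrow> carrier R" and b: "b \<in> S \<rightarrow> carrier R"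
    and eq: "(\<Oplus>\<^bsub>M\<^esub>s\<in>S. a s \<odot>\<^bsub>M\<^esub> s) = (\<Oplus>\<^bsub>M\<^esub>s\<in>S. b s \<odot>\<^bsub>M\<^esub> s)" and t: "t \<in> S" for a b t
  proof -
    have m1: "\<ominus> \<one> \<in> carrier R" by simp
    have "(\<Oplus>\<^bsub>M\<^esub>s\<in>S. (a s \<oplus> \<ominus> \<one> \<otimes> b s) \<odot>\<^bsub>M\<^esub> s) = \<zero>\<^bsub>M\<^esub>"
      using comb_add[OF Sf(2) a b m1] comb_closed[OF Sf(2) b] eq
      by (simp add: smult_l_minus M.r_neg)
    then have "a t \<oplus> \<ominus> \<one> \<otimes> b t = \<zero>"
      by (intro minimal_spanning_independent[OF fld S min _ _ t, where c = "\<lambda>s. a s \<oplus> \<ominus> \<one> \<otimes> b s"])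
        (use a b in auto)
    moreover have "a t \<in> carrier R" "b t \<in> carrier R" using a b t by auto
    ultimately show ?thesis by (simp add: R.l_minus flip: R.minus_eq)
  qed
  have lin: "C (x \<oplus>\<^bsub>M\<^esub> k \<odot>\<^bsub>M\<^esub> y) t = C x t \<oplus> k \<otimes> C y t"
    if *: "x \<in> carrier M" "y \<in> carrier M" "k \<in> carrier R" "t \<in> S" for x y k t
  proof (rule uniq[OF _ _ _ *(4)])
    show "C (x \<oplus>\<^bsub>M\<^esub> k \<odot>\<^bsub>M\<^esub> y) \<in> S \<rightarrow> carrier R" using * by (intro C) auto
    show "(\<lambda>s. C x s \<oplus> k \<otimes> C y s) \<in> S \<rightarrow> carrier R" using * C(1) by auto
    show "(\<Oplus>\<^bsub>M\<^esub>s\<in>S. C (x \<oplus>\<^bsub>M\<^esub> k \<odot>\<^bsub>M\<^esub> y) s \<odot>\<^bsub>M\<^esub> s) = (\<Oplus>\<^bsub>M\<^esub>s\<in>S. (C x s \<oplus> k \<otimes> C y s) \<odot>\<^bsub>M\<^esub> s)"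
      (is "?l = ?r")
    proof -
      have "?l = x \<oplus>\<^bsub>M\<^esub> k \<odot>\<^bsub>M\<^esub> y" by (rule C(2)[symmetric]) (use * in auto)
      also have "\<dots> = ?r"
        using comb_add[OF Sf(2) C(1)[OF *(1)] C(1)[OF *(2)] *(3)]
          C(2)[OF *(1), symmetric] C(2)[OF *(2), symmetric] by simp
      finally show ?thesis .
    qed
  qed
  have Cc: "C v s \<in> carrier R" if "v \<in> carrier M" "s \<in> S" for v s using C(1) that by auto
  have C0: "C \<zero>\<^bsub>M\<^esub> t = \<zero>" if "t \<in> S" for t
    using lin[of "\<zero>\<^bsub>M\<^esub>" "\<zero>\<^bsub>M\<^esub>" "\<one>" t] Cc[of "\<zero>\<^bsub>M\<^esub>" t] that by simp
  have functional: "functional R M (\<lambda>v. C v t)" if "t \<in> S" for t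
    unfolding functional_def
  proof (intro conjI ballI additiveI)
    fix x y assume "x \<in> carrier M" "y \<in> carrier M"
    then show "C (x \<oplus>\<^bsub>M\<^esub> y) t = C x t \<oplus> C y t" using lin[of x y \<one> t] that by (simp add: Cc)
  next
    fix k x assume "k \<in> carrier R" "x \<in> carrier M"
    then show "C (k \<odot>\<^bsub>M\<^esub> x) t = k \<otimes> C x t" using lin[of "\<zero>\<^bsub>M\<^esub>" x k t] that by (simp add: Cc C0)
  qed (use Cc that in auto)
  have delta: "C s t = (if s = t then \<one> else \<zero>)" if "s \<in> S" "t \<in> S" for s t
  proof (rule uniq[OF _ _ _ that(2), of "C s" "\<lambda>t. if s = t then \<one> else \<zero>"])
    show "(\<Oplus>\<^bsub>M\<^esub>t\<in>S. C s t \<odot>\<^bsub>M\<^esub> t) = (\<Oplus>\<^bsub>M\<^esub>t\<in>S. (if s = t then \<one> else \<zero>) \<odot>\<^bsub>M\<^esub> t)"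
      unfolding sum_delta_smult[OF Sf that(1)] by (rule C(2)[symmetric]) (use Sf that in auto)
  qed (use C(1) Sf that in auto)
  obtain e where e: "bij_betw e {..<card S} S"
    using ex_bij_betw_nat_finite[OF Sf(1)] by (auto simp: atLeast0LessThan)
  then have eS: "e i \<in> S" if "i < card S" for i using that by (auto simp: bij_betw_def)
  have eI: "e i = e j \<longleftrightarrow> i = j" if "i < card S" "j < card S" for i j
    using that e by (auto simp: bij_betw_def inj_on_def)
  have expand: "v = (\<Oplus>\<^bsub>M\<^esub>i\<in>{..<card S}. C v (e i) \<odot>\<^bsub>M\<^esub> e i)" if "v \<in> carrier M" for v
  proof -
    have "(\<Oplus>\<^bsub>M\<^esub>s\<in>e ` {..<card S}. C v s \<odot>\<^bsub>M\<^esub> s) = (\<Oplus>\<^bsub>M\<^esub>i\<in>{..<card S}. C v (e i) \<odot>\<^bsub>M\<^esub> e i)"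
      by (rule M.finsum_reindex) (use e Sf Cc that eS in \<open>auto simp: bij_betw_def\<close>)
    moreover have "e ` {..<card S} = S" using e by (simp add: bij_betw_def)
    ultimately show ?thesis by (intro trans[OF C(2)[OF that]]) simp
  qed
  show ?thesis
  proof (rule that[of "card S" e "\<lambda>i v. C v (e i)"])
    show "e i \<in> carrier M" "functional R M (\<lambda>v. C v (e i))" if "i < card S" for i
      using eS[OF that] Sf(2) functional by auto
    show "C (e j) (e i) = (if i = j then \<one> else \<zero>)" if "i < card S" "j < card S" for i j
      using that eI by (auto simp: delta eS)
  qed (rule expand)
qed

text \<open>An infinitesimal base in coordinates: \<open>r\<close> is a basis of \<open>\<M>\<close>, and the \<open>\<theta>\<^sub>i\<close> are the coordinates of
  the component in \<open>\<M>\<close>. That \<open>\<theta>\<^sub>i\<close> vanishes on \<open>1\<close> is a consequence of \<open>expand\<close>.\<close>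

locale inf_base =
  fixes K :: "('k, 'm) ring_scheme" and R :: "('k, 'r) module" and \<epsilon> :: "'r \<Rightarrow> 'k"
    and d :: nat and r :: "nat \<Rightarrow> 'r" and \<theta> :: "nat \<Rightarrow> 'r \<Rightarrow> 'k"
  assumes fld: "field K" and augmented: "augmented_algebra K R \<epsilon>"
    and square_zero: "\<And>x y. x \<in> carrier R \<Longrightarrow> y \<in> carrier R \<Longrightarrow> \<epsilon> x = \<zero>\<^bsub>K\<^esub> \<Longrightarrow> \<epsilon> y = \<zero>\<^bsub>K\<^esub>
            \<Longrightarrow> x \<otimes>\<^bsub>R\<^esub> y = \<zero>\<^bsub>R\<^esub>"
    and r_closed [simp, intro]: "\<And>i. i < d \<Longrightarrow> r i \<in> carrier R"
    and \<epsilon>_r [simp]: "\<And>i. i < d \<Longrightarrow> \<epsilon> (r i) = \<zero>\<^bsub>K\<^esub>"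
    and functional_\<theta>: "\<And>i. i < d \<Longrightarrow> functional K R (\<theta> i)"
    and \<theta>_r: "\<And>i j. i < d \<Longrightarrow> j < d \<Longrightarrow> \<theta> i (r j) = (if i = j then \<one>\<^bsub>K\<^esub> else \<zero>\<^bsub>K\<^esub>)"
    and expand: "\<And>x. x \<in> carrier R
            \<Longrightarrow> x = \<epsilon> x \<odot>\<^bsub>R\<^esub> \<one>\<^bsub>R\<^esub> \<oplus>\<^bsub>R\<^esub> (\<Oplus>\<^bsub>R\<^esub>i\<in>{..<d}. \<theta> i x \<odot>\<^bsub>R\<^esub> r i)"
begin

lemma algebra_R: "algebra K R" using augmented by (simp add: augmented_algebra_def)

sublocale K: field K by (rule fld)
sublocale R: algebra K R by (rule algebra_R)

lemma functional_\<epsilon>: "functional K R \<epsilon>"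
  using augmented unfolding augmented_algebra_def functional_def additive_map_def
  by (auto simp: ring_hom_closed ring_hom_add)

lemma \<epsilon>_mult: "x \<in> carrier R \<Longrightarrow> y \<in> carrier R \<Longrightarrow> \<epsilon> (x \<otimes>\<^bsub>R\<^esub> y) = \<epsilon> x \<otimes>\<^bsub>K\<^esub> \<epsilon> y"
  using augmented unfolding augmented_algebra_def by (auto simp: ring_hom_mult)

lemma \<epsilon>_one [simp]: "\<epsilon> \<one>\<^bsub>R\<^esub> = \<one>\<^bsub>K\<^esub>"
  using augmented unfolding augmented_algebra_def by (auto simp: ring_hom_one)

lemma \<epsilon>_closed [simp]: "x \<in> carrier R \<Longrightarrow> \<epsilon> x \<in> carrier K"
  by (rule functionalD(2)[OF functional_\<epsilon>])

lemma \<theta>_closed [simp]: "i < d \<Longrightarrow> x \<in> carrier R \<Longrightarrow> \<theta> i x \<in> carrier K"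
  by (rule functionalD(2)[OF functional_\<theta>])

lemma functional_comb:
  assumes f: "functional K R f" and c: "\<And>i. i < d \<Longrightarrow> c i \<in> carrier K" and x: "x \<in> carrier R"
  shows "f (x \<oplus>\<^bsub>R\<^esub> (\<Oplus>\<^bsub>R\<^esub>i\<in>{..<d}. c i \<odot>\<^bsub>R\<^esub> r i)) = f x \<oplus>\<^bsub>K\<^esub> (\<Oplus>\<^bsub>K\<^esub>i\<in>{..<d}. c i \<otimes>\<^bsub>K\<^esub> f (r i))"
proof -
  have "f (\<Oplus>\<^bsub>R\<^esub>i\<in>{..<d}. c i \<odot>\<^bsub>R\<^esub> r i) = (\<Oplus>\<^bsub>K\<^esub>i\<in>{..<d}. f (c i \<odot>\<^bsub>R\<^esub> r i))"
    by (rule additive_finsum[OF R.M.abelian_group_axioms K.is_abelian_group functionalD(1)[OF f]])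
      (use c in auto)
  also have "\<dots> = (\<Oplus>\<^bsub>K\<^esub>i\<in>{..<d}. c i \<otimes>\<^bsub>K\<^esub> f (r i))"
    by (rule K.finsum_cong') (use c in \<open>auto simp: functionalD[OF f]\<close>)
  finally have "f (\<Oplus>\<^bsub>R\<^esub>i\<in>{..<d}. c i \<odot>\<^bsub>R\<^esub> r i) = (\<Oplus>\<^bsub>K\<^esub>i\<in>{..<d}. c i \<otimes>\<^bsub>K\<^esub> f (r i))" .
  moreover have "(\<Oplus>\<^bsub>R\<^esub>i\<in>{..<d}. c i \<odot>\<^bsub>R\<^esub> r i) \<in> carrier R"
    by (rule R.M.finsum_closed) (use c in auto)
  ultimately show ?thesis using functionalD(3)[OF f] x by simp
qed

lemma sum_delta:
  assumes "i < d" "\<And>j. j < d \<Longrightarrow> c j \<in> carrier K"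
  shows "(\<Oplus>\<^bsub>K\<^esub>j\<in>{..<d}. c j \<otimes>\<^bsub>K\<^esub> \<theta> i (r j)) = c i"
proof -
  have "(\<Oplus>\<^bsub>K\<^esub>j\<in>{..<d}. c j \<otimes>\<^bsub>K\<^esub> \<theta> i (r j)) = (\<Oplus>\<^bsub>K\<^esub>j\<in>{..<d}. if i = j then c j else \<zero>\<^bsub>K\<^esub>)"
    by (rule K.finsum_cong') (use assms in \<open>auto simp: \<theta>_r\<close>)
  also have "\<dots> = c i" by (rule K.finsum_singleton) (use assms in auto)
  finally show ?thesis .
qed

lemma \<theta>_one [simp]: "i < d \<Longrightarrow> \<theta> i \<one>\<^bsub>R\<^esub> = \<zero>\<^bsub>K\<^esub>"
proof -
  assume i: "i < d"
  have "\<theta> i \<one>\<^bsub>R\<^esub> = \<theta> i (\<epsilon> \<one>\<^bsub>R\<^esub> \<odot>\<^bsub>R\<^esub> \<one>\<^bsub>R\<^esub> \<oplus>\<^bsub>R\<^esub> (\<Oplus>\<^bsub>R\<^esub>j\<in>{..<d}. \<theta> j \<one>\<^bsub>R\<^esub> \<odot>\<^bsub>R\<^esub> r j))"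
    by (rule arg_cong[OF expand]) simp
  also have "\<dots> = \<theta> i \<one>\<^bsub>R\<^esub> \<oplus>\<^bsub>K\<^esub> \<theta> i \<one>\<^bsub>R\<^esub>"
    using functional_comb[OF functional_\<theta>[OF i], of "\<lambda>i. \<theta> i \<one>\<^bsub>R\<^esub>" "\<one>\<^bsub>R\<^esub>"] i
    by (simp add: sum_delta)
  finally have "\<theta> i \<one>\<^bsub>R\<^esub> = \<theta> i \<one>\<^bsub>R\<^esub> \<oplus>\<^bsub>K\<^esub> \<theta> i \<one>\<^bsub>R\<^esub>" .
  then show ?thesis using i by (metis K.add.r_cancel_one' R.one_closed \<theta>_closed)
qed

lemma base_eqI:
  assumes "x \<in> carrier R" "y \<in> carrier R" "\<epsilon> x = \<epsilon> y" "\<And>i. i < d \<Longrightarrow> \<theta> i x = \<theta> i y"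
  shows "x = y"
proof -
  have "x = \<epsilon> x \<odot>\<^bsub>R\<^esub> \<one>\<^bsub>R\<^esub> \<oplus>\<^bsub>R\<^esub> (\<Oplus>\<^bsub>R\<^esub>i\<in>{..<d}. \<theta> i x \<odot>\<^bsub>R\<^esub> r i)" by (rule expand) fact
  also have "(\<Oplus>\<^bsub>R\<^esub>i\<in>{..<d}. \<theta> i x \<odot>\<^bsub>R\<^esub> r i) = (\<Oplus>\<^bsub>R\<^esub>i\<in>{..<d}. \<theta> i y \<odot>\<^bsub>R\<^esub> r i)"
    by (rule R.M.finsum_cong') (use assms in auto)
  also have "\<epsilon> x \<odot>\<^bsub>R\<^esub> \<one>\<^bsub>R\<^esub> \<oplus>\<^bsub>R\<^esub> \<dots> = y" unfolding assms(3) by (rule expand[symmetric]) fact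
  finally show ?thesis .
qed

text \<open>In the product of \<open>\<epsilon>(x) \<cdot> 1 + x'\<close> and \<open>\<epsilon>(y) \<cdot> 1 + y'\<close> the term \<open>x' y'\<close> vanishes since
  \<open>\<M>\<^sup>2 = 0\<close>. So the coordinates are derivations of \<open>R\<close> along \<open>\<epsilon>\<close>; all infinitesimal calculus below
  rests on this rule.\<close>

lemma \<theta>_mult:
  assumes i: "i < d" and x: "x \<in> carrier R" and y: "y \<in> carrier R"
  shows "\<theta> i (x \<otimes>\<^bsub>R\<^esub> y) = \<epsilon> x \<otimes>\<^bsub>K\<^esub> \<theta> i y \<oplus>\<^bsub>K\<^esub> \<theta> i x \<otimes>\<^bsub>K\<^esub> \<epsilon> y"
proof -
  define a where "a = (\<ominus>\<^bsub>K\<^esub> \<epsilon> x) \<odot>\<^bsub>R\<^esub> \<one>\<^bsub>R\<^esub>"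
  define b where "b = (\<ominus>\<^bsub>K\<^esub> \<epsilon> y) \<odot>\<^bsub>R\<^esub> \<one>\<^bsub>R\<^esub>"
  note f = functional_\<theta>[OF i] functional_\<epsilon>
  have ab: "a \<in> carrier R" "b \<in> carrier R" using x y by (auto simp: a_def b_def)
  have prods: "a \<otimes>\<^bsub>R\<^esub> y = (\<ominus>\<^bsub>K\<^esub> \<epsilon> x) \<odot>\<^bsub>R\<^esub> y" "x \<otimes>\<^bsub>R\<^esub> b = (\<ominus>\<^bsub>K\<^esub> \<epsilon> y) \<odot>\<^bsub>R\<^esub> x" "a \<otimes>\<^bsub>R\<^esub> b = (\<ominus>\<^bsub>K\<^esub> \<epsilon> x) \<odot>\<^bsub>R\<^esub> b"
    using x y by (simp_all add: a_def b_def R.smult_assoc2 R.m_comm[of x])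
  have "\<zero>\<^bsub>R\<^esub> = (x \<oplus>\<^bsub>R\<^esub> a) \<otimes>\<^bsub>R\<^esub> (y \<oplus>\<^bsub>R\<^esub> b)"
    by (rule square_zero[symmetric])
      (use x y ab in \<open>auto simp: a_def b_def functionalD[OF f(2)] K.r_neg\<close>)
  also have "\<dots> = x \<otimes>\<^bsub>R\<^esub> y \<oplus>\<^bsub>R\<^esub> (x \<otimes>\<^bsub>R\<^esub> b \<oplus>\<^bsub>R\<^esub> (a \<otimes>\<^bsub>R\<^esub> y \<oplus>\<^bsub>R\<^esub> a \<otimes>\<^bsub>R\<^esub> b))"
    using x y ab by (simp add: R.l_distr R.r_distr R.M.a_ac)
  finally have "\<theta> i \<zero>\<^bsub>R\<^esub> = \<theta> i (x \<otimes>\<^bsub>R\<^esub> y \<oplus>\<^bsub>R\<^esub> (x \<otimes>\<^bsub>R\<^esub> b \<oplus>\<^bsub>R\<^esub> (a \<otimes>\<^bsub>R\<^esub> y \<oplus>\<^bsub>R\<^esub> a \<otimes>\<^bsub>R\<^esub> b)))"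
    by simp
  moreover have "\<theta> i \<zero>\<^bsub>R\<^esub> = \<zero>\<^bsub>K\<^esub>"
    by (rule additive_zero[OF R.M.abelian_group_axioms K.is_abelian_group functionalD(1)[OF f(1)]])
  moreover have "\<theta> i b = \<zero>\<^bsub>K\<^esub>" using y i by (simp add: b_def functionalD[OF f(1)])
  ultimately have "\<zero>\<^bsub>K\<^esub> = \<theta> i (x \<otimes>\<^bsub>R\<^esub> y) \<oplus>\<^bsub>K\<^esub> (\<ominus>\<^bsub>K\<^esub> (\<epsilon> y \<otimes>\<^bsub>K\<^esub> \<theta> i x) \<oplus>\<^bsub>K\<^esub> \<ominus>\<^bsub>K\<^esub> (\<epsilon> x \<otimes>\<^bsub>K\<^esub> \<theta> i y))"
    using x y ab i by (simp add: prods functionalD[OF f(1)] K.l_minus)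
  then have "\<theta> i (x \<otimes>\<^bsub>R\<^esub> y) \<oplus>\<^bsub>K\<^esub> \<ominus>\<^bsub>K\<^esub> (\<epsilon> y \<otimes>\<^bsub>K\<^esub> \<theta> i x \<oplus>\<^bsub>K\<^esub> \<epsilon> x \<otimes>\<^bsub>K\<^esub> \<theta> i y) = \<zero>\<^bsub>K\<^esub>"
    using x y i by (simp add: K.minus_add)
  then have "\<theta> i (x \<otimes>\<^bsub>R\<^esub> y) = \<epsilon> y \<otimes>\<^bsub>K\<^esub> \<theta> i x \<oplus>\<^bsub>K\<^esub> \<epsilon> x \<otimes>\<^bsub>K\<^esub> \<theta> i y"
    using x y i by (metis K.add.inv_closed K.add.m_closed K.m_closed K.minus_equality K.minus_minus R.m_closed \<epsilon>_closed \<theta>_closed)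
  then show ?thesis using x y i by (simp add: K.m_comm K.a_comm)
qed

end

text \<open>The projection \<open>x \<mapsto> x - \<epsilon>(x) \<cdot> 1\<close> of \<open>R\<close> onto \<open>\<M>\<close> carries a finite spanning set of \<open>R\<close> to one of
  \<open>\<M>\<close>. The coordinates of \<open>R\<close> are those of a basis of \<open>\<M>\<close>, composed with this projection.\<close>

lemma inf_base_exists:
  assumes fld: "field K" and aug: "augmented_algebra K R \<epsilon>" and fin: "fin_dim K R"
    and sq: "ideal_power R (aug_ideal K R \<epsilon>) 2 = {\<zero>\<^bsub>R\<^esub>}"
  shows "\<exists>d r \<theta>. inf_base K R \<epsilon> d r \<theta>"
proof -
  have algebra: "algebra K R" using aug by (simp add: augmented_algebra_def)
  interpret K: field K by fact
  interpret R: algebra K R by fact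
  have f: "functional K R \<epsilon>" and hom: "\<epsilon> \<in> ring_hom R K"
    using aug unfolding augmented_algebra_def functional_def additive_map_def
    by (auto simp: ring_hom_closed ring_hom_add)
  note fD = functionalD[OF f]
  have e1: "\<epsilon> \<one>\<^bsub>R\<^esub> = \<one>\<^bsub>K\<^esub>" using hom by (rule ring_hom_one)
  have zK: "\<epsilon> \<zero>\<^bsub>R\<^esub> = \<zero>\<^bsub>K\<^esub>"
    by (rule additive_zero[OF R.M.abelian_group_axioms K.is_abelian_group fD(1)])
  define I where "I = aug_ideal K R \<epsilon>"
  have I: "x \<in> I \<longleftrightarrow> x \<in> carrier R \<and> \<epsilon> x = \<zero>\<^bsub>K\<^esub>" for x
    by (auto simp: I_def aug_ideal_def a_kernel_def')
  have square_zero: "x \<otimes>\<^bsub>R\<^esub> y = \<zero>\<^bsub>R\<^esub>" if "x \<in> I" "y \<in> I" for x y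
  proof -
    \<comment> \<open>\<open>\<M>\<^sup>2\<close> is the iterated product \<open>(R \<M>) \<M>\<close>, which contains \<open>x y = (1 x) y\<close>.\<close>
    have "\<one>\<^bsub>R\<^esub> \<otimes>\<^bsub>R\<^esub> x \<in> ideal_prod R (carrier R) I" by (rule ideal_prod.prod) (use that in auto)
    then have "x \<in> ideal_prod R (carrier R) I" using that I by simp
    then have "x \<otimes>\<^bsub>R\<^esub> y \<in> ideal_prod R (ideal_prod R (carrier R) I) I"
      by (rule ideal_prod.prod) fact
    then show ?thesis using sq by (simp add: I_def numeral_2_eq_2)
  qed
  let ?M = "R\<lparr>carrier := I\<rparr>"
  have "submodule I K R"
    by (rule R.submoduleI)
      (auto simp: I fD zK additive_minus[OF R.M.abelian_group_axioms K.is_abelian_group fD(1)])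
  then have "module K ?M" by (rule submodule.submodule_is_module) (rule R.module)
  then interpret M: module K ?M .
  have sum_M: "(\<Oplus>\<^bsub>?M\<^esub>i\<in>A. x i) = (\<Oplus>\<^bsub>R\<^esub>i\<in>A. x i)" if "\<And>i. i \<in> A \<Longrightarrow> x i \<in> I" for A :: "'x set" and x
    using additive_finsum[OF M.M.abelian_group_axioms R.M.abelian_group_axioms, of "\<lambda>x. x" A x] that I
    by (auto simp: additive_map_def)
  define pr where "pr = (\<lambda>x. x \<oplus>\<^bsub>R\<^esub> (\<ominus>\<^bsub>K\<^esub> \<epsilon> x) \<odot>\<^bsub>R\<^esub> \<one>\<^bsub>R\<^esub>)"
  have pr: "pr x \<in> I" if "x \<in> carrier R" for x
    using that by (auto simp: I pr_def fD e1 K.r_neg)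
  have pr_functional: "functional K R (\<lambda>x. f (pr x))" if g: "functional K ?M f" for f
    unfolding functional_def
  proof (intro conjI ballI additiveI)
    fix x y assume *: "x \<in> carrier R" "y \<in> carrier R"
    have "pr (x \<oplus>\<^bsub>R\<^esub> y) = pr x \<oplus>\<^bsub>R\<^esub> pr y"
      using * by (simp add: pr_def fD K.minus_add R.smult_l_distr R.M.a_ac)
    then show "f (pr (x \<oplus>\<^bsub>R\<^esub> y)) = f (pr x) \<oplus>\<^bsub>K\<^esub> f (pr y)"
      using functionalD(3)[OF g, of "pr x" "pr y"] * pr by simp
  next
    fix k x assume *: "k \<in> carrier K" "x \<in> carrier R"
    have "pr (k \<odot>\<^bsub>R\<^esub> x) = k \<odot>\<^bsub>R\<^esub> pr x"
      using * by (simp add: pr_def fD R.smult_r_distr flip: K.r_minus R.smult_assoc1)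
    then show "f (pr (k \<odot>\<^bsub>R\<^esub> x)) = k \<otimes>\<^bsub>K\<^esub> f (pr x)"
      using functionalD(4)[OF g, of k "pr x"] * pr by simp
  qed (use functionalD(2)[OF g] pr in auto)
  have ex: "\<exists>S. M.spans S"
  proof -
    obtain S where S: "finite S" "S \<subseteq> carrier R"
      "\<And>v. v \<in> carrier R \<Longrightarrow> \<exists>c\<in>S \<rightarrow> carrier K. v = (\<Oplus>\<^bsub>R\<^esub>s\<in>S. c s \<odot>\<^bsub>R\<^esub> s)"
      using fin unfolding fin_dim_def by blast
    have "\<exists>c\<in>pr ` S \<rightarrow> carrier K. v = (\<Oplus>\<^bsub>?M\<^esub>s\<in>pr ` S. c s \<odot>\<^bsub>?M\<^esub> s)" if v: "v \<in> I" for v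
    proof -
      obtain c where c: "c \<in> S \<rightarrow> carrier K" "v = (\<Oplus>\<^bsub>R\<^esub>s\<in>S. c s \<odot>\<^bsub>R\<^esub> s)"
        using S(3)[of v] v I by auto
      have add: "additive_map R ?M pr"
        by (rule additiveI) (use pr in \<open>auto simp: pr_def fD K.minus_add R.smult_l_distr R.M.a_ac\<close>)
      have "v = pr v" using v by (simp add: pr_def I)
      also have "\<dots> = (\<Oplus>\<^bsub>?M\<^esub>s\<in>S. pr (c s \<odot>\<^bsub>R\<^esub> s))"
        unfolding c(2) by (rule additive_finsum[OF R.M.abelian_group_axioms M.M.abelian_group_axioms add])
          (use c S in auto)
      also have "\<dots> = (\<Oplus>\<^bsub>?M\<^esub>s\<in>S. c s \<odot>\<^bsub>?M\<^esub> pr s)"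
      proof (rule M.M.finsum_cong')
        fix s assume "s \<in> S"
        then have "c s \<in> carrier K" "s \<in> carrier R" using c S by auto
        then show "pr (c s \<odot>\<^bsub>R\<^esub> s) = c s \<odot>\<^bsub>?M\<^esub> pr s"
          by (simp add: pr_def fD R.smult_r_distr flip: K.r_minus R.smult_assoc1)
      next
        have "c s \<odot>\<^bsub>?M\<^esub> pr s \<in> carrier ?M" if "s \<in> S" for s
          by (rule M.smult_closed) (use that c S pr in auto)
        then show "(\<lambda>s. c s \<odot>\<^bsub>?M\<^esub> pr s) \<in> S \<rightarrow> carrier ?M" by blast
      qed (rule refl)
      finally show ?thesis
        using M.comb_image[of "pr ` S" S pr c] S(1,2) c(1) pr by auto
    qed
    then show ?thesis using S pr by (intro exI[of _ "pr ` S"]) (auto simp: M.spans_def)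
  qed
  obtain d :: nat and r \<theta> where
    b1: "\<And>i. i < d \<Longrightarrow> r i \<in> carrier ?M" and b2: "\<And>i. i < d \<Longrightarrow> functional K ?M (\<theta> i)" and
    b3: "\<And>i j. i < d \<Longrightarrow> j < d \<Longrightarrow> \<theta> i (r j) = (if i = j then \<one>\<^bsub>K\<^esub> else \<zero>\<^bsub>K\<^esub>)" and
    b4: "\<And>v. v \<in> carrier ?M \<Longrightarrow> v = (\<Oplus>\<^bsub>?M\<^esub>i\<in>{..<d}. \<theta> i v \<odot>\<^bsub>?M\<^esub> r i)"
  proof (rule M.dual_bases_exist[OF fld ex])
    fix n :: nat and r \<theta>
    assume "\<And>i. i < n \<Longrightarrow> r i \<in> carrier ?M" "\<And>i. i < n \<Longrightarrow> functional K ?M (\<theta> i)"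
      "\<And>i j. i < n \<Longrightarrow> j < n \<Longrightarrow> \<theta> i (r j) = (if i = j then \<one>\<^bsub>K\<^esub> else \<zero>\<^bsub>K\<^esub>)"
      "\<And>v. v \<in> carrier ?M \<Longrightarrow> v = (\<Oplus>\<^bsub>?M\<^esub>i\<in>{..<n}. \<theta> i v \<odot>\<^bsub>?M\<^esub> r i)"
    then show thesis by (intro that[of n r \<theta>])
  qed
  have b: "r i \<in> I" "functional K ?M (\<theta> i)" if "i < d" for i using b1 b2 that by auto
  have "inf_base K R \<epsilon> d r (\<lambda>i x. \<theta> i (pr x))"
  proof
    fix x assume x: "x \<in> carrier R"
    have smult_I: "k \<odot>\<^bsub>R\<^esub> m \<in> I" if "k \<in> carrier K" "m \<in> I" for k m
      using that by (simp add: I fD)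
    have "\<theta> i (pr x) \<in> carrier K" if "i < d" for i
      using functionalD(2)[OF b(2)[OF that], of "pr x"] pr[OF x] by simp
    then have "(\<Oplus>\<^bsub>?M\<^esub>i\<in>{..<d}. \<theta> i (pr x) \<odot>\<^bsub>R\<^esub> r i) = (\<Oplus>\<^bsub>R\<^esub>i\<in>{..<d}. \<theta> i (pr x) \<odot>\<^bsub>R\<^esub> r i)"
      by (intro sum_M smult_I) (use b(1) in auto)
    then have "(\<Oplus>\<^bsub>?M\<^esub>i\<in>{..<d}. \<theta> i (pr x) \<odot>\<^bsub>?M\<^esub> r i) = (\<Oplus>\<^bsub>R\<^esub>i\<in>{..<d}. \<theta> i (pr x) \<odot>\<^bsub>R\<^esub> r i)"
      by simp
    moreover have "pr x \<in> carrier ?M" using pr[OF x] by simp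
    ultimately have "pr x = (\<Oplus>\<^bsub>R\<^esub>i\<in>{..<d}. \<theta> i (pr x) \<odot>\<^bsub>R\<^esub> r i)"
      by (rule trans[OF b4, rotated])
    moreover have "x = \<epsilon> x \<odot>\<^bsub>R\<^esub> \<one>\<^bsub>R\<^esub> \<oplus>\<^bsub>R\<^esub> pr x"
    proof -
      have cl: "\<epsilon> x \<in> carrier K" using x by (simp add: fD)
      have "\<epsilon> x \<odot>\<^bsub>R\<^esub> \<one>\<^bsub>R\<^esub> \<oplus>\<^bsub>R\<^esub> pr x = x \<oplus>\<^bsub>R\<^esub> (\<epsilon> x \<oplus>\<^bsub>K\<^esub> \<ominus>\<^bsub>K\<^esub> \<epsilon> x) \<odot>\<^bsub>R\<^esub> \<one>\<^bsub>R\<^esub>"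
        unfolding R.smult_l_distr[OF cl K.a_inv_closed[OF cl] R.one_closed] pr_def
        by (rule R.M.a_lcomm) (use x cl in auto)
      also have "\<dots> = x" using x cl by (simp add: K.r_neg)
      finally show ?thesis by (rule sym)
    qed
    ultimately show "x = \<epsilon> x \<odot>\<^bsub>R\<^esub> \<one>\<^bsub>R\<^esub> \<oplus>\<^bsub>R\<^esub> (\<Oplus>\<^bsub>R\<^esub>i\<in>{..<d}. \<theta> i (pr x) \<odot>\<^bsub>R\<^esub> r i)" by (rule back_subst[of "\<lambda>y. x = \<epsilon> x \<odot>\<^bsub>R\<^esub> \<one>\<^bsub>R\<^esub> \<oplus>\<^bsub>R\<^esub> y", rotated])
  next
    fix i j assume *: "i < d" "j < d"
    then have "pr (r j) = r j" using b(1)[of j] by (simp add: pr_def I)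
    with * b3 show "\<theta> i (pr (r j)) = (if i = j then \<one>\<^bsub>K\<^esub> else \<zero>\<^bsub>K\<^esub>)" by simp
  qed (use fld aug square_zero b(1,2) I pr_functional in auto)
  then show ?thesis by blast
qed

section \<open>Bilinear operations over an infinitesimal base\<close>

lemma bilin_mapsD:
  assumes "\<beta> \<in> bilin_maps K U V W"
  shows "u \<in> carrier U \<Longrightarrow> v \<in> carrier V \<Longrightarrow> \<beta> u v \<in> carrier W"
    and "u \<in> carrier U \<Longrightarrow> v \<in> carrier V \<Longrightarrow> v' \<in> carrier V \<Longrightarrow> \<beta> u (v \<oplus>\<^bsub>V\<^esub> v') = \<beta> u v \<oplus>\<^bsub>W\<^esub> \<beta> u v'"
    and "u \<in> carrier U \<Longrightarrow> u' \<in> carrier U \<Longrightarrow> v \<in> carrier V \<Longrightarrow> \<beta> (u \<oplus>\<^bsub>U\<^esub> u') v = \<beta> u v \<oplus>\<^bsub>W\<^esub> \<beta> u' v"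
    and "k \<in> carrier K \<Longrightarrow> u \<in> carrier U \<Longrightarrow> v \<in> carrier V \<Longrightarrow> \<beta> u (k \<odot>\<^bsub>V\<^esub> v) = k \<odot>\<^bsub>W\<^esub> \<beta> u v"
    and "k \<in> carrier K \<Longrightarrow> u \<in> carrier U \<Longrightarrow> v \<in> carrier V \<Longrightarrow> \<beta> (k \<odot>\<^bsub>U\<^esub> u) v = k \<odot>\<^bsub>W\<^esub> \<beta> u v"
  using assms by (auto simp: bilin_maps_def lin_maps_def)

lemma bilin_mapsI:
  assumes "\<And>u v. u \<in> carrier U \<Longrightarrow> v \<in> carrier V \<Longrightarrow> \<beta> u v \<in> carrier W"
    and "\<And>u v v'. u \<in> carrier U \<Longrightarrow> v \<in> carrier V \<Longrightarrow> v' \<in> carrier V \<Longrightarrow> \<beta> u (v \<oplus>\<^bsub>V\<^esub> v') = \<beta> u v \<oplus>\<^bsub>W\<^esub> \<beta> u v'"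
    and "\<And>u u' v. u \<in> carrier U \<Longrightarrow> u' \<in> carrier U \<Longrightarrow> v \<in> carrier V \<Longrightarrow> \<beta> (u \<oplus>\<^bsub>U\<^esub> u') v = \<beta> u v \<oplus>\<^bsub>W\<^esub> \<beta> u' v"
    and "\<And>k u v. k \<in> carrier K \<Longrightarrow> u \<in> carrier U \<Longrightarrow> v \<in> carrier V \<Longrightarrow> \<beta> u (k \<odot>\<^bsub>V\<^esub> v) = k \<odot>\<^bsub>W\<^esub> \<beta> u v"
    and "\<And>k u v. k \<in> carrier K \<Longrightarrow> u \<in> carrier U \<Longrightarrow> v \<in> carrier V \<Longrightarrow> \<beta> (k \<odot>\<^bsub>U\<^esub> u) v = k \<odot>\<^bsub>W\<^esub> \<beta> u v"
  shows "\<beta> \<in> bilin_maps K U V W"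
  using assms by (auto simp: bilin_maps_def lin_maps_def)

lemma lin_mapsD:
  assumes "f \<in> lin_maps K V W"
  shows "v \<in> carrier V \<Longrightarrow> f v \<in> carrier W"
    and "v \<in> carrier V \<Longrightarrow> v' \<in> carrier V \<Longrightarrow> f (v \<oplus>\<^bsub>V\<^esub> v') = f v \<oplus>\<^bsub>W\<^esub> f v'"
    and "k \<in> carrier K \<Longrightarrow> v \<in> carrier V \<Longrightarrow> f (k \<odot>\<^bsub>V\<^esub> v) = k \<odot>\<^bsub>W\<^esub> f v"
  using assms by (auto simp: lin_maps_def)

lemma lin_mapsI:
  assumes "\<And>v. v \<in> carrier V \<Longrightarrow> f v \<in> carrier W"
    and "\<And>v v'. v \<in> carrier V \<Longrightarrow> v' \<in> carrier V \<Longrightarrow> f (v \<oplus>\<^bsub>V\<^esub> v') = f v \<oplus>\<^bsub>W\<^esub> f v'"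
    and "\<And>k v. k \<in> carrier K \<Longrightarrow> v \<in> carrier V \<Longrightarrow> f (k \<odot>\<^bsub>V\<^esub> v) = k \<odot>\<^bsub>W\<^esub> f v"
  shows "f \<in> lin_maps K V W"
  using assms by (auto simp: lin_maps_def)

lemma (in module) smult_left_commute:
  "a \<in> carrier R \<Longrightarrow> b \<in> carrier R \<Longrightarrow> x \<in> carrier M \<Longrightarrow> a \<odot>\<^bsub>M\<^esub> (b \<odot>\<^bsub>M\<^esub> x) = b \<odot>\<^bsub>M\<^esub> (a \<odot>\<^bsub>M\<^esub> x)"
  by (simp add: R.m_comm flip: smult_assoc1)

text \<open>\<open>T0\<close> and \<open>T i\<close> are the coordinates \<open>\<epsilon> \<otimes> id\<close> and \<open>\<theta>\<^sub>i \<otimes> id\<close> on \<open>R \<otimes> V\<close>, and \<open>incl\<close> is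
  \<open>v \<mapsto> 1 \<otimes> v\<close>.\<close>

locale inf_mod = inf_base K R \<epsilon> d r \<theta> + V: module K V
  for K :: "('k, 'm) ring_scheme" and R :: "('k, 'r) module" and \<epsilon> d r \<theta>
    and V :: "('k, 'v) module"
begin

sublocale E: scalar_ext K R V
  by (intro scalar_ext.intro algebra_R V.module_axioms)

abbreviation "EV \<equiv> ext_scal K R V"
abbreviation "T0 \<equiv> aug_tensor V \<epsilon>"
abbreviation "T i \<equiv> aug_tensor V (\<theta> i)"
abbreviation "incl \<equiv> pure_tensor K R V \<one>\<^bsub>R\<^esub>"

lemma abelian_V: "abelian_group V" by (rule V.M.abelian_group_axioms)

lemma balanced_functional: "functional K R f \<Longrightarrow> balanced K R V V (\<lambda>s v. f s \<odot>\<^bsub>V\<^esub> v)"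
  by (rule balancedI)
    (auto simp: functionalD V.smult_r_distr V.smult_l_distr V.smult_assoc1[symmetric] K.m_comm)

lemma aug_tensor_additive: "functional K R f \<Longrightarrow> additive_map EV V (aug_tensor V f)"
  unfolding aug_tensor_def by (rule E.tensor_lift_additive[OF abelian_V balanced_functional])

lemma aug_tensor_pure:
  "functional K R f \<Longrightarrow> s \<in> carrier R \<Longrightarrow> v \<in> carrier V \<Longrightarrow> aug_tensor V f (E.tens s v) = f s \<odot>\<^bsub>V\<^esub> v"
  unfolding aug_tensor_def by (rule E.tensor_lift_pure[OF abelian_V balanced_functional])

lemma T0_additive: "additive_map EV V T0" by (rule aug_tensor_additive[OF functional_\<epsilon>])
lemma T_additive: "i < d \<Longrightarrow> additive_map EV V (T i)" by (rule aug_tensor_additive[OF functional_\<theta>])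

lemma T_closed [simp, intro]:
  "u \<in> carrier EV \<Longrightarrow> T0 u \<in> carrier V" "u \<in> carrier EV \<Longrightarrow> i < d \<Longrightarrow> T i u \<in> carrier V"
  using T0_additive T_additive by (auto intro: additive_closed)

lemma T_add:
  "u \<in> carrier EV \<Longrightarrow> v \<in> carrier EV \<Longrightarrow> T0 (u \<oplus>\<^bsub>EV\<^esub> v) = T0 u \<oplus>\<^bsub>V\<^esub> T0 v"
  "u \<in> carrier EV \<Longrightarrow> v \<in> carrier EV \<Longrightarrow> i < d \<Longrightarrow> T i (u \<oplus>\<^bsub>EV\<^esub> v) = T i u \<oplus>\<^bsub>V\<^esub> T i v"
  using T0_additive T_additive by (auto intro: additive_add)

lemma T_pure:
  "s \<in> carrier R \<Longrightarrow> v \<in> carrier V \<Longrightarrow> T0 (E.tens s v) = \<epsilon> s \<odot>\<^bsub>V\<^esub> v"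
  "s \<in> carrier R \<Longrightarrow> v \<in> carrier V \<Longrightarrow> i < d \<Longrightarrow> T i (E.tens s v) = \<theta> i s \<odot>\<^bsub>V\<^esub> v"
  by (simp_all add: aug_tensor_pure functional_\<epsilon> functional_\<theta>)

lemma T_incl [simp]:
  "v \<in> carrier V \<Longrightarrow> T0 (incl v) = v" "v \<in> carrier V \<Longrightarrow> i < d \<Longrightarrow> T i (incl v) = \<zero>\<^bsub>V\<^esub>"
  by (simp_all add: T_pure)

lemma incl_closed [simp, intro]: "v \<in> carrier V \<Longrightarrow> incl v \<in> carrier EV"
  by simp

lemma T0_smult: "s \<in> carrier R \<Longrightarrow> u \<in> carrier EV \<Longrightarrow> T0 (s \<odot>\<^bsub>EV\<^esub> u) = \<epsilon> s \<odot>\<^bsub>V\<^esub> T0 u"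
  by (rule E.additive_eqI[OF abelian_V additive_comp[OF E.smult_additive T0_additive]
        V.additive_smult[OF T0_additive]])
    (auto simp: T_pure \<epsilon>_mult V.smult_assoc1)

lemma T_smult:
  assumes i: "i < d" and s: "s \<in> carrier R" and u: "u \<in> carrier EV"
  shows "T i (s \<odot>\<^bsub>EV\<^esub> u) = \<epsilon> s \<odot>\<^bsub>V\<^esub> T i u \<oplus>\<^bsub>V\<^esub> \<theta> i s \<odot>\<^bsub>V\<^esub> T0 u"
proof (rule E.additive_eqI[OF abelian_V additive_comp[OF E.smult_additive T_additive] _ u])
  show "additive_map EV V (\<lambda>u. \<epsilon> s \<odot>\<^bsub>V\<^esub> T i u \<oplus>\<^bsub>V\<^esub> \<theta> i s \<odot>\<^bsub>V\<^esub> T0 u)"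
    by (rule additiveI) (use i s in \<open>simp_all add: T_add V.smult_r_distr V.M.a_ac\<close>)
qed (use i s in \<open>simp_all add: T_pure \<theta>_mult V.smult_assoc1 V.smult_l_distr\<close>)

text \<open>The inverse of the coordinate map \<open>u \<mapsto> (T0 u, T i u)\<close>.\<close>

definition join :: "'v \<Rightarrow> (nat \<Rightarrow> 'v) \<Rightarrow> ('r \<times> 'v \<Rightarrow>\<^sub>0 int) set" where
  "join w v = incl w \<oplus>\<^bsub>EV\<^esub> (\<Oplus>\<^bsub>EV\<^esub>i\<in>{..<d}. E.tens (r i) (v i))"

lemma join_sum_closed: "(\<And>i. i < d \<Longrightarrow> v i \<in> carrier V) \<Longrightarrow> (\<Oplus>\<^bsub>EV\<^esub>i\<in>{..<d}. E.tens (r i) (v i)) \<in> carrier EV"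
  by (rule E.E.finsum_closed) auto

lemma join_closed [simp, intro]: "w \<in> carrier V \<Longrightarrow> (\<And>i. i < d \<Longrightarrow> v i \<in> carrier V) \<Longrightarrow> join w v \<in> carrier EV"
  unfolding join_def using join_sum_closed by simp

lemma aug_tensor_join:
  assumes f: "functional K R f" and w: "w \<in> carrier V" and v: "\<And>i. i < d \<Longrightarrow> v i \<in> carrier V"
  shows "aug_tensor V f (join w v) = f \<one>\<^bsub>R\<^esub> \<odot>\<^bsub>V\<^esub> w \<oplus>\<^bsub>V\<^esub> (\<Oplus>\<^bsub>V\<^esub>i\<in>{..<d}. f (r i) \<odot>\<^bsub>V\<^esub> v i)"
proof -
  note add = aug_tensor_additive[OF f]
  have "aug_tensor V f (\<Oplus>\<^bsub>EV\<^esub>i\<in>{..<d}. E.tens (r i) (v i)) = (\<Oplus>\<^bsub>V\<^esub>i\<in>{..<d}. aug_tensor V f (E.tens (r i) (v i)))"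
    by (rule additive_finsum[OF E.abelian_E abelian_V add]) (use v in auto)
  also have "\<dots> = (\<Oplus>\<^bsub>V\<^esub>i\<in>{..<d}. f (r i) \<odot>\<^bsub>V\<^esub> v i)"
    by (rule V.M.finsum_cong') (use v f in \<open>auto simp: aug_tensor_pure functionalD\<close>)
  finally show ?thesis
    unfolding join_def using additive_add[OF add _ join_sum_closed[OF v]] w
    by (simp add: aug_tensor_pure f)
qed

lemma T0_join [simp]:
  assumes w: "w \<in> carrier V" and v: "\<And>i. i < d \<Longrightarrow> v i \<in> carrier V"
  shows "T0 (join w v) = w"
proof -
  have "(\<Oplus>\<^bsub>V\<^esub>i\<in>{..<d}. \<epsilon> (r i) \<odot>\<^bsub>V\<^esub> v i) = (\<Oplus>\<^bsub>V\<^esub>i\<in>{..<d}. \<zero>\<^bsub>V\<^esub>)"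
    by (rule V.M.finsum_cong') (use v in auto)
  then show ?thesis using aug_tensor_join[OF functional_\<epsilon> w v] w by simp
qed

lemma T_join [simp]:
  assumes i: "i < d" and w: "w \<in> carrier V" and v: "\<And>i. i < d \<Longrightarrow> v i \<in> carrier V"
  shows "T i (join w v) = v i"
proof -
  have "(\<Oplus>\<^bsub>V\<^esub>j\<in>{..<d}. \<theta> i (r j) \<odot>\<^bsub>V\<^esub> v j) = (\<Oplus>\<^bsub>V\<^esub>j\<in>{..<d}. if i = j then v j else \<zero>\<^bsub>V\<^esub>)"
    by (rule V.M.finsum_cong') (use v i in \<open>auto simp: \<theta>_r\<close>)
  also have "\<dots> = v i" by (rule V.M.finsum_singleton) (use v i in auto)
  finally show ?thesis using aug_tensor_join[OF functional_\<theta>[OF i] w v] w v i by simp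
qed

lemma join_add:
  assumes "w \<in> carrier V" "w' \<in> carrier V" "\<And>i. i < d \<Longrightarrow> v i \<in> carrier V" "\<And>i. i < d \<Longrightarrow> v' i \<in> carrier V"
  shows "join (w \<oplus>\<^bsub>V\<^esub> w') (\<lambda>i. v i \<oplus>\<^bsub>V\<^esub> v' i) = join w v \<oplus>\<^bsub>EV\<^esub> join w' v'"
proof -
  have "(\<Oplus>\<^bsub>EV\<^esub>i\<in>{..<d}. E.tens (r i) (v i \<oplus>\<^bsub>V\<^esub> v' i))
      = (\<Oplus>\<^bsub>EV\<^esub>i\<in>{..<d}. E.tens (r i) (v i) \<oplus>\<^bsub>EV\<^esub> E.tens (r i) (v' i))"
    by (rule E.E.finsum_cong') (use assms in \<open>simp_all add: E.pure_add_right\<close>)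
  also have "\<dots> = (\<Oplus>\<^bsub>EV\<^esub>i\<in>{..<d}. E.tens (r i) (v i)) \<oplus>\<^bsub>EV\<^esub> (\<Oplus>\<^bsub>EV\<^esub>i\<in>{..<d}. E.tens (r i) (v' i))"
    by (rule E.E.finsum_addf) (use assms in auto)
  finally show ?thesis
    unfolding join_def
    using assms join_sum_closed[of v] join_sum_closed[of v'] by (simp add: E.pure_add_right E.E.a_ac)
qed

lemma join_T: "u \<in> carrier EV \<Longrightarrow> join (T0 u) (\<lambda>i. T i u) = u"
proof -
  assume u: "u \<in> carrier EV"
  have add: "additive_map EV EV (\<lambda>u. join (T0 u) (\<lambda>i. T i u))"
  proof (rule additiveI)
    fix x y assume *: "x \<in> carrier EV" "y \<in> carrier EV"
    have "(\<Oplus>\<^bsub>EV\<^esub>i\<in>{..<d}. E.tens (r i) (T i (x \<oplus>\<^bsub>EV\<^esub> y)))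
      = (\<Oplus>\<^bsub>EV\<^esub>i\<in>{..<d}. E.tens (r i) (T i x \<oplus>\<^bsub>V\<^esub> T i y))"
      by (rule E.E.finsum_cong') (use * in \<open>simp_all add: T_add\<close>)
    then have "join (T0 (x \<oplus>\<^bsub>EV\<^esub> y)) (\<lambda>i. T i (x \<oplus>\<^bsub>EV\<^esub> y)) = join (T0 x \<oplus>\<^bsub>V\<^esub> T0 y) (\<lambda>i. T i x \<oplus>\<^bsub>V\<^esub> T i y)"
      using * by (simp add: join_def T_add)
    also have "\<dots> = join (T0 x) (\<lambda>i. T i x) \<oplus>\<^bsub>EV\<^esub> join (T0 y) (\<lambda>i. T i y)"
      by (rule join_add) (use * in auto)
    finally show "join (T0 (x \<oplus>\<^bsub>EV\<^esub> y)) (\<lambda>i. T i (x \<oplus>\<^bsub>EV\<^esub> y)) = \<dots>" .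
  qed auto
  show ?thesis
  proof (rule E.additive_eqI[OF E.abelian_E add _ u])
    show "additive_map EV EV (\<lambda>u. u)" by (simp add: additive_map_def)
    fix s v assume s: "s \<in> carrier R" and v: "v \<in> carrier V"
    have addl: "additive_map R EV (\<lambda>s. E.tens s v)"
      by (rule additiveI) (use v in \<open>simp_all add: E.pure_add_left\<close>)
    have cl: "(\<Oplus>\<^bsub>R\<^esub>i\<in>{..<d}. \<theta> i s \<odot>\<^bsub>R\<^esub> r i) \<in> carrier R"
      by (rule R.M.finsum_closed) (use s in auto)
    have "E.tens s v = E.tens (\<epsilon> s \<odot>\<^bsub>R\<^esub> \<one>\<^bsub>R\<^esub> \<oplus>\<^bsub>R\<^esub> (\<Oplus>\<^bsub>R\<^esub>i\<in>{..<d}. \<theta> i s \<odot>\<^bsub>R\<^esub> r i)) v"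
      by (rule arg_cong[OF expand[OF s]])
    also have "\<dots> = E.tens (\<epsilon> s \<odot>\<^bsub>R\<^esub> \<one>\<^bsub>R\<^esub>) v \<oplus>\<^bsub>EV\<^esub> E.tens (\<Oplus>\<^bsub>R\<^esub>i\<in>{..<d}. \<theta> i s \<odot>\<^bsub>R\<^esub> r i) v"
      by (rule E.pure_add_left) (use s v cl in auto)
    also have "E.tens (\<Oplus>\<^bsub>R\<^esub>i\<in>{..<d}. \<theta> i s \<odot>\<^bsub>R\<^esub> r i) v = (\<Oplus>\<^bsub>EV\<^esub>i\<in>{..<d}. E.tens (\<theta> i s \<odot>\<^bsub>R\<^esub> r i) v)"
      by (rule additive_finsum[OF R.M.abelian_group_axioms E.abelian_E addl]) (use s in auto)
    also have "\<dots> = (\<Oplus>\<^bsub>EV\<^esub>i\<in>{..<d}. E.tens (r i) (T i (E.tens s v)))"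
      by (rule E.E.finsum_cong') (use s v in \<open>simp_all add: T_pure E.pure_smult\<close>)
    also have "E.tens (\<epsilon> s \<odot>\<^bsub>R\<^esub> \<one>\<^bsub>R\<^esub>) v = incl (T0 (E.tens s v))"
      using s v by (simp add: T_pure E.pure_smult)
    finally show "join (T0 (E.tens s v)) (\<lambda>i. T i (E.tens s v)) = E.tens s v"
      unfolding join_def by (rule sym)
  qed
qed

text \<open>By \<open>join_T\<close>, an element of \<open>R \<otimes> V\<close> is recovered from its coordinates. This replaces every identity
  in \<open>R \<otimes> V\<close> by identities in \<open>V\<close>.\<close>

lemma coord_eqI:
  assumes "u \<in> carrier EV" "w \<in> carrier EV" "T0 u = T0 w" "\<And>i. i < d \<Longrightarrow> T i u = T i w"
  shows "u = w"
proof -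
  have "join (T0 u) (\<lambda>i. T i u) = join (T0 w) (\<lambda>i. T i w)"
    unfolding join_def assms(3)
    by (rule arg_cong[where f = "\<lambda>x. _ \<oplus>\<^bsub>EV\<^esub> x"], rule E.E.finsum_cong')
      (use assms in simp_all)
  then show ?thesis using join_T assms(1,2) by simp
qed

end

text \<open>An \<open>R\<close>-bilinear lift \<open>m\<close> of a \<open>K\<close>-bilinear operation \<open>m0\<close>. The product, the action and the
  bracket of a deformation are instances, so the calculus in coordinates is done once for
  three modules \<open>U\<close>, \<open>V\<close>, \<open>W\<close>.\<close>

locale inf_op = inf_base K R \<epsilon> d r \<theta> + U: inf_mod K R \<epsilon> d r \<theta> U + V: inf_mod K R \<epsilon> d r \<theta> V
  + W: inf_mod K R \<epsilon> d r \<theta> W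
  for K :: "('k, 'm) ring_scheme" and R :: "('k, 'r) module" and \<epsilon> d r \<theta>
    and U :: "('k, 'u) module" and V :: "('k, 'v) module" and W :: "('k, 'w) module" +
  fixes m0 :: "'u \<Rightarrow> 'v \<Rightarrow> 'w"
    and m :: "('r \<times> 'u \<Rightarrow>\<^sub>0 int) set \<Rightarrow> ('r \<times> 'v \<Rightarrow>\<^sub>0 int) set \<Rightarrow> ('r \<times> 'w \<Rightarrow>\<^sub>0 int) set"
  assumes m0: "m0 \<in> bilin_maps K U V W"
    and m: "m \<in> bilin_maps R U.EV V.EV W.EV"
    and lifts: "\<And>u v. u \<in> carrier U.EV \<Longrightarrow> v \<in> carrier V.EV \<Longrightarrow> W.T0 (m u v) = m0 (U.T0 u) (V.T0 v)"
begin

definition comp :: "nat \<Rightarrow> 'u \<Rightarrow> 'v \<Rightarrow> 'w" where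
  "comp i a b = W.T i (m (U.incl a) (V.incl b))"

lemmas m0D = bilin_mapsD[OF m0]
lemmas mD = bilin_mapsD[OF m]

lemma comp_bilinear:
  assumes i: "i < d"
  shows "comp i \<in> bilin_maps K U V W"
proof -
  have scalU: "U.incl (k \<odot>\<^bsub>U\<^esub> a) = (k \<odot>\<^bsub>R\<^esub> \<one>\<^bsub>R\<^esub>) \<odot>\<^bsub>U.EV\<^esub> U.incl a"
    if "k \<in> carrier K" "a \<in> carrier U" for k a
    using that by (simp add: U.E.pure_smult)
  have scalV: "V.incl (k \<odot>\<^bsub>V\<^esub> a) = (k \<odot>\<^bsub>R\<^esub> \<one>\<^bsub>R\<^esub>) \<odot>\<^bsub>V.EV\<^esub> V.incl a"
    if "k \<in> carrier K" "a \<in> carrier V" for k a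
    using that by (simp add: V.E.pure_smult)
  have one: "\<epsilon> (k \<odot>\<^bsub>R\<^esub> \<one>\<^bsub>R\<^esub>) = k" "\<theta> i (k \<odot>\<^bsub>R\<^esub> \<one>\<^bsub>R\<^esub>) = \<zero>\<^bsub>K\<^esub>" if "k \<in> carrier K" for k
    using that i by (simp_all add: functionalD[OF functional_\<epsilon>] functionalD[OF functional_\<theta>])
  show ?thesis
    by (rule bilin_mapsI; unfold comp_def)
      (use i in \<open>simp_all add: mD U.E.pure_add_right V.E.pure_add_right W.T_add scalU scalV W.T_smult one
        del: U.E.smult_pure V.E.smult_pure\<close>)
qed

lemma comp_closed: "i < d \<Longrightarrow> a \<in> carrier U \<Longrightarrow> b \<in> carrier V \<Longrightarrow> comp i a b \<in> carrier W"
  by (rule bilin_mapsD(1)[OF comp_bilinear])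

text \<open>Both sides are additive in \<open>u\<close> and \<open>v\<close>, so pure tensors \<open>s \<otimes> a\<close> and \<open>t \<otimes> b\<close> suffice. There
  \<open>m(s \<otimes> a, t \<otimes> b) = s t \<cdot> m(1 \<otimes> a, 1 \<otimes> b)\<close>, and the rule is the derivation property of \<open>\<theta>\<^sub>i\<close>.\<close>

lemma product_rule:
  assumes i: "i < d" and u: "u \<in> carrier U.EV" and v: "v \<in> carrier V.EV"
  shows "W.T i (m u v) = m0 (U.T0 u) (V.T i v) \<oplus>\<^bsub>W\<^esub> m0 (U.T i u) (V.T0 v)
    \<oplus>\<^bsub>W\<^esub> comp i (U.T0 u) (V.T0 v)"
proof -
  note cD = bilin_mapsD[OF comp_bilinear[OF i]]
  let ?f = "\<lambda>u v. m0 (U.T0 u) (V.T i v) \<oplus>\<^bsub>W\<^esub> m0 (U.T i u) (V.T0 v) \<oplus>\<^bsub>W\<^esub> comp i (U.T0 u) (V.T0 v)"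
  have addl: "additive_map U.EV W (\<lambda>u. W.T i (m u v))" "additive_map U.EV W (\<lambda>u. ?f u v)"
    if "v \<in> carrier V.EV" for v
    by (rule additiveI; use that i in
        \<open>simp add: mD U.T_add W.T_add m0D cD V.T_closed U.T_closed W.V.M.a_ac\<close>)+
  have addr: "additive_map V.EV W (\<lambda>v. W.T i (m u v))" "additive_map V.EV W (\<lambda>v. ?f u v)"
    if "u \<in> carrier U.EV" for u
    by (rule additiveI; use that i in
        \<open>simp add: mD V.T_add W.T_add m0D cD V.T_closed U.T_closed W.V.M.a_ac\<close>)+
  show ?thesis
  proof (rule U.E.additive_eqI[OF W.abelian_V addl u])
    fix s a assume s: "s \<in> carrier R" "a \<in> carrier U"
    show "W.T i (m (U.E.tens s a) v) = ?f (U.E.tens s a) v"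
    proof (rule V.E.additive_eqI[OF W.abelian_V addr v])
      fix t b assume t: "t \<in> carrier R" "b \<in> carrier V"
      let ?w = "m (U.incl a) (V.incl b)"
      have w: "?w \<in> carrier W.EV" "W.T0 ?w = m0 a b" using s t by (simp_all add: mD lifts)
      have "m (U.E.tens s a) (V.E.tens t b) = m (s \<odot>\<^bsub>U.EV\<^esub> U.incl a) (t \<odot>\<^bsub>V.EV\<^esub> V.incl b)"
        using s t by simp
      also have "\<dots> = s \<odot>\<^bsub>W.EV\<^esub> (t \<odot>\<^bsub>W.EV\<^esub> ?w)"
        using s t by (simp add: mD W.E.E.smult_left_commute[of t] del: U.E.smult_pure V.E.smult_pure)
      finally show "W.T i (m (U.E.tens s a) (V.E.tens t b)) = ?f (U.E.tens s a) (V.E.tens t b)"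
        using s t i w m0D(1)[of a b] cD(1)[of a b]
        by (simp add: W.T_smult W.T0_smult U.T_pure V.T_pure m0D cD W.V.smult_r_distr W.V.M.a_ac
            flip: comp_def W.V.smult_assoc1)
          (simp add: K.m_comm W.V.M.a_ac m0D cD)
    qed (use s in auto)
  qed (use v in auto)
qed

end

text \<open>A bilinear extension whose values on \<open>1 \<otimes> a\<close> and \<open>1 \<otimes> b\<close> have prescribed coordinates \<open>m0 a b\<close> and
  \<open>c i a b\<close> is a lift of \<open>m0\<close> with the components \<open>c i\<close>. Push-outs are of this form.\<close>

lemma (in inf_base) inf_opI:
  assumes U: "module K U" and V: "module K V" and W: "module K W"
    and m0: "m0 \<in> bilin_maps K U V W" and c: "\<And>i. i < d \<Longrightarrow> c i \<in> bilin_maps K U V W"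
    and \<beta>: "\<And>a b. a \<in> carrier U \<Longrightarrow> b \<in> carrier V \<Longrightarrow> \<beta> a b \<in> carrier (ext_scal K R W)"
      "\<And>a b. a \<in> carrier U \<Longrightarrow> b \<in> carrier V \<Longrightarrow> aug_tensor W \<epsilon> (\<beta> a b) = m0 a b"
      "\<And>i a b. i < d \<Longrightarrow> a \<in> carrier U \<Longrightarrow> b \<in> carrier V \<Longrightarrow> aug_tensor W (\<theta> i) (\<beta> a b) = c i a b"
  shows "inf_op K R \<epsilon> d r \<theta> U V W m0 (bilin_ext R (ext_scal K R W) \<beta>)"
    and "\<And>i a b. i < d \<Longrightarrow> a \<in> carrier U \<Longrightarrow> b \<in> carrier V \<Longrightarrow>
           inf_op.comp K R \<theta> U V W (bilin_ext R (ext_scal K R W) \<beta>) i a b = c i a b"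
proof -
  interpret U: inf_mod K R \<epsilon> d r \<theta> U by (intro inf_mod.intro inf_base_axioms U)
  interpret V: inf_mod K R \<epsilon> d r \<theta> V by (intro inf_mod.intro inf_base_axioms V)
  interpret W: inf_mod K R \<epsilon> d r \<theta> W by (intro inf_mod.intro inf_base_axioms W)
  note m0D = bilin_mapsD[OF m0] and cD = bilin_mapsD[OF c]
  have one: "\<epsilon> (k \<odot>\<^bsub>R\<^esub> \<one>\<^bsub>R\<^esub>) = k" "i < d \<Longrightarrow> \<theta> i (k \<odot>\<^bsub>R\<^esub> \<one>\<^bsub>R\<^esub>) = \<zero>\<^bsub>K\<^esub>" if "k \<in> carrier K" for i k
    using that by (simp_all add: functionalD[OF functional_\<epsilon>] functionalD[OF functional_\<theta>])
  have sb: "scalar_bilinear K R U V W.EV \<beta>"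
    unfolding scalar_bilinear_def
    by (intro conjI ballI additiveI; (rule W.coord_eqI)?)
      (simp_all add: \<beta> W.T_add m0D cD W.T_smult W.T0_smult one)
  interpret bilinear_ext K R U V W.EV \<beta>
    by (intro bilinear_ext.intro U.E.scalar_ext_axioms V.E.scalar_ext_axioms W.E.module_E
        bilinear_ext_axioms.intro sb)
  let ?m = "bilin_ext R W.EV \<beta>"
  have add0: "additive_map U.EV W (\<lambda>u. m0 (U.T0 u) x)" if "x \<in> carrier V" for x
    by (rule additiveI) (use that in \<open>simp_all add: m0D U.T_add\<close>)
  have "W.T0 (?m u v) = m0 (U.T0 u) (V.T0 v)" if u: "u \<in> carrier U.EV" and v: "v \<in> carrier V.EV" for u v
  proof (rule U.E.additive_eqI[OF W.abelian_V additive_comp[OF bilin_ext_additive_left[OF v] W.T0_additive] _ u])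
    show "additive_map U.EV W (\<lambda>u. m0 (U.T0 u) (V.T0 v))" using v by (intro add0) auto
    fix s a assume s: "s \<in> carrier R" "a \<in> carrier U"
    show "W.T0 (?m (U.E.tens s a) v) = m0 (U.T0 (U.E.tens s a)) (V.T0 v)"
    proof (rule V.E.additive_eqI[OF W.abelian_V additive_comp[OF bilin_ext_additive_right W.T0_additive] _ v])
      show "additive_map V.EV W (\<lambda>v. m0 (U.T0 (U.E.tens s a)) (V.T0 v))"
        by (rule additiveI) (use s in \<open>simp_all add: m0D V.T_add\<close>)
    qed (use s in \<open>simp_all add: bilin_ext_pure W.T0_smult \<beta> U.T_pure V.T_pure m0D \<epsilon>_mult W.V.smult_assoc1 W.V.smult_left_commute\<close>)
  qed
  then show op: "inf_op K R \<epsilon> d r \<theta> U V W m0 ?m"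
    by (intro inf_op.intro inf_base_axioms U.inf_mod_axioms V.inf_mod_axioms W.inf_mod_axioms
        inf_op_axioms.intro m0 bilin_ext_bilin)
  fix i a b assume *: "i < d" "a \<in> carrier U" "b \<in> carrier V"
  then show "inf_op.comp K R \<theta> U V W ?m i a b = c i a b"
    by (simp add: inf_op.comp_def[OF op] bilin_ext_pure \<beta> W.T_smult \<beta>)
qed

section \<open>Deformations in coordinates\<close>

text \<open>The four components of the 2-cocycle equation for a triplet of maps \<open>A \<times> A \<rightarrow> A\<close>, \<open>L \<times> A \<rightarrow> A\<close>
  and \<open>L \<times> L \<rightarrow> L\<close>. Each is the linearisation of one law of a Courant pair. All signs are moved to
  the other side, so that the laws can be compared by cancellation.\<close>

definition assoc_cocycle :: "('k, 'a, 'l) courant_data \<Rightarrow> ('a \<Rightarrow> 'a \<Rightarrow> 'a) \<Rightarrow> bool" where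
  "assoc_cocycle P m \<longleftrightarrow> (\<forall>a\<in>carrier (alg P). \<forall>b\<in>carrier (alg P). \<forall>c\<in>carrier (alg P).
     m a b \<otimes>\<^bsub>alg P\<^esub> c \<oplus>\<^bsub>alg P\<^esub> m (a \<otimes>\<^bsub>alg P\<^esub> b) c
     = a \<otimes>\<^bsub>alg P\<^esub> m b c \<oplus>\<^bsub>alg P\<^esub> m a (b \<otimes>\<^bsub>alg P\<^esub> c))"

definition derivation_cocycle ::
  "('k, 'a, 'l) courant_data \<Rightarrow> ('a \<Rightarrow> 'a \<Rightarrow> 'a) \<Rightarrow> ('l \<Rightarrow> 'a \<Rightarrow> 'a) \<Rightarrow> bool" where
  "derivation_cocycle P m \<mu> \<longleftrightarrow>
     (\<forall>x\<in>carrier (lei P). \<forall>a\<in>carrier (alg P). \<forall>b\<in>carrier (alg P).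
     act P x (m a b) \<oplus>\<^bsub>alg P\<^esub> \<mu> x (a \<otimes>\<^bsub>alg P\<^esub> b)
     = (\<mu> x a \<otimes>\<^bsub>alg P\<^esub> b \<oplus>\<^bsub>alg P\<^esub> m (act P x a) b)
       \<oplus>\<^bsub>alg P\<^esub> (a \<otimes>\<^bsub>alg P\<^esub> \<mu> x b \<oplus>\<^bsub>alg P\<^esub> m a (act P x b)))"

definition action_cocycle ::
  "('k, 'a, 'l) courant_data \<Rightarrow> ('l \<Rightarrow> 'a \<Rightarrow> 'a) \<Rightarrow> ('l \<Rightarrow> 'l \<Rightarrow> 'l) \<Rightarrow> bool" where
  "action_cocycle P \<mu> b \<longleftrightarrow>
     (\<forall>x\<in>carrier (lei P). \<forall>y\<in>carrier (lei P). \<forall>a\<in>carrier (alg P).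
     (act P (b x y) a \<oplus>\<^bsub>alg P\<^esub> \<mu> (x \<otimes>\<^bsub>lei P\<^esub> y) a)
       \<oplus>\<^bsub>alg P\<^esub> (act P y (\<mu> x a) \<oplus>\<^bsub>alg P\<^esub> \<mu> y (act P x a))
     = act P x (\<mu> y a) \<oplus>\<^bsub>alg P\<^esub> \<mu> x (act P y a))"

definition leibniz_cocycle :: "('k, 'a, 'l) courant_data \<Rightarrow> ('l \<Rightarrow> 'l \<Rightarrow> 'l) \<Rightarrow> bool" where
  "leibniz_cocycle P b \<longleftrightarrow>
     (\<forall>x\<in>carrier (lei P). \<forall>y\<in>carrier (lei P). \<forall>z\<in>carrier (lei P).
     x \<otimes>\<^bsub>lei P\<^esub> b y z \<oplus>\<^bsub>lei P\<^esub> b x (y \<otimes>\<^bsub>lei P\<^esub> z)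
     = (b x y \<otimes>\<^bsub>lei P\<^esub> z \<oplus>\<^bsub>lei P\<^esub> b (x \<otimes>\<^bsub>lei P\<^esub> y) z)
       \<oplus>\<^bsub>lei P\<^esub> (y \<otimes>\<^bsub>lei P\<^esub> b x z \<oplus>\<^bsub>lei P\<^esub> b y (x \<otimes>\<^bsub>lei P\<^esub> z)))"

text \<open>\<open>t\<close> is \<open>t'\<close> plus the coboundary of the 1-cochain \<open>(F, \<psi>)\<close>, with the negative terms of the
  coboundary moved to the left. Only values on the carriers are compared.\<close>

definition cohomologous ::
  "('k, 'm) ring_scheme \<Rightarrow> ('k, 'a, 'l) courant_data \<Rightarrow> ('a, 'l) triplet \<Rightarrow> ('a, 'l) triplet \<Rightarrow> bool" where
  "cohomologous K P t t' \<longleftrightarrow> (case (t, t') of ((m, \<mu>, b), (m', \<mu>', b')) \<Rightarrow>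
     (\<exists>F\<in>lin_maps K (alg P) (alg P). \<exists>\<psi>\<in>lin_maps K (lei P) (lei P).
       (\<forall>a\<in>carrier (alg P). \<forall>c\<in>carrier (alg P).
          m a c \<oplus>\<^bsub>alg P\<^esub> F (a \<otimes>\<^bsub>alg P\<^esub> c)
          = (a \<otimes>\<^bsub>alg P\<^esub> F c \<oplus>\<^bsub>alg P\<^esub> F a \<otimes>\<^bsub>alg P\<^esub> c) \<oplus>\<^bsub>alg P\<^esub> m' a c) \<and>
       (\<forall>x\<in>carrier (lei P). \<forall>a\<in>carrier (alg P).
          \<mu> x a \<oplus>\<^bsub>alg P\<^esub> F (act P x a)
          = (act P x (F a) \<oplus>\<^bsub>alg P\<^esub> act P (\<psi> x) a) \<oplus>\<^bsub>alg P\<^esub> \<mu>' x a) \<and>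
       (\<forall>x\<in>carrier (lei P). \<forall>y\<in>carrier (lei P).
          b x y \<oplus>\<^bsub>lei P\<^esub> \<psi> (x \<otimes>\<^bsub>lei P\<^esub> y)
          = (x \<otimes>\<^bsub>lei P\<^esub> \<psi> y \<oplus>\<^bsub>lei P\<^esub> \<psi> x \<otimes>\<^bsub>lei P\<^esub> y) \<oplus>\<^bsub>lei P\<^esub> b' x y)))"

locale courant =
  fixes K :: "('k, 'm) ring_scheme" and P :: "('k, 'a, 'l) courant_data"
  assumes courant: "courant_pair K P"
begin

abbreviation "A \<equiv> alg P"
abbreviation "L \<equiv> lei P"

sublocale A: module K A using courant unfolding courant_pair_def assoc_algebra_def by blast
sublocale L: module K L using courant unfolding courant_pair_def leibniz_algebra_def by blast

lemma mult_bilin: "monoid.mult A \<in> bilin_maps K A A A"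
  using courant unfolding courant_pair_def assoc_algebra_def by blast
lemma bracket_bilin: "monoid.mult L \<in> bilin_maps K L L L"
  using courant unfolding courant_pair_def leibniz_algebra_def by blast
lemma act_bilin: "act P \<in> bilin_maps K L A A"
  using courant unfolding courant_pair_def by blast

lemmas multD = bilin_mapsD[OF mult_bilin]
lemmas bracketD = bilin_mapsD[OF bracket_bilin]
lemmas actD = bilin_mapsD[OF act_bilin]

lemma A_assoc:
  "a \<in> carrier A \<Longrightarrow> b \<in> carrier A \<Longrightarrow> c \<in> carrier A
    \<Longrightarrow> (a \<otimes>\<^bsub>A\<^esub> b) \<otimes>\<^bsub>A\<^esub> c = a \<otimes>\<^bsub>A\<^esub> (b \<otimes>\<^bsub>A\<^esub> c)"
  using courant unfolding courant_pair_def assoc_algebra_def by blast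

lemma leibniz:
  "x \<in> carrier L \<Longrightarrow> y \<in> carrier L \<Longrightarrow> z \<in> carrier L
    \<Longrightarrow> x \<otimes>\<^bsub>L\<^esub> (y \<otimes>\<^bsub>L\<^esub> z) = ((x \<otimes>\<^bsub>L\<^esub> y) \<otimes>\<^bsub>L\<^esub> z) \<oplus>\<^bsub>L\<^esub> (y \<otimes>\<^bsub>L\<^esub> (x \<otimes>\<^bsub>L\<^esub> z))"
  using courant unfolding courant_pair_def leibniz_algebra_def by blast

lemma act_derivation:
  "x \<in> carrier L \<Longrightarrow> a \<in> carrier A \<Longrightarrow> b \<in> carrier A
    \<Longrightarrow> act P x (a \<otimes>\<^bsub>A\<^esub> b) = (act P x a \<otimes>\<^bsub>A\<^esub> b) \<oplus>\<^bsub>A\<^esub> (a \<otimes>\<^bsub>A\<^esub> act P x b)"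
  using courant unfolding courant_pair_def derivations_def by blast

lemma act_bracket:
  "x \<in> carrier L \<Longrightarrow> y \<in> carrier L \<Longrightarrow> a \<in> carrier A
    \<Longrightarrow> act P x (act P y a) = act P (x \<otimes>\<^bsub>L\<^esub> y) a \<oplus>\<^bsub>A\<^esub> act P y (act P x a)"
proof -
  assume *: "x \<in> carrier L" "y \<in> carrier L" "a \<in> carrier A"
  then have "act P (x \<otimes>\<^bsub>L\<^esub> y) a = act P x (act P y a) \<ominus>\<^bsub>A\<^esub> act P y (act P x a)"
    using courant unfolding courant_pair_def by blast
  then show ?thesis using * by (simp add: actD A.M.minus_eq A.M.a_assoc A.M.l_neg)
qed

end

context inf_mod
begin

lemma T0_smult0: "k \<in> carrier K \<Longrightarrow> u \<in> carrier EV \<Longrightarrow> T0 (k \<odot>\<^bsub>tensor_prod K R V\<^esub> u) = k \<odot>\<^bsub>V\<^esub> T0 u"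
  by (simp add: E.smult0_eq T0_smult functionalD[OF functional_\<epsilon>])

text \<open>In coordinates, an \<open>R\<close>-linear endomorphism of \<open>R \<otimes> V\<close> over the identity of \<open>V\<close> adds to \<open>u\<^sub>i\<close> a linear
  function of \<open>u\<^sub>0\<close>. The shifts are these maps, and \<open>lifted_identity\<close> shows that there are no others.\<close>

definition shift :: "(nat \<Rightarrow> 'v \<Rightarrow> 'v) \<Rightarrow> ('r \<times> 'v \<Rightarrow>\<^sub>0 int) set \<Rightarrow> ('r \<times> 'v \<Rightarrow>\<^sub>0 int) set" where
  "shift F u = join (T0 u) (\<lambda>i. T i u \<oplus>\<^bsub>V\<^esub> F i (T0 u))"

context
  fixes F assumes F: "\<And>i. i < d \<Longrightarrow> F i \<in> lin_maps K V V"
begin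

lemma shift_closed: "u \<in> carrier EV \<Longrightarrow> shift F u \<in> carrier EV"
  unfolding shift_def by (intro join_closed) (simp_all add: lin_mapsD[OF F])

lemma T_shift:
  "u \<in> carrier EV \<Longrightarrow> T0 (shift F u) = T0 u"
  "i < d \<Longrightarrow> u \<in> carrier EV \<Longrightarrow> T i (shift F u) = T i u \<oplus>\<^bsub>V\<^esub> F i (T0 u)"
  unfolding shift_def by (simp_all add: lin_mapsD[OF F])

lemma shift_linear: "shift F \<in> lin_maps R EV EV"
proof (rule lin_mapsI)
  fix u v assume "u \<in> carrier EV" "v \<in> carrier EV"
  then show "shift F (u \<oplus>\<^bsub>EV\<^esub> v) = shift F u \<oplus>\<^bsub>EV\<^esub> shift F v"
    by (intro coord_eqI) (simp_all add: shift_closed T_shift T_add lin_mapsD[OF F] V.M.a_ac)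
next
  fix s u assume "s \<in> carrier R" "u \<in> carrier EV"
  then show "shift F (s \<odot>\<^bsub>EV\<^esub> u) = s \<odot>\<^bsub>EV\<^esub> shift F u"
    by (intro coord_eqI)
      (simp_all add: shift_closed T_shift T_smult T0_smult lin_mapsD[OF F] V.smult_r_distr V.M.a_ac)
qed (rule shift_closed)

end

lemma lin_maps_minus:
  assumes f: "f \<in> lin_maps K V V"
  shows "(\<lambda>v. \<ominus>\<^bsub>V\<^esub> f v) \<in> lin_maps K V V"
  by (rule lin_mapsI) (simp_all add: lin_mapsD[OF f] V.M.minus_add V.smult_r_minus)

text \<open>The inverse shifts by \<open>- F\<close>.\<close>

lemma shift_bij:
  assumes F: "\<And>i. i < d \<Longrightarrow> F i \<in> lin_maps K V V"
  shows "bij_betw (shift F) (carrier EV) (carrier EV)"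
proof (rule bij_betwI)
  let ?G = "\<lambda>i v. \<ominus>\<^bsub>V\<^esub> F i v"
  have G: "\<And>i. i < d \<Longrightarrow> ?G i \<in> lin_maps K V V" using F by (rule lin_maps_minus)
  note s = shift_closed[OF F] T_shift[OF F] shift_closed[OF G] T_shift[OF G] lin_mapsD[OF F]
  show "shift F \<in> carrier EV \<rightarrow> carrier EV" "shift ?G \<in> carrier EV \<rightarrow> carrier EV" by (auto simp: s)
  fix u assume "u \<in> carrier EV"
  then show "shift ?G (shift F u) = u" "shift F (shift ?G u) = u"
    by (intro coord_eqI; simp add: s V.M.a_assoc V.M.r_neg V.M.l_neg)+
qed

text \<open>The function is read off on \<open>1 \<otimes> v\<close>. By linearity over \<open>R\<close>,
  \<open>f(s \<otimes> v) = s f(1 \<otimes> v)\<close>, whose \<open>i\<close>-th coordinate is \<open>\<theta>\<^sub>i(s) v + \<epsilon>(s) f(1 \<otimes> v)\<^sub>i\<close>.\<close>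

lemma lifted_identity:
  assumes f: "f \<in> lin_maps R EV EV" and f0: "\<And>u. u \<in> carrier EV \<Longrightarrow> T0 (f u) = T0 u" and i: "i < d"
  shows "(\<lambda>v. T i (f (incl v))) \<in> lin_maps K V V"
    and "u \<in> carrier EV \<Longrightarrow> T i (f u) = T i u \<oplus>\<^bsub>V\<^esub> T i (f (incl (T0 u)))"
proof -
  note fD = lin_mapsD[OF f]
  have scal: "incl (k \<odot>\<^bsub>V\<^esub> a) = (k \<odot>\<^bsub>R\<^esub> \<one>\<^bsub>R\<^esub>) \<odot>\<^bsub>EV\<^esub> incl a" if "k \<in> carrier K" "a \<in> carrier V" for k a
    using that by (simp add: E.pure_smult)
  show lin: "(\<lambda>v. T i (f (incl v))) \<in> lin_maps K V V"
    by (rule lin_mapsI)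
      (use i in \<open>simp_all add: fD E.pure_add_right T_add scal T_smult functionalD[OF functional_\<epsilon>]
        functionalD[OF functional_\<theta>] del: E.smult_pure\<close>)
  note lD = lin_mapsD[OF lin]
  assume u: "u \<in> carrier EV"
  show "T i (f u) = T i u \<oplus>\<^bsub>V\<^esub> T i (f (incl (T0 u)))"
  proof (rule E.additive_eqI[OF abelian_V _ _ u])
    show "additive_map EV V (\<lambda>u. T i (f u))"
      by (rule additiveI) (use i in \<open>simp_all add: fD T_add\<close>)
    show "additive_map EV V (\<lambda>u. T i u \<oplus>\<^bsub>V\<^esub> T i (f (incl (T0 u))))"
      by (rule additiveI) (use i in \<open>simp_all add: lD T_add fD V.M.a_ac\<close>)
    fix s v assume s: "s \<in> carrier R" "v \<in> carrier V"
    have "f (E.tens s v) = s \<odot>\<^bsub>EV\<^esub> f (incl v)" using s fD(3)[of s "incl v"] by simp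
    then show "T i (f (E.tens s v)) = T i (E.tens s v) \<oplus>\<^bsub>V\<^esub> T i (f (incl (T0 (E.tens s v))))"
      using s i by (simp add: T_smult fD f0 T_pure lD V.M.a_comm)
  qed
qed

end

locale inf_courant = inf_base K R \<epsilon> d r \<theta> + courant K P
  for K :: "('k, 'm) ring_scheme" and R :: "('k, 'r) module" and \<epsilon> d r \<theta>
    and P :: "('k, 'a, 'l) courant_data"
begin

sublocale A: inf_mod K R \<epsilon> d r \<theta> A by (intro inf_mod.intro inf_base_axioms A.module_axioms)
sublocale L: inf_mod K R \<epsilon> d r \<theta> L by (intro inf_mod.intro inf_base_axioms L.module_axioms)

abbreviation "EA \<equiv> ext_scal K R (alg P)"
abbreviation "EL \<equiv> ext_scal K R (lei P)"

end

text \<open>Three \<open>R\<close>-bilinear operations that reduce to those of the Courant pair, before any law is imposed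
  on them.\<close>

locale inf_triple = inf_courant K R \<epsilon> d r \<theta> P
  + M: inf_op K R \<epsilon> d r \<theta> "alg P" "alg P" "alg P" "monoid.mult (alg P)" m
  + U: inf_op K R \<epsilon> d r \<theta> "lei P" "alg P" "alg P" "act P" \<mu>
  + B: inf_op K R \<epsilon> d r \<theta> "lei P" "lei P" "lei P" "monoid.mult (lei P)" b
  for K :: "('k, 'm) ring_scheme" and R :: "('k, 'r) module" and \<epsilon> d r \<theta>
    and P :: "('k, 'a, 'l) courant_data" and m \<mu> b
begin

lemmas closed = M.mD(1) U.mD(1) B.mD(1) multD(1) actD(1) bracketD(1)
  M.comp_closed U.comp_closed B.comp_closed
lemmas T0_op = M.lifts U.lifts B.lifts
lemmas T_op = M.product_rule U.product_rule B.product_rule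
lemmas distr = multD(2,3) actD(2,3) bracketD(2,3)

definition components :: "nat \<Rightarrow> ('a, 'l) triplet" where
  "components i = (M.comp i, U.comp i, B.comp i)"

text \<open>The law holds in the coordinate \<open>T0\<close> because \<open>A\<close> is associative. By the product rule, both sides in
  the coordinate \<open>T i\<close> have in common the sum \<open>z\<close> of the terms with some \<open>T i u\<close>, and what remains is
  the cocycle equation at \<open>T0 u, T0 v, T0 w\<close>. These are arbitrary elements of \<open>A\<close>, since
  \<open>T0 (1 \<otimes> a) = a\<close>. The next three lemmas follow the same pattern.\<close>

lemma assoc_iff:
  "(\<forall>u\<in>carrier EA. \<forall>v\<in>carrier EA. \<forall>w\<in>carrier EA. m (m u v) w = m u (m v w))
    \<longleftrightarrow> (\<forall>i<d. assoc_cocycle P (M.comp i))"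
proof -
  have T: "A.T i (m (m u v) w) = A.T i (m u (m v w)) \<longleftrightarrow>
      M.comp i (A.T0 u) (A.T0 v) \<otimes>\<^bsub>A\<^esub> A.T0 w \<oplus>\<^bsub>A\<^esub> M.comp i (A.T0 u \<otimes>\<^bsub>A\<^esub> A.T0 v) (A.T0 w)
      = A.T0 u \<otimes>\<^bsub>A\<^esub> M.comp i (A.T0 v) (A.T0 w) \<oplus>\<^bsub>A\<^esub> M.comp i (A.T0 u) (A.T0 v \<otimes>\<^bsub>A\<^esub> A.T0 w)"
    (is "_ \<longleftrightarrow> ?x = ?y")
    if "i < d" "u \<in> carrier EA" "v \<in> carrier EA" "w \<in> carrier EA" for i u v w
  proof -
    define z where "z = A.T0 u \<otimes>\<^bsub>A\<^esub> (A.T0 v \<otimes>\<^bsub>A\<^esub> A.T i w) \<oplus>\<^bsub>A\<^esub> (A.T0 u \<otimes>\<^bsub>A\<^esub> (A.T i v \<otimes>\<^bsub>A\<^esub> A.T0 w)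
      \<oplus>\<^bsub>A\<^esub> A.T i u \<otimes>\<^bsub>A\<^esub> (A.T0 v \<otimes>\<^bsub>A\<^esub> A.T0 w))"
    have "A.T i (m (m u v) w) = z \<oplus>\<^bsub>A\<^esub> ?x" "A.T i (m u (m v w)) = z \<oplus>\<^bsub>A\<^esub> ?y"
      using that by (simp_all add: z_def T_op T0_op closed distr A_assoc A.M.a_ac)
    moreover have "z \<in> carrier A" "?x \<in> carrier A" "?y \<in> carrier A"
      using that by (simp_all add: z_def closed)
    ultimately show ?thesis by simp
  qed
  show ?thesis
  proof (intro iffI allI impI ballI)
    fix i assume i: "i < d"
      and law: "\<forall>u\<in>carrier EA. \<forall>v\<in>carrier EA. \<forall>w\<in>carrier EA. m (m u v) w = m u (m v w)"
    show "assoc_cocycle P (M.comp i)" unfolding assoc_cocycle_def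
    proof (intro ballI)
      fix a b c assume "a \<in> carrier A" "b \<in> carrier A" "c \<in> carrier A"
      then show "M.comp i a b \<otimes>\<^bsub>A\<^esub> c \<oplus>\<^bsub>A\<^esub> M.comp i (a \<otimes>\<^bsub>A\<^esub> b) c
          = a \<otimes>\<^bsub>A\<^esub> M.comp i b c \<oplus>\<^bsub>A\<^esub> M.comp i a (b \<otimes>\<^bsub>A\<^esub> c)"
        using T[OF i, of "A.incl a" "A.incl b" "A.incl c"] law by simp
    qed
  next
    fix u v w assume coc: "\<forall>i<d. assoc_cocycle P (M.comp i)"
      and *: "u \<in> carrier EA" "v \<in> carrier EA" "w \<in> carrier EA"
    show "m (m u v) w = m u (m v w)"
    proof (rule A.coord_eqI)
      show "A.T0 (m (m u v) w) = A.T0 (m u (m v w))"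
        using * by (simp add: closed T0_op A.T_add(1) A_assoc)
      fix i assume i: "i < d"
      have "assoc_cocycle P (M.comp i)" using coc i by blast
      then show "A.T i (m (m u v) w) = A.T i (m u (m v w))"
        unfolding T[OF i *] assoc_cocycle_def using * by blast
    qed (use * in \<open>simp_all add: closed\<close>)
  qed
qed

lemma derivation_iff:
  "(\<forall>x\<in>carrier EL. \<forall>u\<in>carrier EA. \<forall>v\<in>carrier EA. \<mu> x (m u v) = m (\<mu> x u) v \<oplus>\<^bsub>EA\<^esub> m u (\<mu> x v))
    \<longleftrightarrow> (\<forall>i<d. derivation_cocycle P (M.comp i) (U.comp i))"
proof -
  have T: "A.T i (\<mu> x (m u v)) = A.T i (m (\<mu> x u) v \<oplus>\<^bsub>EA\<^esub> m u (\<mu> x v)) \<longleftrightarrow>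
      act P (L.T0 x) (M.comp i (A.T0 u) (A.T0 v)) \<oplus>\<^bsub>A\<^esub> U.comp i (L.T0 x) (A.T0 u \<otimes>\<^bsub>A\<^esub> A.T0 v)
      = (U.comp i (L.T0 x) (A.T0 u) \<otimes>\<^bsub>A\<^esub> A.T0 v \<oplus>\<^bsub>A\<^esub> M.comp i (act P (L.T0 x) (A.T0 u)) (A.T0 v))
       \<oplus>\<^bsub>A\<^esub> (A.T0 u \<otimes>\<^bsub>A\<^esub> U.comp i (L.T0 x) (A.T0 v) \<oplus>\<^bsub>A\<^esub> M.comp i (A.T0 u) (act P (L.T0 x) (A.T0 v)))"
    (is "_ \<longleftrightarrow> ?x = ?y")
    if "i < d" "x \<in> carrier EL" "u \<in> carrier EA" "v \<in> carrier EA" for i x u v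
  proof -
    define z where "z = act P (L.T0 x) (A.T0 u \<otimes>\<^bsub>A\<^esub> A.T i v) \<oplus>\<^bsub>A\<^esub> (act P (L.T0 x) (A.T i u \<otimes>\<^bsub>A\<^esub> A.T0 v)
      \<oplus>\<^bsub>A\<^esub> act P (L.T i x) (A.T0 u \<otimes>\<^bsub>A\<^esub> A.T0 v))"
    have "A.T i (\<mu> x (m u v)) = z \<oplus>\<^bsub>A\<^esub> ?x" "A.T i (m (\<mu> x u) v \<oplus>\<^bsub>EA\<^esub> m u (\<mu> x v)) = z \<oplus>\<^bsub>A\<^esub> ?y"
      using that by (simp_all add: z_def A.T_add T_op T0_op closed distr act_derivation A.M.a_ac)
    moreover have "z \<in> carrier A" "?x \<in> carrier A" "?y \<in> carrier A"
      using that by (simp_all add: z_def closed)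
    ultimately show ?thesis by simp
  qed
  show ?thesis
  proof (intro iffI allI impI ballI)
    fix i assume i: "i < d"
      and law: "\<forall>x\<in>carrier EL. \<forall>u\<in>carrier EA. \<forall>v\<in>carrier EA.
        \<mu> x (m u v) = m (\<mu> x u) v \<oplus>\<^bsub>EA\<^esub> m u (\<mu> x v)"
    show "derivation_cocycle P (M.comp i) (U.comp i)" unfolding derivation_cocycle_def
    proof (intro ballI)
      fix x a b assume "x \<in> carrier L" "a \<in> carrier A" "b \<in> carrier A"
      then show "act P x (M.comp i a b) \<oplus>\<^bsub>A\<^esub> U.comp i x (a \<otimes>\<^bsub>A\<^esub> b)
         = (U.comp i x a \<otimes>\<^bsub>A\<^esub> b \<oplus>\<^bsub>A\<^esub> M.comp i (act P x a) b)
          \<oplus>\<^bsub>A\<^esub> (a \<otimes>\<^bsub>A\<^esub> U.comp i x b \<oplus>\<^bsub>A\<^esub> M.comp i a (act P x b))"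
        using T[OF i, of "L.incl x" "A.incl a" "A.incl b"] law by simp
    qed
  next
    fix x u v assume coc: "\<forall>i<d. derivation_cocycle P (M.comp i) (U.comp i)"
      and *: "x \<in> carrier EL" "u \<in> carrier EA" "v \<in> carrier EA"
    show "\<mu> x (m u v) = m (\<mu> x u) v \<oplus>\<^bsub>EA\<^esub> m u (\<mu> x v)"
    proof (rule A.coord_eqI)
      show "A.T0 (\<mu> x (m u v)) = A.T0 (m (\<mu> x u) v \<oplus>\<^bsub>EA\<^esub> m u (\<mu> x v))"
        using * by (simp add: closed T0_op A.T_add(1) act_derivation)
      fix i assume i: "i < d"
      have "derivation_cocycle P (M.comp i) (U.comp i)" using coc i by blast
      then show "A.T i (\<mu> x (m u v)) = A.T i (m (\<mu> x u) v \<oplus>\<^bsub>EA\<^esub> m u (\<mu> x v))"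
        unfolding T[OF i *] derivation_cocycle_def using * by blast
    qed (use * in \<open>simp_all add: closed\<close>)
  qed
qed

lemma action_iff:
  "(\<forall>x\<in>carrier EL. \<forall>y\<in>carrier EL. \<forall>u\<in>carrier EA. \<mu> (b x y) u \<oplus>\<^bsub>EA\<^esub> \<mu> y (\<mu> x u) = \<mu> x (\<mu> y u))
    \<longleftrightarrow> (\<forall>i<d. action_cocycle P (U.comp i) (B.comp i))"
proof -
  have T: "A.T i (\<mu> (b x y) u \<oplus>\<^bsub>EA\<^esub> \<mu> y (\<mu> x u)) = A.T i (\<mu> x (\<mu> y u)) \<longleftrightarrow>
     (act P (B.comp i (L.T0 x) (L.T0 y)) (A.T0 u) \<oplus>\<^bsub>A\<^esub> U.comp i (L.T0 x \<otimes>\<^bsub>L\<^esub> L.T0 y) (A.T0 u))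
       \<oplus>\<^bsub>A\<^esub> (act P (L.T0 y) (U.comp i (L.T0 x) (A.T0 u)) \<oplus>\<^bsub>A\<^esub> U.comp i (L.T0 y) (act P (L.T0 x) (A.T0 u)))
     = act P (L.T0 x) (U.comp i (L.T0 y) (A.T0 u)) \<oplus>\<^bsub>A\<^esub> U.comp i (L.T0 x) (act P (L.T0 y) (A.T0 u))"
    (is "_ \<longleftrightarrow> ?x = ?y")
    if "i < d" "x \<in> carrier EL" "y \<in> carrier EL" "u \<in> carrier EA" for i x y u
  proof -
    define z where "z = act P (L.T0 x) (act P (L.T0 y) (A.T i u)) \<oplus>\<^bsub>A\<^esub> (act P (L.T0 x) (act P (L.T i y) (A.T0 u))
      \<oplus>\<^bsub>A\<^esub> act P (L.T i x) (act P (L.T0 y) (A.T0 u)))"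
    note br = act_bracket[of "L.T0 x" "L.T0 y" "A.T i u"] act_bracket[of "L.T0 x" "L.T i y" "A.T0 u"]
      act_bracket[of "L.T i x" "L.T0 y" "A.T0 u"]
    have "A.T i (\<mu> (b x y) u \<oplus>\<^bsub>EA\<^esub> \<mu> y (\<mu> x u)) = z \<oplus>\<^bsub>A\<^esub> ?x"
      using that by (simp add: z_def br A.T_add T_op T0_op closed distr A.M.a_ac)
    moreover have "A.T i (\<mu> x (\<mu> y u)) = z \<oplus>\<^bsub>A\<^esub> ?y"
      using that by (simp add: z_def T_op T0_op closed distr A.M.a_ac)
    moreover have "z \<in> carrier A" "?x \<in> carrier A" "?y \<in> carrier A"
      using that by (simp_all add: z_def closed)
    ultimately show ?thesis by simp
  qed
  show ?thesis
  proof (intro iffI allI impI ballI)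
    fix i assume i: "i < d"
      and law: "\<forall>x\<in>carrier EL. \<forall>y\<in>carrier EL. \<forall>u\<in>carrier EA. \<mu> (b x y) u \<oplus>\<^bsub>EA\<^esub> \<mu> y (\<mu> x u) = \<mu> x (\<mu> y u)"
    show "action_cocycle P (U.comp i) (B.comp i)" unfolding action_cocycle_def
    proof (intro ballI)
      fix x y a assume "x \<in> carrier L" "y \<in> carrier L" "a \<in> carrier A"
      then show "(act P (B.comp i x y) a \<oplus>\<^bsub>A\<^esub> U.comp i (x \<otimes>\<^bsub>L\<^esub> y) a)
          \<oplus>\<^bsub>A\<^esub> (act P y (U.comp i x a) \<oplus>\<^bsub>A\<^esub> U.comp i y (act P x a))
        = act P x (U.comp i y a) \<oplus>\<^bsub>A\<^esub> U.comp i x (act P y a)"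
        using T[OF i, of "L.incl x" "L.incl y" "A.incl a"] law by simp
    qed
  next
    fix x y u assume coc: "\<forall>i<d. action_cocycle P (U.comp i) (B.comp i)"
      and *: "x \<in> carrier EL" "y \<in> carrier EL" "u \<in> carrier EA"
    show "\<mu> (b x y) u \<oplus>\<^bsub>EA\<^esub> \<mu> y (\<mu> x u) = \<mu> x (\<mu> y u)"
    proof (rule A.coord_eqI)
      show "A.T0 (\<mu> (b x y) u \<oplus>\<^bsub>EA\<^esub> \<mu> y (\<mu> x u)) = A.T0 (\<mu> x (\<mu> y u))"
        using * by (simp add: closed T0_op A.T_add(1) act_bracket[of "L.T0 x" "L.T0 y"])
      fix i assume i: "i < d"
      have "action_cocycle P (U.comp i) (B.comp i)" using coc i by blast
      then show "A.T i (\<mu> (b x y) u \<oplus>\<^bsub>EA\<^esub> \<mu> y (\<mu> x u)) = A.T i (\<mu> x (\<mu> y u))"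
        unfolding T[OF i *] action_cocycle_def using * by blast
    qed (use * in \<open>simp_all add: closed\<close>)
  qed
qed

lemma leibniz_iff:
  "(\<forall>x\<in>carrier EL. \<forall>y\<in>carrier EL. \<forall>w\<in>carrier EL. b x (b y w) = b (b x y) w \<oplus>\<^bsub>EL\<^esub> b y (b x w))
    \<longleftrightarrow> (\<forall>i<d. leibniz_cocycle P (B.comp i))"
proof -
  have T: "L.T i (b x (b y w)) = L.T i (b (b x y) w \<oplus>\<^bsub>EL\<^esub> b y (b x w)) \<longleftrightarrow>
     L.T0 x \<otimes>\<^bsub>L\<^esub> B.comp i (L.T0 y) (L.T0 w) \<oplus>\<^bsub>L\<^esub> B.comp i (L.T0 x) (L.T0 y \<otimes>\<^bsub>L\<^esub> L.T0 w)
     = (B.comp i (L.T0 x) (L.T0 y) \<otimes>\<^bsub>L\<^esub> L.T0 w \<oplus>\<^bsub>L\<^esub> B.comp i (L.T0 x \<otimes>\<^bsub>L\<^esub> L.T0 y) (L.T0 w))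
       \<oplus>\<^bsub>L\<^esub> (L.T0 y \<otimes>\<^bsub>L\<^esub> B.comp i (L.T0 x) (L.T0 w) \<oplus>\<^bsub>L\<^esub> B.comp i (L.T0 y) (L.T0 x \<otimes>\<^bsub>L\<^esub> L.T0 w))"
    (is "_ \<longleftrightarrow> ?x = ?y")
    if "i < d" "x \<in> carrier EL" "y \<in> carrier EL" "w \<in> carrier EL" for i x y w
  proof -
    define z where "z = L.T0 x \<otimes>\<^bsub>L\<^esub> (L.T0 y \<otimes>\<^bsub>L\<^esub> L.T i w) \<oplus>\<^bsub>L\<^esub> (L.T0 x \<otimes>\<^bsub>L\<^esub> (L.T i y \<otimes>\<^bsub>L\<^esub> L.T0 w)
      \<oplus>\<^bsub>L\<^esub> L.T i x \<otimes>\<^bsub>L\<^esub> (L.T0 y \<otimes>\<^bsub>L\<^esub> L.T0 w))"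
    note br = leibniz[of "L.T0 x" "L.T0 y" "L.T i w"] leibniz[of "L.T0 x" "L.T i y" "L.T0 w"]
      leibniz[of "L.T i x" "L.T0 y" "L.T0 w"]
    have "L.T i (b (b x y) w \<oplus>\<^bsub>EL\<^esub> b y (b x w)) = z \<oplus>\<^bsub>L\<^esub> ?y"
      using that by (simp add: z_def br L.T_add T_op T0_op closed distr L.M.a_ac)
    moreover have "L.T i (b x (b y w)) = z \<oplus>\<^bsub>L\<^esub> ?x"
      using that by (simp add: z_def T_op T0_op closed distr L.M.a_ac)
    moreover have "z \<in> carrier L" "?x \<in> carrier L" "?y \<in> carrier L"
      using that by (simp_all add: z_def closed)
    ultimately show ?thesis by simp
  qed
  show ?thesis
  proof (intro iffI allI impI ballI)
    fix i assume i: "i < d"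
      and law: "\<forall>x\<in>carrier EL. \<forall>y\<in>carrier EL. \<forall>w\<in>carrier EL. b x (b y w) = b (b x y) w \<oplus>\<^bsub>EL\<^esub> b y (b x w)"
    show "leibniz_cocycle P (B.comp i)" unfolding leibniz_cocycle_def
    proof (intro ballI)
      fix x y z assume *: "x \<in> carrier L" "y \<in> carrier L" "z \<in> carrier L"
      then have "L.T i (b (L.incl x) (b (L.incl y) (L.incl z)))
          = L.T i (b (b (L.incl x) (L.incl y)) (L.incl z) \<oplus>\<^bsub>EL\<^esub> b (L.incl y) (b (L.incl x) (L.incl z)))"
        by (intro arg_cong[where f = "L.T i"]) (use law in blast)
      with * show "x \<otimes>\<^bsub>L\<^esub> B.comp i y z \<oplus>\<^bsub>L\<^esub> B.comp i x (y \<otimes>\<^bsub>L\<^esub> z)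
        = (B.comp i x y \<otimes>\<^bsub>L\<^esub> z \<oplus>\<^bsub>L\<^esub> B.comp i (x \<otimes>\<^bsub>L\<^esub> y) z)
          \<oplus>\<^bsub>L\<^esub> (y \<otimes>\<^bsub>L\<^esub> B.comp i x z \<oplus>\<^bsub>L\<^esub> B.comp i y (x \<otimes>\<^bsub>L\<^esub> z))"
        using T[OF i, of "L.incl x" "L.incl y" "L.incl z"] by simp
    qed
  next
    fix x y w assume coc: "\<forall>i<d. leibniz_cocycle P (B.comp i)"
      and *: "x \<in> carrier EL" "y \<in> carrier EL" "w \<in> carrier EL"
    show "b x (b y w) = b (b x y) w \<oplus>\<^bsub>EL\<^esub> b y (b x w)"
    proof (rule L.coord_eqI)
      show "L.T0 (b x (b y w)) = L.T0 (b (b x y) w \<oplus>\<^bsub>EL\<^esub> b y (b x w))"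
        using * by (simp add: closed T0_op L.T_add(1) leibniz[of "L.T0 x" "L.T0 y" "L.T0 w"])
      fix i assume i: "i < d"
      have "leibniz_cocycle P (B.comp i)" using coc i by blast
      then show "L.T i (b x (b y w)) = L.T i (b (b x y) w \<oplus>\<^bsub>EL\<^esub> b y (b x w))"
        unfolding T[OF i *] leibniz_cocycle_def using * by blast
    qed (use * in \<open>simp_all add: closed\<close>)
  qed
qed

end

definition triplet_cocycle :: "('k, 'a, 'l) courant_data \<Rightarrow> ('a, 'l) triplet \<Rightarrow> bool" where
  "triplet_cocycle P t \<longleftrightarrow> (case t of (m, \<mu>, b) \<Rightarrow>
     assoc_cocycle P m \<and> derivation_cocycle P m \<mu> \<and> action_cocycle P \<mu> b \<and> leibniz_cocycle P b)"

text \<open>A deformed algebra is the module \<open>R \<otimes> A\<close> with a replaced product. The replacement leaves the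
  notions that refer only to the module structure unchanged.\<close>

lemma bilin_maps_mult_update [simp]:
  "bilin_maps S (U\<lparr>monoid.mult := m\<rparr>) V W = bilin_maps S U V W"
  "bilin_maps S U (V\<lparr>monoid.mult := m'\<rparr>) W = bilin_maps S U V W"
  "bilin_maps S U V (W\<lparr>monoid.mult := m''\<rparr>) = bilin_maps S U V W"
  by (simp_all add: bilin_maps_def lin_maps_def)

lemma lin_maps_mult_update [simp]:
  "lin_maps S (U\<lparr>monoid.mult := m\<rparr>) V = lin_maps S U V"
  "lin_maps S U (V\<lparr>monoid.mult := m'\<rparr>) = lin_maps S U V"
  by (simp_all add: lin_maps_def)

lemma abelian_group_mult_update:
  assumes "abelian_group V" shows "abelian_group (V\<lparr>monoid.mult := m\<rparr>)"
  by (rule abelian_group_transfer[OF assms]) simp_all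

lemma module_mult_update:
  assumes "module S V" shows "module S (V\<lparr>monoid.mult := m\<rparr>)"
proof -
  interpret V: module S V by fact
  show ?thesis
    by (rule moduleI)
      (simp_all add: V.R.is_cring abelian_group_mult_update V.M.abelian_group_axioms
        V.smult_l_distr V.smult_r_distr V.smult_assoc1)
qed

lemma bilin_maps_zero:
  assumes \<beta>: "\<beta> \<in> bilin_maps K U V W" and "abelian_group U" "abelian_group V" "abelian_group W"
  shows "u \<in> carrier U \<Longrightarrow> \<beta> u \<zero>\<^bsub>V\<^esub> = \<zero>\<^bsub>W\<^esub>" "v \<in> carrier V \<Longrightarrow> \<beta> \<zero>\<^bsub>U\<^esub> v = \<zero>\<^bsub>W\<^esub>"
  using additive_zero[OF assms(3,4), of "\<beta> u"] additive_zero[OF assms(2,4), of "\<lambda>u. \<beta> u v"]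
  by (simp_all add: additive_map_def bilin_mapsD[OF \<beta>])

lemmas (in courant) zero_op =
  bilin_maps_zero[OF mult_bilin A.M.abelian_group_axioms A.M.abelian_group_axioms A.M.abelian_group_axioms]
  bilin_maps_zero[OF act_bilin L.M.abelian_group_axioms A.M.abelian_group_axioms A.M.abelian_group_axioms]
  bilin_maps_zero[OF bracket_bilin L.M.abelian_group_axioms L.M.abelian_group_axioms L.M.abelian_group_axioms]

context inf_courant
begin

lemma a_minus_mult_update: "x \<ominus>\<^bsub>V\<lparr>monoid.mult := m\<rparr>\<^esub> y = x \<ominus>\<^bsub>V\<^esub> y" for V :: "('x, 'y) module"
  by (simp add: a_minus_def a_inv_def)

lemma courant_pair_deformed:
  "courant_pair R (deformed K P R (m, \<mu>, b)) \<longleftrightarrow>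
     m \<in> bilin_maps R EA EA EA \<and> \<mu> \<in> bilin_maps R EL EA EA \<and> b \<in> bilin_maps R EL EL EL \<and>
     (\<forall>u\<in>carrier EA. \<forall>v\<in>carrier EA. \<forall>w\<in>carrier EA. m (m u v) w = m u (m v w)) \<and>
     (\<forall>x\<in>carrier EL. \<forall>u\<in>carrier EA. \<forall>v\<in>carrier EA. \<mu> x (m u v) = m (\<mu> x u) v \<oplus>\<^bsub>EA\<^esub> m u (\<mu> x v)) \<and>
     (\<forall>x\<in>carrier EL. \<forall>y\<in>carrier EL. \<forall>u\<in>carrier EA. \<mu> (b x y) u \<oplus>\<^bsub>EA\<^esub> \<mu> y (\<mu> x u) = \<mu> x (\<mu> y u)) \<and>
     (\<forall>x\<in>carrier EL. \<forall>y\<in>carrier EL. \<forall>w\<in>carrier EL. b x (b y w) = b (b x y) w \<oplus>\<^bsub>EL\<^esub> b y (b x w))"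
  (is "?l \<longleftrightarrow> ?bm \<and> ?b\<mu> \<and> ?bb \<and> ?assoc \<and> ?der \<and> ?act \<and> ?lei")
proof -
  have mods: "module R (EA\<lparr>monoid.mult := m\<rparr>)" "module R (EL\<lparr>monoid.mult := b\<rparr>)"
    by (simp_all add: module_mult_update A.E.module_E L.E.module_E)
  have assoc: "assoc_algebra R (EA\<lparr>monoid.mult := m\<rparr>) \<longleftrightarrow> ?bm \<and> ?assoc"
    using mods by (simp add: assoc_algebra_def)
  have lei: "leibniz_algebra R (EL\<lparr>monoid.mult := b\<rparr>) \<longleftrightarrow> ?bb \<and> ?lei"
    using mods unfolding leibniz_algebra_def by simp
  have der: "(\<forall>x\<in>carrier EL. \<mu> x \<in> derivations R (EA\<lparr>monoid.mult := m\<rparr>)) \<longleftrightarrow> ?der" if ?b\<mu>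
    using that by (auto simp: derivations_def bilin_maps_def)
  have act: "(\<forall>x\<in>carrier EL. \<forall>y\<in>carrier EL. \<forall>u\<in>carrier EA.
      \<mu> (b x y) u = \<mu> x (\<mu> y u) \<ominus>\<^bsub>EA\<^esub> \<mu> y (\<mu> x u)) \<longleftrightarrow> ?act" if "?b\<mu>" "?bb"
  proof -
    have "\<mu> (b x y) u = \<mu> x (\<mu> y u) \<ominus>\<^bsub>EA\<^esub> \<mu> y (\<mu> x u) \<longleftrightarrow> \<mu> (b x y) u \<oplus>\<^bsub>EA\<^esub> \<mu> y (\<mu> x u) = \<mu> x (\<mu> y u)"
      if *: "x \<in> carrier EL" "y \<in> carrier EL" "u \<in> carrier EA" for x y u
    proof -
      have "\<mu> (b x y) u \<in> carrier EA" "\<mu> x (\<mu> y u) \<in> carrier EA" "\<mu> y (\<mu> x u) \<in> carrier EA"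
        using * bilin_mapsD(1)[OF \<open>?b\<mu>\<close>] bilin_mapsD(1)[OF \<open>?bb\<close>] by auto
      then show ?thesis unfolding A.E.E.minus_eq by (metis A.E.E.add.inv_solve_right)
    qed
    then show ?thesis by blast
  qed
  have l: "?l \<longleftrightarrow> assoc_algebra R (EA\<lparr>monoid.mult := m\<rparr>) \<and> leibniz_algebra R (EL\<lparr>monoid.mult := b\<rparr>) \<and>
      (\<forall>x\<in>carrier EL. \<mu> x \<in> derivations R (EA\<lparr>monoid.mult := m\<rparr>)) \<and> ?b\<mu> \<and>
      (\<forall>x\<in>carrier EL. \<forall>y\<in>carrier EL. \<forall>u\<in>carrier EA.
        \<mu> (b x y) u = \<mu> x (\<mu> y u) \<ominus>\<^bsub>EA\<^esub> \<mu> y (\<mu> x u))"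
    by (simp add: courant_pair_def deformed_def with_triplet_def a_minus_mult_update)
  show ?thesis
  proof (cases "?b\<mu> \<and> ?bb")
    case True
    then show ?thesis
      unfolding l assoc lei
      by (simp only: der act) (intro iffI conjI; elim conjE; assumption)
  next
    case False
    then have "\<not> ?l" unfolding l lei by blast
    then show ?thesis using False by blast
  qed
qed

lemma courant_hom_aug:
  "courant_hom K (deformed_restr K P R (m, \<mu>, b)) P A.T0 L.T0 \<longleftrightarrow>
     (\<forall>u\<in>carrier EA. \<forall>v\<in>carrier EA. A.T0 (m u v) = A.T0 u \<otimes>\<^bsub>A\<^esub> A.T0 v) \<and>
     (\<forall>x\<in>carrier EL. \<forall>y\<in>carrier EL. L.T0 (b x y) = L.T0 x \<otimes>\<^bsub>L\<^esub> L.T0 y) \<and>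
     (\<forall>x\<in>carrier EL. \<forall>u\<in>carrier EA. A.T0 (\<mu> x u) = act P (L.T0 x) (A.T0 u))"
proof -
  have c: "carrier (tensor_prod K R A) = carrier EA" "carrier (tensor_prod K R L) = carrier EL"
    "(\<oplus>\<^bsub>tensor_prod K R A\<^esub>) = (\<oplus>\<^bsub>EA\<^esub>)" "(\<oplus>\<^bsub>tensor_prod K R L\<^esub>) = (\<oplus>\<^bsub>EL\<^esub>)"
    by (simp_all add: A.E.ext_scal_sel A.E.tensor_prod_sel L.E.ext_scal_sel L.E.tensor_prod_sel)
  have "A.T0 \<in> lin_maps K (tensor_prod K R A) A" "L.T0 \<in> lin_maps K (tensor_prod K R L) L"
    by (intro lin_mapsI; simp add: c A.T_add L.T_add A.T0_smult0 L.T0_smult0)+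
  then show ?thesis
    by (simp add: courant_hom_def deformed_restr_def with_triplet_def c)
qed

lemma inf_triple_iff:
  "inf_triple K R \<epsilon> d r \<theta> P m \<mu> b \<longleftrightarrow>
     m \<in> bilin_maps R EA EA EA \<and> \<mu> \<in> bilin_maps R EL EA EA \<and> b \<in> bilin_maps R EL EL EL \<and>
     (\<forall>u\<in>carrier EA. \<forall>v\<in>carrier EA. A.T0 (m u v) = A.T0 u \<otimes>\<^bsub>A\<^esub> A.T0 v) \<and>
     (\<forall>x\<in>carrier EL. \<forall>y\<in>carrier EL. L.T0 (b x y) = L.T0 x \<otimes>\<^bsub>L\<^esub> L.T0 y) \<and>
     (\<forall>x\<in>carrier EL. \<forall>u\<in>carrier EA. A.T0 (\<mu> x u) = act P (L.T0 x) (A.T0 u))"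
  by (auto simp: inf_triple_def inf_op_def inf_op_axioms_def inf_courant_axioms inf_base_axioms
      A.inf_mod_axioms L.inf_mod_axioms mult_bilin act_bilin bracket_bilin)

text \<open>The four laws of a Courant pair over \<open>R\<close> turn into the four components of the cocycle equation in every
  coordinate.\<close>

lemma deformation_iff:
  "deformation K P R \<epsilon> (m, \<mu>, b) \<longleftrightarrow> deformation_base K R \<epsilon> \<and> inf_triple K R \<epsilon> d r \<theta> P m \<mu> b \<and>
     (\<forall>i<d. triplet_cocycle P (inf_triple.components K R \<theta> P m \<mu> b i))"
proof (cases "inf_triple K R \<epsilon> d r \<theta> P m \<mu> b")
  case True
  then interpret X: inf_triple K R \<epsilon> d r \<theta> P m \<mu> b .
  have "courant_pair R (deformed K P R (m, \<mu>, b)) \<longleftrightarrow> (\<forall>i<d. triplet_cocycle P (X.components i))"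
    unfolding courant_pair_deformed X.assoc_iff X.derivation_iff X.action_iff X.leibniz_iff
    using X.M.m X.U.m X.B.m by (auto simp: triplet_cocycle_def X.components_def)
  moreover have "courant_hom K (deformed_restr K P R (m, \<mu>, b)) P A.T0 L.T0"
    using True unfolding inf_triple_iff courant_hom_aug by blast
  ultimately show ?thesis using True by (simp add: deformation_def)
next
  case False
  then show ?thesis
    unfolding deformation_def courant_hom_aug courant_pair_deformed inf_triple_iff by blast
qed

lemma courant_hom_deformed:
  "courant_hom R (deformed K P R (m, \<mu>, b)) (deformed K P R (m', \<mu>', b')) f g \<longleftrightarrow>
      f \<in> lin_maps R EA EA \<and> g \<in> lin_maps R EL EL \<and>
      (\<forall>u\<in>carrier EA. \<forall>v\<in>carrier EA. f (m u v) = m' (f u) (f v)) \<and>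
      (\<forall>x\<in>carrier EL. \<forall>y\<in>carrier EL. g (b x y) = b' (g x) (g y)) \<and>
      (\<forall>x\<in>carrier EL. \<forall>u\<in>carrier EA. f (\<mu> x u) = \<mu>' (g x) (f u))"
  by (simp add: courant_hom_def deformed_def with_triplet_def)

text \<open>The isomorphism shifts by the 1-cochains \<open>(F\<^sub>i, \<psi>\<^sub>i)\<close>. In the coordinate \<open>i\<close> the homomorphism property
  is the equation between the components and the coboundary, up to terms with \<open>T i\<close> that
  agree on both sides. Only bilinear lifts are assumed, so that the lemma applies in
  \<open>deformation_transport\<close>, where the laws on one side are still to be derived.\<close>

lemma cohomologous_isomorphic:
  assumes X: "inf_triple K R \<epsilon> d r \<theta> P m \<mu> b" and Y: "inf_triple K R \<epsilon> d r \<theta> P m' \<mu>' b'"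
    and coh: "\<forall>i<d. cohomologous K P (inf_triple.components K R \<theta> P m \<mu> b i)
                        (inf_triple.components K R \<theta> P m' \<mu>' b' i)"
  shows "\<exists>f g. courant_hom R (deformed K P R (m, \<mu>, b)) (deformed K P R (m', \<mu>', b')) f g \<and>
      bij_betw f (carrier EA) (carrier EA) \<and> bij_betw g (carrier EL) (carrier EL) \<and>
      (\<forall>u\<in>carrier EA. A.T0 (f u) = A.T0 u) \<and> (\<forall>w\<in>carrier EL. L.T0 (g w) = L.T0 w)"
proof -
  interpret X: inf_triple K R \<epsilon> d r \<theta> P m \<mu> b by fact
  interpret Y: inf_triple K R \<epsilon> d r \<theta> P m' \<mu>' b' by fact
  define good where "good i F \<psi> \<longleftrightarrow> F \<in> lin_maps K A A \<and> \<psi> \<in> lin_maps K L L \<and>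
    (\<forall>a\<in>carrier A. \<forall>c\<in>carrier A. X.M.comp i a c \<oplus>\<^bsub>A\<^esub> F (a \<otimes>\<^bsub>A\<^esub> c)
        = (a \<otimes>\<^bsub>A\<^esub> F c \<oplus>\<^bsub>A\<^esub> F a \<otimes>\<^bsub>A\<^esub> c) \<oplus>\<^bsub>A\<^esub> Y.M.comp i a c) \<and>
    (\<forall>x\<in>carrier L. \<forall>a\<in>carrier A. X.U.comp i x a \<oplus>\<^bsub>A\<^esub> F (act P x a)
        = (act P x (F a) \<oplus>\<^bsub>A\<^esub> act P (\<psi> x) a) \<oplus>\<^bsub>A\<^esub> Y.U.comp i x a) \<and>
    (\<forall>x\<in>carrier L. \<forall>y\<in>carrier L. X.B.comp i x y \<oplus>\<^bsub>L\<^esub> \<psi> (x \<otimes>\<^bsub>L\<^esub> y)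
        = (x \<otimes>\<^bsub>L\<^esub> \<psi> y \<oplus>\<^bsub>L\<^esub> \<psi> x \<otimes>\<^bsub>L\<^esub> y) \<oplus>\<^bsub>L\<^esub> Y.B.comp i x y)" for i F \<psi>
  have "\<exists>F \<psi>. good i F \<psi>" if "i < d" for i
    using coh[rule_format, OF that]
    unfolding cohomologous_def X.components_def Y.components_def good_def by auto
  then obtain F \<psi> where good: "\<And>i. i < d \<Longrightarrow> good i (F i) (\<psi> i)" by metis
  have F: "\<And>i. i < d \<Longrightarrow> F i \<in> lin_maps K A A" and \<psi>: "\<And>i. i < d \<Longrightarrow> \<psi> i \<in> lin_maps K L L"
    using good by (auto simp: good_def)
  have eq1: "X.M.comp i a c \<oplus>\<^bsub>A\<^esub> F i (a \<otimes>\<^bsub>A\<^esub> c)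
        = (a \<otimes>\<^bsub>A\<^esub> F i c \<oplus>\<^bsub>A\<^esub> F i a \<otimes>\<^bsub>A\<^esub> c) \<oplus>\<^bsub>A\<^esub> Y.M.comp i a c"
    if "i < d" "a \<in> carrier A" "c \<in> carrier A" for i a c
    using good[OF that(1)] that(2,3) by (simp add: good_def)
  have eq2: "X.U.comp i x a \<oplus>\<^bsub>A\<^esub> F i (act P x a)
        = (act P x (F i a) \<oplus>\<^bsub>A\<^esub> act P (\<psi> i x) a) \<oplus>\<^bsub>A\<^esub> Y.U.comp i x a"
    if "i < d" "x \<in> carrier L" "a \<in> carrier A" for i x a
    using good[OF that(1)] that(2,3) by (simp add: good_def)
  have eq3: "X.B.comp i x y \<oplus>\<^bsub>L\<^esub> \<psi> i (x \<otimes>\<^bsub>L\<^esub> y)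
        = (x \<otimes>\<^bsub>L\<^esub> \<psi> i y \<oplus>\<^bsub>L\<^esub> \<psi> i x \<otimes>\<^bsub>L\<^esub> y) \<oplus>\<^bsub>L\<^esub> Y.B.comp i x y"
    if "i < d" "x \<in> carrier L" "y \<in> carrier L" for i x y
    using good[OF that(1)] that(2,3) by (simp add: good_def)
  define f where "f = A.shift F"
  define g where "g = L.shift \<psi>"
  note fs = A.shift_closed[where F = F, OF F, folded f_def] A.T_shift[where F = F, OF F, folded f_def]
  note gs = L.shift_closed[where F = \<psi>, OF \<psi>, folded g_def] L.T_shift[where F = \<psi>, OF \<psi>, folded g_def]
  note s = X.T_op Y.T_op X.T0_op Y.T0_op X.closed Y.closed lin_mapsD(1)[OF F] lin_mapsD(1)[OF \<psi>] fs gs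
  have 1: "f (m u v) = m' (f u) (f v)" if "u \<in> carrier EA" "v \<in> carrier EA" for u v
  proof (rule A.coord_eqI)
    fix i assume i: "i < d"
    let ?z = "A.T0 u \<otimes>\<^bsub>A\<^esub> A.T i v \<oplus>\<^bsub>A\<^esub> A.T i u \<otimes>\<^bsub>A\<^esub> A.T0 v"
    have "A.T i (f (m u v)) = ?z \<oplus>\<^bsub>A\<^esub> (X.M.comp i (A.T0 u) (A.T0 v) \<oplus>\<^bsub>A\<^esub> F i (A.T0 u \<otimes>\<^bsub>A\<^esub> A.T0 v))"
      using that i by (simp add: s A.M.a_ac)
    also have "\<dots> = A.T i (m' (f u) (f v))"
      using that i by (subst eq1) (simp_all add: s multD(2,3) A.M.a_ac)
    finally show "A.T i (f (m u v)) = A.T i (m' (f u) (f v))" .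
  qed (use that in \<open>simp_all add: s\<close>)
  have 2: "f (\<mu> x u) = \<mu>' (g x) (f u)" if "x \<in> carrier EL" "u \<in> carrier EA" for x u
  proof (rule A.coord_eqI)
    fix i assume i: "i < d"
    let ?z = "act P (L.T0 x) (A.T i u) \<oplus>\<^bsub>A\<^esub> act P (L.T i x) (A.T0 u)"
    have "A.T i (f (\<mu> x u)) = ?z \<oplus>\<^bsub>A\<^esub> (X.U.comp i (L.T0 x) (A.T0 u) \<oplus>\<^bsub>A\<^esub> F i (act P (L.T0 x) (A.T0 u)))"
      using that i by (simp add: s A.M.a_ac)
    also have "\<dots> = A.T i (\<mu>' (g x) (f u))"
      using that i by (subst eq2) (simp_all add: s actD(2,3) A.M.a_ac)
    finally show "A.T i (f (\<mu> x u)) = A.T i (\<mu>' (g x) (f u))" .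
  qed (use that in \<open>simp_all add: s\<close>)
  have 3: "g (b x y) = b' (g x) (g y)" if "x \<in> carrier EL" "y \<in> carrier EL" for x y
  proof (rule L.coord_eqI)
    fix i assume i: "i < d"
    let ?z = "L.T0 x \<otimes>\<^bsub>L\<^esub> L.T i y \<oplus>\<^bsub>L\<^esub> L.T i x \<otimes>\<^bsub>L\<^esub> L.T0 y"
    have "L.T i (g (b x y)) = ?z \<oplus>\<^bsub>L\<^esub> (X.B.comp i (L.T0 x) (L.T0 y) \<oplus>\<^bsub>L\<^esub> \<psi> i (L.T0 x \<otimes>\<^bsub>L\<^esub> L.T0 y))"
      using that i by (simp add: s L.M.a_ac)
    also have "\<dots> = L.T i (b' (g x) (g y))"
      using that i by (subst eq3) (simp_all add: s bracketD(2,3) L.M.a_ac)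
    finally show "L.T i (g (b x y)) = L.T i (b' (g x) (g y))" .
  qed (use that in \<open>simp_all add: s\<close>)
  show ?thesis
    unfolding courant_hom_deformed
    using A.shift_linear[where F = F, OF F] L.shift_linear[where F = \<psi>, OF \<psi>]
      A.shift_bij[where F = F, OF F] L.shift_bij[where F = \<psi>, OF \<psi>] 1 2 3 fs gs
    by (intro exI[of _ f] exI[of _ g] conjI) (auto simp: f_def g_def)
qed

text \<open>The laws hold for \<open>(m', \<mu>', b')\<close> and are transported along the bijections of
  \<open>cohomologous_isomorphic\<close>. In this way a push-out is recognised as a deformation by its classes.\<close>

lemma deformation_transport:
  assumes X: "inf_triple K R \<epsilon> d r \<theta> P m \<mu> b" and Y: "deformation K P R \<epsilon> (m', \<mu>', b')"
    and coh: "\<forall>i<d. cohomologous K P (inf_triple.components K R \<theta> P m \<mu> b i)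
                        (inf_triple.components K R \<theta> P m' \<mu>' b' i)"
  shows "deformation K P R \<epsilon> (m, \<mu>, b)"
proof -
  interpret X: inf_triple K R \<epsilon> d r \<theta> P m \<mu> b by fact
  have Y': "inf_triple K R \<epsilon> d r \<theta> P m' \<mu>' b'" "deformation_base K R \<epsilon>" using Y by (simp_all add: deformation_iff)
  obtain f g where H: "courant_hom R (deformed K P R (m, \<mu>, b)) (deformed K P R (m', \<mu>', b')) f g"
    and fb: "bij_betw f (carrier EA) (carrier EA)" and gb: "bij_betw g (carrier EL) (carrier EL)"
    using cohomologous_isomorphic[OF X Y'(1) coh] by blast
  note H = H[unfolded courant_hom_deformed]
  have f: "f \<in> lin_maps R EA EA" and g: "g \<in> lin_maps R EL EL" using H by blast+
  have h: "\<And>u v. u \<in> carrier EA \<Longrightarrow> v \<in> carrier EA \<Longrightarrow> f (m u v) = m' (f u) (f v)"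
    "\<And>x y. x \<in> carrier EL \<Longrightarrow> y \<in> carrier EL \<Longrightarrow> g (b x y) = b' (g x) (g y)"
    "\<And>x u. x \<in> carrier EL \<Longrightarrow> u \<in> carrier EA \<Longrightarrow> f (\<mu> x u) = \<mu>' (g x) (f u)"
    using H by blast+
  have "courant_pair R (deformed K P R (m', \<mu>', b'))" using Y by (simp add: deformation_def)
  note Yl = this[unfolded courant_pair_deformed]
  note cl = X.M.mD(1) X.U.mD(1) X.B.mD(1) lin_mapsD(1)[OF f] lin_mapsD(1)[OF g] A.E.E.a_closed L.E.E.a_closed
  note s = h cl lin_mapsD(2)[OF f] lin_mapsD(2)[OF g]
  have finj: "u = v" if "f u = f v" "u \<in> carrier EA" "v \<in> carrier EA" for u v
    using fb that by (auto simp: bij_betw_def inj_on_def)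
  have ginj: "u = v" if "g u = g v" "u \<in> carrier EL" "v \<in> carrier EL" for u v
    using gb that by (auto simp: bij_betw_def inj_on_def)
  have l1: "m (m u v) w = m u (m v w)" if "u \<in> carrier EA" "v \<in> carrier EA" "w \<in> carrier EA" for u v w
  proof (rule finj)
    have "m' (m' (f u) (f v)) (f w) = m' (f u) (m' (f v) (f w))" using Yl that cl(4) by blast
    then show "f (m (m u v) w) = f (m u (m v w))" using that by (simp add: s)
  qed (use that in \<open>simp_all add: cl\<close>)
  have l2: "\<mu> x (m u v) = m (\<mu> x u) v \<oplus>\<^bsub>EA\<^esub> m u (\<mu> x v)"
    if "x \<in> carrier EL" "u \<in> carrier EA" "v \<in> carrier EA" for x u v
  proof (rule finj)
    have "\<mu>' (g x) (m' (f u) (f v)) = m' (\<mu>' (g x) (f u)) (f v) \<oplus>\<^bsub>EA\<^esub> m' (f u) (\<mu>' (g x) (f v))"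
      using Yl that cl(4,5) by blast
    then show "f (\<mu> x (m u v)) = f (m (\<mu> x u) v \<oplus>\<^bsub>EA\<^esub> m u (\<mu> x v))" using that by (simp add: s)
  qed (use that in \<open>simp_all add: cl\<close>)
  have l3: "\<mu> (b x y) u \<oplus>\<^bsub>EA\<^esub> \<mu> y (\<mu> x u) = \<mu> x (\<mu> y u)"
    if "x \<in> carrier EL" "y \<in> carrier EL" "u \<in> carrier EA" for x y u
  proof (rule finj)
    have "\<mu>' (b' (g x) (g y)) (f u) \<oplus>\<^bsub>EA\<^esub> \<mu>' (g y) (\<mu>' (g x) (f u)) = \<mu>' (g x) (\<mu>' (g y) (f u))"
      using Yl that cl(4,5) by blast
    then show "f (\<mu> (b x y) u \<oplus>\<^bsub>EA\<^esub> \<mu> y (\<mu> x u)) = f (\<mu> x (\<mu> y u))" using that by (simp add: s)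
  qed (use that in \<open>simp_all add: cl\<close>)
  have l4: "b x (b y w) = b (b x y) w \<oplus>\<^bsub>EL\<^esub> b y (b x w)"
    if "x \<in> carrier EL" "y \<in> carrier EL" "w \<in> carrier EL" for x y w
  proof (rule ginj)
    have "b' (g x) (b' (g y) (g w)) = b' (b' (g x) (g y)) (g w) \<oplus>\<^bsub>EL\<^esub> b' (g y) (b' (g x) (g w))"
      using Yl that cl(5) by blast
    then show "g (b x (b y w)) = g (b (b x y) w \<oplus>\<^bsub>EL\<^esub> b y (b x w))" using that by (simp add: s)
  qed (use that in \<open>simp_all add: cl\<close>)
  have "courant_pair R (deformed K P R (m, \<mu>, b))"
    unfolding courant_pair_deformed by (intro conjI ballI X.M.m X.U.m X.B.m l1 l2 l3 l4)
  moreover have "courant_hom K (deformed_restr K P R (m, \<mu>, b)) P A.T0 L.T0"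
    using X unfolding inf_triple_iff courant_hom_aug by blast
  ultimately show ?thesis using Y'(2) by (simp add: deformation_def)
qed

text \<open>Conversely to \<open>cohomologous_isomorphic\<close>, an isomorphism over the identities of \<open>A\<close> and \<open>L\<close> is a pair of
  shifts by \<open>lifted_identity\<close>; comparing coordinates on elements \<open>1 \<otimes> a\<close> and \<open>1 \<otimes> x\<close> gives the coboundary
  equations.\<close>

lemma equivalent_iff:
  assumes X: "deformation K P R \<epsilon> (m, \<mu>, b)" and Y: "deformation K P R \<epsilon> (m', \<mu>', b')"
  shows "equivalent_deformations K P R \<epsilon> (m, \<mu>, b) (m', \<mu>', b') \<longleftrightarrow>
     (\<forall>i<d. cohomologous K P (inf_triple.components K R \<theta> P m \<mu> b i)
              (inf_triple.components K R \<theta> P m' \<mu>' b' i))"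
proof -
  interpret X: inf_triple K R \<epsilon> d r \<theta> P m \<mu> b using X by (simp add: deformation_iff)
  interpret Y: inf_triple K R \<epsilon> d r \<theta> P m' \<mu>' b' using Y by (simp add: deformation_iff)
  show ?thesis
  proof
    assume "equivalent_deformations K P R \<epsilon> (m, \<mu>, b) (m', \<mu>', b')"
    then obtain f g where H: "courant_hom R (deformed K P R (m, \<mu>, b)) (deformed K P R (m', \<mu>', b')) f g"
      and f0: "\<And>u. u \<in> carrier EA \<Longrightarrow> A.T0 (f u) = A.T0 u"
      and g0: "\<And>x. x \<in> carrier EL \<Longrightarrow> L.T0 (g x) = L.T0 x"
      unfolding equivalent_deformations_def by blast
    note H = H[unfolded courant_hom_deformed]
    have f: "f \<in> lin_maps R EA EA" and g: "g \<in> lin_maps R EL EL" using H by blast+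
    have fm: "f (m u v) = m' (f u) (f v)" if "u \<in> carrier EA" "v \<in> carrier EA" for u v
      using H that by blast
    have gb: "g (b x y) = b' (g x) (g y)" if "x \<in> carrier EL" "y \<in> carrier EL" for x y
      using H that by blast
    have f\<mu>: "f (\<mu> x u) = \<mu>' (g x) (f u)" if "x \<in> carrier EL" "u \<in> carrier EA" for x u
      using H that by blast
    show "\<forall>i<d. cohomologous K P (X.components i) (Y.components i)"
    proof (intro allI impI)
      fix i assume i: "i < d"
      define F where "F = (\<lambda>a. A.T i (f (A.incl a)))"
      define \<psi> where "\<psi> = (\<lambda>x. L.T i (g (L.incl x)))"
      have F: "F \<in> lin_maps K A A" and \<psi>: "\<psi> \<in> lin_maps K L L"
        unfolding F_def \<psi>_def using A.lifted_identity(1)[OF f f0 i] L.lifted_identity(1)[OF g g0 i] by auto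
      have Tf: "A.T i (f u) = A.T i u \<oplus>\<^bsub>A\<^esub> F (A.T0 u)" if "u \<in> carrier EA" for u
        unfolding F_def by (rule A.lifted_identity(2)[OF f f0 i that])
      have Tg: "L.T i (g x) = L.T i x \<oplus>\<^bsub>L\<^esub> \<psi> (L.T0 x)" if "x \<in> carrier EL" for x
        unfolding \<psi>_def by (rule L.lifted_identity(2)[OF g g0 i that])
      note s = X.T_op Y.T_op X.T0_op Y.T0_op X.closed Y.closed lin_mapsD[OF F] lin_mapsD[OF \<psi>]
        lin_mapsD[OF f] lin_mapsD[OF g] f0 g0 zero_op
      have 1: "X.M.comp i a c \<oplus>\<^bsub>A\<^esub> F (a \<otimes>\<^bsub>A\<^esub> c)
          = (a \<otimes>\<^bsub>A\<^esub> F c \<oplus>\<^bsub>A\<^esub> F a \<otimes>\<^bsub>A\<^esub> c) \<oplus>\<^bsub>A\<^esub> Y.M.comp i a c"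
        if "a \<in> carrier A" "c \<in> carrier A" for a c
        using arg_cong[OF fm[of "A.incl a" "A.incl c"], of "A.T i"] that i
        by (simp add: s Tf multD(2,3))
      have 2: "X.U.comp i x a \<oplus>\<^bsub>A\<^esub> F (act P x a)
          = (act P x (F a) \<oplus>\<^bsub>A\<^esub> act P (\<psi> x) a) \<oplus>\<^bsub>A\<^esub> Y.U.comp i x a"
        if "x \<in> carrier L" "a \<in> carrier A" for x a
        using arg_cong[OF f\<mu>[of "L.incl x" "A.incl a"], of "A.T i"] that i
        by (simp add: s Tf Tg actD(2,3))
      have 3: "X.B.comp i x y \<oplus>\<^bsub>L\<^esub> \<psi> (x \<otimes>\<^bsub>L\<^esub> y)
          = (x \<otimes>\<^bsub>L\<^esub> \<psi> y \<oplus>\<^bsub>L\<^esub> \<psi> x \<otimes>\<^bsub>L\<^esub> y) \<oplus>\<^bsub>L\<^esub> Y.B.comp i x y"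
        if "x \<in> carrier L" "y \<in> carrier L" for x y
        using arg_cong[OF gb[of "L.incl x" "L.incl y"], of "L.T i"] that i
        by (simp add: s Tg bracketD(2,3))
      show "cohomologous K P (X.components i) (Y.components i)"
        unfolding cohomologous_def X.components_def Y.components_def prod.case
        by (intro bexI[of _ F] bexI[of _ \<psi>] conjI ballI 1 2 3 F \<psi>)
    qed
  next
    assume coh: "\<forall>i<d. cohomologous K P (X.components i) (Y.components i)"
    show "equivalent_deformations K P R \<epsilon> (m, \<mu>, b) (m', \<mu>', b')"
      unfolding equivalent_deformations_def
      using X Y cohomologous_isomorphic[OF X.inf_triple_axioms Y.inf_triple_axioms coh] by blast
  qed
qed

end

section \<open>Cochains and cohomology in degree two\<close>

lemma multilin_sel [simp]:
  "f \<oplus>\<^bsub>multilin K V W n\<^esub> g = (\<lambda>vs. f vs \<oplus>\<^bsub>W\<^esub> g vs)" "\<zero>\<^bsub>multilin K V W n\<^esub> = (\<lambda>_. \<zero>\<^bsub>W\<^esub>)"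
  "k \<odot>\<^bsub>multilin K V W n\<^esub> f = (\<lambda>vs. k \<odot>\<^bsub>W\<^esub> f vs)"
  by (simp_all add: multilin_def)

lemma multilin_carrier:
  "f \<in> carrier (multilin K V W n) \<longleftrightarrow> f \<in> tuples V n \<rightarrow> carrier W \<and>
     (\<forall>vs\<in>tuples V n. \<forall>i<n. (\<lambda>v. f (vs[i := v])) \<in> lin_maps K V W) \<and>
     (\<forall>vs. vs \<notin> tuples V n \<longrightarrow> f vs = \<zero>\<^bsub>W\<^esub>)"
  by (simp add: multilin_def)

lemma tuples_conv:
  "vs \<in> tuples V 0 \<longleftrightarrow> vs = []"
  "vs \<in> tuples V (Suc n) \<longleftrightarrow> (\<exists>a as. vs = a # as \<and> a \<in> carrier V \<and> as \<in> tuples V n)"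
  by (cases vs; auto simp: tuples_def)+

lemmas tuples_1 = tuples_conv(2)[of _ _ 0, unfolded tuples_conv(1), simplified]
lemmas tuples_2 = tuples_conv(2)[of _ _ "Suc 0", unfolded tuples_1, folded numeral_2_eq_2, simplified]
lemmas tuples_3 = tuples_conv(2)[of _ _ 2, unfolded tuples_2, simplified]

lemma multilin_0:
  "f \<in> carrier (multilin K V W 0) \<longleftrightarrow> f [] \<in> carrier W \<and> (\<forall>vs. vs \<noteq> [] \<longrightarrow> f vs = \<zero>\<^bsub>W\<^esub>)"
  by (auto simp: multilin_carrier tuples_conv(1))

lemma multilin_1:
  "f \<in> carrier (multilin K V W (Suc 0)) \<longleftrightarrow> (\<lambda>v. f [v]) \<in> lin_maps K V W \<and>
     (\<forall>vs. vs \<notin> tuples V (Suc 0) \<longrightarrow> f vs = \<zero>\<^bsub>W\<^esub>)"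
proof -
  have "f \<in> tuples V (Suc 0) \<rightarrow> carrier W" if "(\<lambda>v. f [v]) \<in> lin_maps K V W"
    using lin_mapsD(1)[OF that] by (auto simp: tuples_1)
  moreover have "(\<lambda>v. f [v]) \<in> lin_maps K V W" if "f \<in> tuples V (Suc 0) \<rightarrow> carrier W"
    "\<forall>vs\<in>tuples V (Suc 0). (\<lambda>v. f (vs[0 := v])) \<in> lin_maps K V W"
  proof (cases "carrier V = {}")
    case True
    then show ?thesis by (auto simp: lin_maps_def)
  next
    case False
    then obtain a where "[a] \<in> tuples V (Suc 0)" by (auto simp: tuples_1)
    from that(2)[rule_format, OF this] show ?thesis by simp
  qed
  ultimately show ?thesis by (auto simp: multilin_carrier tuples_1)
qed

lemma multilin_2:
  "f \<in> carrier (multilin K V W 2) \<longleftrightarrow> (\<lambda>a b. f [a, b]) \<in> bilin_maps K V V W \<and>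
     (\<forall>vs. vs \<notin> tuples V 2 \<longrightarrow> f vs = \<zero>\<^bsub>W\<^esub>)"
proof -
  have "f \<in> tuples V 2 \<rightarrow> carrier W" if "(\<lambda>a b. f [a, b]) \<in> bilin_maps K V V W"
    using bilin_mapsD(1)[OF that] by (auto simp: tuples_2)
  moreover have "(\<forall>vs\<in>tuples V 2. \<forall>i<2. (\<lambda>v. f (vs[i := v])) \<in> lin_maps K V W)
      \<longleftrightarrow> (\<lambda>a b. f [a, b]) \<in> bilin_maps K V V W" (is "?l = ?r")
  proof
    assume l: ?l
    have "(\<lambda>v. f [a, v]) \<in> lin_maps K V W" if "a \<in> carrier V" for a
      using l[rule_format, of "[a, a]" 1] that by (simp add: tuples_2)
    moreover have "(\<lambda>v. f [v, a]) \<in> lin_maps K V W" if "a \<in> carrier V" for a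
      using l[rule_format, of "[a, a]" 0] that by (simp add: tuples_2)
    ultimately show ?r by (simp add: bilin_maps_def)
  next
    assume ?r
    then show ?l by (auto simp: tuples_2 less_2_cases_iff bilin_maps_def)
  qed
  ultimately show ?thesis by (auto simp: multilin_carrier)
qed

lemma multilin_value:
  assumes "module K W" "f \<in> carrier (multilin K V W n)"
  shows "f vs \<in> carrier W"
proof -
  interpret W: module K W by fact
  show ?thesis using assms(2) by (cases "vs \<in> tuples V n") (auto simp: multilin_carrier)
qed

lemma module_multilin:
  assumes V: "module K V" and W: "module K W"
  shows "module K (multilin K V W n)"
proof -
  interpret W: module K W by fact
  note val = multilin_value[OF W]
  have add: "(\<lambda>vs. f vs \<oplus>\<^bsub>W\<^esub> g vs) \<in> carrier (multilin K V W n)"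
    if "f \<in> carrier (multilin K V W n)" "g \<in> carrier (multilin K V W n)" for f g
    using that
    by (auto simp: multilin_carrier lin_maps_def W.M.a_ac W.smult_r_distr Pi_iff)
  have smult: "(\<lambda>vs. k \<odot>\<^bsub>W\<^esub> f vs) \<in> carrier (multilin K V W n)"
    if "f \<in> carrier (multilin K V W n)" "k \<in> carrier K" for f k
    using that
    by (auto simp: multilin_carrier lin_maps_def W.smult_r_distr Pi_iff intro: W.smult_left_commute)
  show ?thesis
  proof (rule moduleI)
    show "cring K" by (rule W.R.is_cring)
    show "abelian_group (multilin K V W n)"
    proof (rule abelian_groupI)
      show "\<zero>\<^bsub>multilin K V W n\<^esub> \<in> carrier (multilin K V W n)"
        by (auto simp: multilin_carrier lin_maps_def)
      fix f assume f: "f \<in> carrier (multilin K V W n)"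
      have "(\<lambda>vs. (\<ominus>\<^bsub>K\<^esub> \<one>\<^bsub>K\<^esub>) \<odot>\<^bsub>W\<^esub> f vs) \<in> carrier (multilin K V W n)" by (rule smult[OF f]) simp
      moreover have "(\<lambda>vs. (\<ominus>\<^bsub>K\<^esub> \<one>\<^bsub>K\<^esub>) \<odot>\<^bsub>W\<^esub> f vs) \<oplus>\<^bsub>multilin K V W n\<^esub> f = \<zero>\<^bsub>multilin K V W n\<^esub>"
        using val[OF f] by (simp add: W.smult_l_minus W.M.l_neg)
      ultimately show "\<exists>g\<in>carrier (multilin K V W n). g \<oplus>\<^bsub>multilin K V W n\<^esub> f = \<zero>\<^bsub>multilin K V W n\<^esub>" by blast
    qed (auto simp: add val W.M.a_ac)
  qed (auto simp: add smult val W.smult_l_distr W.smult_r_distr W.smult_assoc1)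
qed

lemma tot_cochains_sel [simp]:
  "c \<oplus>\<^bsub>tot_cochains K P n\<^esub> c' = (\<lambda>xs. fst c xs \<oplus>\<^bsub>lei P\<^esub> fst c' xs,
     \<lambda>p xs as. snd c p xs as \<oplus>\<^bsub>alg P\<^esub> snd c' p xs as)"
  "\<zero>\<^bsub>tot_cochains K P n\<^esub> = (\<lambda>_. \<zero>\<^bsub>lei P\<^esub>, \<lambda>_ _ _. \<zero>\<^bsub>alg P\<^esub>)"
  "k \<odot>\<^bsub>tot_cochains K P n\<^esub> c = (\<lambda>xs. k \<odot>\<^bsub>lei P\<^esub> fst c xs, \<lambda>p xs as. k \<odot>\<^bsub>alg P\<^esub> snd c p xs as)"
  by (simp_all add: tot_cochains_def case_prod_beta)

context courant
begin

lemma module_cochains0: "module K (cochains0 K P q)"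
  unfolding cochains0_def by (rule module_multilin[OF L.module_axioms L.module_axioms])

lemma module_cochains: "module K (cochains K P p q)"
  unfolding cochains_def
  by (rule module_multilin[OF L.module_axioms module_multilin[OF A.module_axioms A.module_axioms]])

lemma tot_cochains_carrier:
  "c \<in> carrier (tot_cochains K P n) \<longleftrightarrow> fst c \<in> carrier (cochains0 K P n) \<and>
     (\<forall>p\<in>{1..n}. snd c p \<in> carrier (cochains K P p (n - p))) \<and>
     (\<forall>p. p \<notin> {1..n} \<longrightarrow> snd c p = (\<lambda>_ _. \<zero>\<^bsub>A\<^esub>))"
  by (cases c) (auto simp: tot_cochains_def)

lemma tot_value:
  assumes c: "c \<in> carrier (tot_cochains K P n)"
  shows "fst c xs \<in> carrier L" "snd c p xs as \<in> carrier A"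
proof -
  have "fst c \<in> carrier (cochains0 K P n)" using c by (simp add: tot_cochains_carrier)
  then show "fst c xs \<in> carrier L"
    unfolding cochains0_def by (rule multilin_value[OF L.module_axioms])
  show "snd c p xs as \<in> carrier A"
  proof (cases "p \<in> {1..n}")
    case True
    then have "snd c p \<in> carrier (cochains K P p (n - p))" using c by (simp add: tot_cochains_carrier)
    then have "snd c p xs \<in> carrier (multilin K A A p)"
      unfolding cochains_def by (rule multilin_value[OF module_multilin[OF A.module_axioms A.module_axioms]])
    then show ?thesis by (rule multilin_value[OF A.module_axioms])
  next
    case False
    then have "snd c p = (\<lambda>_ _. \<zero>\<^bsub>A\<^esub>)" using c unfolding tot_cochains_carrier by blast
    then show ?thesis by simp
  qed
qed

lemma cochains_sel:
  "f \<oplus>\<^bsub>cochains K P p q\<^esub> g = (\<lambda>xs as. f xs as \<oplus>\<^bsub>A\<^esub> g xs as)"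
  "k \<odot>\<^bsub>cochains K P p q\<^esub> f = (\<lambda>xs as. k \<odot>\<^bsub>A\<^esub> f xs as)"
  "\<zero>\<^bsub>cochains K P p q\<^esub> = (\<lambda>xs as. \<zero>\<^bsub>A\<^esub>)"
  by (simp_all add: cochains_def)

lemma cochains0_sel:
  "f \<oplus>\<^bsub>cochains0 K P q\<^esub> g = (\<lambda>xs. f xs \<oplus>\<^bsub>L\<^esub> g xs)"
  "k \<odot>\<^bsub>cochains0 K P q\<^esub> f = (\<lambda>xs. k \<odot>\<^bsub>L\<^esub> f xs)"
  "\<zero>\<^bsub>cochains0 K P q\<^esub> = (\<lambda>xs. \<zero>\<^bsub>L\<^esub>)"
  by (simp_all add: cochains0_def)

lemma module_tot_cochains: "module K (tot_cochains K P n)"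
proof -
  let ?C = "tot_cochains K P n"
  note val = tot_value
  have add: "c \<oplus>\<^bsub>?C\<^esub> c' \<in> carrier ?C" if "c \<in> carrier ?C" "c' \<in> carrier ?C" for c c'
  proof -
    interpret C0: module K "cochains0 K P n" by (rule module_cochains0)
    have "(\<lambda>xs as. snd c p xs as \<oplus>\<^bsub>A\<^esub> snd c' p xs as) \<in> carrier (cochains K P p (n - p))"
      if "p \<in> {1..n}" for p
    proof -
      interpret C: module K "cochains K P p (n - p)" by (rule module_cochains)
      show ?thesis
        using \<open>c \<in> carrier ?C\<close> \<open>c' \<in> carrier ?C\<close> that C.M.a_closed[of "snd c p" "snd c' p"]
        unfolding tot_cochains_carrier cochains_sel by blast
    qed
    then show ?thesis
      using that C0.M.a_closed[of "fst c" "fst c'"] unfolding tot_cochains_carrier cochains0_sel by auto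
  qed
  have smult: "k \<odot>\<^bsub>?C\<^esub> c \<in> carrier ?C" if "k \<in> carrier K" "c \<in> carrier ?C" for k c
  proof -
    interpret C0: module K "cochains0 K P n" by (rule module_cochains0)
    have "(\<lambda>xs as. k \<odot>\<^bsub>A\<^esub> snd c p xs as) \<in> carrier (cochains K P p (n - p))"
      if "p \<in> {1..n}" for p
    proof -
      interpret C: module K "cochains K P p (n - p)" by (rule module_cochains)
      show ?thesis
        using \<open>c \<in> carrier ?C\<close> \<open>k \<in> carrier K\<close> that C.smult_closed[of k "snd c p"]
        unfolding tot_cochains_carrier cochains_sel by blast
    qed
    then show ?thesis
      using that C0.smult_closed[of k "fst c"] unfolding tot_cochains_carrier cochains0_sel by auto
  qed
  show ?thesis
  proof (rule moduleI)
    show "cring K" by (rule A.R.is_cring)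
    show "abelian_group ?C"
    proof (rule abelian_groupI)
      show "\<zero>\<^bsub>?C\<^esub> \<in> carrier ?C"
        using module.axioms(2)[OF module_cochains0, THEN abelian_groupE(2), unfolded cochains0_sel]
          module.axioms(2)[OF module_cochains, THEN abelian_groupE(2), unfolded cochains_sel]
        by (simp add: tot_cochains_carrier)
      fix c assume c: "c \<in> carrier ?C"
      have "(\<ominus>\<^bsub>K\<^esub> \<one>\<^bsub>K\<^esub>) \<odot>\<^bsub>?C\<^esub> c \<in> carrier ?C" by (rule smult[OF _ c]) simp
      moreover have "(\<ominus>\<^bsub>K\<^esub> \<one>\<^bsub>K\<^esub>) \<odot>\<^bsub>?C\<^esub> c \<oplus>\<^bsub>?C\<^esub> c = \<zero>\<^bsub>?C\<^esub>"
        using val[OF c] by (simp add: A.smult_l_minus L.smult_l_minus A.M.l_neg L.M.l_neg)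
      ultimately show "\<exists>c'\<in>carrier ?C. c' \<oplus>\<^bsub>?C\<^esub> c = \<zero>\<^bsub>?C\<^esub>" by blast
    next
      fix x y assume "x \<in> carrier ?C" "y \<in> carrier ?C"
      then show "x \<oplus>\<^bsub>?C\<^esub> y \<in> carrier ?C" by (rule add)
    qed (simp_all add: val A.M.a_ac L.M.a_ac)
  next
    fix k x assume "k \<in> carrier K" "x \<in> carrier ?C"
    then show "k \<odot>\<^bsub>?C\<^esub> x \<in> carrier ?C" by (rule smult)
  qed (simp_all add: val A.smult_l_distr L.smult_l_distr A.smult_r_distr L.smult_r_distr
      A.smult_assoc1 L.smult_assoc1)
qed

text \<open>A cochain is a function of argument lists that vanishes off the tuples of the right lengths, whereas
  the components of a deformation are curried and arbitrary off the carriers. The next two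
  definitions translate; \<open>cochain_of\<close> normalises the values off the carriers.\<close>

definition triplet_of :: "('a, 'l) tot_cochain \<Rightarrow> ('a, 'l) triplet" where
  "triplet_of c = (\<lambda>a b. snd c 2 [] [a, b], \<lambda>x a. snd c 1 [x] [a], \<lambda>x y. fst c [x, y])"

definition cochain_of :: "('a, 'l) triplet \<Rightarrow> ('a, 'l) tot_cochain" where
  "cochain_of t = (case t of (m, \<mu>, b) \<Rightarrow>
     (\<lambda>xs. if xs \<in> tuples L 2 then b (xs ! 0) (xs ! 1) else \<zero>\<^bsub>L\<^esub>,
      \<lambda>p xs as. if p = 2 \<and> xs = [] \<and> as \<in> tuples A 2 then m (as ! 0) (as ! 1)
        else if p = 1 \<and> xs \<in> tuples L 1 \<and> as \<in> tuples A 1 then \<mu> (xs ! 0) (as ! 0) else \<zero>\<^bsub>A\<^esub>))"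

definition bilinear_triplet :: "('a, 'l) triplet \<Rightarrow> bool" where
  "bilinear_triplet t \<longleftrightarrow> (case t of (m, \<mu>, b) \<Rightarrow>
     m \<in> bilin_maps K A A A \<and> \<mu> \<in> bilin_maps K L A A \<and> b \<in> bilin_maps K L L L)"

abbreviation "C2 \<equiv> tot_cochains K P 2"

lemma C2_iff:
  "c \<in> carrier C2 \<longleftrightarrow> fst c \<in> carrier (multilin K L L 2) \<and>
     snd c 2 \<in> carrier (multilin K L (multilin K A A 2) 0) \<and>
     snd c 1 \<in> carrier (multilin K L (multilin K A A (Suc 0)) (Suc 0)) \<and>
     (\<forall>p. p \<noteq> 1 \<longrightarrow> p \<noteq> 2 \<longrightarrow> snd c p = (\<lambda>_ _. \<zero>\<^bsub>A\<^esub>))"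
proof -
  have "{1..2::nat} = {1, 2}" by auto
  then show ?thesis
    unfolding tot_cochains_carrier by (auto simp: cochains0_def cochains_def)
qed

lemma C2_bilinear:
  assumes "c \<in> carrier C2"
  shows "bilinear_triplet (triplet_of c)"
proof -
  have c: "fst c \<in> carrier (multilin K L L 2)" "snd c 2 [] \<in> carrier (multilin K A A 2)"
    "(\<lambda>x. snd c 1 [x]) \<in> lin_maps K L (multilin K A A (Suc 0))"
    using assms unfolding C2_iff multilin_0 multilin_1 by auto
  note D = lin_mapsD[OF c(3)]
  have lin: "(\<lambda>a. snd c 1 [x] [a]) \<in> lin_maps K A A" if "x \<in> carrier L" for x
    using D(1)[OF that] unfolding multilin_1 by blast
  have "(\<lambda>x a. snd c 1 [x] [a]) \<in> bilin_maps K L A A"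
    by (rule bilin_mapsI) (use D in \<open>auto simp: lin_mapsD[OF lin, unfolded One_nat_def]\<close>)
  then show ?thesis
    using c(1,2) unfolding multilin_2 by (simp add: bilinear_triplet_def triplet_of_def)
qed

lemma C2_eqI:
  assumes c: "c \<in> carrier C2" and c': "c' \<in> carrier C2"
    and "\<And>a b. a \<in> carrier A \<Longrightarrow> b \<in> carrier A \<Longrightarrow> snd c 2 [] [a, b] = snd c' 2 [] [a, b]"
    and "\<And>x a. x \<in> carrier L \<Longrightarrow> a \<in> carrier A \<Longrightarrow> snd c 1 [x] [a] = snd c' 1 [x] [a]"
    and "\<And>x y. x \<in> carrier L \<Longrightarrow> y \<in> carrier L \<Longrightarrow> fst c [x, y] = fst c' [x, y]"
  shows "c = c'"
proof (rule prod_eqI)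
  show "fst c = fst c'"
  proof
    fix xs show "fst c xs = fst c' xs"
      using c c' assms(5) unfolding C2_iff multilin_2 tuples_2 by (cases "xs \<in> tuples L 2") (auto simp: tuples_2)
  qed
  show "snd c = snd c'"
  proof (intro ext)
    fix p :: nat and xs as
    consider "p = 2" | "p = 1" | "p \<noteq> 1" "p \<noteq> 2" by blast
    then show "snd c p xs as = snd c' p xs as"
    proof cases
      case 1
      have "snd c 2 [] \<in> carrier (multilin K A A 2)" "snd c' 2 [] \<in> carrier (multilin K A A 2)"
        "xs \<noteq> [] \<Longrightarrow> snd c 2 xs = snd c' 2 xs"
        using c c' unfolding C2_iff multilin_0 by auto
      then show ?thesis
        using assms(3) 1 unfolding multilin_2
        by (cases "xs = []"; cases "as \<in> tuples A 2") (auto simp: tuples_2)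
    next
      case 2
      have l: "(\<lambda>x. snd c 1 [x]) \<in> lin_maps K L (multilin K A A (Suc 0))"
        "(\<lambda>x. snd c' 1 [x]) \<in> lin_maps K L (multilin K A A (Suc 0))"
        and off: "xs \<notin> tuples L (Suc 0) \<Longrightarrow> snd c 1 xs = snd c' 1 xs"
        using c c' unfolding C2_iff multilin_1 by auto
      show ?thesis
      proof (cases "xs \<in> tuples L (Suc 0)")
        case True
        then obtain x where x: "xs = [x]" "x \<in> carrier L" by (auto simp: tuples_1)
        then show ?thesis
          using lin_mapsD(1)[OF l(1) x(2)] lin_mapsD(1)[OF l(2) x(2)] assms(4)[OF x(2)] 2
          unfolding multilin_1 by (cases "as \<in> tuples A (Suc 0)") (auto simp: tuples_1)
      next
        case False
        then show ?thesis using off 2 by simp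
      qed
    next
      case 3
      then have "snd c p = (\<lambda>_ _. \<zero>\<^bsub>A\<^esub>)" "snd c' p = (\<lambda>_ _. \<zero>\<^bsub>A\<^esub>)"
        using c c' unfolding C2_iff by blast+
      then show ?thesis by simp
    qed
  qed
qed

lemma cochain_of_closed:
  assumes t: "bilinear_triplet t"
  shows "cochain_of t \<in> carrier C2"
proof -
  obtain m \<mu> b where [simp]: "t = (m, \<mu>, b)" by (cases t)
  have m: "m \<in> bilin_maps K A A A" and \<mu>: "\<mu> \<in> bilin_maps K L A A" and b: "b \<in> bilin_maps K L L L"
    using t by (auto simp: bilinear_triplet_def)
  note D = bilin_mapsD[OF m] bilin_mapsD[OF \<mu>] bilin_mapsD[OF b]
  have "fst (cochain_of t) \<in> carrier (multilin K L L 2)"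
    unfolding multilin_2
    by (intro conjI bilin_mapsI) (auto simp: cochain_of_def tuples_2 D)
  moreover have "snd (cochain_of t) 2 \<in> carrier (multilin K L (multilin K A A 2) 0)"
    unfolding multilin_0 multilin_2
    by (intro conjI bilin_mapsI) (auto simp: cochain_of_def tuples_2 D)
  moreover have "snd (cochain_of t) 1 \<in> carrier (multilin K L (multilin K A A (Suc 0)) (Suc 0))"
    unfolding multilin_1
  proof (intro conjI lin_mapsI)
    fix x assume "x \<in> carrier L"
    then show "snd (cochain_of t) 1 [x] \<in> carrier (multilin K A A (Suc 0))"
      unfolding multilin_1 by (intro conjI lin_mapsI) (auto simp: cochain_of_def tuples_1 D)
  qed (auto simp: cochain_of_def tuples_1 D fun_eq_iff)
  moreover have "\<forall>p. p \<noteq> 1 \<longrightarrow> p \<noteq> 2 \<longrightarrow> snd (cochain_of t) p = (\<lambda>_ _. \<zero>\<^bsub>A\<^esub>)"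
    by (auto simp: cochain_of_def)
  ultimately show ?thesis unfolding C2_iff by blast
qed

lemma cochain_of_apply:
  "a \<in> carrier A \<Longrightarrow> a' \<in> carrier A \<Longrightarrow> snd (cochain_of (m, \<mu>, b)) 2 [] [a, a'] = m a a'"
  "x \<in> carrier L \<Longrightarrow> a \<in> carrier A \<Longrightarrow> snd (cochain_of (m, \<mu>, b)) 1 [x] [a] = \<mu> x a"
  "x \<in> carrier L \<Longrightarrow> y \<in> carrier L \<Longrightarrow> fst (cochain_of (m, \<mu>, b)) [x, y] = b x y"
  by (simp_all add: cochain_of_def tuples_1 tuples_2)

end

subsection \<open>Quotients of submodules\<close>

context module
begin

lemma submoduleI_smult:
  assumes "H \<subseteq> carrier M" "\<zero>\<^bsub>M\<^esub> \<in> H" "\<And>a b. a \<in> H \<Longrightarrow> b \<in> H \<Longrightarrow> a \<oplus>\<^bsub>M\<^esub> b \<in> H"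
    and smult: "\<And>a x. a \<in> carrier R \<Longrightarrow> x \<in> H \<Longrightarrow> a \<odot>\<^bsub>M\<^esub> x \<in> H"
  shows "submodule H R M"
proof (rule submoduleI)
  fix x assume x: "x \<in> H"
  have "\<ominus>\<^bsub>M\<^esub> x = (\<ominus> \<one>) \<odot>\<^bsub>M\<^esub> x" using x assms(1) by (auto simp: smult_l_minus)
  then show "\<ominus>\<^bsub>M\<^esub> x \<in> H" using smult[OF _ x, of "\<ominus> \<one>"] by simp
qed (use assms in auto)

end

text \<open>The carrier of \<open>Q\<close> consists of the cosets of \<open>N\<close> that meet \<open>Z\<close>, that is of \<open>(N + Z) / N\<close>. Cohomology is
  this module for the coboundaries \<open>N\<close> and the cocycles \<open>Z\<close>.\<close>

locale subquotient = module K V for K :: "('k, 'm) ring_scheme" and V :: "('k, 'v) module" +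
  fixes N Z :: "'v set"
  assumes N: "submodule N K V" and Z: "submodule Z K V"
begin

sublocale N: abelian_subgroup N V
  using N by (intro abelian_subgroupI3 additive_subgroup.intro M.abelian_group_axioms) (simp add: submodule_def)

abbreviation "Q \<equiv> quot_module (V\<lparr>carrier := Z\<rparr>) N"
abbreviation coset where "coset x \<equiv> N +>\<^bsub>V\<^esub> x"

lemma Z_carrier: "x \<in> Z \<Longrightarrow> x \<in> carrier V"
  using submoduleE(1)[OF Z] by blast

lemma Z_closed: "x \<in> Z \<Longrightarrow> y \<in> Z \<Longrightarrow> x \<oplus>\<^bsub>V\<^esub> y \<in> Z" "k \<in> carrier K \<Longrightarrow> x \<in> Z \<Longrightarrow> k \<odot>\<^bsub>V\<^esub> x \<in> Z"
  using submoduleE[OF Z] by auto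

lemma zero_Z: "\<zero>\<^bsub>V\<^esub> \<in> Z"
  using submodule.axioms(1)[OF Z] subgroup.one_closed by fastforce

lemma carrier_Q: "carrier Q = coset ` Z"
  by (auto simp: quot_module_def A_RCOSETS_def' a_r_coset_def')

lemma add_Q: "x \<in> Z \<Longrightarrow> y \<in> Z \<Longrightarrow> coset x \<oplus>\<^bsub>Q\<^esub> coset y = coset (x \<oplus>\<^bsub>V\<^esub> y)"
  using N.a_rcos_sum[of x y] by (simp add: quot_module_def set_add_def' Z_carrier)

lemma zero_Q: "\<zero>\<^bsub>Q\<^esub> = coset \<zero>\<^bsub>V\<^esub>"
  using submoduleE(1)[OF N] by (simp add: quot_module_def M.a_coset_add_zero)

lemma mem_coset: "x \<in> carrier V \<Longrightarrow> x \<in> coset x"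
  by (rule N.a_rcos_self)

lemma coset_eqI: "y \<in> coset x \<Longrightarrow> x \<in> carrier V \<Longrightarrow> coset y = coset x"
  using N.a_repr_independence'[of y x] by simp

lemma smult_Q: "k \<in> carrier K \<Longrightarrow> x \<in> Z \<Longrightarrow> k \<odot>\<^bsub>Q\<^esub> coset x = coset (k \<odot>\<^bsub>V\<^esub> x)"
proof -
  assume k: "k \<in> carrier K" and x: "x \<in> Z"
  have "coset (k \<odot>\<^bsub>V\<^esub> y) = coset (k \<odot>\<^bsub>V\<^esub> x)" if "y \<in> coset x" for y
  proof -
    obtain h where h: "h \<in> N" "y = h \<oplus>\<^bsub>V\<^esub> x" using \<open>y \<in> coset x\<close> by (auto simp: a_r_coset_def')
    have "h \<in> carrier V" using h submoduleE(1)[OF N] by blast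
    then have "k \<odot>\<^bsub>V\<^esub> y = k \<odot>\<^bsub>V\<^esub> h \<oplus>\<^bsub>V\<^esub> k \<odot>\<^bsub>V\<^esub> x" using h k x by (simp add: smult_r_distr Z_carrier)
    moreover have "k \<odot>\<^bsub>V\<^esub> h \<in> N" using submoduleE(4)[OF N k h(1)] .
    ultimately have "k \<odot>\<^bsub>V\<^esub> y \<in> coset (k \<odot>\<^bsub>V\<^esub> x)" by (auto simp: a_r_coset_def')
    then show ?thesis using k x by (intro coset_eqI) (auto simp: Z_carrier)
  qed
  then have "(\<Union>y\<in>coset x. coset (k \<odot>\<^bsub>V\<^esub> y)) = coset (k \<odot>\<^bsub>V\<^esub> x)"
    using mem_coset[OF Z_carrier[OF x]] by blast
  then show ?thesis by (simp add: quot_module_def a_r_coset_def')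
qed

lemma module_Q: "module K Q"
proof (rule moduleI)
  show "cring K" by (rule R.is_cring)
  show "abelian_group Q"
  proof (rule abelian_groupI)
    fix x assume "x \<in> carrier Q"
    then obtain a where a: "a \<in> Z" "x = coset a" by (auto simp: carrier_Q)
    have "\<ominus>\<^bsub>V\<^esub> a \<in> Z" using submoduleE(3)[OF Z] a by blast
    then show "\<exists>y\<in>carrier Q. y \<oplus>\<^bsub>Q\<^esub> x = \<zero>\<^bsub>Q\<^esub>"
      using a by (intro bexI[of _ "coset (\<ominus>\<^bsub>V\<^esub> a)"]) (auto simp: add_Q zero_Q carrier_Q M.l_neg Z_carrier)
  qed (auto simp: carrier_Q add_Q zero_Q Z_closed zero_Z Z_carrier M.a_ac)
qed (auto simp: carrier_Q add_Q smult_Q Z_closed Z_carrier smult_l_distr smult_r_distr smult_assoc1)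

end

subsection \<open>The cocycle condition\<close>

text \<open>The Leibniz coboundary in degrees 0, 1 and 2, with values in an arbitrary module. It is used for
  \<open>M = L\<close> and for the modules \<open>Hom(A\<^sup>p, A)\<close> with \<open>p = 1, 2\<close>.\<close>

locale cochain_values = module K M for K :: "('k, 'm) ring_scheme" and M :: "('k, 'v) module"
begin

lemma signed_simps [simp]:
  "x \<in> carrier M \<Longrightarrow> signed K M 0 x = x"
  "x \<in> carrier M \<Longrightarrow> signed K M (Suc 0) x = \<ominus>\<^bsub>M\<^esub> x"
  "x \<in> carrier M \<Longrightarrow> signed K M 2 x = x"
  "x \<in> carrier M \<Longrightarrow> signed K M 3 x = \<ominus>\<^bsub>M\<^esub> x"
  by (simp_all add: signed_def numeral_2_eq_2 numeral_3_eq_3 smult_l_minus R.l_minus)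

lemma finsum_1: "f 0 \<in> carrier M \<Longrightarrow> (\<Oplus>\<^bsub>M\<^esub>i\<in>{..<Suc 0}. f i) = f 0"
  by (simp add: lessThan_Suc)

lemma finsum_2: "f 0 \<in> carrier M \<Longrightarrow> f (Suc 0) \<in> carrier M \<Longrightarrow> (\<Oplus>\<^bsub>M\<^esub>i\<in>{..<2}. f i) = f 0 \<oplus>\<^bsub>M\<^esub> f (Suc 0)"
  by (simp add: lessThan_Suc numeral_2_eq_2 M.a_comm)

lemma finsum_triangle:
  assumes "g (Suc 0) 0 \<in> carrier M" "g 2 0 \<in> carrier M" "g 2 (Suc 0) \<in> carrier M"
  shows "(\<Oplus>\<^bsub>M\<^esub>j\<in>{..2}. \<Oplus>\<^bsub>M\<^esub>i\<in>{..<j}. g j i) = g (Suc 0) 0 \<oplus>\<^bsub>M\<^esub> (g 2 0 \<oplus>\<^bsub>M\<^esub> g 2 (Suc 0))"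
proof -
  have "{..2::nat} = insert 0 (insert (Suc 0) {2})" by auto
  then show ?thesis using assms by (simp add: finsum_1 finsum_2)
qed

lemma leibniz_cobdry_0:
  "x \<in> carrier L \<Longrightarrow> leibniz_cobdry K L M la ra 0 \<psi> [x]
    = signed K M (Suc 0) (\<zero>\<^bsub>M\<^esub> \<oplus>\<^bsub>M\<^esub> signed K M (Suc 0) (ra (\<psi> []) x) \<oplus>\<^bsub>M\<^esub> \<zero>\<^bsub>M\<^esub>)"
  by (simp add: leibniz_cobdry_def tuples_1)

lemma leibniz_cobdry_1:
  assumes "x \<in> carrier L" "y \<in> carrier L" "\<And>x. x \<in> carrier L \<Longrightarrow> \<psi> [x] \<in> carrier M"
    "x \<otimes>\<^bsub>L\<^esub> y \<in> carrier L" "la x (\<psi> [y]) \<in> carrier M"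
  shows "leibniz_cobdry K L M la ra (Suc 0) \<psi> [x, y]
    = signed K M 2 (signed K M 0 (la x (\<psi> [y])) \<oplus>\<^bsub>M\<^esub> signed K M 2 (ra (\<psi> [x]) y)
        \<oplus>\<^bsub>M\<^esub> signed K M (Suc 0) (\<psi> [x \<otimes>\<^bsub>L\<^esub> y]))"
proof -
  have "{..Suc 0} = {0, Suc 0}" by auto
  then show ?thesis
    using assms by (simp add: leibniz_cobdry_def tuples_2 finsum_1 omit_nth_def flip: numeral_2_eq_2)
qed

lemma leibniz_cobdry_2:
  assumes "x \<in> carrier L" "y \<in> carrier L" "z \<in> carrier L"
    "\<And>x y. x \<in> carrier L \<Longrightarrow> y \<in> carrier L \<Longrightarrow> \<psi> [x, y] \<in> carrier M"
    "\<And>x y. x \<in> carrier L \<Longrightarrow> y \<in> carrier L \<Longrightarrow> x \<otimes>\<^bsub>L\<^esub> y \<in> carrier L"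
    "\<And>x v. x \<in> carrier L \<Longrightarrow> v \<in> carrier M \<Longrightarrow> la x v \<in> carrier M"
  shows "leibniz_cobdry K L M la ra 2 \<psi> [x, y, z]
    = signed K M 3 ((la x (\<psi> [y, z]) \<oplus>\<^bsub>M\<^esub> signed K M (Suc 0) (la y (\<psi> [x, z])))
        \<oplus>\<^bsub>M\<^esub> signed K M 3 (ra (\<psi> [x, y]) z)
        \<oplus>\<^bsub>M\<^esub> (signed K M (Suc 0) (\<psi> [x \<otimes>\<^bsub>L\<^esub> y, z])
            \<oplus>\<^bsub>M\<^esub> (signed K M (Suc 0) (\<psi> [y, x \<otimes>\<^bsub>L\<^esub> z]) \<oplus>\<^bsub>M\<^esub> signed K M 2 (\<psi> [x, y \<otimes>\<^bsub>L\<^esub> z]))))"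
proof -
  have lists: "omit_nth 0 [x, y, z] = [y, z]" "omit_nth (Suc 0) [x, y, z] = [x, z]"
    "omit_nth 0 [x, w, z] = [w, z]" "omit_nth 0 [x, y, w] = [y, w]" "omit_nth (Suc 0) [x, y, w] = [x, w]"
    "[x, y, z] ! 2 = z" "[x, y, z][2 := w] = [x, y, w]" "take 2 [x, y, z] = [x, y]" for w
    by (simp_all add: omit_nth_def numeral_2_eq_2)
  have three: "2 + 1 = (3::nat)" "Suc 2 = 3" by simp_all
  have mem: "[x, y, z] \<in> tuples L 3" using assms(1-3) by (simp add: tuples_3)
  have S1: "(\<Oplus>\<^bsub>M\<^esub>i\<in>{..<2}. signed K M i (la ([x, y, z] ! i) (\<psi> (omit_nth i [x, y, z]))))
      = la x (\<psi> [y, z]) \<oplus>\<^bsub>M\<^esub> signed K M (Suc 0) (la y (\<psi> [x, z]))"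
    by (subst finsum_2) (use assms in \<open>simp_all add: lists\<close>)
  have S2: "(\<Oplus>\<^bsub>M\<^esub>j\<in>{..2}. \<Oplus>\<^bsub>M\<^esub>i\<in>{..<j}.
        signed K M (i + 1) (\<psi> (omit_nth i ([x, y, z][j := [x, y, z] ! i \<otimes>\<^bsub>L\<^esub> [x, y, z] ! j]))))
      = signed K M (Suc 0) (\<psi> [x \<otimes>\<^bsub>L\<^esub> y, z])
        \<oplus>\<^bsub>M\<^esub> (signed K M (Suc 0) (\<psi> [y, x \<otimes>\<^bsub>L\<^esub> z]) \<oplus>\<^bsub>M\<^esub> signed K M 2 (\<psi> [x, y \<otimes>\<^bsub>L\<^esub> z]))"
    by (subst finsum_triangle) (use assms in \<open>simp_all add: lists flip: numeral_2_eq_2\<close>)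
  show ?thesis
    unfolding leibniz_cobdry_def three(1) if_P[OF mem] S1 S2 lists ..
qed

end

context courant
begin

sublocale A: cochain_values K A by (intro cochain_values.intro A.module_axioms)
sublocale L: cochain_values K L by (intro cochain_values.intro L.module_axioms)

lemma multilin_A: "module K (multilin K A A p)"
  by (rule module_multilin[OF A.module_axioms A.module_axioms])

lemma signed_multilin [simp]: "signed K (multilin K A A p) i f as = signed K A i (f as)"
  by (simp add: signed_def)

lemma hom_left_act_1:
  assumes f: "f \<in> carrier (multilin K A A (Suc 0))" and x: "x \<in> carrier L"
  shows "a \<in> carrier A \<Longrightarrow> hom_left_act P (Suc 0) x f [a] = act P x (f [a]) \<ominus>\<^bsub>A\<^esub> f [act P x a]"
    and "hom_left_act P (Suc 0) x f \<in> carrier (multilin K A A (Suc 0))"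
proof -
  have lin: "(\<lambda>a. f [a]) \<in> lin_maps K A A" using f by (simp add: multilin_1)
  note D = lin_mapsD[OF lin]
  show val: "hom_left_act P (Suc 0) x f [a] = act P x (f [a]) \<ominus>\<^bsub>A\<^esub> f [act P x a]" if "a \<in> carrier A" for a
    using that x by (simp add: hom_left_act_def tuples_1 A.finsum_1 D actD)
  show "hom_left_act P (Suc 0) x f \<in> carrier (multilin K A A (Suc 0))"
    unfolding multilin_1
    by (intro conjI lin_mapsI)
      (use x in \<open>simp_all add: val D actD A.M.minus_eq A.M.minus_add A.M.a_ac A.smult_r_distr A.smult_r_minus,
        auto simp: hom_left_act_def\<close>)
qed

lemma hom_left_act_2:
  assumes f: "f \<in> carrier (multilin K A A 2)" and x: "x \<in> carrier L" "a \<in> carrier A" "b \<in> carrier A"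
  shows "hom_left_act P 2 x f [a, b] = act P x (f [a, b]) \<ominus>\<^bsub>A\<^esub> (f [act P x a, b] \<oplus>\<^bsub>A\<^esub> f [a, act P x b])"
proof -
  have lin: "(\<lambda>a b. f [a, b]) \<in> bilin_maps K A A A" using f by (simp add: multilin_2)
  note D = bilin_mapsD[OF lin]
  show ?thesis using x by (simp add: hom_left_act_def tuples_2 A.finsum_2 D actD)
qed

lemma hochschild_1:
  assumes "\<And>a. a \<in> carrier A \<Longrightarrow> f [a] \<in> carrier A" "a \<in> carrier A" "b \<in> carrier A"
  shows "hochschild K A (Suc 0) f [a, b] = (a \<otimes>\<^bsub>A\<^esub> f [b]) \<oplus>\<^bsub>A\<^esub> \<ominus>\<^bsub>A\<^esub> f [a \<otimes>\<^bsub>A\<^esub> b] \<oplus>\<^bsub>A\<^esub> f [a] \<otimes>\<^bsub>A\<^esub> b"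
  using assms by (simp add: hochschild_def tuples_2 A.finsum_1 multD flip: numeral_2_eq_2)

lemma hochschild_2:
  assumes "\<And>a b. a \<in> carrier A \<Longrightarrow> b \<in> carrier A \<Longrightarrow> f [a, b] \<in> carrier A"
    "a \<in> carrier A" "b \<in> carrier A" "c \<in> carrier A"
  shows "hochschild K A 2 f [a, b, c] = (a \<otimes>\<^bsub>A\<^esub> f [b, c])
    \<oplus>\<^bsub>A\<^esub> (\<ominus>\<^bsub>A\<^esub> f [a \<otimes>\<^bsub>A\<^esub> b, c] \<oplus>\<^bsub>A\<^esub> f [a, b \<otimes>\<^bsub>A\<^esub> c]) \<oplus>\<^bsub>A\<^esub> \<ominus>\<^bsub>A\<^esub> (f [a, b] \<otimes>\<^bsub>A\<^esub> c)"
proof -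
  have [simp]: "Suc (Suc 0) = 2" "Suc 2 = 3" by auto
  show ?thesis using assms by (simp add: hochschild_def tuples_3 A.finsum_2 multD)
qed

end

context cochain_values
begin

lemma minus_zero [simp]: "\<ominus>\<^bsub>M\<^esub> \<zero>\<^bsub>M\<^esub> = \<zero>\<^bsub>M\<^esub>"
  by (rule M.minus_equality) simp_all

lemma diff_zero_iff:
  assumes "a \<in> carrier M" "b \<in> carrier M"
  shows "a \<ominus>\<^bsub>M\<^esub> b = \<zero>\<^bsub>M\<^esub> \<longleftrightarrow> a = b" "a \<ominus>\<^bsub>M\<^esub> b = \<zero>\<^bsub>M\<^esub> \<longleftrightarrow> b = a"
proof -
  show "a \<ominus>\<^bsub>M\<^esub> b = \<zero>\<^bsub>M\<^esub> \<longleftrightarrow> a = b"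
  proof
    assume "a \<ominus>\<^bsub>M\<^esub> b = \<zero>\<^bsub>M\<^esub>"
    then have "a \<oplus>\<^bsub>M\<^esub> \<ominus>\<^bsub>M\<^esub> b \<oplus>\<^bsub>M\<^esub> b = b" using assms by (simp add: M.minus_eq)
    then show "a = b" using assms by (simp add: M.a_assoc M.l_neg)
  qed (use assms in \<open>simp add: M.minus_eq M.r_neg\<close>)
  then show "a \<ominus>\<^bsub>M\<^esub> b = \<zero>\<^bsub>M\<^esub> \<longleftrightarrow> b = a" by blast
qed

end

context courant
begin

lemma hochschild_null:
  "hochschild K A (Suc 0) (\<lambda>_. \<zero>\<^bsub>A\<^esub>) as = \<zero>\<^bsub>A\<^esub>" "hochschild K A 2 (\<lambda>_. \<zero>\<^bsub>A\<^esub>) as = \<zero>\<^bsub>A\<^esub>"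
proof -
  show "hochschild K A (Suc 0) (\<lambda>_. \<zero>\<^bsub>A\<^esub>) as = \<zero>\<^bsub>A\<^esub>"
  proof (cases "as \<in> tuples A 2")
    case True
    then obtain a b where "as = [a, b]" "a \<in> carrier A" "b \<in> carrier A" by (auto simp: tuples_2)
    then show ?thesis using hochschild_1[of "\<lambda>_. \<zero>\<^bsub>A\<^esub>" a b] by (simp add: zero_op)
  qed (simp add: hochschild_def flip: numeral_2_eq_2)
  show "hochschild K A 2 (\<lambda>_. \<zero>\<^bsub>A\<^esub>) as = \<zero>\<^bsub>A\<^esub>"
  proof (cases "as \<in> tuples A 3")
    case True
    then obtain a b c where "as = [a, b, c]" "a \<in> carrier A" "b \<in> carrier A" "c \<in> carrier A"
      by (auto simp: tuples_3)
    then show ?thesis using hochschild_2[of "\<lambda>_. \<zero>\<^bsub>A\<^esub>" a b c] by (simp add: zero_op)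
  qed (simp add: hochschild_def)
qed

text \<open>The coboundary of a 2-cochain has its values in the bidegrees \<open>(0,3)\<close>, \<open>(1,2)\<close>, \<open>(2,1)\<close> and \<open>(3,0)\<close>. After
  the signs are sorted out, each of them is the difference of the two sides of one of the four
  cocycle equations.\<close>

context
  fixes c assumes c: "c \<in> carrier C2"
begin

lemma C2_parts:
  "fst c \<in> carrier (multilin K L L 2)" "snd c 2 [] \<in> carrier (multilin K A A 2)"
  "\<And>x. x \<in> carrier L \<Longrightarrow> snd c (Suc 0) [x] \<in> carrier (multilin K A A (Suc 0))"
  "\<And>xs. xs \<notin> tuples L 2 \<Longrightarrow> fst c xs = \<zero>\<^bsub>L\<^esub>"
  "\<And>xs. xs \<noteq> [] \<Longrightarrow> snd c 2 xs = (\<lambda>_. \<zero>\<^bsub>A\<^esub>)"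
  "\<And>xs. xs \<notin> tuples L (Suc 0) \<Longrightarrow> snd c (Suc 0) xs = (\<lambda>_. \<zero>\<^bsub>A\<^esub>)"
  using c unfolding C2_iff by (auto simp: multilin_0 multilin_1 multilin_2 dest: lin_mapsD(1))

abbreviation (input) "cm a b \<equiv> snd c 2 [] [a, b]"
abbreviation (input) "cu x a \<equiv> snd c (Suc 0) [x] [a]"
abbreviation (input) "cb x y \<equiv> fst c [x, y]"

lemma cbilin: "(\<lambda>a b. cm a b) \<in> bilin_maps K A A A" "(\<lambda>x a. cu x a) \<in> bilin_maps K L A A"
  "(\<lambda>x y. cb x y) \<in> bilin_maps K L L L"
  using C2_bilinear[OF c] by (simp_all add: bilinear_triplet_def triplet_of_def)

lemmas cD = bilin_mapsD[OF cbilin(1)] bilin_mapsD[OF cbilin(2)] bilin_mapsD[OF cbilin(3)]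

lemma cval: "fst c xs \<in> carrier L" "snd c p xs as \<in> carrier A"
  by (rule tot_value[OF c])+

lemma d2_bracket:
  assumes "x \<in> carrier L" "y \<in> carrier L" "z \<in> carrier L"
  shows "fst (d_tot K P 2 c) [x, y, z]
    = ((cb x y \<otimes>\<^bsub>L\<^esub> z \<oplus>\<^bsub>L\<^esub> cb (x \<otimes>\<^bsub>L\<^esub> y) z) \<oplus>\<^bsub>L\<^esub> (y \<otimes>\<^bsub>L\<^esub> cb x z \<oplus>\<^bsub>L\<^esub> cb y (x \<otimes>\<^bsub>L\<^esub> z)))
       \<ominus>\<^bsub>L\<^esub> (x \<otimes>\<^bsub>L\<^esub> cb y z \<oplus>\<^bsub>L\<^esub> cb x (y \<otimes>\<^bsub>L\<^esub> z))"
proof -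
  have "fst (d_tot K P 2 c) [x, y, z] = leibniz_cobdry K L L (monoid.mult L) (monoid.mult L) 2 (fst c) [x, y, z]"
    by (simp add: d_tot_def dL0_def case_prod_beta)
  also have "\<dots> = ((cb x y \<otimes>\<^bsub>L\<^esub> z \<oplus>\<^bsub>L\<^esub> cb (x \<otimes>\<^bsub>L\<^esub> y) z) \<oplus>\<^bsub>L\<^esub> (y \<otimes>\<^bsub>L\<^esub> cb x z \<oplus>\<^bsub>L\<^esub> cb y (x \<otimes>\<^bsub>L\<^esub> z)))
       \<ominus>\<^bsub>L\<^esub> (x \<otimes>\<^bsub>L\<^esub> cb y z \<oplus>\<^bsub>L\<^esub> cb x (y \<otimes>\<^bsub>L\<^esub> z))"
    by (subst L.leibniz_cobdry_2)
      (use assms in \<open>simp_all add: cD bracketD L.M.minus_eq L.M.minus_add L.M.a_ac\<close>)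
  finally show ?thesis .
qed

lemma d2_action:
  assumes "x \<in> carrier L" "y \<in> carrier L"
  shows "a \<in> carrier A \<Longrightarrow> snd (d_tot K P 2 c) (Suc 0) [x, y] [a]
    = ((act P (cb x y) a \<oplus>\<^bsub>A\<^esub> cu (x \<otimes>\<^bsub>L\<^esub> y) a) \<oplus>\<^bsub>A\<^esub> (act P y (cu x a) \<oplus>\<^bsub>A\<^esub> cu y (act P x a)))
       \<ominus>\<^bsub>A\<^esub> (act P x (cu y a) \<oplus>\<^bsub>A\<^esub> cu x (act P y a))"
    and "as \<notin> tuples A (Suc 0) \<Longrightarrow> snd (d_tot K P 2 c) (Suc 0) [x, y] as = \<zero>\<^bsub>A\<^esub>"
proof -
  interpret M: cochain_values K "multilin K A A (Suc 0)"
    by (intro cochain_values.intro multilin_A)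
  have "snd (d_tot K P 2 c) (Suc 0) [x, y] as = dH0 P (fst c) [x, y] as
      \<oplus>\<^bsub>A\<^esub> signed K A (Suc 0) (leibniz_cobdry K L (multilin K A A (Suc 0)) (hom_left_act P (Suc 0))
          (hom_right_act P (Suc 0)) (Suc 0) (snd c (Suc 0)) [x, y] as)" for as
    by (simp add: d_tot_def dL_def case_prod_beta)
  moreover have "leibniz_cobdry K L (multilin K A A (Suc 0)) (hom_left_act P (Suc 0))
          (hom_right_act P (Suc 0)) (Suc 0) (snd c (Suc 0)) [x, y] as
      = signed K A 2 (signed K A 0 (hom_left_act P (Suc 0) x (snd c (Suc 0) [y]) as)
        \<oplus>\<^bsub>A\<^esub> signed K A 2 (\<ominus>\<^bsub>A\<^esub> hom_left_act P (Suc 0) y (snd c (Suc 0) [x]) as)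
        \<oplus>\<^bsub>A\<^esub> signed K A (Suc 0) (snd c (Suc 0) [x \<otimes>\<^bsub>L\<^esub> y] as))" for as
    by (subst M.leibniz_cobdry_1)
      (use assms in \<open>simp_all add: C2_parts hom_left_act_1(2) bracketD hom_right_act_def del: M.signed_simps\<close>)
  ultimately have eq: "snd (d_tot K P 2 c) (Suc 0) [x, y] as = dH0 P (fst c) [x, y] as
      \<oplus>\<^bsub>A\<^esub> signed K A (Suc 0) (signed K A 2 (signed K A 0 (hom_left_act P (Suc 0) x (snd c (Suc 0) [y]) as)
        \<oplus>\<^bsub>A\<^esub> signed K A 2 (\<ominus>\<^bsub>A\<^esub> hom_left_act P (Suc 0) y (snd c (Suc 0) [x]) as)
        \<oplus>\<^bsub>A\<^esub> signed K A (Suc 0) (snd c (Suc 0) [x \<otimes>\<^bsub>L\<^esub> y] as)))" for as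
    by simp
  show "snd (d_tot K P 2 c) (Suc 0) [x, y] [a]
    = ((act P (cb x y) a \<oplus>\<^bsub>A\<^esub> cu (x \<otimes>\<^bsub>L\<^esub> y) a) \<oplus>\<^bsub>A\<^esub> (act P y (cu x a) \<oplus>\<^bsub>A\<^esub> cu y (act P x a)))
       \<ominus>\<^bsub>A\<^esub> (act P x (cu y a) \<oplus>\<^bsub>A\<^esub> cu x (act P y a))" if "a \<in> carrier A"
    unfolding eq using that assms
    by (simp add: hom_left_act_1(1) C2_parts dH0_def tuples_1 cD actD bracketD A.M.minus_eq A.M.minus_add A.M.a_ac)
  show "snd (d_tot K P 2 c) (Suc 0) [x, y] as = \<zero>\<^bsub>A\<^esub>" if "as \<notin> tuples A (Suc 0)"
  proof -
    have "snd c (Suc 0) [x \<otimes>\<^bsub>L\<^esub> y] as = \<zero>\<^bsub>A\<^esub>"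
      using C2_parts(3)[of "x \<otimes>\<^bsub>L\<^esub> y"] assms that by (simp add: multilin_1 bracketD)
    then show ?thesis
      unfolding eq using that by (simp add: hom_left_act_def dH0_def)
  qed
qed

lemma d2_derivation:
  assumes "x \<in> carrier L"
  shows "a \<in> carrier A \<Longrightarrow> b \<in> carrier A \<Longrightarrow> snd (d_tot K P 2 c) 2 [x] [a, b]
    = ((cu x a \<otimes>\<^bsub>A\<^esub> b \<oplus>\<^bsub>A\<^esub> cm (act P x a) b) \<oplus>\<^bsub>A\<^esub> (a \<otimes>\<^bsub>A\<^esub> cu x b \<oplus>\<^bsub>A\<^esub> cm a (act P x b)))
       \<ominus>\<^bsub>A\<^esub> (act P x (cm a b) \<oplus>\<^bsub>A\<^esub> cu x (a \<otimes>\<^bsub>A\<^esub> b))"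
    and "as \<notin> tuples A 2 \<Longrightarrow> snd (d_tot K P 2 c) 2 [x] as = \<zero>\<^bsub>A\<^esub>"
proof -
  interpret M: cochain_values K "multilin K A A 2"
    by (intro cochain_values.intro multilin_A)
  have eq: "snd (d_tot K P 2 c) 2 [x] as = hochschild K A (Suc 0) (snd c (Suc 0) [x]) as
      \<oplus>\<^bsub>A\<^esub> signed K A 2 (signed K A (Suc 0) (\<zero>\<^bsub>A\<^esub> \<oplus>\<^bsub>A\<^esub> signed K A (Suc 0)
          (\<ominus>\<^bsub>A\<^esub> hom_left_act P 2 x (snd c 2 []) as) \<oplus>\<^bsub>A\<^esub> \<zero>\<^bsub>A\<^esub>))" for as
    using M.leibniz_cobdry_0[OF assms, of "hom_left_act P 2" "hom_right_act P 2" "snd c 2"]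
    by (simp add: d_tot_def dL_def dH_def case_prod_beta hom_right_act_def del: M.signed_simps)
  show "snd (d_tot K P 2 c) 2 [x] [a, b]
    = ((cu x a \<otimes>\<^bsub>A\<^esub> b \<oplus>\<^bsub>A\<^esub> cm (act P x a) b) \<oplus>\<^bsub>A\<^esub> (a \<otimes>\<^bsub>A\<^esub> cu x b \<oplus>\<^bsub>A\<^esub> cm a (act P x b)))
       \<ominus>\<^bsub>A\<^esub> (act P x (cm a b) \<oplus>\<^bsub>A\<^esub> cu x (a \<otimes>\<^bsub>A\<^esub> b))" if "a \<in> carrier A" "b \<in> carrier A"
    unfolding eq using that assms
    by (simp add: hom_left_act_2 hochschild_1 C2_parts cD actD multD A.M.minus_eq A.M.minus_add A.M.a_ac)
  show "snd (d_tot K P 2 c) 2 [x] as = \<zero>\<^bsub>A\<^esub>" if "as \<notin> tuples A 2"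
    unfolding eq using that by (simp add: hom_left_act_def hochschild_def flip: numeral_2_eq_2)
qed

lemma d2_assoc:
  assumes "a \<in> carrier A" "b \<in> carrier A" "e \<in> carrier A"
  shows "snd (d_tot K P 2 c) 3 [] [a, b, e]
    = (a \<otimes>\<^bsub>A\<^esub> cm b e \<oplus>\<^bsub>A\<^esub> cm a (b \<otimes>\<^bsub>A\<^esub> e)) \<ominus>\<^bsub>A\<^esub> (cm a b \<otimes>\<^bsub>A\<^esub> e \<oplus>\<^bsub>A\<^esub> cm (a \<otimes>\<^bsub>A\<^esub> b) e)"
proof -
  have "snd (d_tot K P 2 c) 3 [] [a, b, e] = hochschild K A 2 (snd c 2 []) [a, b, e] \<oplus>\<^bsub>A\<^esub> \<zero>\<^bsub>A\<^esub>"
    by (simp add: d_tot_def dH_def case_prod_beta)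
  then show ?thesis
    using assms by (simp add: hochschild_2 cD multD A.M.minus_eq A.M.minus_add A.M.a_ac)
qed

text \<open>With these values off the tuples, the four preceding lemmas describe the coboundary completely.\<close>

lemma d2_off:
  "xs \<notin> tuples L 3 \<Longrightarrow> fst (d_tot K P 2 c) xs = \<zero>\<^bsub>L\<^esub>"
  "xs \<notin> tuples L 2 \<Longrightarrow> snd (d_tot K P 2 c) (Suc 0) xs as = \<zero>\<^bsub>A\<^esub>"
  "xs \<notin> tuples L (Suc 0) \<Longrightarrow> snd (d_tot K P 2 c) 2 xs as = \<zero>\<^bsub>A\<^esub>"
  "xs \<noteq> [] \<or> as \<notin> tuples A 3 \<Longrightarrow> snd (d_tot K P 2 c) 3 xs as = \<zero>\<^bsub>A\<^esub>"
  "p \<notin> {1, 2, 3} \<Longrightarrow> snd (d_tot K P 2 c) p xs as = \<zero>\<^bsub>A\<^esub>"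
proof -
  show "fst (d_tot K P 2 c) xs = \<zero>\<^bsub>L\<^esub>" if "xs \<notin> tuples L 3"
    using that by (simp add: d_tot_def dL0_def leibniz_cobdry_def case_prod_beta)
  show "snd (d_tot K P 2 c) (Suc 0) xs as = \<zero>\<^bsub>A\<^esub>" if "xs \<notin> tuples L 2"
  proof -
    have "act P \<zero>\<^bsub>L\<^esub> (as ! 0) = \<zero>\<^bsub>A\<^esub>" if "as \<in> tuples A (Suc 0)"
      using that by (auto simp: tuples_1 zero_op)
    then show ?thesis
      using that C2_parts(4)[OF that]
      by (simp add: d_tot_def dL_def leibniz_cobdry_def case_prod_beta dH0_def flip: numeral_2_eq_2)
  qed
  show "snd (d_tot K P 2 c) 2 xs as = \<zero>\<^bsub>A\<^esub>" if "xs \<notin> tuples L (Suc 0)"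
    using that C2_parts(6)[OF that] hochschild_null
    by (simp add: d_tot_def dL_def dH_def leibniz_cobdry_def case_prod_beta)
  show "snd (d_tot K P 2 c) 3 xs as = \<zero>\<^bsub>A\<^esub>" if "xs \<noteq> [] \<or> as \<notin> tuples A 3"
  proof (cases "xs = []")
    case True
    with that show ?thesis by (simp add: d_tot_def dH_def case_prod_beta hochschild_def)
  next
    case False
    then show ?thesis using C2_parts(5)[OF False] hochschild_null
      by (simp add: d_tot_def dH_def case_prod_beta)
  qed
  show "snd (d_tot K P 2 c) p xs as = \<zero>\<^bsub>A\<^esub>" if "p \<notin> {1, 2, 3}"
    using that by (auto simp: d_tot_def case_prod_beta)
qed

lemma cocycle_iff: "c \<in> cocycles K P 2 \<longleftrightarrow> triplet_cocycle P (triplet_of c)"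
proof -
  have three: "2 + 1 = (3::nat)" by simp
  note cl = cval multD(1) actD(1) bracketD(1)
  have coc: "c \<in> cocycles K P 2 \<longleftrightarrow> (\<forall>xs. fst (d_tot K P 2 c) xs = \<zero>\<^bsub>L\<^esub>) \<and>
      (\<forall>p xs as. snd (d_tot K P 2 c) p xs as = \<zero>\<^bsub>A\<^esub>)"
  proof -
    obtain f g where fg: "d_tot K P 2 c = (f, g)" by (cases "d_tot K P 2 c")
    show ?thesis
      unfolding cocycles_def using c by (simp add: fg fun_eq_iff)
  qed
  have "(\<forall>xs. fst (d_tot K P 2 c) xs = \<zero>\<^bsub>L\<^esub>) \<longleftrightarrow>
      (\<forall>x\<in>carrier L. \<forall>y\<in>carrier L. \<forall>z\<in>carrier L. fst (d_tot K P 2 c) [x, y, z] = \<zero>\<^bsub>L\<^esub>)"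
  proof (intro iffI allI)
    fix xs assume *: "\<forall>x\<in>carrier L. \<forall>y\<in>carrier L. \<forall>z\<in>carrier L. fst (d_tot K P 2 c) [x, y, z] = \<zero>\<^bsub>L\<^esub>"
    show "fst (d_tot K P 2 c) xs = \<zero>\<^bsub>L\<^esub>"
    proof (cases "xs \<in> tuples L 3")
      case True
      then show ?thesis unfolding tuples_3 using * by blast
    qed (rule d2_off(1))
  qed simp
  also have "\<dots> \<longleftrightarrow> leibniz_cocycle P (\<lambda>x y. cb x y)"
    unfolding leibniz_cocycle_def
    by (intro ball_cong refl) (simp add: d2_bracket L.diff_zero_iff(2) cl)
  finally have 1: "(\<forall>xs. fst (d_tot K P 2 c) xs = \<zero>\<^bsub>L\<^esub>) \<longleftrightarrow> leibniz_cocycle P (\<lambda>x y. cb x y)" .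
  have "(\<forall>xs as. snd (d_tot K P 2 c) (Suc 0) xs as = \<zero>\<^bsub>A\<^esub>) \<longleftrightarrow>
      (\<forall>x\<in>carrier L. \<forall>y\<in>carrier L. \<forall>a\<in>carrier A. snd (d_tot K P 2 c) (Suc 0) [x, y] [a] = \<zero>\<^bsub>A\<^esub>)"
  proof (intro iffI allI)
    fix xs as
    assume *: "\<forall>x\<in>carrier L. \<forall>y\<in>carrier L. \<forall>a\<in>carrier A. snd (d_tot K P 2 c) (Suc 0) [x, y] [a] = \<zero>\<^bsub>A\<^esub>"
    show "snd (d_tot K P 2 c) (Suc 0) xs as = \<zero>\<^bsub>A\<^esub>"
    proof (cases "xs \<in> tuples L 2 \<and> as \<in> tuples A (Suc 0)")
      case True
      then show ?thesis unfolding tuples_1 tuples_2 using * by blast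
    next
      case False
      show ?thesis
      proof (cases "xs \<in> tuples L 2")
        case True
        then obtain x y where "xs = [x, y]" "x \<in> carrier L" "y \<in> carrier L" unfolding tuples_2 by blast
        then show ?thesis using False True by (simp add: d2_action(2))
      qed (rule d2_off(2))
    qed
  qed simp
  also have "\<dots> \<longleftrightarrow> action_cocycle P (\<lambda>x a. cu x a) (\<lambda>x y. cb x y)"
    unfolding action_cocycle_def
    by (intro ball_cong refl) (simp add: d2_action(1) A.diff_zero_iff(1) cl)
  finally have 2: "(\<forall>xs as. snd (d_tot K P 2 c) (Suc 0) xs as = \<zero>\<^bsub>A\<^esub>) \<longleftrightarrow>
    action_cocycle P (\<lambda>x a. cu x a) (\<lambda>x y. cb x y)" .
  have "(\<forall>xs as. snd (d_tot K P 2 c) 2 xs as = \<zero>\<^bsub>A\<^esub>) \<longleftrightarrow>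
      (\<forall>x\<in>carrier L. \<forall>a\<in>carrier A. \<forall>b\<in>carrier A. snd (d_tot K P 2 c) 2 [x] [a, b] = \<zero>\<^bsub>A\<^esub>)"
  proof (intro iffI allI)
    fix xs as
    assume *: "\<forall>x\<in>carrier L. \<forall>a\<in>carrier A. \<forall>b\<in>carrier A. snd (d_tot K P 2 c) 2 [x] [a, b] = \<zero>\<^bsub>A\<^esub>"
    show "snd (d_tot K P 2 c) 2 xs as = \<zero>\<^bsub>A\<^esub>"
    proof (cases "xs \<in> tuples L (Suc 0) \<and> as \<in> tuples A 2")
      case True
      then show ?thesis unfolding tuples_1 tuples_2 using * by blast
    next
      case False
      show ?thesis
      proof (cases "xs \<in> tuples L (Suc 0)")
        case True
        then obtain x where "xs = [x]" "x \<in> carrier L" unfolding tuples_1 by blast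
        then show ?thesis using False True by (simp add: d2_derivation(2))
      qed (rule d2_off(3))
    qed
  qed simp
  also have "\<dots> \<longleftrightarrow> derivation_cocycle P (\<lambda>a b. cm a b) (\<lambda>x a. cu x a)"
    unfolding derivation_cocycle_def
    by (intro ball_cong refl) (simp add: d2_derivation(1) A.diff_zero_iff(2) cl)
  finally have 3: "(\<forall>xs as. snd (d_tot K P 2 c) 2 xs as = \<zero>\<^bsub>A\<^esub>) \<longleftrightarrow>
    derivation_cocycle P (\<lambda>a b. cm a b) (\<lambda>x a. cu x a)" .
  have "(\<forall>xs as. snd (d_tot K P 2 c) 3 xs as = \<zero>\<^bsub>A\<^esub>) \<longleftrightarrow>
      (\<forall>a\<in>carrier A. \<forall>b\<in>carrier A. \<forall>e\<in>carrier A. snd (d_tot K P 2 c) 3 [] [a, b, e] = \<zero>\<^bsub>A\<^esub>)"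
  proof (intro iffI allI)
    fix xs as
    assume *: "\<forall>a\<in>carrier A. \<forall>b\<in>carrier A. \<forall>e\<in>carrier A. snd (d_tot K P 2 c) 3 [] [a, b, e] = \<zero>\<^bsub>A\<^esub>"
    show "snd (d_tot K P 2 c) 3 xs as = \<zero>\<^bsub>A\<^esub>"
    proof (cases "xs = [] \<and> as \<in> tuples A 3")
      case True
      then show ?thesis unfolding tuples_3 using * by blast
    next
      case False
      then show ?thesis by (intro d2_off(4)) blast
    qed
  qed simp
  also have "\<dots> \<longleftrightarrow> assoc_cocycle P (\<lambda>a b. cm a b)"
    unfolding assoc_cocycle_def
    by (intro ball_cong refl) (simp add: d2_assoc A.diff_zero_iff(2) cl)
  finally have 4: "(\<forall>xs as. snd (d_tot K P 2 c) 3 xs as = \<zero>\<^bsub>A\<^esub>) \<longleftrightarrow> assoc_cocycle P (\<lambda>a b. cm a b)" .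
  have "(\<forall>p xs as. snd (d_tot K P 2 c) p xs as = \<zero>\<^bsub>A\<^esub>) \<longleftrightarrow>
      (\<forall>xs as. snd (d_tot K P 2 c) (Suc 0) xs as = \<zero>\<^bsub>A\<^esub>) \<and> (\<forall>xs as. snd (d_tot K P 2 c) 2 xs as = \<zero>\<^bsub>A\<^esub>)
      \<and> (\<forall>xs as. snd (d_tot K P 2 c) 3 xs as = \<zero>\<^bsub>A\<^esub>)"
    using d2_off(5) by (metis One_nat_def insertE singletonD)
  then show ?thesis
    unfolding coc 1 2 3 4 triplet_cocycle_def triplet_of_def by auto
qed

end

text \<open>The cocycle equations are linear in the triplet.\<close>

lemma cocycles_submodule: "submodule (cocycles K P 2) K C2"
proof -
  interpret C: module K C2 by (rule module_tot_cochains)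
  have sub: "cocycles K P 2 \<subseteq> carrier C2" by (auto simp: cocycles_def)
  define l1 r1 l2 r2 l3 r3 l4 r4 where
    "l1 = (\<lambda>(c :: ('a, 'l) tot_cochain) a b e. snd c 2 [] [a, b] \<otimes>\<^bsub>A\<^esub> e \<oplus>\<^bsub>A\<^esub> snd c 2 [] [a \<otimes>\<^bsub>A\<^esub> b, e])"
    and "r1 = (\<lambda>(c :: ('a, 'l) tot_cochain) a b e. a \<otimes>\<^bsub>A\<^esub> snd c 2 [] [b, e] \<oplus>\<^bsub>A\<^esub> snd c 2 [] [a, b \<otimes>\<^bsub>A\<^esub> e])"
    and "l2 = (\<lambda>(c :: ('a, 'l) tot_cochain) x a b. act P x (snd c 2 [] [a, b]) \<oplus>\<^bsub>A\<^esub> snd c 1 [x] [a \<otimes>\<^bsub>A\<^esub> b])"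
    and "r2 = (\<lambda>(c :: ('a, 'l) tot_cochain) x a b. (snd c 1 [x] [a] \<otimes>\<^bsub>A\<^esub> b \<oplus>\<^bsub>A\<^esub> snd c 2 [] [act P x a, b])
       \<oplus>\<^bsub>A\<^esub> (a \<otimes>\<^bsub>A\<^esub> snd c 1 [x] [b] \<oplus>\<^bsub>A\<^esub> snd c 2 [] [a, act P x b]))"
    and "l3 = (\<lambda>(c :: ('a, 'l) tot_cochain) x y a. (act P (fst c [x, y]) a \<oplus>\<^bsub>A\<^esub> snd c 1 [x \<otimes>\<^bsub>L\<^esub> y] [a])
       \<oplus>\<^bsub>A\<^esub> (act P y (snd c 1 [x] [a]) \<oplus>\<^bsub>A\<^esub> snd c 1 [y] [act P x a]))"
    and "r3 = (\<lambda>(c :: ('a, 'l) tot_cochain) x y a. act P x (snd c 1 [y] [a]) \<oplus>\<^bsub>A\<^esub> snd c 1 [x] [act P y a])"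
    and "l4 = (\<lambda>(c :: ('a, 'l) tot_cochain) x y z. x \<otimes>\<^bsub>L\<^esub> fst c [y, z] \<oplus>\<^bsub>L\<^esub> fst c [x, y \<otimes>\<^bsub>L\<^esub> z])"
    and "r4 = (\<lambda>(c :: ('a, 'l) tot_cochain) x y z. (fst c [x, y] \<otimes>\<^bsub>L\<^esub> z \<oplus>\<^bsub>L\<^esub> fst c [x \<otimes>\<^bsub>L\<^esub> y, z])
       \<oplus>\<^bsub>L\<^esub> (y \<otimes>\<^bsub>L\<^esub> fst c [x, z] \<oplus>\<^bsub>L\<^esub> fst c [y, x \<otimes>\<^bsub>L\<^esub> z]))"
  note d = l1_def r1_def l2_def r2_def l3_def r3_def l4_def r4_def
  have iff: "c \<in> cocycles K P 2 \<longleftrightarrow> c \<in> carrier C2 \<and>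
      (\<forall>a\<in>carrier A. \<forall>b\<in>carrier A. \<forall>e\<in>carrier A. l1 c a b e = r1 c a b e) \<and>
      (\<forall>x\<in>carrier L. \<forall>a\<in>carrier A. \<forall>b\<in>carrier A. l2 c x a b = r2 c x a b) \<and>
      (\<forall>x\<in>carrier L. \<forall>y\<in>carrier L. \<forall>a\<in>carrier A. l3 c x y a = r3 c x y a) \<and>
      (\<forall>x\<in>carrier L. \<forall>y\<in>carrier L. \<forall>z\<in>carrier L. l4 c x y z = r4 c x y z)" for c
  proof -
    have "c \<in> cocycles K P 2 \<longleftrightarrow> c \<in> carrier C2 \<and> triplet_cocycle P (triplet_of c)"
      using cocycle_iff[of c] sub by blast
    then show ?thesis
      unfolding triplet_cocycle_def triplet_of_def assoc_cocycle_def derivation_cocycle_def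
        action_cocycle_def leibniz_cocycle_def d prod.case .
  qed
  note cl = multD(1) actD(1) bracketD(1)
  note distr = multD(2,3) actD(2,3) bracketD(2,3)
  note scal = multD(4,5) actD(4,5) bracketD(4,5)
  have add:
    "a \<in> carrier A \<Longrightarrow> b \<in> carrier A \<Longrightarrow> e \<in> carrier A \<Longrightarrow> l1 (c \<oplus>\<^bsub>C2\<^esub> c') a b e = l1 c a b e \<oplus>\<^bsub>A\<^esub> l1 c' a b e"
    "a \<in> carrier A \<Longrightarrow> b \<in> carrier A \<Longrightarrow> e \<in> carrier A \<Longrightarrow> r1 (c \<oplus>\<^bsub>C2\<^esub> c') a b e = r1 c a b e \<oplus>\<^bsub>A\<^esub> r1 c' a b e"
    "x \<in> carrier L \<Longrightarrow> a \<in> carrier A \<Longrightarrow> b \<in> carrier A \<Longrightarrow> l2 (c \<oplus>\<^bsub>C2\<^esub> c') x a b = l2 c x a b \<oplus>\<^bsub>A\<^esub> l2 c' x a b"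
    "x \<in> carrier L \<Longrightarrow> a \<in> carrier A \<Longrightarrow> b \<in> carrier A \<Longrightarrow> r2 (c \<oplus>\<^bsub>C2\<^esub> c') x a b = r2 c x a b \<oplus>\<^bsub>A\<^esub> r2 c' x a b"
    "x \<in> carrier L \<Longrightarrow> y \<in> carrier L \<Longrightarrow> a \<in> carrier A \<Longrightarrow> l3 (c \<oplus>\<^bsub>C2\<^esub> c') x y a = l3 c x y a \<oplus>\<^bsub>A\<^esub> l3 c' x y a"
    "x \<in> carrier L \<Longrightarrow> y \<in> carrier L \<Longrightarrow> a \<in> carrier A \<Longrightarrow> r3 (c \<oplus>\<^bsub>C2\<^esub> c') x y a = r3 c x y a \<oplus>\<^bsub>A\<^esub> r3 c' x y a"
    "x \<in> carrier L \<Longrightarrow> y \<in> carrier L \<Longrightarrow> z \<in> carrier L \<Longrightarrow> l4 (c \<oplus>\<^bsub>C2\<^esub> c') x y z = l4 c x y z \<oplus>\<^bsub>L\<^esub> l4 c' x y z"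
    "x \<in> carrier L \<Longrightarrow> y \<in> carrier L \<Longrightarrow> z \<in> carrier L \<Longrightarrow> r4 (c \<oplus>\<^bsub>C2\<^esub> c') x y z = r4 c x y z \<oplus>\<^bsub>L\<^esub> r4 c' x y z"
    if C: "c \<in> carrier C2" "c' \<in> carrier C2" for c c' a b e x y z
    by (simp_all add: d distr tot_value[OF C(1)] tot_value[OF C(2)] cl A.M.a_ac L.M.a_ac)
  have smult:
    "a \<in> carrier A \<Longrightarrow> b \<in> carrier A \<Longrightarrow> e \<in> carrier A \<Longrightarrow> l1 (k \<odot>\<^bsub>C2\<^esub> c) a b e = k \<odot>\<^bsub>A\<^esub> l1 c a b e"
    "a \<in> carrier A \<Longrightarrow> b \<in> carrier A \<Longrightarrow> e \<in> carrier A \<Longrightarrow> r1 (k \<odot>\<^bsub>C2\<^esub> c) a b e = k \<odot>\<^bsub>A\<^esub> r1 c a b e"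
    "x \<in> carrier L \<Longrightarrow> a \<in> carrier A \<Longrightarrow> b \<in> carrier A \<Longrightarrow> l2 (k \<odot>\<^bsub>C2\<^esub> c) x a b = k \<odot>\<^bsub>A\<^esub> l2 c x a b"
    "x \<in> carrier L \<Longrightarrow> a \<in> carrier A \<Longrightarrow> b \<in> carrier A \<Longrightarrow> r2 (k \<odot>\<^bsub>C2\<^esub> c) x a b = k \<odot>\<^bsub>A\<^esub> r2 c x a b"
    "x \<in> carrier L \<Longrightarrow> y \<in> carrier L \<Longrightarrow> a \<in> carrier A \<Longrightarrow> l3 (k \<odot>\<^bsub>C2\<^esub> c) x y a = k \<odot>\<^bsub>A\<^esub> l3 c x y a"
    "x \<in> carrier L \<Longrightarrow> y \<in> carrier L \<Longrightarrow> a \<in> carrier A \<Longrightarrow> r3 (k \<odot>\<^bsub>C2\<^esub> c) x y a = k \<odot>\<^bsub>A\<^esub> r3 c x y a"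
    "x \<in> carrier L \<Longrightarrow> y \<in> carrier L \<Longrightarrow> z \<in> carrier L \<Longrightarrow> l4 (k \<odot>\<^bsub>C2\<^esub> c) x y z = k \<odot>\<^bsub>L\<^esub> l4 c x y z"
    "x \<in> carrier L \<Longrightarrow> y \<in> carrier L \<Longrightarrow> z \<in> carrier L \<Longrightarrow> r4 (k \<odot>\<^bsub>C2\<^esub> c) x y z = k \<odot>\<^bsub>L\<^esub> r4 c x y z"
    if C: "c \<in> carrier C2" "k \<in> carrier K" for c k a b e x y z
    by (simp_all add: d scal tot_value[OF C(1)] C(2) cl A.smult_r_distr L.smult_r_distr)
  show ?thesis
  proof (rule C.submoduleI_smult)
    show "\<zero>\<^bsub>C2\<^esub> \<in> cocycles K P 2"
      unfolding iff using C.M.zero_closed by (simp add: d zero_op cl)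
  next
    fix c e assume "c \<in> cocycles K P 2" "e \<in> cocycles K P 2"
    then show "c \<oplus>\<^bsub>C2\<^esub> e \<in> cocycles K P 2"
      unfolding iff by (simp add: add C.M.a_closed del: tot_cochains_sel)
  next
    fix k c assume "k \<in> carrier K" "c \<in> cocycles K P 2"
    then show "k \<odot>\<^bsub>C2\<^esub> c \<in> cocycles K P 2"
      unfolding iff by (simp add: smult C.smult_closed del: tot_cochains_sel)
  qed (rule sub)
qed

end

subsection \<open>Coboundaries\<close>

context courant
begin

text \<open>The coboundary of the 1-cochain \<open>(F, \<psi>)\<close>.\<close>

definition coboundary_triplet :: "('a \<Rightarrow> 'a) \<Rightarrow> ('l \<Rightarrow> 'l) \<Rightarrow> ('a, 'l) triplet" where
  "coboundary_triplet F \<psi> =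
     (\<lambda>a b. (a \<otimes>\<^bsub>A\<^esub> F b \<oplus>\<^bsub>A\<^esub> F a \<otimes>\<^bsub>A\<^esub> b) \<ominus>\<^bsub>A\<^esub> F (a \<otimes>\<^bsub>A\<^esub> b),
      \<lambda>x a. (act P x (F a) \<oplus>\<^bsub>A\<^esub> act P (\<psi> x) a) \<ominus>\<^bsub>A\<^esub> F (act P x a),
      \<lambda>x y. (x \<otimes>\<^bsub>L\<^esub> \<psi> y \<oplus>\<^bsub>L\<^esub> \<psi> x \<otimes>\<^bsub>L\<^esub> y) \<ominus>\<^bsub>L\<^esub> \<psi> (x \<otimes>\<^bsub>L\<^esub> y))"

abbreviation "C1' \<equiv> tot_cochains K P (Suc 0)"

lemma C1_iff:
  "e \<in> carrier C1' \<longleftrightarrow> fst e \<in> carrier (multilin K L L (Suc 0)) \<and>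
     snd e (Suc 0) \<in> carrier (multilin K L (multilin K A A (Suc 0)) 0) \<and>
     (\<forall>p. p \<noteq> Suc 0 \<longrightarrow> snd e p = (\<lambda>_ _. \<zero>\<^bsub>A\<^esub>))"
proof -
  have "{1..Suc 0} = {Suc 0}" by auto
  then show ?thesis unfolding tot_cochains_carrier by (auto simp: cochains0_def cochains_def)
qed

context
  fixes F \<psi> assumes F: "F \<in> lin_maps K A A" and \<psi>: "\<psi> \<in> lin_maps K L L"
begin

lemmas FD = lin_mapsD[OF F] lin_mapsD[OF \<psi>]

lemma coboundary_bilinear: "bilinear_triplet (coboundary_triplet F \<psi>)"
  unfolding bilinear_triplet_def coboundary_triplet_def prod.case
  by (intro conjI bilin_mapsI)
    (simp_all add: FD multD actD bracketD A.M.minus_eq L.M.minus_eq A.M.minus_add L.M.minus_add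
      A.M.a_ac L.M.a_ac A.smult_r_distr L.smult_r_distr A.smult_r_minus L.smult_r_minus)

lemma cochain1_exists:
  "\<exists>e\<in>carrier C1'. (\<forall>a\<in>carrier A. snd e (Suc 0) [] [a] = F a) \<and> (\<forall>x\<in>carrier L. fst e [x] = \<psi> x)"
proof -
  define e where "e = ((\<lambda>xs. if xs \<in> tuples L (Suc 0) then \<psi> (xs ! 0) else \<zero>\<^bsub>L\<^esub>),
    (\<lambda>p (xs :: 'l list) as. if p = Suc 0 \<and> xs = [] \<and> as \<in> tuples A (Suc 0) then F (as ! 0) else \<zero>\<^bsub>A\<^esub>))"
  have "fst e \<in> carrier (multilin K L L (Suc 0))"
    unfolding multilin_1 by (intro conjI lin_mapsI) (auto simp: e_def tuples_1 FD)
  moreover have "snd e (Suc 0) \<in> carrier (multilin K L (multilin K A A (Suc 0)) 0)"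
    unfolding multilin_0 multilin_1 by (intro conjI lin_mapsI) (auto simp: e_def tuples_1 FD)
  moreover have "\<forall>p. p \<noteq> Suc 0 \<longrightarrow> snd e p = (\<lambda>_ _. \<zero>\<^bsub>A\<^esub>)" by (auto simp: e_def)
  ultimately have "e \<in> carrier C1'" unfolding C1_iff by blast
  then show ?thesis by (rule bexI[rotated]) (auto simp: e_def tuples_1)
qed

end

text \<open>A 1-cochain is a pair of linear maps \<open>F\<close> on \<open>A\<close> and \<open>\<psi>\<close> on \<open>L\<close>. Its Hochschild coboundaries contribute
  \<open>a F(b) - F(ab) + F(a) b\<close> and \<open>\<psi>(x) \<cdot> a\<close>, and its Leibniz coboundaries contribute the rest.\<close>

lemma d_tot_1:
  assumes e: "e \<in> carrier C1'"
  shows "(\<lambda>a. snd e (Suc 0) [] [a]) \<in> lin_maps K A A" "(\<lambda>x. fst e [x]) \<in> lin_maps K L L"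
    and "d_tot K P (Suc 0) e = cochain_of (coboundary_triplet (\<lambda>a. snd e (Suc 0) [] [a]) (\<lambda>x. fst e [x]))"
proof -
  have parts: "fst e \<in> carrier (multilin K L L (Suc 0))" "snd e (Suc 0) [] \<in> carrier (multilin K A A (Suc 0))"
    "\<And>xs. xs \<noteq> [] \<Longrightarrow> snd e (Suc 0) xs = (\<lambda>_. \<zero>\<^bsub>A\<^esub>)"
    "\<And>xs. xs \<notin> tuples L (Suc 0) \<Longrightarrow> fst e xs = \<zero>\<^bsub>L\<^esub>"
    using e unfolding C1_iff by (auto simp: multilin_0 multilin_1)
  show F: "(\<lambda>a. snd e (Suc 0) [] [a]) \<in> lin_maps K A A" and \<psi>: "(\<lambda>x. fst e [x]) \<in> lin_maps K L L"
    using parts by (auto simp: multilin_1)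
  note D = lin_mapsD[OF F] lin_mapsD[OF \<psi>]
  let ?t = "coboundary_triplet (\<lambda>a. snd e (Suc 0) [] [a]) (\<lambda>x. fst e [x])"
  show "d_tot K P (Suc 0) e = cochain_of ?t"
  proof (rule prod_eqI)
    show "fst (d_tot K P (Suc 0) e) = fst (cochain_of ?t)"
    proof
      fix xs
      have d: "fst (d_tot K P (Suc 0) e) xs
          = leibniz_cobdry K L L (monoid.mult L) (monoid.mult L) (Suc 0) (fst e) xs"
        by (simp add: d_tot_def dL0_def case_prod_beta)
      show "fst (d_tot K P (Suc 0) e) xs = fst (cochain_of ?t) xs"
      proof (cases "xs \<in> tuples L 2")
        case True
        then obtain x y where xs: "xs = [x, y]" "x \<in> carrier L" "y \<in> carrier L" unfolding tuples_2 by blast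
        then show ?thesis
          unfolding d unfolding xs(1) using True
          by (subst L.leibniz_cobdry_1)
            (simp_all add: cochain_of_def tuples_2 coboundary_triplet_def D bracketD L.M.minus_eq)
      next
        case False
        then show ?thesis
          unfolding d by (simp add: leibniz_cobdry_def cochain_of_def coboundary_triplet_def flip: numeral_2_eq_2)
      qed
    qed
    show "snd (d_tot K P (Suc 0) e) = snd (cochain_of ?t)"
    proof (intro ext)
      fix p :: nat and xs as
      consider "p = Suc 0" | "p = 2" | "p \<noteq> Suc 0" "p \<noteq> 2" by blast
      then show "snd (d_tot K P (Suc 0) e) p xs as = snd (cochain_of ?t) p xs as"
      proof cases
        case 1
        have d: "snd (d_tot K P (Suc 0) e) (Suc 0) xs as = dH0 P (fst e) xs as
            \<oplus>\<^bsub>A\<^esub> signed K A (Suc 0) (leibniz_cobdry K L (multilin K A A (Suc 0)) (hom_left_act P (Suc 0))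
              (hom_right_act P (Suc 0)) 0 (snd e (Suc 0)) xs as)"
          by (simp add: d_tot_def dL_def case_prod_beta)
        show ?thesis
        proof (cases "xs \<in> tuples L (Suc 0)")
          case True
          then obtain x where xs: "xs = [x]" "x \<in> carrier L" unfolding tuples_1 by blast
          interpret M: cochain_values K "multilin K A A (Suc 0)"
            by (intro cochain_values.intro multilin_A)
          have d': "snd (d_tot K P (Suc 0) e) (Suc 0) [x] as = dH0 P (fst e) [x] as
            \<oplus>\<^bsub>A\<^esub> signed K A (Suc 0) (signed K A (Suc 0) (\<zero>\<^bsub>A\<^esub> \<oplus>\<^bsub>A\<^esub> signed K A (Suc 0)
              (\<ominus>\<^bsub>A\<^esub> hom_left_act P (Suc 0) x (snd e (Suc 0) []) as) \<oplus>\<^bsub>A\<^esub> \<zero>\<^bsub>A\<^esub>))"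
            using d M.leibniz_cobdry_0[OF xs(2), of "hom_left_act P (Suc 0)" "hom_right_act P (Suc 0)" "snd e (Suc 0)"]
            unfolding xs(1) by (simp add: hom_right_act_def del: M.signed_simps)
          show ?thesis
          proof (cases "as \<in> tuples A (Suc 0)")
            case True
            then obtain a where as: "as = [a]" "a \<in> carrier A" unfolding tuples_1 by blast
            show ?thesis
              unfolding 1 xs(1) d' unfolding as(1) using xs(2) as(2)
              by (simp add: hom_left_act_1 parts dH0_def cochain_of_def tuples_1 coboundary_triplet_def D actD
                  A.M.minus_eq A.M.minus_add A.M.a_ac)
          next
            case False
            then show ?thesis
              unfolding 1 xs(1) d' by (simp add: hom_left_act_def dH0_def cochain_of_def coboundary_triplet_def)
          qed
        next
          case False
          have "act P \<zero>\<^bsub>L\<^esub> (as ! 0) = \<zero>\<^bsub>A\<^esub>" if "as \<in> tuples A (Suc 0)"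
            using that by (auto simp: tuples_1 zero_op)
          then show ?thesis
            unfolding 1 d using False parts(4)[OF False]
            by (simp add: leibniz_cobdry_def dH0_def cochain_of_def coboundary_triplet_def)
        qed
      next
        case 2
        have d: "snd (d_tot K P (Suc 0) e) 2 xs as = hochschild K A (Suc 0) (snd e (Suc 0) xs) as \<oplus>\<^bsub>A\<^esub> \<zero>\<^bsub>A\<^esub>"
          by (simp add: d_tot_def dH_def case_prod_beta)
        show ?thesis
        proof (cases "xs = [] \<and> as \<in> tuples A 2")
          case True
          then obtain a b where "xs = []" "as = [a, b]" "a \<in> carrier A" "b \<in> carrier A" unfolding tuples_2 by blast
          then show ?thesis
            unfolding 2 d
            by (simp add: hochschild_1 cochain_of_def tuples_2 coboundary_triplet_def D multD A.M.minus_eq A.M.a_ac)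
        next
          case False
          then have "hochschild K A (Suc 0) (snd e (Suc 0) xs) as = \<zero>\<^bsub>A\<^esub>"
            using parts(3)[of xs] hochschild_null(1)
            by (cases "xs = []") (simp_all add: hochschild_def flip: numeral_2_eq_2)
          then show ?thesis unfolding 2 d using False by (auto simp: cochain_of_def coboundary_triplet_def)
        qed
      next
        case 3
        then show ?thesis by (auto simp: d_tot_def case_prod_beta cochain_of_def coboundary_triplet_def)
      qed
    qed
  qed
qed

lemma coboundaries_2:
  "coboundaries K P 2 = {cochain_of (coboundary_triplet F \<psi>) |F \<psi>. F \<in> lin_maps K A A \<and> \<psi> \<in> lin_maps K L L}"
proof -
  have B: "coboundaries K P 2 = d_tot K P (Suc 0) ` carrier C1'"
    by (simp add: coboundaries_def numeral_2_eq_2)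
  have "cochain_of (coboundary_triplet F \<psi>) \<in> d_tot K P (Suc 0) ` carrier C1'"
    if F: "F \<in> lin_maps K A A" and \<psi>: "\<psi> \<in> lin_maps K L L" for F \<psi>
  proof -
    obtain e where e: "e \<in> carrier C1'" "\<And>a. a \<in> carrier A \<Longrightarrow> snd e (Suc 0) [] [a] = F a"
      "\<And>x. x \<in> carrier L \<Longrightarrow> fst e [x] = \<psi> x" using cochain1_exists[OF F \<psi>] by blast
    have "cochain_of (coboundary_triplet F \<psi>)
        = cochain_of (coboundary_triplet (\<lambda>a. snd e (Suc 0) [] [a]) (\<lambda>x. fst e [x]))"
      by (rule C2_eqI; (intro cochain_of_closed coboundary_bilinear F \<psi> d_tot_1(1,2) e(1))?)
        (simp_all add: coboundary_triplet_def cochain_of_apply[unfolded One_nat_def] e(2,3) multD actD bracketD)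
    also have "\<dots> = d_tot K P (Suc 0) e" by (rule d_tot_1(3)[OF e(1), symmetric])
    finally show ?thesis using e(1) by blast
  qed
  then show ?thesis unfolding B using d_tot_1 by blast
qed

lemma coboundaries_submodule: "submodule (coboundaries K P 2) K C2"
proof -
  interpret C: module K C2 by (rule module_tot_cochains)
  note cl = cochain_of_closed[OF coboundary_bilinear]
  show ?thesis
  proof (rule C.submoduleI_smult)
    show "coboundaries K P 2 \<subseteq> carrier C2" unfolding coboundaries_2 using cl by blast
    have z: "(\<lambda>_. \<zero>\<^bsub>A\<^esub>) \<in> lin_maps K A A" "(\<lambda>_. \<zero>\<^bsub>L\<^esub>) \<in> lin_maps K L L" by (auto simp: lin_maps_def)
    have "\<zero>\<^bsub>C2\<^esub> = cochain_of (coboundary_triplet (\<lambda>_. \<zero>\<^bsub>A\<^esub>) (\<lambda>_. \<zero>\<^bsub>L\<^esub>))"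
      by (rule C2_eqI[OF C.M.zero_closed cl[OF z]])
        (simp_all add: coboundary_triplet_def cochain_of_apply[unfolded One_nat_def] zero_op A.M.minus_eq L.M.minus_eq)
    then show "\<zero>\<^bsub>C2\<^esub> \<in> coboundaries K P 2" unfolding coboundaries_2 using z by blast
  next
    fix c c' assume "c \<in> coboundaries K P 2" "c' \<in> coboundaries K P 2"
    then obtain F \<psi> F' \<psi>' where F: "F \<in> lin_maps K A A" "\<psi> \<in> lin_maps K L L"
      and F': "F' \<in> lin_maps K A A" "\<psi>' \<in> lin_maps K L L"
      and c: "c = cochain_of (coboundary_triplet F \<psi>)" "c' = cochain_of (coboundary_triplet F' \<psi>')"
      unfolding coboundaries_2 by blast
    note D = FD[OF F] FD[OF F']
    have s: "(\<lambda>a. F a \<oplus>\<^bsub>A\<^esub> F' a) \<in> lin_maps K A A" "(\<lambda>x. \<psi> x \<oplus>\<^bsub>L\<^esub> \<psi>' x) \<in> lin_maps K L L"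
      by (auto intro!: lin_mapsI simp: D A.M.a_ac L.M.a_ac A.smult_r_distr L.smult_r_distr)
    have "c \<oplus>\<^bsub>C2\<^esub> c' = cochain_of (coboundary_triplet (\<lambda>a. F a \<oplus>\<^bsub>A\<^esub> F' a) (\<lambda>x. \<psi> x \<oplus>\<^bsub>L\<^esub> \<psi>' x))"
      unfolding c
      by (rule C2_eqI[OF C.M.a_closed[OF cl[OF F] cl[OF F']] cl[OF s]])
        (simp_all add: coboundary_triplet_def cochain_of_apply[unfolded One_nat_def] D multD actD bracketD
          A.M.minus_eq L.M.minus_eq A.M.minus_add L.M.minus_add A.M.a_ac L.M.a_ac)
    then show "c \<oplus>\<^bsub>C2\<^esub> c' \<in> coboundaries K P 2" unfolding coboundaries_2 using s by blast
  next
    fix k c assume k: "k \<in> carrier K" and "c \<in> coboundaries K P 2"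
    then obtain F \<psi> where F: "F \<in> lin_maps K A A" "\<psi> \<in> lin_maps K L L"
      and c: "c = cochain_of (coboundary_triplet F \<psi>)"
      unfolding coboundaries_2 by blast
    note D = FD[OF F]
    have s: "(\<lambda>a. k \<odot>\<^bsub>A\<^esub> F a) \<in> lin_maps K A A" "(\<lambda>x. k \<odot>\<^bsub>L\<^esub> \<psi> x) \<in> lin_maps K L L"
      using k by (auto intro!: lin_mapsI simp: D A.smult_r_distr L.smult_r_distr A.smult_left_commute[of k]
          L.smult_left_commute[of k])
    have "k \<odot>\<^bsub>C2\<^esub> c = cochain_of (coboundary_triplet (\<lambda>a. k \<odot>\<^bsub>A\<^esub> F a) (\<lambda>x. k \<odot>\<^bsub>L\<^esub> \<psi> x))"
      unfolding c
      by (rule C2_eqI[OF C.smult_closed[OF k cl[OF F]] cl[OF s]])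
        (use k in \<open>simp_all add: coboundary_triplet_def cochain_of_apply[unfolded One_nat_def] D multD actD bracketD
          A.M.minus_eq L.M.minus_eq A.smult_r_distr L.smult_r_distr A.smult_r_minus L.smult_r_minus\<close>)
    then show "k \<odot>\<^bsub>C2\<^esub> c \<in> coboundaries K P 2" unfolding coboundaries_2 using s by blast
  qed
qed

lemma diff_eq_iff:
  "x \<in> carrier A \<Longrightarrow> y \<in> carrier A \<Longrightarrow> z \<in> carrier A \<Longrightarrow> w \<in> carrier A
    \<Longrightarrow> x = (y \<ominus>\<^bsub>A\<^esub> z) \<oplus>\<^bsub>A\<^esub> w \<longleftrightarrow> x \<oplus>\<^bsub>A\<^esub> z = y \<oplus>\<^bsub>A\<^esub> w"
  for x y z w
proof -
  assume *: "x \<in> carrier A" "y \<in> carrier A" "z \<in> carrier A" "w \<in> carrier A"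
  have "(y \<ominus>\<^bsub>A\<^esub> z) \<oplus>\<^bsub>A\<^esub> w \<oplus>\<^bsub>A\<^esub> z = y \<oplus>\<^bsub>A\<^esub> w"
    using * by (simp add: A.M.minus_eq A.M.a_assoc A.M.a_comm[of w z] A.M.r_neg1 A.M.r_neg2)
  then show ?thesis using * by (metis A.M.add.r_cancel A.M.a_closed A.M.minus_closed)
qed

lemma diff_eq_iff_L:
  "x \<in> carrier L \<Longrightarrow> y \<in> carrier L \<Longrightarrow> z \<in> carrier L \<Longrightarrow> w \<in> carrier L
    \<Longrightarrow> x = (y \<ominus>\<^bsub>L\<^esub> z) \<oplus>\<^bsub>L\<^esub> w \<longleftrightarrow> x \<oplus>\<^bsub>L\<^esub> z = y \<oplus>\<^bsub>L\<^esub> w"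
  for x y z w
proof -
  assume *: "x \<in> carrier L" "y \<in> carrier L" "z \<in> carrier L" "w \<in> carrier L"
  have "(y \<ominus>\<^bsub>L\<^esub> z) \<oplus>\<^bsub>L\<^esub> w \<oplus>\<^bsub>L\<^esub> z = y \<oplus>\<^bsub>L\<^esub> w"
    using * by (simp add: L.M.minus_eq L.M.a_assoc L.M.a_comm[of w z] L.M.r_neg1 L.M.r_neg2)
  then show ?thesis using * by (metis L.M.add.r_cancel L.M.a_closed L.M.minus_closed)
qed

text \<open>The coset relation of the cohomology module, in terms of triplets. Subtracted terms of the coboundary
  are moved to the other side as in the definition of \<open>cohomologous\<close>.\<close>

lemma coset_iff_cohomologous:
  assumes c: "c \<in> carrier C2" and c': "c' \<in> carrier C2"
  shows "c \<in> coboundaries K P 2 +>\<^bsub>C2\<^esub> c' \<longleftrightarrow> cohomologous K P (triplet_of c) (triplet_of c')"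
proof -
  interpret C: module K C2 by (rule module_tot_cochains)
  have eq: "c = cochain_of (coboundary_triplet F \<psi>) \<oplus>\<^bsub>C2\<^esub> c' \<longleftrightarrow>
     (\<forall>a\<in>carrier A. \<forall>e\<in>carrier A. snd c 2 [] [a, e] \<oplus>\<^bsub>A\<^esub> F (a \<otimes>\<^bsub>A\<^esub> e)
        = (a \<otimes>\<^bsub>A\<^esub> F e \<oplus>\<^bsub>A\<^esub> F a \<otimes>\<^bsub>A\<^esub> e) \<oplus>\<^bsub>A\<^esub> snd c' 2 [] [a, e]) \<and>
     (\<forall>x\<in>carrier L. \<forall>a\<in>carrier A. snd c 1 [x] [a] \<oplus>\<^bsub>A\<^esub> F (act P x a)
        = (act P x (F a) \<oplus>\<^bsub>A\<^esub> act P (\<psi> x) a) \<oplus>\<^bsub>A\<^esub> snd c' 1 [x] [a]) \<and>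
     (\<forall>x\<in>carrier L. \<forall>y\<in>carrier L. fst c [x, y] \<oplus>\<^bsub>L\<^esub> \<psi> (x \<otimes>\<^bsub>L\<^esub> y)
        = (x \<otimes>\<^bsub>L\<^esub> \<psi> y \<oplus>\<^bsub>L\<^esub> \<psi> x \<otimes>\<^bsub>L\<^esub> y) \<oplus>\<^bsub>L\<^esub> fst c' [x, y])"
    (is "_ \<longleftrightarrow> ?r1 \<and> ?r2 \<and> ?r3")
    if F: "F \<in> lin_maps K A A" and \<psi>: "\<psi> \<in> lin_maps K L L" for F \<psi>
  proof -
    let ?h = "cochain_of (coboundary_triplet F \<psi>)"
    have h: "?h \<in> carrier C2" by (rule cochain_of_closed[OF coboundary_bilinear[OF F \<psi>]])
    note cl = tot_value[OF c] tot_value[OF c'] FD[OF F \<psi>] multD(1) actD(1) bracketD(1) A.M.a_closed L.M.a_closed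
    have hv: "a \<in> carrier A \<Longrightarrow> e \<in> carrier A \<Longrightarrow> snd ?h 2 [] [a, e] = (a \<otimes>\<^bsub>A\<^esub> F e \<oplus>\<^bsub>A\<^esub> F a \<otimes>\<^bsub>A\<^esub> e) \<ominus>\<^bsub>A\<^esub> F (a \<otimes>\<^bsub>A\<^esub> e)"
      "x \<in> carrier L \<Longrightarrow> a \<in> carrier A \<Longrightarrow> snd ?h 1 [x] [a] = (act P x (F a) \<oplus>\<^bsub>A\<^esub> act P (\<psi> x) a) \<ominus>\<^bsub>A\<^esub> F (act P x a)"
      "x \<in> carrier L \<Longrightarrow> y \<in> carrier L \<Longrightarrow> fst ?h [x, y] = (x \<otimes>\<^bsub>L\<^esub> \<psi> y \<oplus>\<^bsub>L\<^esub> \<psi> x \<otimes>\<^bsub>L\<^esub> y) \<ominus>\<^bsub>L\<^esub> \<psi> (x \<otimes>\<^bsub>L\<^esub> y)"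
      for a e x y
      unfolding coboundary_triplet_def by (simp_all only: cochain_of_apply)
    have "c = ?h \<oplus>\<^bsub>C2\<^esub> c' \<longleftrightarrow>
      (\<forall>a\<in>carrier A. \<forall>e\<in>carrier A. snd c 2 [] [a, e] = snd ?h 2 [] [a, e] \<oplus>\<^bsub>A\<^esub> snd c' 2 [] [a, e]) \<and>
      (\<forall>x\<in>carrier L. \<forall>a\<in>carrier A. snd c 1 [x] [a] = snd ?h 1 [x] [a] \<oplus>\<^bsub>A\<^esub> snd c' 1 [x] [a]) \<and>
      (\<forall>x\<in>carrier L. \<forall>y\<in>carrier L. fst c [x, y] = fst ?h [x, y] \<oplus>\<^bsub>L\<^esub> fst c' [x, y])"
      (is "_ \<longleftrightarrow> ?e")
    proof
      assume "c = ?h \<oplus>\<^bsub>C2\<^esub> c'"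
      then have "snd c = snd (?h \<oplus>\<^bsub>C2\<^esub> c')" "fst c = fst (?h \<oplus>\<^bsub>C2\<^esub> c')" by simp_all
      then show ?e by simp
    next
      assume ?e
      then show "c = ?h \<oplus>\<^bsub>C2\<^esub> c'"
        by (intro C2_eqI[OF c C.M.a_closed[OF h c']]) simp_all
    qed
    also have "\<dots> \<longleftrightarrow> ?r1 \<and> ?r2 \<and> ?r3"
    proof (intro conj_cong ball_cong refl)
      fix a e assume *: "a \<in> carrier A" "e \<in> carrier A"
      show "snd c 2 [] [a, e] = snd ?h 2 [] [a, e] \<oplus>\<^bsub>A\<^esub> snd c' 2 [] [a, e] \<longleftrightarrow>
          snd c 2 [] [a, e] \<oplus>\<^bsub>A\<^esub> F (a \<otimes>\<^bsub>A\<^esub> e) = (a \<otimes>\<^bsub>A\<^esub> F e \<oplus>\<^bsub>A\<^esub> F a \<otimes>\<^bsub>A\<^esub> e) \<oplus>\<^bsub>A\<^esub> snd c' 2 [] [a, e]"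
        unfolding hv(1)[OF *] by (rule diff_eq_iff) (use * in \<open>simp_all add: cl\<close>)
    next
      fix x a assume *: "x \<in> carrier L" "a \<in> carrier A"
      show "snd c 1 [x] [a] = snd ?h 1 [x] [a] \<oplus>\<^bsub>A\<^esub> snd c' 1 [x] [a] \<longleftrightarrow>
          snd c 1 [x] [a] \<oplus>\<^bsub>A\<^esub> F (act P x a) = (act P x (F a) \<oplus>\<^bsub>A\<^esub> act P (\<psi> x) a) \<oplus>\<^bsub>A\<^esub> snd c' 1 [x] [a]"
        unfolding hv(2)[OF *] by (rule diff_eq_iff) (use * in \<open>simp_all add: cl\<close>)
    next
      fix x y assume *: "x \<in> carrier L" "y \<in> carrier L"
      show "fst c [x, y] = fst ?h [x, y] \<oplus>\<^bsub>L\<^esub> fst c' [x, y] \<longleftrightarrow>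
          fst c [x, y] \<oplus>\<^bsub>L\<^esub> \<psi> (x \<otimes>\<^bsub>L\<^esub> y) = (x \<otimes>\<^bsub>L\<^esub> \<psi> y \<oplus>\<^bsub>L\<^esub> \<psi> x \<otimes>\<^bsub>L\<^esub> y) \<oplus>\<^bsub>L\<^esub> fst c' [x, y]"
        unfolding hv(3)[OF *] by (rule diff_eq_iff_L) (use * in \<open>simp_all add: cl\<close>)
    qed
    finally show ?thesis .
  qed
  have "c \<in> coboundaries K P 2 +>\<^bsub>C2\<^esub> c' \<longleftrightarrow> (\<exists>F\<in>lin_maps K A A. \<exists>\<psi>\<in>lin_maps K L L.
      c = cochain_of (coboundary_triplet F \<psi>) \<oplus>\<^bsub>C2\<^esub> c')"
    unfolding a_r_coset_def' coboundaries_2 by (simp only: UN_iff singleton_iff) blast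
  also have "\<dots> \<longleftrightarrow> cohomologous K P (triplet_of c) (triplet_of c')"
    unfolding cohomologous_def triplet_of_def prod.case
    by (intro bex_cong refl) (rule eq)
  finally show ?thesis .
qed

lemma subquotient_H: "subquotient K C2 (coboundaries K P 2) (cocycles K P 2)"
  by (intro subquotient.intro module_tot_cochains subquotient_axioms.intro
      coboundaries_submodule cocycles_submodule)

end

section \<open>Push-outs of the deformation \<open>\<eta>\<^sub>1\<close>\<close>

lemma module_dual_space:
  assumes "cring K" shows "module K (dual_space K V)"
proof -
  interpret K: cring K by fact
  have val: "f x \<in> carrier K" if "f \<in> carrier (dual_space K V)" for f x
    using that by (cases "x \<in> carrier V") (auto simp: dual_space_def)
  have smult: "(\<lambda>x. k \<otimes>\<^bsub>K\<^esub> f x) \<in> carrier (dual_space K V)"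
    if "k \<in> carrier K" "f \<in> carrier (dual_space K V)" for k f
    using that by (auto simp: dual_space_def K.r_distr K.m_lcomm Pi_iff)
  show ?thesis
  proof (rule moduleI)
    show "abelian_group (dual_space K V)"
    proof (rule abelian_groupI)
      fix f assume f: "f \<in> carrier (dual_space K V)"
      have "(\<lambda>x. (\<ominus>\<^bsub>K\<^esub> \<one>\<^bsub>K\<^esub>) \<otimes>\<^bsub>K\<^esub> f x) \<in> carrier (dual_space K V)" by (rule smult[OF _ f]) simp
      moreover have "(\<lambda>x. (\<ominus>\<^bsub>K\<^esub> \<one>\<^bsub>K\<^esub>) \<otimes>\<^bsub>K\<^esub> f x) \<oplus>\<^bsub>dual_space K V\<^esub> f = \<zero>\<^bsub>dual_space K V\<^esub>"
        using val[OF f] by (simp add: dual_space_def K.l_minus K.l_neg)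
      ultimately show "\<exists>g\<in>carrier (dual_space K V). g \<oplus>\<^bsub>dual_space K V\<^esub> f = \<zero>\<^bsub>dual_space K V\<^esub>" by blast
    next
      fix f g assume "f \<in> carrier (dual_space K V)" "g \<in> carrier (dual_space K V)"
      then show "f \<oplus>\<^bsub>dual_space K V\<^esub> g \<in> carrier (dual_space K V)"
        by (auto simp: dual_space_def K.r_distr K.a_ac Pi_iff)
    next
      show "\<zero>\<^bsub>dual_space K V\<^esub> \<in> carrier (dual_space K V)" by (auto simp: dual_space_def)
    next
      fix f g h assume "f \<in> carrier (dual_space K V)" "g \<in> carrier (dual_space K V)" "h \<in> carrier (dual_space K V)"
      from this[THEN val] show "f \<oplus>\<^bsub>dual_space K V\<^esub> g \<oplus>\<^bsub>dual_space K V\<^esub> h = f \<oplus>\<^bsub>dual_space K V\<^esub> (g \<oplus>\<^bsub>dual_space K V\<^esub> h)"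
        by (simp add: dual_space_def K.a_assoc)
    next
      fix f g assume "f \<in> carrier (dual_space K V)" "g \<in> carrier (dual_space K V)"
      from this[THEN val] show "f \<oplus>\<^bsub>dual_space K V\<^esub> g = g \<oplus>\<^bsub>dual_space K V\<^esub> f"
        by (simp add: dual_space_def K.a_comm)
    next
      fix f assume "f \<in> carrier (dual_space K V)"
      from this[THEN val] show "\<zero>\<^bsub>dual_space K V\<^esub> \<oplus>\<^bsub>dual_space K V\<^esub> f = f" by (simp add: dual_space_def)
    qed
  next
    fix k f assume "k \<in> carrier K" "f \<in> carrier (dual_space K V)"
    then show "k \<odot>\<^bsub>dual_space K V\<^esub> f \<in> carrier (dual_space K V)" using smult[of k f] by (simp add: dual_space_def)
  next
    fix k l f assume *: "k \<in> carrier K" "l \<in> carrier K" "f \<in> carrier (dual_space K V)"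
    note v = val[OF *(3)]
    show "(k \<oplus>\<^bsub>K\<^esub> l) \<odot>\<^bsub>dual_space K V\<^esub> f = k \<odot>\<^bsub>dual_space K V\<^esub> f \<oplus>\<^bsub>dual_space K V\<^esub> l \<odot>\<^bsub>dual_space K V\<^esub> f"
      using * v by (simp add: dual_space_def K.l_distr)
    show "(k \<otimes>\<^bsub>K\<^esub> l) \<odot>\<^bsub>dual_space K V\<^esub> f = k \<odot>\<^bsub>dual_space K V\<^esub> (l \<odot>\<^bsub>dual_space K V\<^esub> f)"
      using * v by (simp add: dual_space_def K.m_assoc)
  next
    fix k f g assume *: "k \<in> carrier K" "f \<in> carrier (dual_space K V)" "g \<in> carrier (dual_space K V)"
    show "k \<odot>\<^bsub>dual_space K V\<^esub> (f \<oplus>\<^bsub>dual_space K V\<^esub> g) = k \<odot>\<^bsub>dual_space K V\<^esub> f \<oplus>\<^bsub>dual_space K V\<^esub> k \<odot>\<^bsub>dual_space K V\<^esub> g"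
      using * val[OF *(2)] val[OF *(3)] by (simp add: dual_space_def K.r_distr)
  next
    fix f assume "f \<in> carrier (dual_space K V)"
    from val[OF this] show "\<one>\<^bsub>K\<^esub> \<odot>\<^bsub>dual_space K V\<^esub> f = f" by (simp add: dual_space_def)
  qed (rule assms)
qed

lemma algebra_trivial_ext:
  assumes "module K V" shows "algebra K (trivial_ext K V)"
proof -
  interpret V: module K V by fact
  have abel: "abelian_group (trivial_ext K V)"
  proof (rule abelian_groupI)
    fix x assume "x \<in> carrier (trivial_ext K V)"
    then show "\<exists>y\<in>carrier (trivial_ext K V). y \<oplus>\<^bsub>trivial_ext K V\<^esub> x = \<zero>\<^bsub>trivial_ext K V\<^esub>"
      by (intro bexI[of _ "(\<ominus>\<^bsub>K\<^esub> fst x, \<ominus>\<^bsub>V\<^esub> snd x)"])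
        (auto simp: trivial_ext_def V.R.l_neg V.M.l_neg)
  qed (auto simp: trivial_ext_def V.R.a_ac V.M.a_ac)
  have comm: "comm_monoid (trivial_ext K V)"
    by (rule comm_monoidI)
      (auto simp: trivial_ext_def V.R.m_ac V.M.a_ac V.smult_r_distr V.smult_assoc1[symmetric])
  have cring: "cring (trivial_ext K V)"
    by (rule cringI[OF abel comm])
      (auto simp: trivial_ext_def V.R.l_distr V.smult_l_distr V.smult_r_distr V.M.a_ac)
  show ?thesis
    by (rule algebraI[OF V.R.is_cring cring])
      (auto simp: trivial_ext_def V.R.l_distr V.R.r_distr V.R.m_ac V.smult_l_distr V.smult_r_distr
        V.smult_assoc1 V.smult_left_commute)
qed

lemma (in scalar_ext) scalar_bilinear_sum:
  assumes "module K U" "module K U'" and w0: "w0 \<in> bilin_maps K U U' V"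
    and w: "\<And>i. i \<in> I \<Longrightarrow> w i \<in> bilin_maps K U U' V" and s: "\<And>i. i \<in> I \<Longrightarrow> s i \<in> carrier R" and I: "finite I"
  shows "scalar_bilinear K R U U' E (\<lambda>a b. tens \<one>\<^bsub>R\<^esub> (w0 a b) \<oplus>\<^bsub>E\<^esub> (\<Oplus>\<^bsub>E\<^esub>i\<in>I. tens (s i) (w i a b)))"
proof -
  note D0 = bilin_mapsD[OF w0] and D = bilin_mapsD[OF w]
  have cl: "(\<Oplus>\<^bsub>E\<^esub>i\<in>I. tens (s i) (w i a b)) \<in> carrier E" if "a \<in> carrier U" "b \<in> carrier U'" for a b
    by (rule E.finsum_closed) (use that s D in auto)
  have tens_k: "tens x (k \<odot>\<^bsub>V\<^esub> v) = (k \<odot>\<^bsub>R\<^esub> \<one>\<^bsub>R\<^esub>) \<odot>\<^bsub>E\<^esub> tens x v"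
    if "k \<in> carrier K" "x \<in> carrier R" "v \<in> carrier V" for k x v
    using that by (simp add: R.smult_assoc2 flip: pure_smult)
  have addr: "(\<Oplus>\<^bsub>E\<^esub>i\<in>I. tens (s i) (w i a (b \<oplus>\<^bsub>U'\<^esub> b')))
      = (\<Oplus>\<^bsub>E\<^esub>i\<in>I. tens (s i) (w i a b)) \<oplus>\<^bsub>E\<^esub> (\<Oplus>\<^bsub>E\<^esub>i\<in>I. tens (s i) (w i a b'))"
    if "a \<in> carrier U" "b \<in> carrier U'" "b' \<in> carrier U'" for a b b'
  proof -
    have "(\<Oplus>\<^bsub>E\<^esub>i\<in>I. tens (s i) (w i a (b \<oplus>\<^bsub>U'\<^esub> b'))) = (\<Oplus>\<^bsub>E\<^esub>i\<in>I. tens (s i) (w i a b) \<oplus>\<^bsub>E\<^esub> tens (s i) (w i a b'))"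
      by (rule E.finsum_cong') (use that s D in \<open>simp_all add: pure_add_right\<close>)
    also have "\<dots> = (\<Oplus>\<^bsub>E\<^esub>i\<in>I. tens (s i) (w i a b)) \<oplus>\<^bsub>E\<^esub> (\<Oplus>\<^bsub>E\<^esub>i\<in>I. tens (s i) (w i a b'))"
      by (rule E.finsum_addf) (use that s D in auto)
    finally show ?thesis .
  qed
  have addl: "(\<Oplus>\<^bsub>E\<^esub>i\<in>I. tens (s i) (w i (a \<oplus>\<^bsub>U\<^esub> a') b))
      = (\<Oplus>\<^bsub>E\<^esub>i\<in>I. tens (s i) (w i a b)) \<oplus>\<^bsub>E\<^esub> (\<Oplus>\<^bsub>E\<^esub>i\<in>I. tens (s i) (w i a' b))"
    if "a \<in> carrier U" "a' \<in> carrier U" "b \<in> carrier U'" for a a' b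
  proof -
    have "(\<Oplus>\<^bsub>E\<^esub>i\<in>I. tens (s i) (w i (a \<oplus>\<^bsub>U\<^esub> a') b)) = (\<Oplus>\<^bsub>E\<^esub>i\<in>I. tens (s i) (w i a b) \<oplus>\<^bsub>E\<^esub> tens (s i) (w i a' b))"
      by (rule E.finsum_cong') (use that s D in \<open>simp_all add: pure_add_right\<close>)
    also have "\<dots> = (\<Oplus>\<^bsub>E\<^esub>i\<in>I. tens (s i) (w i a b)) \<oplus>\<^bsub>E\<^esub> (\<Oplus>\<^bsub>E\<^esub>i\<in>I. tens (s i) (w i a' b))"
      by (rule E.finsum_addf) (use that s D in auto)
    finally show ?thesis .
  qed
  have scal: "(\<Oplus>\<^bsub>E\<^esub>i\<in>I. tens (s i) (k \<odot>\<^bsub>V\<^esub> w i a b))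
      = (k \<odot>\<^bsub>R\<^esub> \<one>\<^bsub>R\<^esub>) \<odot>\<^bsub>E\<^esub> (\<Oplus>\<^bsub>E\<^esub>i\<in>I. tens (s i) (w i a b))"
    if "k \<in> carrier K" "a \<in> carrier U" "b \<in> carrier U'" for k a b
  proof -
    have "(\<Oplus>\<^bsub>E\<^esub>i\<in>I. tens (s i) (k \<odot>\<^bsub>V\<^esub> w i a b)) = (\<Oplus>\<^bsub>E\<^esub>i\<in>I. (k \<odot>\<^bsub>R\<^esub> \<one>\<^bsub>R\<^esub>) \<odot>\<^bsub>E\<^esub> tens (s i) (w i a b))"
      by (rule E.finsum_cong') (use that s D in \<open>auto simp: tens_k simp del: smult_pure intro!: E.smult_closed\<close>)
    also have "\<dots> = (k \<odot>\<^bsub>R\<^esub> \<one>\<^bsub>R\<^esub>) \<odot>\<^bsub>E\<^esub> (\<Oplus>\<^bsub>E\<^esub>i\<in>I. tens (s i) (w i a b))"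
      by (rule additive_finsum[OF abelian_E abelian_E smult_additive, symmetric]) (use that s D in auto)
    finally show ?thesis .
  qed
  have scall: "(\<Oplus>\<^bsub>E\<^esub>i\<in>I. tens (s i) (w i (k \<odot>\<^bsub>U\<^esub> a) b)) = (\<Oplus>\<^bsub>E\<^esub>i\<in>I. tens (s i) (k \<odot>\<^bsub>V\<^esub> w i a b))"
    "(\<Oplus>\<^bsub>E\<^esub>i\<in>I. tens (s i) (w i a (k \<odot>\<^bsub>U'\<^esub> b))) = (\<Oplus>\<^bsub>E\<^esub>i\<in>I. tens (s i) (k \<odot>\<^bsub>V\<^esub> w i a b))"
    if "k \<in> carrier K" "a \<in> carrier U" "b \<in> carrier U'" for k a b
    by (rule E.finsum_cong'; use that s D in \<open>auto simp: Pi_iff\<close>)+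
  show ?thesis
    unfolding scalar_bilinear_def
    by (intro conjI ballI additiveI)
      (simp_all add: cl addl addr scall scal D0 pure_add_right tens_k E.smult_r_distr E.a_ac del: smult_pure)
qed

text \<open>On pure tensors, base change along \<open>\<phi>\<close> applies \<open>\<phi>\<close> to the scalars. So the coordinate \<open>\<theta>\<^sub>i\<close> of a base
  change is the coordinate with respect to the functional \<open>\<theta>\<^sub>i \<circ> \<phi>\<close>.\<close>

lemma (in inf_mod) aug_tensor_base_change:
  assumes S: "algebra K S" and \<phi>: "\<phi> \<in> lin_maps K S R" and f: "functional K R f"
  shows "additive_map (ext_scal K S V) V (\<lambda>u. aug_tensor V f (base_change K R V \<phi> u))"
    and "additive_map (ext_scal K S V) EV (base_change K R V \<phi>)"
    and "s \<in> carrier S \<Longrightarrow> v \<in> carrier V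
      \<Longrightarrow> aug_tensor V f (base_change K R V \<phi> (pure_tensor K S V s v)) = f (\<phi> s) \<odot>\<^bsub>V\<^esub> v"
proof -
  interpret S: scalar_ext K S V by (intro scalar_ext.intro S V.module_axioms)
  note \<phi>D = lin_mapsD[OF \<phi>]
  have bal: "balanced K S V (tensor_prod K R V) (\<lambda>r v. pure_tensor K R V (\<phi> r) v)"
    by (rule balancedI)
      (auto simp: E.tensor_prod_sel \<phi>D E.T.pure_add_left E.T.pure_add_right E.T.pure_smult)
  have add: "additive_map (ext_scal K S V) (tensor_prod K R V) (base_change K R V \<phi>)"
    unfolding base_change_def by (rule S.tensor_lift_additive[OF E.abelian_E0 bal])
  show add': "additive_map (ext_scal K S V) EV (base_change K R V \<phi>)"
    using add by (simp add: additive_map_def E.tensor_prod_sel E.ext_scal_sel)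
  show "additive_map (ext_scal K S V) V (\<lambda>u. aug_tensor V f (base_change K R V \<phi> u))"
    by (rule additive_comp[OF add' aug_tensor_additive[OF f]])
  assume s: "s \<in> carrier S" "v \<in> carrier V"
  have "base_change K R V \<phi> (pure_tensor K S V s v) = E.tens (\<phi> s) v"
    unfolding base_change_def by (rule S.tensor_lift_pure[OF E.abelian_E0 bal s])
  then show "aug_tensor V f (base_change K R V \<phi> (pure_tensor K S V s v)) = f (\<phi> s) \<odot>\<^bsub>V\<^esub> v"
    using s by (simp add: aug_tensor_pure f \<phi>D)
qed

text \<open>One operation of a push-out of a first order deformation \<open>w\<^sub>0 + \<Sum>\<^sub>j s\<^sub>j \<otimes> w\<^sub>j\<close>. On \<open>1 \<otimes> a\<close> and \<open>1 \<otimes> b\<close> the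
  push-out has the value \<open>1 \<otimes> w\<^sub>0(a,b) + \<Sum>\<^sub>j \<phi>(s\<^sub>j) \<otimes> w\<^sub>j(a,b)\<close>, to which \<open>\<theta>\<^sub>i\<close> is applied. The components
  \<open>c i\<close> are given in advance because the sum is a value of a linear choice of cocycles later on.\<close>

lemma (in inf_base) push_out_op:
  fixes S :: "('k, 's) module" and n :: nat
  assumes S: "algebra K S" and \<phi>: "\<phi> \<in> lin_maps K S R" and \<phi>1: "\<phi> \<one>\<^bsub>S\<^esub> = \<one>\<^bsub>R\<^esub>"
    and mods: "module K U" "module K U'" "module K V"
    and w0: "w0 \<in> bilin_maps K U U' V" and w: "\<And>j. j < n \<Longrightarrow> w j \<in> bilin_maps K U U' V"
    and s: "\<And>j. j < n \<Longrightarrow> s j \<in> carrier S" and s0: "\<And>j. j < n \<Longrightarrow> \<epsilon> (\<phi> (s j)) = \<zero>\<^bsub>K\<^esub>"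
    and c: "\<And>i. i < d \<Longrightarrow> c i \<in> bilin_maps K U U' V"
    and c_eq: "\<And>i a b. i < d \<Longrightarrow> a \<in> carrier U \<Longrightarrow> b \<in> carrier U'
        \<Longrightarrow> c i a b = (\<Oplus>\<^bsub>V\<^esub>j\<in>{..<n}. \<theta> i (\<phi> (s j)) \<odot>\<^bsub>V\<^esub> w j a b)"
  defines "m \<equiv> bilin_ext S (ext_scal K S V) (\<lambda>a b. pure_tensor K S V \<one>\<^bsub>S\<^esub> (w0 a b)
      \<oplus>\<^bsub>ext_scal K S V\<^esub> (\<Oplus>\<^bsub>ext_scal K S V\<^esub>j\<in>{..<n}. pure_tensor K S V (s j) (w j a b)))"
  defines "p \<equiv> bilin_ext R (ext_scal K R V) (\<lambda>a b. base_change K R V \<phi>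
      (m (pure_tensor K S U \<one>\<^bsub>S\<^esub> a) (pure_tensor K S U' \<one>\<^bsub>S\<^esub> b)))"
  shows "inf_op K R \<epsilon> d r \<theta> U U' V w0 p"
    and "\<And>i a b. i < d \<Longrightarrow> a \<in> carrier U \<Longrightarrow> b \<in> carrier U' \<Longrightarrow> inf_op.comp K R \<theta> U U' V p i a b = c i a b"
proof -
  interpret V: inf_mod K R \<epsilon> d r \<theta> V by (intro inf_mod.intro inf_base_axioms mods)
  interpret SU: scalar_ext K S U by (intro scalar_ext.intro S mods)
  interpret SU': scalar_ext K S U' by (intro scalar_ext.intro S mods)
  interpret SV: scalar_ext K S V by (intro scalar_ext.intro S mods)
  let ?E = "ext_scal K S V"
  let ?\<beta> = "\<lambda>a b. SV.tens \<one>\<^bsub>S\<^esub> (w0 a b) \<oplus>\<^bsub>?E\<^esub> (\<Oplus>\<^bsub>?E\<^esub>j\<in>{..<n}. SV.tens (s j) (w j a b))"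
  have sb: "scalar_bilinear K S U U' ?E ?\<beta>"
    by (rule SV.scalar_bilinear_sum) (use mods w0 w s in auto)
  interpret bilinear_ext K S U U' ?E ?\<beta>
    by (intro bilinear_ext.intro bilinear_ext_axioms.intro SU.scalar_ext_axioms SU'.scalar_ext_axioms SV.module_E sb)
  have one: "\<one>\<^bsub>S\<^esub> \<in> carrier S" by simp
  have m1: "m (SU.tens \<one>\<^bsub>S\<^esub> a) (SU'.tens \<one>\<^bsub>S\<^esub> b) = ?\<beta> a b" if "a \<in> carrier U" "b \<in> carrier U'" for a b
    unfolding m_def bilin_ext_pure[OF one that(1) one that(2)]
    using \<beta>_closed[OF that] by simp
  have sum_cl: "(\<Oplus>\<^bsub>?E\<^esub>j\<in>{..<n}. SV.tens (s j) (w j a b)) \<in> carrier ?E" if "a \<in> carrier U" "b \<in> carrier U'" for a b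
    by (rule SV.E.finsum_closed) (use that s bilin_mapsD(1)[OF w] in auto)
  have T: "aug_tensor V f (base_change K R V \<phi> (?\<beta> a b))
      = f \<one>\<^bsub>R\<^esub> \<odot>\<^bsub>V\<^esub> w0 a b \<oplus>\<^bsub>V\<^esub> (\<Oplus>\<^bsub>V\<^esub>j\<in>{..<n}. f (\<phi> (s j)) \<odot>\<^bsub>V\<^esub> w j a b)"
    if f: "functional K R f" and ab: "a \<in> carrier U" "b \<in> carrier U'" for f a b
  proof -
    let ?T = "\<lambda>u. aug_tensor V f (base_change K R V \<phi> u)"
    note bc = V.aug_tensor_base_change[OF S \<phi> f]
    have "?T (\<Oplus>\<^bsub>?E\<^esub>j\<in>{..<n}. SV.tens (s j) (w j a b)) = (\<Oplus>\<^bsub>V\<^esub>j\<in>{..<n}. ?T (SV.tens (s j) (w j a b)))"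
      by (rule additive_finsum[OF SV.abelian_E V.abelian_V bc(1)]) (use ab s bilin_mapsD(1)[OF w] in auto)
    also have "\<dots> = (\<Oplus>\<^bsub>V\<^esub>j\<in>{..<n}. f (\<phi> (s j)) \<odot>\<^bsub>V\<^esub> w j a b)"
      by (rule V.V.M.finsum_cong')
        (use ab s bilin_mapsD(1)[OF w] functionalD(2)[OF f] lin_mapsD(1)[OF \<phi>] in \<open>auto simp: bc(3)\<close>)
    finally show ?thesis
      using additive_add[OF bc(1) _ sum_cl[OF ab], of "SV.tens \<one>\<^bsub>S\<^esub> (w0 a b)"] bilin_mapsD(1)[OF w0 ab]
      by (simp add: bc(3) \<phi>1)
  qed
  have \<beta>: "base_change K R V \<phi> (?\<beta> a b) \<in> carrier V.EV"
    "aug_tensor V \<epsilon> (base_change K R V \<phi> (?\<beta> a b)) = w0 a b"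
    "i < d \<Longrightarrow> aug_tensor V (\<theta> i) (base_change K R V \<phi> (?\<beta> a b)) = c i a b"
    if ab: "a \<in> carrier U" "b \<in> carrier U'" for i a b
  proof -
    show "base_change K R V \<phi> (?\<beta> a b) \<in> carrier V.EV"
      by (rule additive_closed[OF V.aug_tensor_base_change(2)[OF S \<phi> functional_\<epsilon>] \<beta>_closed[OF ab]])
    have "(\<Oplus>\<^bsub>V\<^esub>j\<in>{..<n}. \<epsilon> (\<phi> (s j)) \<odot>\<^bsub>V\<^esub> w j a b) = (\<Oplus>\<^bsub>V\<^esub>j\<in>{..<n}. \<zero>\<^bsub>V\<^esub>)"
      by (rule V.V.M.finsum_cong') (use ab s0 bilin_mapsD(1)[OF w] in auto)
    then show "aug_tensor V \<epsilon> (base_change K R V \<phi> (?\<beta> a b)) = w0 a b"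
      unfolding T[OF functional_\<epsilon> ab] using bilin_mapsD(1)[OF w0 ab] by simp
    assume i: "i < d"
    show "aug_tensor V (\<theta> i) (base_change K R V \<phi> (?\<beta> a b)) = c i a b"
      unfolding T[OF functional_\<theta>[OF i] ab]
      using bilin_mapsD(1)[OF w0 ab] bilin_mapsD(1)[OF c[OF i] ab] c_eq[OF i ab] i by simp
  qed
  have \<beta>': "base_change K R V \<phi> (m (SU.tens \<one>\<^bsub>S\<^esub> a) (SU'.tens \<one>\<^bsub>S\<^esub> b)) \<in> carrier V.EV"
    "aug_tensor V \<epsilon> (base_change K R V \<phi> (m (SU.tens \<one>\<^bsub>S\<^esub> a) (SU'.tens \<one>\<^bsub>S\<^esub> b))) = w0 a b"
    "i < d \<Longrightarrow> aug_tensor V (\<theta> i) (base_change K R V \<phi> (m (SU.tens \<one>\<^bsub>S\<^esub> a) (SU'.tens \<one>\<^bsub>S\<^esub> b))) = c i a b"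
    if ab: "a \<in> carrier U" "b \<in> carrier U'" for i a b
    unfolding m1[OF ab] using \<beta>[OF ab] by auto
  show "inf_op K R \<epsilon> d r \<theta> U U' V w0 p"
    unfolding p_def by (rule inf_opI(1)[OF mods w0 c \<beta>'])
  show "inf_op.comp K R \<theta> U U' V p i a b = c i a b" if "i < d" "a \<in> carrier U" "b \<in> carrier U'" for i a b
    unfolding p_def by (rule inf_opI(2)[OF mods w0 c \<beta>']) (use that in auto)
qed

section \<open>The universal property\<close>

context courant
begin

text \<open>Components of a deformation and cochains correspond to each other only up to their values off the
  carriers.\<close>

definition agree :: "('a, 'l) triplet \<Rightarrow> ('a, 'l) triplet \<Rightarrow> bool" where
  "agree t t' \<longleftrightarrow> (case (t, t') of ((m, \<mu>, b), (m', \<mu>', b')) \<Rightarrow>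
     (\<forall>a\<in>carrier A. \<forall>c\<in>carrier A. m a c = m' a c) \<and>
     (\<forall>x\<in>carrier L. \<forall>a\<in>carrier A. \<mu> x a = \<mu>' x a) \<and>
     (\<forall>x\<in>carrier L. \<forall>y\<in>carrier L. b x y = b' x y))"

lemma agree_sym: "agree t t' \<Longrightarrow> agree t' t"
  by (auto simp: agree_def split: prod.splits)

lemma agree_cochain_of: "agree (triplet_of (cochain_of t)) t"
  by (cases t) (simp add: agree_def triplet_of_def cochain_of_apply[unfolded One_nat_def])

lemma cohomologous_agree:
  assumes "agree t u" "agree t' u'" "cohomologous K P t t'"
  shows "cohomologous K P u u'"
proof -
  obtain m \<mu> b m' \<mu>' b' n \<nu> c n' \<nu>' c'
    where [simp]: "t = (m, \<mu>, b)" "t' = (m', \<mu>', b')" "u = (n, \<nu>, c)" "u' = (n', \<nu>', c')"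
    by (cases t, cases t', cases u, cases u') auto
  show ?thesis using assms unfolding agree_def cohomologous_def by simp
qed

lemma triplet_cocycle_agree:
  assumes "agree t u" "triplet_cocycle P t"
  shows "triplet_cocycle P u"
proof -
  obtain m \<mu> b n \<nu> c where [simp]: "t = (m, \<mu>, b)" "u = (n, \<nu>, c)" by (cases t, cases u) auto
  have e: "\<And>a c. a \<in> carrier A \<Longrightarrow> c \<in> carrier A \<Longrightarrow> n a c = m a c"
    "\<And>x a. x \<in> carrier L \<Longrightarrow> a \<in> carrier A \<Longrightarrow> \<nu> x a = \<mu> x a"
    "\<And>x y. x \<in> carrier L \<Longrightarrow> y \<in> carrier L \<Longrightarrow> c x y = b x y"
    using assms(1) by (auto simp: agree_def)
  note s = e multD(1) actD(1) bracketD(1)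
  have coc: "assoc_cocycle P m" "derivation_cocycle P m \<mu>" "action_cocycle P \<mu> b" "leibniz_cocycle P b"
    using assms(2) by (auto simp: triplet_cocycle_def)
  have "assoc_cocycle P n"
    unfolding assoc_cocycle_def
  proof (intro ballI)
    fix x y z assume *: "x \<in> carrier A" "y \<in> carrier A" "z \<in> carrier A"
    show "n x y \<otimes>\<^bsub>A\<^esub> z \<oplus>\<^bsub>A\<^esub> n (x \<otimes>\<^bsub>A\<^esub> y) z = x \<otimes>\<^bsub>A\<^esub> n y z \<oplus>\<^bsub>A\<^esub> n x (y \<otimes>\<^bsub>A\<^esub> z)"
      using coc(1)[unfolded assoc_cocycle_def, rule_format, OF *] * by (simp only: s)
  qed
  moreover have "derivation_cocycle P n \<nu>"
    unfolding derivation_cocycle_def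
  proof (intro ballI)
    fix x a c assume *: "x \<in> carrier L" "a \<in> carrier A" "c \<in> carrier A"
    show "act P x (n a c) \<oplus>\<^bsub>A\<^esub> \<nu> x (a \<otimes>\<^bsub>A\<^esub> c)
        = (\<nu> x a \<otimes>\<^bsub>A\<^esub> c \<oplus>\<^bsub>A\<^esub> n (act P x a) c) \<oplus>\<^bsub>A\<^esub> (a \<otimes>\<^bsub>A\<^esub> \<nu> x c \<oplus>\<^bsub>A\<^esub> n a (act P x c))"
      using coc(2)[unfolded derivation_cocycle_def, rule_format, OF *] * by (simp only: s)
  qed
  moreover have "action_cocycle P \<nu> c"
    unfolding action_cocycle_def
  proof (intro ballI)
    fix x y a assume *: "x \<in> carrier L" "y \<in> carrier L" "a \<in> carrier A"
    show "(act P (c x y) a \<oplus>\<^bsub>A\<^esub> \<nu> (x \<otimes>\<^bsub>L\<^esub> y) a) \<oplus>\<^bsub>A\<^esub> (act P y (\<nu> x a) \<oplus>\<^bsub>A\<^esub> \<nu> y (act P x a))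
        = act P x (\<nu> y a) \<oplus>\<^bsub>A\<^esub> \<nu> x (act P y a)"
      using coc(3)[unfolded action_cocycle_def, rule_format, OF *] * by (simp only: s)
  qed
  moreover have "leibniz_cocycle P c"
    unfolding leibniz_cocycle_def
  proof (intro ballI)
    fix x y z assume *: "x \<in> carrier L" "y \<in> carrier L" "z \<in> carrier L"
    show "x \<otimes>\<^bsub>L\<^esub> c y z \<oplus>\<^bsub>L\<^esub> c x (y \<otimes>\<^bsub>L\<^esub> z)
        = (c x y \<otimes>\<^bsub>L\<^esub> z \<oplus>\<^bsub>L\<^esub> c (x \<otimes>\<^bsub>L\<^esub> y) z) \<oplus>\<^bsub>L\<^esub> (y \<otimes>\<^bsub>L\<^esub> c x z \<oplus>\<^bsub>L\<^esub> c y (x \<otimes>\<^bsub>L\<^esub> z))"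
      using coc(4)[unfolded leibniz_cocycle_def, rule_format, OF *] * by (simp only: s)
  qed
  ultimately show ?thesis by (simp add: triplet_cocycle_def)
qed

end

lemma (in inf_triple) components_bilinear: "i < d \<Longrightarrow> bilinear_triplet (components i)"
  by (simp add: bilinear_triplet_def components_def M.comp_bilinear U.comp_bilinear B.comp_bilinear)

text \<open>The data of the universal deformation: a linear choice of cocycles, a basis of the cohomology and its
  dual basis.\<close>

locale classified = inf_courant K R \<epsilon> d r \<theta> P
  for K :: "('k, 'm) ring_scheme" and R :: "('k, 'r) module" and \<epsilon> d r \<theta>
    and P :: "('k, 'a, 'l) courant_data" +
  fixes \<nu> :: "('a, 'l) tot_cochain set \<Rightarrow> ('a, 'l) tot_cochain"
    and n :: nat and h :: "nat \<Rightarrow> ('a, 'l) tot_cochain set"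
    and g :: "nat \<Rightarrow> ('a, 'l) tot_cochain set \<Rightarrow> 'k"
  assumes choice: "cocycle_choice K P \<nu>" and basis: "is_basis K (H_CP K P 2) n h"
    and dual: "is_dual_basis K (H_CP K P 2) n h g"
begin

abbreviation "H \<equiv> H_CP K P 2"
abbreviation "D \<equiv> dual_space K H"
abbreviation "C \<equiv> C1 K P"

sublocale Q: subquotient K "tot_cochains K P 2" "coboundaries K P 2" "cocycles K P 2"
  by (rule subquotient_H)

sublocale C2: module K C2 by (rule module_tot_cochains)

lemma H_eq: "H = Q.Q" by (simp add: H_CP_def)

sublocale H: module K H unfolding H_eq by (rule Q.module_Q)
sublocale D: module K D by (rule module_dual_space) (rule K.is_cring)

lemma algebra_C: "algebra K C"
  unfolding C1_def by (rule algebra_trivial_ext[OF D.module_axioms])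

sublocale C: algebra K C by (rule algebra_C)

lemma \<nu>_lin: "\<nu> \<in> lin_maps K H C2" using choice by (simp add: cocycle_choice_def)
lemmas \<nu>D = lin_mapsD[OF \<nu>_lin]

lemma class_of_representative: "Z \<in> carrier H \<Longrightarrow> Q.coset (\<nu> Z) = Z"
proof -
  assume Z: "Z \<in> carrier H"
  then obtain c where c: "c \<in> cocycles K P 2" "Z = Q.coset c" unfolding H_eq Q.carrier_Q by blast
  have "\<nu> Z \<in> Z" using choice Z by (simp add: cocycle_choice_def)
  then show ?thesis using Q.coset_eqI[of "\<nu> Z" c] c Q.Z_carrier[OF c(1)] by simp
qed

lemma h_closed [simp, intro]: "j < n \<Longrightarrow> h j \<in> carrier H" using basis by (auto simp: is_basis_def)
lemma g_closed [simp, intro]: "j < n \<Longrightarrow> g j \<in> carrier D" using dual by (auto simp: is_dual_basis_def)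
lemma g_h: "i < n \<Longrightarrow> j < n \<Longrightarrow> g i (h j) = (if i = j then \<one>\<^bsub>K\<^esub> else \<zero>\<^bsub>K\<^esub>)"
  using dual by (auto simp: is_dual_basis_def)

lemma D_functional: "\<xi> \<in> carrier D \<Longrightarrow> functional K H \<xi>"
  by (auto simp: dual_space_def functional_def additive_map_def)

lemma D_sel: "(\<xi> \<oplus>\<^bsub>D\<^esub> \<xi>') Z = \<xi> Z \<oplus>\<^bsub>K\<^esub> \<xi>' Z" "(k \<odot>\<^bsub>D\<^esub> \<xi>) Z = k \<otimes>\<^bsub>K\<^esub> \<xi> Z" "\<zero>\<^bsub>D\<^esub> Z = \<zero>\<^bsub>K\<^esub>"
  by (simp_all add: dual_space_def)

lemma D_value [simp]: "\<xi> \<in> carrier D \<Longrightarrow> \<xi> Z \<in> carrier K"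
  by (cases "Z \<in> carrier H") (auto simp: dual_space_def)

definition combo :: "(nat \<Rightarrow> 'k) \<Rightarrow> ('a, 'l) tot_cochain set" where
  "combo t = (\<Oplus>\<^bsub>H\<^esub>j\<in>{..<n}. t j \<odot>\<^bsub>H\<^esub> h j)"

lemma combo_closed: "(\<And>j. j < n \<Longrightarrow> t j \<in> carrier K) \<Longrightarrow> combo t \<in> carrier H"
  unfolding combo_def by (rule H.M.finsum_closed) auto

lemma functional_combo:
  assumes f: "functional K H f" and t: "\<And>j. j < n \<Longrightarrow> t j \<in> carrier K"
  shows "f (combo t) = (\<Oplus>\<^bsub>K\<^esub>j\<in>{..<n}. t j \<otimes>\<^bsub>K\<^esub> f (h j))"
proof -
  have "f (combo t) = (\<Oplus>\<^bsub>K\<^esub>j\<in>{..<n}. f (t j \<odot>\<^bsub>H\<^esub> h j))"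
    unfolding combo_def
    by (rule additive_finsum[OF H.M.abelian_group_axioms K.is_abelian_group functionalD(1)[OF f]]) (use t in auto)
  also have "\<dots> = (\<Oplus>\<^bsub>K\<^esub>j\<in>{..<n}. t j \<otimes>\<^bsub>K\<^esub> f (h j))"
    by (rule K.finsum_cong') (use t functionalD[OF f] in auto)
  finally show ?thesis .
qed

lemma g_combo:
  assumes i: "i < n" and t: "\<And>j. j < n \<Longrightarrow> t j \<in> carrier K"
  shows "g i (combo t) = t i"
proof -
  have "g i (combo t) = (\<Oplus>\<^bsub>K\<^esub>j\<in>{..<n}. t j \<otimes>\<^bsub>K\<^esub> g i (h j))"
    by (rule functional_combo) (use i t in \<open>auto intro: D_functional\<close>)
  also have "\<dots> = (\<Oplus>\<^bsub>K\<^esub>j\<in>{..<n}. if i = j then t j else \<zero>\<^bsub>K\<^esub>)"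
    by (rule K.finsum_cong') (use i t in \<open>auto simp: g_h\<close>)
  also have "\<dots> = t i" by (rule K.finsum_singleton) (use i t in auto)
  finally show ?thesis .
qed

lemma combo_cong: "(\<And>j. j < n \<Longrightarrow> t j \<in> carrier K) \<Longrightarrow> (\<And>j. j < n \<Longrightarrow> t j = t' j) \<Longrightarrow> combo t = combo t'"
  unfolding combo_def by (rule H.M.finsum_cong') auto

lemma combo_g:
  assumes Z: "Z \<in> carrier H"
  shows "combo (\<lambda>j. g j Z) = Z"
proof -
  obtain t where t: "t \<in> {..<n} \<rightarrow>\<^sub>E carrier K" "Z = (\<Oplus>\<^bsub>H\<^esub>j\<in>{..<n}. t j \<odot>\<^bsub>H\<^esub> h j)"
  proof -
    have "\<exists>t. t \<in> {..<n} \<rightarrow>\<^sub>E carrier K \<and> Z = (\<Oplus>\<^bsub>H\<^esub>j\<in>{..<n}. t j \<odot>\<^bsub>H\<^esub> h j)"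
      by (rule ex1_implies_ex[OF bspec[OF conjunct2[OF basis[unfolded is_basis_def]] Z]])
    then show thesis by (elim exE conjE) (rule that)
  qed
  have tK: "\<And>j. j < n \<Longrightarrow> t j \<in> carrier K" using t(1) by auto
  have Zt: "Z = combo t" unfolding combo_def by (rule t(2))
  show ?thesis unfolding Zt by (rule combo_cong[symmetric]) (simp_all add: tK g_combo)
qed

text \<open>\<open>g j Z\<close> is the \<open>j\<close>-th coordinate of the class \<open>Z\<close>.\<close>

lemma combo_eq_iff:
  assumes "Z \<in> carrier H" "\<And>j. j < n \<Longrightarrow> t j \<in> carrier K"
  shows "Z = combo t \<longleftrightarrow> (\<forall>j<n. t j = g j Z)"
proof
  assume "\<forall>j<n. t j = g j Z"
  then have "combo t = combo (\<lambda>j. g j Z)" by (intro combo_cong) (use assms in auto)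
  then show "Z = combo t" using combo_g[OF assms(1)] by simp
next
  assume "Z = combo t"
  then show "\<forall>j<n. t j = g j Z" using g_combo[OF _ assms(2)] by simp
qed

text \<open>Linearity of \<open>\<nu>\<close>, pointwise: a combination of the chosen cocycles is again a chosen cocycle.\<close>

lemma \<nu>_combo:
  assumes t: "\<And>j. j < n \<Longrightarrow> t j \<in> carrier K"
  shows "snd (\<nu> (combo t)) p xs as = (\<Oplus>\<^bsub>A\<^esub>j\<in>{..<n}. t j \<odot>\<^bsub>A\<^esub> snd (\<nu> (h j)) p xs as)"
    and "fst (\<nu> (combo t)) xs = (\<Oplus>\<^bsub>L\<^esub>j\<in>{..<n}. t j \<odot>\<^bsub>L\<^esub> fst (\<nu> (h j)) xs)"
proof -
  have tc: "\<And>j. j < n \<Longrightarrow> \<nu> (h j) \<in> carrier C2" by (simp add: \<nu>D)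
  have add: "additive_map H A (\<lambda>Z. snd (\<nu> Z) p xs as)" "additive_map H L (\<lambda>Z. fst (\<nu> Z) xs)"
    by (auto intro!: additiveI simp: \<nu>D tot_value[of _ 2])
  have "snd (\<nu> (combo t)) p xs as = (\<Oplus>\<^bsub>A\<^esub>j\<in>{..<n}. snd (\<nu> (t j \<odot>\<^bsub>H\<^esub> h j)) p xs as)"
    unfolding combo_def
    by (rule additive_finsum[OF H.M.abelian_group_axioms A.M.abelian_group_axioms add(1)]) (use t in auto)
  also have "\<dots> = (\<Oplus>\<^bsub>A\<^esub>j\<in>{..<n}. t j \<odot>\<^bsub>A\<^esub> snd (\<nu> (h j)) p xs as)"
    by (rule A.M.finsum_cong') (use t tot_value[OF tc] in \<open>auto simp: \<nu>D\<close>)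
  finally show "snd (\<nu> (combo t)) p xs as = (\<Oplus>\<^bsub>A\<^esub>j\<in>{..<n}. t j \<odot>\<^bsub>A\<^esub> snd (\<nu> (h j)) p xs as)" .
  have "fst (\<nu> (combo t)) xs = (\<Oplus>\<^bsub>L\<^esub>j\<in>{..<n}. fst (\<nu> (t j \<odot>\<^bsub>H\<^esub> h j)) xs)"
    unfolding combo_def
    by (rule additive_finsum[OF H.M.abelian_group_axioms L.M.abelian_group_axioms add(2)]) (use t in auto)
  also have "\<dots> = (\<Oplus>\<^bsub>L\<^esub>j\<in>{..<n}. t j \<odot>\<^bsub>L\<^esub> fst (\<nu> (h j)) xs)"
    by (rule L.M.finsum_cong') (use t tot_value[OF tc] in \<open>auto simp: \<nu>D\<close>)
  finally show "fst (\<nu> (combo t)) xs = (\<Oplus>\<^bsub>L\<^esub>j\<in>{..<n}. t j \<odot>\<^bsub>L\<^esub> fst (\<nu> (h j)) xs)" .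
qed

lemma C_sel:
  "x \<in> carrier C \<longleftrightarrow> fst x \<in> carrier K \<and> snd x \<in> carrier D"
  "x \<oplus>\<^bsub>C\<^esub> y = (fst x \<oplus>\<^bsub>K\<^esub> fst y, snd x \<oplus>\<^bsub>D\<^esub> snd y)"
  "x \<otimes>\<^bsub>C\<^esub> y = (fst x \<otimes>\<^bsub>K\<^esub> fst y, (fst x \<odot>\<^bsub>D\<^esub> snd y) \<oplus>\<^bsub>D\<^esub> (fst y \<odot>\<^bsub>D\<^esub> snd x))"
  "k \<odot>\<^bsub>C\<^esub> x = (k \<otimes>\<^bsub>K\<^esub> fst x, k \<odot>\<^bsub>D\<^esub> snd x)" "\<one>\<^bsub>C\<^esub> = (\<one>\<^bsub>K\<^esub>, \<zero>\<^bsub>D\<^esub>)"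
  by (cases x; cases y; auto simp: C1_def trivial_ext_def)+

text \<open>The class of the cocycle that \<open>\<theta>\<^sub>i\<close> extracts from \<open>\<phi>\<^sub>* \<eta>\<^sub>1\<close>.\<close>

definition push_class :: "('k \<times> (('a, 'l) tot_cochain set \<Rightarrow> 'k) \<Rightarrow> 'r) \<Rightarrow> nat \<Rightarrow> ('a, 'l) tot_cochain set" where
  "push_class \<phi> i = combo (\<lambda>j. \<theta> i (\<phi> (\<zero>\<^bsub>K\<^esub>, g j)))"

text \<open>By linearity of \<open>\<nu>\<close>, the components \<open>\<Sum>\<^sub>j \<theta>\<^sub>i(\<phi>(g\<^sub>j)) \<nu>(h\<^sub>j)\<close> of the push-out are the cocycle chosen for
  \<open>push_class \<phi> i\<close>.\<close>

lemma push_out_eta1: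
  assumes \<phi>: "augmented_hom K C fst R \<epsilon> \<phi>"
  obtains m \<mu> b where "push_out K P C R \<phi> (eta1 K P \<nu> n h g) = (m, \<mu>, b)"
    and "inf_triple K R \<epsilon> d r \<theta> P m \<mu> b"
    and "\<And>i. i < d \<Longrightarrow> agree (inf_triple.components K R \<theta> P m \<mu> b i) (triplet_of (\<nu> (push_class \<phi> i)))"
    and "\<And>i. i < d \<Longrightarrow> push_class \<phi> i \<in> carrier H"
proof -
  have lin: "\<phi> \<in> lin_maps K C R" and hom: "\<phi> \<in> ring_hom C R" and aug: "\<And>x. x \<in> carrier C \<Longrightarrow> \<epsilon> (\<phi> x) = fst x"
    using \<phi> by (auto simp: augmented_hom_def)
  have one: "\<phi> \<one>\<^bsub>C\<^esub> = \<one>\<^bsub>R\<^esub>" using hom by (rule ring_hom_one)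
  have s: "(\<zero>\<^bsub>K\<^esub>, g j) \<in> carrier C" if "j < n" for j using that by (simp add: C_sel)
  have s0: "\<epsilon> (\<phi> (\<zero>\<^bsub>K\<^esub>, g j)) = \<zero>\<^bsub>K\<^esub>" if "j < n" for j using aug[OF s[OF that]] by simp
  have t: "\<theta> i (\<phi> (\<zero>\<^bsub>K\<^esub>, g j)) \<in> carrier K" if "i < d" "j < n" for i j
    using that lin_mapsD(1)[OF lin s] by simp
  have Z: "push_class \<phi> i \<in> carrier H" if "i < d" for i
    unfolding push_class_def by (rule combo_closed) (use t that in auto)
  have bil: "bilinear_triplet (triplet_of (\<nu> Z))" if "Z \<in> carrier H" for Z
    using that by (intro C2_bilinear \<nu>D)
  note bil' = bil[unfolded bilinear_triplet_def triplet_of_def prod.case]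
  have wM: "(\<lambda>a b. snd (\<nu> Z) 2 [] [a, b]) \<in> bilin_maps K A A A"
    and wU: "(\<lambda>x a. snd (\<nu> Z) 1 [x] [a]) \<in> bilin_maps K L A A"
    and wB: "(\<lambda>x y. fst (\<nu> Z) [x, y]) \<in> bilin_maps K L L L" if "Z \<in> carrier H" for Z
    using bil'[OF that] by auto
  note common = algebra_C lin one
  note M = push_out_op[OF common A.module_axioms A.module_axioms A.module_axioms mult_bilin,
      where n = n and w = "\<lambda>j a b. snd (\<nu> (h j)) 2 [] [a, b]" and s = "\<lambda>j. (\<zero>\<^bsub>K\<^esub>, g j)"
        and c = "\<lambda>i a b. snd (\<nu> (push_class \<phi> i)) 2 [] [a, b]",
      OF wM[OF h_closed] s s0 wM[OF Z]]
  note U = push_out_op[OF common L.module_axioms A.module_axioms A.module_axioms act_bilin,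
      where n = n and w = "\<lambda>j x a. snd (\<nu> (h j)) 1 [x] [a]" and s = "\<lambda>j. (\<zero>\<^bsub>K\<^esub>, g j)"
        and c = "\<lambda>i x a. snd (\<nu> (push_class \<phi> i)) 1 [x] [a]",
      OF wU[OF h_closed] s s0 wU[OF Z]]
  note B = push_out_op[OF common L.module_axioms L.module_axioms L.module_axioms bracket_bilin,
      where n = n and w = "\<lambda>j x y. fst (\<nu> (h j)) [x, y]" and s = "\<lambda>j. (\<zero>\<^bsub>K\<^esub>, g j)"
        and c = "\<lambda>i x y. fst (\<nu> (push_class \<phi> i)) [x, y]",
      OF wB[OF h_closed] s s0 wB[OF Z]]
  obtain m \<mu> b where p: "push_out K P C R \<phi> (eta1 K P \<nu> n h g) = (m, \<mu>, b)"
    by (cases "push_out K P C R \<phi> (eta1 K P \<nu> n h g)") auto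
  have mub: "m = bilin_ext R EA (\<lambda>a a'. base_change K R A \<phi> (bilin_ext C (ext_scal K C A)
        (\<lambda>a b. pure_tensor K C A \<one>\<^bsub>C\<^esub> (a \<otimes>\<^bsub>A\<^esub> b) \<oplus>\<^bsub>ext_scal K C A\<^esub>
          (\<Oplus>\<^bsub>ext_scal K C A\<^esub>i\<in>{..<n}. pure_tensor K C A (\<zero>\<^bsub>K\<^esub>, g i) (snd (\<nu> (h i)) 2 [] [a, b])))
        (pure_tensor K C A \<one>\<^bsub>C\<^esub> a) (pure_tensor K C A \<one>\<^bsub>C\<^esub> a')))"
    "\<mu> = bilin_ext R EA (\<lambda>x a. base_change K R A \<phi> (bilin_ext C (ext_scal K C A)
        (\<lambda>x a. pure_tensor K C A \<one>\<^bsub>C\<^esub> (act P x a) \<oplus>\<^bsub>ext_scal K C A\<^esub>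
          (\<Oplus>\<^bsub>ext_scal K C A\<^esub>i\<in>{..<n}. pure_tensor K C A (\<zero>\<^bsub>K\<^esub>, g i) (snd (\<nu> (h i)) 1 [x] [a])))
        (pure_tensor K C L \<one>\<^bsub>C\<^esub> x) (pure_tensor K C A \<one>\<^bsub>C\<^esub> a)))"
    "b = bilin_ext R EL (\<lambda>x y. base_change K R L \<phi> (bilin_ext C (ext_scal K C L)
        (\<lambda>x y. pure_tensor K C L \<one>\<^bsub>C\<^esub> (x \<otimes>\<^bsub>L\<^esub> y) \<oplus>\<^bsub>ext_scal K C L\<^esub>
          (\<Oplus>\<^bsub>ext_scal K C L\<^esub>i\<in>{..<n}. pure_tensor K C L (\<zero>\<^bsub>K\<^esub>, g i) (fst (\<nu> (h i)) [x, y])))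
        (pure_tensor K C L \<one>\<^bsub>C\<^esub> x) (pure_tensor K C L \<one>\<^bsub>C\<^esub> y)))"
    using p unfolding push_out_def eta1_def Let_def prod.case by simp_all
  have eq: "snd (\<nu> (push_class \<phi> i)) q xs as = (\<Oplus>\<^bsub>A\<^esub>j\<in>{..<n}. \<theta> i (\<phi> (\<zero>\<^bsub>K\<^esub>, g j)) \<odot>\<^bsub>A\<^esub> snd (\<nu> (h j)) q xs as)"
    "fst (\<nu> (push_class \<phi> i)) xs = (\<Oplus>\<^bsub>L\<^esub>j\<in>{..<n}. \<theta> i (\<phi> (\<zero>\<^bsub>K\<^esub>, g j)) \<odot>\<^bsub>L\<^esub> fst (\<nu> (h j)) xs)"
    if "i < d" for i q xs as
    unfolding push_class_def by (rule \<nu>_combo; use t that in auto)+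
  have opM: "inf_op K R \<epsilon> d r \<theta> A A A (monoid.mult A) m"
    and opU: "inf_op K R \<epsilon> d r \<theta> L A A (act P) \<mu>"
    and opB: "inf_op K R \<epsilon> d r \<theta> L L L (monoid.mult L) b"
    unfolding mub by (rule M(1) U(1) B(1); simp add: eq)+
  have compM: "inf_op.comp K R \<theta> A A A m i a a' = snd (\<nu> (push_class \<phi> i)) 2 [] [a, a']"
    if "i < d" "a \<in> carrier A" "a' \<in> carrier A" for i a a'
    unfolding mub by (rule M(2)) (use that eq in auto)
  have compU: "inf_op.comp K R \<theta> L A A \<mu> i x a = snd (\<nu> (push_class \<phi> i)) 1 [x] [a]"
    if "i < d" "x \<in> carrier L" "a \<in> carrier A" for i x a
    unfolding mub by (rule U(2)) (use that eq in auto)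
  have compB: "inf_op.comp K R \<theta> L L L b i x y = fst (\<nu> (push_class \<phi> i)) [x, y]"
    if "i < d" "x \<in> carrier L" "y \<in> carrier L" for i x y
    unfolding mub by (rule B(2)) (use that eq in auto)
  have X: "inf_triple K R \<epsilon> d r \<theta> P m \<mu> b"
    by (intro inf_triple.intro inf_courant_axioms opM opU opB)
  show thesis
  proof (rule that[OF p X _ Z])
    fix i assume "i < d"
    then show "agree (inf_triple.components K R \<theta> P m \<mu> b i) (triplet_of (\<nu> (push_class \<phi> i)))"
      unfolding inf_triple.components_def[OF X] agree_def triplet_of_def by (simp add: compM compU compB)
  qed
qed

text \<open>The classes of the cocycles that form a deformation. They are the complete invariant of its
  equivalence class.\<close>

definition def_class :: "('r, 'a, 'l) deform \<Rightarrow> nat \<Rightarrow> ('a, 'l) tot_cochain set" where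
  "def_class t i = (case t of (m, \<mu>, b) \<Rightarrow> Q.coset (cochain_of (inf_triple.components K R \<theta> P m \<mu> b i)))"

lemma def_class_closed:
  assumes t: "deformation K P R \<epsilon> t" and i: "i < d"
  shows "def_class t i \<in> carrier H"
proof -
  obtain m \<mu> b where [simp]: "t = (m, \<mu>, b)" by (cases t)
  interpret X: inf_triple K R \<epsilon> d r \<theta> P m \<mu> b using t by (simp add: deformation_iff)
  have "triplet_cocycle P (X.components i)" using t i by (simp add: deformation_iff)
  then have "triplet_cocycle P (triplet_of (cochain_of (X.components i)))"
    by (rule triplet_cocycle_agree[OF agree_sym[OF agree_cochain_of]])
  then have "cochain_of (X.components i) \<in> cocycles K P 2"
    using cocycle_iff[OF cochain_of_closed[OF X.components_bilinear[OF i]]] by blast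
  then show ?thesis unfolding H_eq Q.carrier_Q by (auto simp: def_class_def)
qed

text \<open>Both sides say that \<open>\<lambda>\<close> and the push-out have the same classes. The class of the push-out in the coordinate
  \<open>i\<close> is \<open>\<Sum>\<^sub>j \<theta>\<^sub>i(\<phi>(g\<^sub>j)) h\<^sub>j\<close>, and its coordinates with respect to the basis \<open>h\<close> are compared with those of
  the class of \<open>\<lambda>\<close>.\<close>

lemma equivalent_push_out_iff:
  assumes t: "deformation K P R \<epsilon> t" and \<phi>: "augmented_hom K C fst R \<epsilon> \<phi>"
  shows "equivalent_deformations K P R \<epsilon> t (push_out K P C R \<phi> (eta1 K P \<nu> n h g))
    \<longleftrightarrow> (\<forall>i<d. \<forall>j<n. \<theta> i (\<phi> (\<zero>\<^bsub>K\<^esub>, g j)) = g j (def_class t i))"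
proof -
  obtain m \<mu> b where [simp]: "t = (m, \<mu>, b)" by (cases t)
  interpret X: inf_triple K R \<epsilon> d r \<theta> P m \<mu> b using t by (simp add: deformation_iff)
  obtain m' \<mu>' b' where p: "push_out K P C R \<phi> (eta1 K P \<nu> n h g) = (m', \<mu>', b')"
    and Y: "inf_triple K R \<epsilon> d r \<theta> P m' \<mu>' b'"
    and ag: "\<And>i. i < d \<Longrightarrow> agree (inf_triple.components K R \<theta> P m' \<mu>' b' i) (triplet_of (\<nu> (push_class \<phi> i)))"
    and Z: "\<And>i. i < d \<Longrightarrow> push_class \<phi> i \<in> carrier H"
    using push_out_eta1[OF \<phi>] by blast
  interpret Y: inf_triple K R \<epsilon> d r \<theta> P m' \<mu>' b' by (rule Y)
  let ?c = "\<lambda>i. cochain_of (X.components i)"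
  have c: "?c i \<in> carrier C2" if "i < d" for i
    by (rule cochain_of_closed[OF X.components_bilinear[OF that]])
  have e: "\<nu> (push_class \<phi> i) \<in> carrier C2" if "i < d" for i
    by (rule \<nu>D(1)[OF Z[OF that]])
  have coset_eq: "def_class t i = push_class \<phi> i \<longleftrightarrow> ?c i \<in> Q.coset (\<nu> (push_class \<phi> i))"
    "def_class t i = push_class \<phi> i \<longleftrightarrow> \<nu> (push_class \<phi> i) \<in> Q.coset (?c i)" if i: "i < d" for i
  proof -
    have cls: "def_class t i = Q.coset (?c i)" "push_class \<phi> i = Q.coset (\<nu> (push_class \<phi> i))"
      using class_of_representative[OF Z[OF i]] by (simp_all add: def_class_def)
    show "def_class t i = push_class \<phi> i \<longleftrightarrow> ?c i \<in> Q.coset (\<nu> (push_class \<phi> i))"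
      using Q.mem_coset[OF c[OF i]] Q.coset_eqI[OF _ e[OF i], of "?c i"] cls by metis
    show "def_class t i = push_class \<phi> i \<longleftrightarrow> \<nu> (push_class \<phi> i) \<in> Q.coset (?c i)"
      using Q.mem_coset[OF e[OF i]] Q.coset_eqI[OF _ c[OF i], of "\<nu> (push_class \<phi> i)"] cls by metis
  qed
  have XY: "cohomologous K P (X.components i) (Y.components i) \<longleftrightarrow> def_class t i = push_class \<phi> i" if i: "i < d" for i
    unfolding coset_eq(1)[OF i] coset_iff_cohomologous[OF c[OF i] e[OF i]]
    using cohomologous_agree agree_sym agree_cochain_of ag[OF i] by metis
  \<comment> \<open>\<open>equivalent_iff\<close> asks for the relation in one direction, \<open>deformation_transport\<close> for the other.\<close>
  have YX: "cohomologous K P (Y.components i) (X.components i) \<longleftrightarrow> def_class t i = push_class \<phi> i" if i: "i < d" for i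
    unfolding coset_eq(2)[OF i] coset_iff_cohomologous[OF e[OF i] c[OF i]]
    using cohomologous_agree agree_sym agree_cochain_of ag[OF i] by metis
  have lin: "\<phi> \<in> lin_maps K C R" using \<phi> by (simp add: augmented_hom_def)
  have "equivalent_deformations K P R \<epsilon> t (m', \<mu>', b') \<longleftrightarrow> (\<forall>i<d. def_class t i = push_class \<phi> i)"
  proof
    assume eq: "equivalent_deformations K P R \<epsilon> t (m', \<mu>', b')"
    then have "deformation K P R \<epsilon> (m', \<mu>', b')" by (simp add: equivalent_deformations_def)
    then show "\<forall>i<d. def_class t i = push_class \<phi> i"
      using eq equivalent_iff[of m \<mu> b m' \<mu>' b'] t XY by simp
  next
    assume cls: "\<forall>i<d. def_class t i = push_class \<phi> i"
    have "deformation K P R \<epsilon> (m', \<mu>', b')"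
      using deformation_transport[OF Y, of m \<mu> b] t YX cls by simp
    then show "equivalent_deformations K P R \<epsilon> t (m', \<mu>', b')"
      using equivalent_iff[of m \<mu> b m' \<mu>' b'] t XY cls by simp
  qed
  also have "\<dots> \<longleftrightarrow> (\<forall>i<d. \<forall>j<n. \<theta> i (\<phi> (\<zero>\<^bsub>K\<^esub>, g j)) = g j (def_class t i))"
  proof -
    have "def_class t i = push_class \<phi> i \<longleftrightarrow> (\<forall>j<n. \<theta> i (\<phi> (\<zero>\<^bsub>K\<^esub>, g j)) = g j (def_class t i))" if i: "i < d" for i
      unfolding push_class_def
      by (rule combo_eq_iff[OF def_class_closed[OF t i]])
        (use i lin_mapsD(1)[OF lin] in \<open>auto simp: C_sel\<close>)
    then show ?thesis by blast
  qed
  finally show ?thesis unfolding p .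
qed

text \<open>The solution of the equations in \<open>equivalent_push_out_iff\<close>. A functional \<open>\<xi>\<close> is evaluated at the classes of
  the deformation, which gives the coordinates of its image in \<open>\<M>\<close>.\<close>

definition classifying :: "('r, 'a, 'l) deform \<Rightarrow> 'k \<times> (('a, 'l) tot_cochain set \<Rightarrow> 'k) \<Rightarrow> 'r" where
  "classifying t = (\<lambda>x\<in>carrier C. fst x \<odot>\<^bsub>R\<^esub> \<one>\<^bsub>R\<^esub> \<oplus>\<^bsub>R\<^esub> (\<Oplus>\<^bsub>R\<^esub>i\<in>{..<d}. snd x (def_class t i) \<odot>\<^bsub>R\<^esub> r i))"

lemma classifying_coordinates:
  assumes x: "x \<in> carrier C"
  shows "classifying t x \<in> carrier R" "\<epsilon> (classifying t x) = fst x"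
    and "i < d \<Longrightarrow> \<theta> i (classifying t x) = snd x (def_class t i)"
proof -
  have v: "fst x \<in> carrier K" "\<And>Z. snd x Z \<in> carrier K" using x by (simp_all add: C_sel)
  have sum: "(\<Oplus>\<^bsub>R\<^esub>i\<in>{..<d}. snd x (def_class t i) \<odot>\<^bsub>R\<^esub> r i) \<in> carrier R"
    by (rule R.M.finsum_closed) (use v in auto)
  show "classifying t x \<in> carrier R" using x v sum by (simp add: classifying_def)
  have "(\<Oplus>\<^bsub>K\<^esub>i\<in>{..<d}. snd x (def_class t i) \<otimes>\<^bsub>K\<^esub> \<epsilon> (r i)) = (\<Oplus>\<^bsub>K\<^esub>i\<in>{..<d}. \<zero>\<^bsub>K\<^esub>)"
    by (rule K.finsum_cong') (use v in auto)
  then show "\<epsilon> (classifying t x) = fst x"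
    using functional_comb[OF functional_\<epsilon>, of "\<lambda>i. snd x (def_class t i)" "fst x \<odot>\<^bsub>R\<^esub> \<one>\<^bsub>R\<^esub>"] x v
    by (simp add: classifying_def functionalD[OF functional_\<epsilon>])
  assume i: "i < d"
  show "\<theta> i (classifying t x) = snd x (def_class t i)"
    using functional_comb[OF functional_\<theta>[OF i], of "\<lambda>i. snd x (def_class t i)" "fst x \<odot>\<^bsub>R\<^esub> \<one>\<^bsub>R\<^esub>"] x v i
    by (simp add: classifying_def functionalD[OF functional_\<theta>[OF i]] sum_delta)
qed

text \<open>The map is multiplicative because products in \<open>C\<close> and in \<open>R\<close> obey the same rule: \<open>\<epsilon>\<close> is multiplicative and
  the coordinates are derivations along it.\<close>

lemma classifying_hom: "augmented_hom K C fst R \<epsilon> (classifying t)"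
proof -
  note co = classifying_coordinates
  note fe = functionalD[OF functional_\<epsilon>]
  have cl: "x \<oplus>\<^bsub>C\<^esub> y \<in> carrier C" "x \<otimes>\<^bsub>C\<^esub> y \<in> carrier C" "k \<odot>\<^bsub>C\<^esub> x \<in> carrier C" "\<one>\<^bsub>C\<^esub> \<in> carrier C"
    if "x \<in> carrier C" "y \<in> carrier C" "k \<in> carrier K" for x y k
    using that by simp_all
  have v: "fst x \<in> carrier K" "snd x Z \<in> carrier K" if "x \<in> carrier C" for x Z
    using that by (simp_all add: C_sel(1))
  have one: "classifying t \<one>\<^bsub>C\<^esub> = \<one>\<^bsub>R\<^esub>"
    by (rule base_eqI) (simp_all add: co, simp_all add: C_sel D_sel)
  have mult: "classifying t (x \<otimes>\<^bsub>C\<^esub> y) = classifying t x \<otimes>\<^bsub>R\<^esub> classifying t y"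
    if "x \<in> carrier C" "y \<in> carrier C" for x y
  proof (rule base_eqI)
    show "\<epsilon> (classifying t (x \<otimes>\<^bsub>C\<^esub> y)) = \<epsilon> (classifying t x \<otimes>\<^bsub>R\<^esub> classifying t y)"
      using that by (simp add: co \<epsilon>_mult) (simp add: C_sel)
    fix i assume "i < d"
    then show "\<theta> i (classifying t (x \<otimes>\<^bsub>C\<^esub> y)) = \<theta> i (classifying t x \<otimes>\<^bsub>R\<^esub> classifying t y)"
      using that v by (simp add: co \<theta>_mult) (simp add: C_sel(3) D_sel K.m_comm)
  qed (use that in \<open>simp_all add: co\<close>)
  have add: "classifying t (x \<oplus>\<^bsub>C\<^esub> y) = classifying t x \<oplus>\<^bsub>R\<^esub> classifying t y"
    if "x \<in> carrier C" "y \<in> carrier C" for x y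
  proof (rule base_eqI)
    show "\<epsilon> (classifying t (x \<oplus>\<^bsub>C\<^esub> y)) = \<epsilon> (classifying t x \<oplus>\<^bsub>R\<^esub> classifying t y)"
      using that by (simp add: co fe) (simp add: C_sel)
    fix i assume i: "i < d"
    then show "\<theta> i (classifying t (x \<oplus>\<^bsub>C\<^esub> y)) = \<theta> i (classifying t x \<oplus>\<^bsub>R\<^esub> classifying t y)"
      using that by (simp add: co functionalD[OF functional_\<theta>[OF i]]) (simp add: C_sel(2) D_sel)
  qed (use that in \<open>simp_all add: co\<close>)
  have smult: "classifying t (k \<odot>\<^bsub>C\<^esub> x) = k \<odot>\<^bsub>R\<^esub> classifying t x"
    if "k \<in> carrier K" "x \<in> carrier C" for k x
  proof (rule base_eqI)
    show "\<epsilon> (classifying t (k \<odot>\<^bsub>C\<^esub> x)) = \<epsilon> (k \<odot>\<^bsub>R\<^esub> classifying t x)"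
      using that by (simp add: co fe) (simp add: C_sel)
    fix i assume i: "i < d"
    then show "\<theta> i (classifying t (k \<odot>\<^bsub>C\<^esub> x)) = \<theta> i (k \<odot>\<^bsub>R\<^esub> classifying t x)"
      using that by (simp add: co functionalD[OF functional_\<theta>[OF i]]) (simp add: C_sel(4) D_sel)
  qed (use that in \<open>simp_all add: co\<close>)
  show ?thesis
    unfolding augmented_hom_def
    by (intro conjI ring_hom_memI lin_mapsI ballI) (simp_all add: co one mult add smult)
qed

text \<open>The dual basis spans the dual space. A functional is a function on all sets of cochains that vanishes
  off the cohomology, so both cases have to be compared.\<close>

lemma D_expand:
  assumes \<xi>: "\<xi> \<in> carrier D"
  shows "(\<Oplus>\<^bsub>D\<^esub>j\<in>{..<n}. \<xi> (h j) \<odot>\<^bsub>D\<^esub> g j) = \<xi>"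
proof (rule ext)
  fix Z
  have ev: "additive_map D K (\<lambda>\<xi>. \<xi> Z)" by (rule additiveI) (simp_all add: D_sel)
  have "(\<Oplus>\<^bsub>D\<^esub>j\<in>{..<n}. \<xi> (h j) \<odot>\<^bsub>D\<^esub> g j) Z = (\<Oplus>\<^bsub>K\<^esub>j\<in>{..<n}. (\<xi> (h j) \<odot>\<^bsub>D\<^esub> g j) Z)"
    by (rule additive_finsum[OF D.M.abelian_group_axioms K.is_abelian_group ev]) (use \<xi> in auto)
  also have "\<dots> = (\<Oplus>\<^bsub>K\<^esub>j\<in>{..<n}. g j Z \<otimes>\<^bsub>K\<^esub> \<xi> (h j))"
    by (rule K.finsum_cong') (use \<xi> in \<open>auto simp: D_sel K.m_comm\<close>)
  also have "\<dots> = \<xi> Z"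
  proof (cases "Z \<in> carrier H")
    case True
    have "\<xi> (combo (\<lambda>j. g j Z)) = (\<Oplus>\<^bsub>K\<^esub>j\<in>{..<n}. g j Z \<otimes>\<^bsub>K\<^esub> \<xi> (h j))"
      by (rule functional_combo[OF D_functional[OF \<xi>]]) auto
    then show ?thesis using combo_g[OF True] by simp
  next
    case False
    then have z: "f Z = \<zero>\<^bsub>K\<^esub>" if "f \<in> carrier D" for f using that by (auto simp: dual_space_def simp del: D_value)
    have gz: "g j Z = \<zero>\<^bsub>K\<^esub>" if "j < n" for j by (rule z) (use that in simp)
    have "(\<Oplus>\<^bsub>K\<^esub>j\<in>{..<n}. g j Z \<otimes>\<^bsub>K\<^esub> \<xi> (h j)) = (\<Oplus>\<^bsub>K\<^esub>j\<in>{..<n}. \<zero>\<^bsub>K\<^esub>)"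
      by (rule K.finsum_cong') (use \<xi> in \<open>auto simp: gz\<close>)
    then show ?thesis using z[OF \<xi>] by simp
  qed
  finally show "(\<Oplus>\<^bsub>D\<^esub>j\<in>{..<n}. \<xi> (h j) \<odot>\<^bsub>D\<^esub> g j) Z = \<xi> Z" .
qed

lemma functional_D_eqI:
  assumes f: "functional K D f" and f': "functional K D f'" and "\<And>j. j < n \<Longrightarrow> f (g j) = f' (g j)"
    and \<xi>: "\<xi> \<in> carrier D"
  shows "f \<xi> = f' \<xi>"
proof -
  have val: "f \<xi> = (\<Oplus>\<^bsub>K\<^esub>j\<in>{..<n}. \<xi> (h j) \<otimes>\<^bsub>K\<^esub> f (g j))" if f: "functional K D f" for f
  proof -
    have "f (\<Oplus>\<^bsub>D\<^esub>j\<in>{..<n}. \<xi> (h j) \<odot>\<^bsub>D\<^esub> g j) = (\<Oplus>\<^bsub>K\<^esub>j\<in>{..<n}. f (\<xi> (h j) \<odot>\<^bsub>D\<^esub> g j))"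
      by (rule additive_finsum[OF D.M.abelian_group_axioms K.is_abelian_group functionalD(1)[OF f]]) (use \<xi> in auto)
    also have "\<dots> = (\<Oplus>\<^bsub>K\<^esub>j\<in>{..<n}. \<xi> (h j) \<otimes>\<^bsub>K\<^esub> f (g j))"
      by (rule K.finsum_cong') (use \<xi> functionalD[OF f] in auto)
    finally show ?thesis unfolding D_expand[OF \<xi>] .
  qed
  show ?thesis
    unfolding val[OF f] val[OF f'] by (rule K.finsum_cong') (use assms(3) \<xi> functionalD(2)[OF f'] in auto)
qed

text \<open>The equations prescribe the coordinates of \<open>\<phi>\<close> on the elements \<open>(0, g\<^sub>j)\<close>. These elements and the unit
  span \<open>C\<close>, and \<open>\<phi>\<close> is linear and unital.\<close>

lemma classifying_unique:
  assumes \<phi>: "augmented_hom K C fst R \<epsilon> \<phi>" and ext: "\<phi> \<in> extensional (carrier C)"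
    and eq: "\<And>i j. i < d \<Longrightarrow> j < n \<Longrightarrow> \<theta> i (\<phi> (\<zero>\<^bsub>K\<^esub>, g j)) = g j (def_class t i)"
  shows "\<phi> = classifying t"
proof (rule extensionalityI[OF ext])
  show "classifying t \<in> extensional (carrier C)" by (simp add: classifying_def)
  have lin: "\<phi> \<in> lin_maps K C R" and hom: "\<phi> \<in> ring_hom C R" and aug: "\<And>x. x \<in> carrier C \<Longrightarrow> \<epsilon> (\<phi> x) = fst x"
    using \<phi> by (auto simp: augmented_hom_def)
  note \<phi>D = lin_mapsD[OF lin]
  fix x assume x: "x \<in> carrier C"
  obtain k \<xi> where [simp]: "x = (k, \<xi>)" by (cases x)
  have k: "k \<in> carrier K" and \<xi>: "\<xi> \<in> carrier D" using x by (simp_all add: C_sel)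
  show "\<phi> x = classifying t x"
  proof (rule base_eqI)
    show "\<phi> x \<in> carrier R" using x by (rule \<phi>D)
    show "classifying t x \<in> carrier R" "\<epsilon> (\<phi> x) = \<epsilon> (classifying t x)"
      using classifying_coordinates[OF x] aug[OF x] by simp_all
    fix i assume i: "i < d"
    note \<theta>D = functionalD[OF functional_\<theta>[OF i]]
    have in_C: "(\<zero>\<^bsub>K\<^esub>, \<xi>) \<in> carrier C" if "\<xi> \<in> carrier D" for \<xi> using that by (simp add: C_sel)
    have f: "functional K D (\<lambda>\<xi>. \<theta> i (\<phi> (\<zero>\<^bsub>K\<^esub>, \<xi>)))"
      unfolding functional_def
    proof (intro conjI ballI additiveI)
      fix \<xi> \<xi>' assume *: "\<xi> \<in> carrier D" "\<xi>' \<in> carrier D"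
      have "(\<zero>\<^bsub>K\<^esub>, \<xi> \<oplus>\<^bsub>D\<^esub> \<xi>') = (\<zero>\<^bsub>K\<^esub>, \<xi>) \<oplus>\<^bsub>C\<^esub> (\<zero>\<^bsub>K\<^esub>, \<xi>')" by (simp add: C_sel)
      then show "\<theta> i (\<phi> (\<zero>\<^bsub>K\<^esub>, \<xi> \<oplus>\<^bsub>D\<^esub> \<xi>')) = \<theta> i (\<phi> (\<zero>\<^bsub>K\<^esub>, \<xi>)) \<oplus>\<^bsub>K\<^esub> \<theta> i (\<phi> (\<zero>\<^bsub>K\<^esub>, \<xi>'))"
        using * in_C by (simp add: \<phi>D \<theta>D)
    next
      fix l \<xi> assume *: "l \<in> carrier K" "\<xi> \<in> carrier D"
      have "(\<zero>\<^bsub>K\<^esub>, l \<odot>\<^bsub>D\<^esub> \<xi>) = l \<odot>\<^bsub>C\<^esub> (\<zero>\<^bsub>K\<^esub>, \<xi>)" using * by (simp add: C_sel)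
      then show "\<theta> i (\<phi> (\<zero>\<^bsub>K\<^esub>, l \<odot>\<^bsub>D\<^esub> \<xi>)) = l \<otimes>\<^bsub>K\<^esub> \<theta> i (\<phi> (\<zero>\<^bsub>K\<^esub>, \<xi>))"
        using * in_C by (simp add: \<phi>D \<theta>D)
    qed (use in_C \<phi>D i in auto)
    have f': "functional K D (\<lambda>\<xi>. \<xi> (def_class t i))"
      by (auto simp: functional_def D_sel intro!: additiveI)
    have "x = k \<odot>\<^bsub>C\<^esub> \<one>\<^bsub>C\<^esub> \<oplus>\<^bsub>C\<^esub> (\<zero>\<^bsub>K\<^esub>, \<xi>)" using k \<xi> by (simp add: C_sel)
    then have "\<theta> i (\<phi> x) = \<theta> i (\<phi> (k \<odot>\<^bsub>C\<^esub> \<one>\<^bsub>C\<^esub> \<oplus>\<^bsub>C\<^esub> (\<zero>\<^bsub>K\<^esub>, \<xi>)))" by (rule arg_cong)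
    also have "\<dots> = \<theta> i (\<phi> (\<zero>\<^bsub>K\<^esub>, \<xi>))"
      using k in_C[OF \<xi>] i by (simp add: \<phi>D \<theta>D ring_hom_one[OF hom])
    also have "\<dots> = \<xi> (def_class t i)"
      by (rule functional_D_eqI[OF f f' _ \<xi>]) (use eq i in auto)
    finally show "\<theta> i (\<phi> x) = \<theta> i (classifying t x)"
      using classifying_coordinates(3)[OF x i] by simp
  qed
qed

end

theorem theorem3p8:
  fixes K :: "'k ring"
    and P :: "('k, 'a, 'l) courant_data"
    and \<nu> :: "('a, 'l) tot_cochain set \<Rightarrow> ('a, 'l) tot_cochain"
    and n :: nat
    and h :: "nat \<Rightarrow> ('a, 'l) tot_cochain set"
    and g :: "nat \<Rightarrow> ('a, 'l) tot_cochain set \<Rightarrow> 'k"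
    and R :: "('k, 'r) module"
    and \<epsilon> :: "'r \<Rightarrow> 'k"
    and lam :: "('r, 'a, 'l) deform"
  assumes "field K"
    and "\<forall>m::nat. 0 < m \<longrightarrow> add_pow K m \<one>\<^bsub>K\<^esub> \<noteq> \<zero>\<^bsub>K\<^esub>"
    and "courant_pair K P"
    and "fin_dim K (H_CP K P 2)"
    and "cocycle_choice K P \<nu>"
    and "is_basis K (H_CP K P 2) n h"
    and "is_dual_basis K (H_CP K P 2) n h g"
    and "infinitesimal_deformation K P R \<epsilon> lam"
    and "fin_dim K R"
  shows "\<exists>!\<phi>. \<phi> \<in> extensional (carrier (C1 K P)) \<and>
           augmented_hom K (C1 K P) fst R \<epsilon> \<phi> \<and>
           equivalent_deformations K P R \<epsilon> lam (push_out K P (C1 K P) R \<phi> (eta1 K P \<nu> n h g))"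
proof -
  have lam: "deformation K P R \<epsilon> lam" and sq: "ideal_power R (aug_ideal K R \<epsilon>) 2 = {\<zero>\<^bsub>R\<^esub>}"
    using assms(8) by (simp_all add: infinitesimal_deformation_def)
  have aug: "augmented_algebra K R \<epsilon>"
    using lam by (simp add: deformation_def deformation_base_def)
  obtain d r \<theta> where "inf_base K R \<epsilon> d r \<theta>"
    using inf_base_exists[OF assms(1) aug assms(9) sq] by blast
  then interpret classified K R \<epsilon> d r \<theta> P \<nu> n h g
    by (intro classified.intro inf_courant.intro courant.intro classified_axioms.intro assms)
  show ?thesis
  proof (rule ex1I[of _ "classifying lam"])
    have "\<theta> i (classifying lam (\<zero>\<^bsub>K\<^esub>, g j)) = g j (def_class lam i)" if "i < d" "j < n" for i j
      using classifying_coordinates(3)[of "(\<zero>\<^bsub>K\<^esub>, g j)" i lam] that by (simp add: C_sel)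
    then show "classifying lam \<in> extensional (carrier (C1 K P)) \<and>
        augmented_hom K (C1 K P) fst R \<epsilon> (classifying lam) \<and>
        equivalent_deformations K P R \<epsilon> lam (push_out K P (C1 K P) R (classifying lam) (eta1 K P \<nu> n h g))"
      using classifying_hom equivalent_push_out_iff[OF lam classifying_hom] by (simp add: classifying_def)
  next
    fix \<phi> assume \<phi>: "\<phi> \<in> extensional (carrier (C1 K P)) \<and> augmented_hom K (C1 K P) fst R \<epsilon> \<phi> \<and>
        equivalent_deformations K P R \<epsilon> lam (push_out K P (C1 K P) R \<phi> (eta1 K P \<nu> n h g))"
    then show "\<phi> = classifying lam"
      using equivalent_push_out_iff[OF lam, of \<phi>] by (intro classifying_unique) auto
  qed
qed

end
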